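(* For $\mu>0$ consider the problem of minimizing $\mathcal{G}_\mu=8\pi\mathcal{H}+\mu P$ over $\{u\in\mathcal{E}:M(u)=1\}$. Then: (i) For any $\mu>0$ there exists a global minimizer. (ii) For $\mu>\frac12$, the Gaussian $\varphi_0$ is the unique global minimizer, up to phase and space rotations. (iii) For $\mu=\frac12$, the global minimizers are, up to phase and space rotations, exactly $\varphi_0$, $\varphi_1$ and the family $\{\psi_b\}_{b\ge0}$. (iv) There exists $\mu_0\in[\frac{5}{32},\frac12)$ such that: (a) for all $\mu\in(\mu_0,\frac12)$, $\varphi_1$ is the unique global minimizer, up to phase and space rotations; (b) for all $0<\mu<\mu_0$, any global minimizer has infinitely many zeros in $\mathbb{C}$. (v) For $\mu\in(0,\frac{5}{32})$, any local or global minimizer of $\mathcal{G}_\mu$ has infinitely many zeros in $\mathbb{C}$.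
   Context: $L$ denotes Lebesgue measure on $\mathbb{C}$. The Bargmann-Fock space is $\mathcal{E}=\{u(z)=e^{-|z|^2/2}f(z): f \text{ entire holomorphic on } \mathbb{C}\}\cap L^2(\mathbb{C})$. For $u\in\mathcal{E}$ set $\mathcal{H}(u)=\frac14\int_{\mathbb{C}}|u|^4\,dL$, $M(u)=\int_{\mathbb{C}}|u|^2\,dL$, $P(u)=\int_{\mathbb{C}}(|z|^2-1)|u(z)|^2\,dL(z)$ (possibly $+\infty$). Functions: $\varphi_0(z)=\frac{1}{\sqrt\pi}e^{-|z|^2/2}$, $\varphi_1(z)=\frac{1}{\sqrt\pi}ze^{-|z|^2/2}$, and for $b\ge0$, $\psi_b(z)=\frac{e^{-\frac12\left(\frac{b}{1+b^2}\right)^2}}{\sqrt{\pi(1+b^2)}}\left(z-\frac{b(2+b^2)}{1+b^2}\right)e^{\frac{b}{1+b^2}z-\frac{|z|^2}{2}}$. Phase rotations are the maps $u(z)\mapsto e^{i\gamma}u(z)$, $\gamma\in\mathbb{R}$; space rotations are the maps $u(z)\mapsto u(e^{i\theta}z)$, $\theta\in\mathbb{R}$. A global minimizer is a $u\in\mathcal{E}$ with $M(u)=1$ and $\mathcal{G}_\mu(u)\le\mathcal{G}_\mu(v)$ for all $v\in\mathcal{E}$ with $M(v)=1$. A local minimizer is a $u\in L^{2,1}_{\mathcal{E}}=\{u\in\mathcal{E}:\int_{\mathbb{C}}(1+|z|^2)|u|^2\,dL<\infty\}$ with $M(u)=1$ for which there is $\delta>0$ such that $\mathcal{G}_\mu(u)\le\mathcal{G}_\mu(v)$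 for all $v\in L^{2,1}_{\mathcal{E}}$ with $M(v)=1$ and $\int_{\mathbb{C}}(1+|z|^2)|u-v|^2\,dL<\delta^2$. *)

theory Defs
  imports "HOL-Complex_Analysis.Complex_Analysis"
begin

text \<open>
  Integral with values in the extended reals: integral of the positive part minus integral of the
  negative part (\<^const>\<open>ennreal\<close> truncates negative reals to zero). Unlike the Bochner integral it
  yields infinity, rather than a default value, when only the positive part is not integrable.
\<close>

definition ext_integral :: "'a measure \<Rightarrow> ('a \<Rightarrow> real) \<Rightarrow> ereal" where
  "ext_integral N f =
     enn2ereal (\<integral>\<^sup>+ x. ennreal (f x) \<partial>N) - enn2ereal (\<integral>\<^sup>+ x. ennreal (- f x) \<partial>N)"

definition bargmann_fock :: "(complex \<Rightarrow> complex) set" where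
  "bargmann_fock =
     {u. (\<exists>f. f holomorphic_on UNIV \<and>
              (\<forall>z. u z = complex_of_real (exp (- (norm z)\<^sup>2 / 2)) * f z)) \<and>
         integrable lborel (\<lambda>z. (norm (u z))\<^sup>2)}"

definition bargmann_fock_21 :: "(complex \<Rightarrow> complex) set" where
  "bargmann_fock_21 =
     {u \<in> bargmann_fock. integrable lborel (\<lambda>z. (1 + (norm z)\<^sup>2) * (norm (u z))\<^sup>2)}"

definition Ham :: "(complex \<Rightarrow> complex) \<Rightarrow> ereal" where
  "Ham u = ereal (1 / 4) * ext_integral lborel (\<lambda>z. (norm (u z)) ^ 4)"

definition Mass :: "(complex \<Rightarrow> complex) \<Rightarrow> real" where
  "Mass u = (\<integral>z. (norm (u z))\<^sup>2 \<partial>lborel)"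

text \<open>
  On \<^const>\<open>bargmann_fock\<close> the negative part of the integrand below is dominated by the integrable
  function \<^term>\<open>\<lambda>z. (norm (u z))\<^sup>2\<close>, so no difference of two infinities occurs.
\<close>

definition Ang :: "(complex \<Rightarrow> complex) \<Rightarrow> ereal" where
  "Ang u = ext_integral lborel (\<lambda>z. ((norm z)\<^sup>2 - 1) * (norm (u z))\<^sup>2)"

definition Gfun :: "real \<Rightarrow> (complex \<Rightarrow> complex) \<Rightarrow> ereal" where
  "Gfun \<mu> u = ereal (8 * pi) * Ham u + ereal \<mu> * Ang u"

definition global_minimizer :: "real \<Rightarrow> (complex \<Rightarrow> complex) \<Rightarrow> bool" where
  "global_minimizer \<mu> u \<longleftrightarrow>
     u \<in> bargmann_fock \<and> Mass u = 1 \<and>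
     (\<forall>v \<in> bargmann_fock. Mass v = 1 \<longrightarrow> Gfun \<mu> u \<le> Gfun \<mu> v)"

definition local_minimizer :: "real \<Rightarrow> (complex \<Rightarrow> complex) \<Rightarrow> bool" where
  "local_minimizer \<mu> u \<longleftrightarrow>
     u \<in> bargmann_fock_21 \<and> Mass u = 1 \<and>
     (\<exists>\<delta>>0. \<forall>v \<in> bargmann_fock_21.
        Mass v = 1 \<longrightarrow>
        (\<integral>z. (1 + (norm z)\<^sup>2) * (norm (u z - v z))\<^sup>2 \<partial>lborel) < \<delta>\<^sup>2 \<longrightarrow>
        Gfun \<mu> u \<le> Gfun \<mu> v)"

definition phi0 :: "complex \<Rightarrow> complex" where
  "phi0 z = complex_of_real (1 / sqrt pi * exp (- (norm z)\<^sup>2 / 2))"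

definition phi1 :: "complex \<Rightarrow> complex" where
  "phi1 z = complex_of_real (1 / sqrt pi) * z * complex_of_real (exp (- (norm z)\<^sup>2 / 2))"

definition psi :: "real \<Rightarrow> complex \<Rightarrow> complex" where
  "psi b z =
     complex_of_real (exp (- (1 / 2) * (b / (1 + b\<^sup>2))\<^sup>2) / sqrt (pi * (1 + b\<^sup>2))) *
     (z - complex_of_real (b * (2 + b\<^sup>2) / (1 + b\<^sup>2))) *
     exp (complex_of_real (b / (1 + b\<^sup>2)) * z - complex_of_real ((norm z)\<^sup>2 / 2))"

text \<open>
  The functions obtained from \<open>u\<close> by phase and space rotations. The two kinds of rotation commute,
  so every composition of them has this form.
\<close>

definition rotation_orbit :: "(complex \<Rightarrow> complex) \<Rightarrow> (complex \<Rightarrow> complex) set" where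
  "rotation_orbit u = {\<lambda>z. cis \<gamma> * u (cis \<theta> * z) | \<gamma> \<theta>. True}"

end

theory Submission
  imports Defs "HOL-Probability.Distributions" "HOL-Library.Diagonal_Subsequence"
    "HOL-Computational_Algebra.Fundamental_Theorem_Algebra"
begin

text \<open>
  With \<open>u = exp (- |z|\<^sup>2 / 2) * f\<close> and \<open>f = \<Sum> a\<^sub>n z\<^sup>n\<close> one has \<open>M = \<pi> \<Sum> n! |a\<^sub>n|\<^sup>2\<close>, \<open>P = \<pi> \<Sum> n n! |a\<^sub>n|\<^sup>2\<close> and
  \<open>8 \<pi> H = \<pi>\<^sup>2 \<Sum> N! 2\<^bsup>-N\<^esup> |b\<^sub>N|\<^sup>2\<close>, where the \<open>b\<^sub>N\<close> are the coefficients of \<open>f\<^sup>2\<close>.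

  For fixed \<open>w\<close> the function \<open>f (w + z/2) * f (w - z/2)\<close> is even in \<open>z\<close>; a comparison of its constant and quadratic
  terms with those of order at least four, integrated over \<open>w\<close>, gives \<open>8 \<pi> H + (M P - |Q|\<^sup>2) / 2 \<ge> M\<^sup>2\<close> with
  \<open>Q = \<integral> z |u|\<^sup>2\<close>. Equality means that all these functions are polynomials of degree two in \<open>z\<close>, that is,
  \<open>f = (A z + B) exp (c z)\<close>; this settles \<open>\<mu> \<ge> 1/2\<close>.

  Minimising sequences are compact because \<open>P\<close> controls high modes. As \<open>\<mu>\<close> increases to \<open>1/2\<close>, minimisers
  other than \<open>z\<close> would converge to \<open>z\<close>, which an explicit estimate near \<open>z\<close> forbids. The energy is affine in \<open>\<mu>\<close>, so the
  set of \<open>\<mu> < 1/2\<close> at which \<open>z\<close> is a minimiser is an interval; \<open>\<mu>\<^sub>0\<close> is its infimum.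

  If \<open>u\<close> has finitely many zeros, its growth forces \<open>f = p exp (\<alpha> z + \<beta> z\<^sup>2)\<close> with a polynomial \<open>p\<close>. The
  Euler-Lagrange equation then gives \<open>\<beta> = 0\<close>, and comparing coefficients leaves, for \<open>0 < \<mu> < 1/2\<close>, only monomials. The
  second variation excludes every monomial except \<open>z\<close>, and \<open>z\<close> too when \<open>\<mu> < 5/32\<close>.
\<close>

section \<open>Lebesgue measure on the plane\<close>

text \<open>The Gaussian weight of two points factors in the centre and the relative coordinate, and
  monomials in the latter are orthogonal. The sharp inequality thus reduces to n + 1 >= 3 for even n
  >= 2; the deficit at n = 0 is paid by the quartic term.

  The term |Q|^2 makes the gap invariant under translations of the plane, so at \<mu> = 1/2 a whole
  continuous family of minimisers survives and a local estimate at z alone cannot decide what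
  happens just below. What decides is P: along that family P is at most 1, with equality only at z,
  whereas a competitor beating z for \<mu> < 1/2 must have P > 1. This selects z as the limit.

  In coefficients the cubic term of the Euler-Lagrange equation is f, used as a differential
  operator, applied to f(z/2)^2. Polynomials times Gaussians are closed under this operation, so the
  classification becomes a comparison of exponents followed by finite algebra. It only needs series
  whose coefficients decay geometrically in the Fock norm, and the bound |\<beta>| < 1/2 supplies
  these.

  The number 5/32 is the stability threshold of z against the mode z^5.\<close>

lemma lborel_complex_eq_distr:
  "(lborel :: complex measure) = distr (lborel \<Otimes>\<^sub>M lborel) borel (\<lambda>(x, y). Complex x y)"
proof (rule lborel_eqI)
  fix l u :: complex assume lu: "\<And>b. b \<in> Basis \<Longrightarrow> l \<bullet> b \<le> u \<bullet> b"
  have meas: "(\<lambda>(x, y). Complex x y) \<in> borel_measurable (lborel \<Otimes>\<^sub>M lborel)"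
    unfolding Complex_eq by measurable
  have "(\<lambda>(x, y). Complex x y) -` box l u \<inter> space (lborel \<Otimes>\<^sub>M lborel)
      = {Re l<..<Re u} \<times> {Im l<..<Im u}"
    by (auto simp: box_def Basis_complex_def space_pair_measure)
  moreover have "Re l \<le> Re u" "Im l \<le> Im u" using lu[of 1] lu[of \<i>] by (auto simp: Basis_complex_def)
  ultimately show "emeasure (distr (lborel \<Otimes>\<^sub>M lborel) borel (\<lambda>(x, y). Complex x y)) (box l u)
      = ennreal (\<Prod>b\<in>Basis. (u - l) \<bullet> b)"
    using meas by (subst emeasure_distr)
      (auto simp: lborel.emeasure_pair_measure_Times Basis_complex_def ennreal_mult' complex_i_not_one[symmetric])
qed auto

lemma nn_integral_complex:
  fixes f :: "complex \<Rightarrow> ennreal"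
  assumes [measurable]: "f \<in> borel_measurable borel"
  shows "(\<integral>\<^sup>+z. f z \<partial>lborel) = (\<integral>\<^sup>+x. \<integral>\<^sup>+y. f (Complex x y) \<partial>lborel \<partial>lborel)"
    and "(\<integral>\<^sup>+z. f z \<partial>lborel) = (\<integral>\<^sup>+y. \<integral>\<^sup>+x. f (Complex x y) \<partial>lborel \<partial>lborel)"
proof -
  have [measurable]: "(\<lambda>(x, y). Complex x y) \<in> borel_measurable (lborel \<Otimes>\<^sub>M lborel)"
    unfolding Complex_eq by measurable
  have *: "(\<integral>\<^sup>+z. f z \<partial>lborel) = (\<integral>\<^sup>+p. f (case p of (x, y) \<Rightarrow> Complex x y) \<partial>(lborel \<Otimes>\<^sub>M lborel))"
    by (subst lborel_complex_eq_distr, subst nn_integral_distr) auto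
  have m: "(\<lambda>(x,y). f (Complex x y)) \<in> borel_measurable (lborel \<Otimes>\<^sub>M lborel)"
    unfolding Complex_eq by measurable
  show "(\<integral>\<^sup>+z. f z \<partial>lborel) = (\<integral>\<^sup>+x. \<integral>\<^sup>+y. f (Complex x y) \<partial>lborel \<partial>lborel)"
    using lborel.nn_integral_fst[OF m] * by (simp add: split_beta')
  then show "(\<integral>\<^sup>+z. f z \<partial>lborel) = (\<integral>\<^sup>+y. \<integral>\<^sup>+x. f (Complex x y) \<partial>lborel \<partial>lborel)"
    using lborel_pair.Fubini'[OF m] by simp
qed

lemma nn_integral_translate:
  fixes f :: "'a::euclidean_space \<Rightarrow> ennreal"
  assumes [measurable]: "f \<in> borel_measurable borel"
  shows "(\<integral>\<^sup>+z. f (z + a) \<partial>lborel) = (\<integral>\<^sup>+z. f z \<partial>lborel)"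
  by (subst (2) lborel_distr_plus[of a, symmetric]) (simp add: nn_integral_distr add.commute)

text \<open>With one coordinate held fixed, a shear translates the other one; the two orders of
  integration above serve the two directions.\<close>

lemma nn_integral_shear:
  fixes f :: "complex \<Rightarrow> ennreal"
  assumes [measurable]: "f \<in> borel_measurable borel"
  shows "(\<integral>\<^sup>+z. f (z + of_real (t * Im z)) \<partial>lborel) = (\<integral>\<^sup>+z. f z \<partial>lborel)"
    and "(\<integral>\<^sup>+z. f (z + \<i> * of_real (t * Re z)) \<partial>lborel) = (\<integral>\<^sup>+z. f z \<partial>lborel)"
proof -
  have c: "Complex x y + of_real r = Complex (x + r) y" "Complex x y + \<i> * of_real r = Complex x (y + r)" for x y r
    by (auto simp: complex_eq_iff)
  have m1: "(\<lambda>x. f (Complex x y)) \<in> borel_measurable borel" for y unfolding Complex_eq by measurable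
  have m2: "(\<lambda>y. f (Complex x y)) \<in> borel_measurable borel" for x unfolding Complex_eq by measurable
  show "(\<integral>\<^sup>+z. f (z + of_real (t * Im z)) \<partial>lborel) = (\<integral>\<^sup>+z. f z \<partial>lborel)"
    using nn_integral_translate[OF m1]
    by (subst (1 2) nn_integral_complex(2)) (auto simp: c simp del: of_real_mult)
  show "(\<integral>\<^sup>+z. f (z + \<i> * of_real (t * Re z)) \<partial>lborel) = (\<integral>\<^sup>+z. f z \<partial>lborel)"
    using nn_integral_translate[OF m2]
    by (subst (1 2) nn_integral_complex(1)) (auto simp: c simp del: of_real_mult)
qed

text \<open>A rotation by an angle other than the straight one is a composition of three shears.\<close>

lemma lborel_rotate:
  fixes w :: complex
  assumes w: "norm w = 1" "Re w \<noteq> -1"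
  shows "distr lborel borel ((*) w) = lborel"
proof (rule measure_eqI)
  \<comment> \<open>Minus the tangent of half the angle of \<open>w\<close>, which explains why
    \<open>Re w = -1\<close> is excluded.\<close>
  define t where "t = - Im w / (1 + Re w)"
  have sq: "Re w ^ 2 + Im w ^ 2 = 1" using w by (simp add: cmod_def)
  have "1 + Re w \<noteq> 0" using w by linarith
  have tt: "t * Im w = Re w - 1" using sq \<open>1 + Re w \<noteq> 0\<close> unfolding t_def
    by (simp add: divide_simps) algebra
  have tt': "t * (1 + Re w) = - Im w" using \<open>1 + Re w \<noteq> 0\<close> unfolding t_def by simp
  define S where "S = (\<lambda>z::complex. z + of_real (t * Im z))"
  define V where "V = (\<lambda>z::complex. z + \<i> * of_real (Im w * Re z))"
  have SVS: "S (V (S z)) = w * z" for z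
  proof -
    have im: "Im z + Im w * (Re z + t * Im z) = Re w * Im z + Im w * Re z"
      using tt by algebra
    have "Re z + t * Im z + t * (Re w * Im z + Im w * Re z) = Re w * Re z - Im w * Im z"
      using tt tt' by algebra
    with im show ?thesis unfolding S_def V_def complex_eq_iff by simp
  qed
  have [measurable]: "S \<in> borel_measurable borel" "V \<in> borel_measurable borel"
    unfolding S_def V_def by measurable
  fix A assume "A \<in> sets (distr lborel borel ((*) w))"
  then have [measurable]: "A \<in> sets borel" by simp
  have "emeasure (distr lborel borel ((*) w)) A = (\<integral>\<^sup>+z. indicator A (w * z) \<partial>lborel)"
    by (subst nn_integral_distr[of "(*) w" lborel borel, symmetric]) auto
  also have "\<dots> = (\<integral>\<^sup>+z. (\<lambda>z. indicator A (S (V z)) :: ennreal) (S z) \<partial>lborel)"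
    by (simp add: SVS)
  also have "\<dots> = (\<integral>\<^sup>+z. (\<lambda>z. indicator A (S z) :: ennreal) (V z) \<partial>lborel)"
    by (subst S_def, subst nn_integral_shear(1)) auto
  also have "\<dots> = (\<integral>\<^sup>+z. indicator A (S z) \<partial>lborel)"
    by (subst V_def, subst nn_integral_shear(2)) auto
  also have "\<dots> = emeasure lborel A"
    by (subst S_def, subst nn_integral_shear(1)) auto
  finally show "emeasure (distr lborel borel ((*) w)) A = emeasure lborel A" .
qed simp

text \<open>A disc of squared radius a has area pi * a. This replaces polar coordinates: radial
  integrals become Gamma integrals on the half line.\<close>

lemma distr_norm_squared:
  "distr (lborel :: complex measure) borel (\<lambda>z. (norm z)\<^sup>2)
    = density lborel (\<lambda>x. ennreal pi * indicator {0..} x)"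
proof (rule measure_eqI_generator_eq[where E = "range atMost" and \<Omega> = UNIV and A = "\<lambda>n. {..real n}"])
  show "Int_stable (range (atMost :: real \<Rightarrow> real set))"
    by (auto simp: Int_stable_def)
  have em: "emeasure (distr (lborel :: complex measure) borel (\<lambda>z. (norm z)\<^sup>2)) {..a} = (if a < 0 then 0 else ennreal (pi * a))" for a
  proof -
    have "emeasure (distr (lborel :: complex measure) borel (\<lambda>z. (norm z)\<^sup>2)) {..a}
        = emeasure lborel {z::complex. (norm z)\<^sup>2 \<le> a}"
      by (subst emeasure_distr) (auto simp: vimage_def)
    also have "\<dots> = (if a < 0 then 0 else ennreal (pi * a))"
    proof (cases "a < 0")
      case True
      then have "{z::complex. (norm z)\<^sup>2 \<le> a} = {}" by (auto simp: not_le) (meson le_less_trans not_less zero_le_power2)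
      then show ?thesis using True by simp
    next
      case False
      then have "{z::complex. (norm z)\<^sup>2 \<le> a} = cball 0 (sqrt a)"
        by (auto simp: real_le_rsqrt) (metis norm_ge_zero real_sqrt_le_iff real_sqrt_abs abs_norm_cancel real_sqrt_pow2_iff not_less power_mono)
      then show ?thesis using False by (simp add: emeasure_cball unit_ball_vol_2)
    qed
    finally show ?thesis .
  qed
  have em2: "emeasure (density lborel (\<lambda>x. ennreal pi * indicator {0..} x)) {..a} = (if a < 0 then 0 else ennreal (pi * a))" for a
  proof -
    have "emeasure (density lborel (\<lambda>x. ennreal pi * indicator {0..} x)) {..a}
       = (\<integral>\<^sup>+x. ennreal pi * indicator {0..a} x \<partial>lborel)"
      by (subst emeasure_density) (auto intro!: nn_integral_cong split: split_indicator)
    also have "\<dots> = ennreal pi * emeasure lborel {0..a}" by (subst nn_integral_cmult_indicator) auto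
    also have "\<dots> = (if a < 0 then 0 else ennreal (pi * a))" by (auto simp: ennreal_mult')
    finally show ?thesis .
  qed
  show "emeasure (distr (lborel :: complex measure) borel (\<lambda>z. (norm z)\<^sup>2)) X = emeasure (density lborel (\<lambda>x. ennreal pi * indicator {0..} x)) X"
    if "X \<in> range atMost" for X using that em em2 by auto
  show "emeasure (distr (lborel :: complex measure) borel (\<lambda>z. (norm z)\<^sup>2)) {..real i} \<noteq> \<infinity>" for i
    by (simp add: em)
  show "(\<Union>i. {..real i}) = UNIV" using real_arch_simple by auto
  show "sets (distr (lborel :: complex measure) borel (\<lambda>z. (norm z)\<^sup>2)) = sigma_sets UNIV (range atMost)"
    by (simp add: borel_eq_atMost)
  show "sets (density lborel (\<lambda>x. ennreal pi * indicator {0..} x)) = sigma_sets UNIV (range (atMost :: real \<Rightarrow> _))"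
    by (simp add: borel_eq_atMost)
qed auto

lemma radial_moment:
  assumes s: "s > 0"
  shows "(\<integral>\<^sup>+z. ennreal ((norm (z::complex)) ^ (2 * n) * exp (- s * (norm z)\<^sup>2)) \<partial>lborel)
    = ennreal (pi * fact n / s ^ Suc n)"
proof -
  have "(\<integral>\<^sup>+z. ennreal ((norm (z::complex)) ^ (2 * n) * exp (- s * (norm z)\<^sup>2)) \<partial>lborel)
      = (\<integral>\<^sup>+x. ennreal (x ^ n * exp (- s * x)) \<partial>distr (lborel::complex measure) borel (\<lambda>z. (norm z)\<^sup>2))"
    by (subst nn_integral_distr) (auto simp: power_mult)
  also have "\<dots> = (\<integral>\<^sup>+x. ennreal pi * indicator {0..} x * ennreal (x ^ n * exp (- s * x)) \<partial>lborel)"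
    unfolding distr_norm_squared by (subst nn_integral_density) auto
  also have "\<dots> = ennreal pi * (\<integral>\<^sup>+x. indicator {0..} x * ennreal (x ^ n * exp (- s * x)) \<partial>lborel)"
    by (subst nn_integral_cmult[symmetric]) (auto simp: mult.assoc)
  also have "(\<integral>\<^sup>+x. indicator {0..} x * ennreal (x ^ n * exp (- s * x)) \<partial>lborel)
     = ennreal \<bar>1/s\<bar> * (\<integral>\<^sup>+x. indicator {0..} (0 + (1/s) * x) * ennreal ((0 + (1/s) * x) ^ n * exp (- s * (0 + (1/s) * x))) \<partial>lborel)"
    using s by (subst nn_integral_real_affine[where c = "1/s" and t = 0]) auto
  also have "(\<integral>\<^sup>+x. indicator {0..} (0 + (1/s) * x) * ennreal ((0 + (1/s) * x) ^ n * exp (- s * (0 + (1/s) * x))) \<partial>lborel)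
     = (\<integral>\<^sup>+x. ennreal (1 / s ^ n) * (ennreal (x ^ n * exp (- x)) * indicator {0..} x) \<partial>lborel)"
    using s by (intro nn_integral_cong) (auto split: split_indicator simp: ennreal_mult'[symmetric] power_divide zero_le_divide_iff)
  also have "\<dots> = ennreal (1 / s ^ n) * ennreal (fact n)"
    by (subst nn_integral_cmult) (auto simp: nn_intergal_power_times_exp_Ici)
  finally show ?thesis using s by (simp add: ennreal_mult'[symmetric] field_simps)
qed

text \<open>Here \<open>w\<close> is the centre of mass and \<open>z\<close> the relative coordinate of two points.\<close>

lemma nn_integral_relative:
  fixes \<Phi> :: "complex \<Rightarrow> complex \<Rightarrow> ennreal"
  assumes [measurable]: "case_prod \<Phi> \<in> borel_measurable (borel \<Otimes>\<^sub>M borel)"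
  shows "(\<integral>\<^sup>+w. \<integral>\<^sup>+z. \<Phi> z w \<partial>lborel \<partial>lborel) = (\<integral>\<^sup>+w. \<integral>\<^sup>+z. \<Phi> (w + z / 2) (w - z / 2) \<partial>lborel \<partial>lborel)"
proof -
  have m1: "(\<lambda>z. \<Phi> z w) \<in> borel_measurable borel" for w by measurable
  have m2: "(\<lambda>w. \<Phi> (z + w) w) \<in> borel_measurable borel" for z by measurable
  have m3: "(\<lambda>(w, z). \<Phi> (z + w) w) \<in> borel_measurable (lborel \<Otimes>\<^sub>M lborel)" by measurable
  have m4: "(\<lambda>(w, z). \<Phi> (w + z / 2) (w - z / 2)) \<in> borel_measurable (lborel \<Otimes>\<^sub>M lborel)" by measurable
  have "(\<integral>\<^sup>+w. \<integral>\<^sup>+z. \<Phi> z w \<partial>lborel \<partial>lborel) = (\<integral>\<^sup>+w. \<integral>\<^sup>+z. \<Phi> (z + w) w \<partial>lborel \<partial>lborel)"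
    by (subst nn_integral_translate[OF m1]) simp
  also have "\<dots> = (\<integral>\<^sup>+z. \<integral>\<^sup>+w. \<Phi> (z + w) w \<partial>lborel \<partial>lborel)"
    using lborel_pair.Fubini'[OF m3] by simp
  also have "\<dots> = (\<integral>\<^sup>+z. \<integral>\<^sup>+w. \<Phi> (w + z / 2) (w - z / 2) \<partial>lborel \<partial>lborel)"
  proof (rule nn_integral_cong)
    fix z
    have "(\<integral>\<^sup>+w. \<Phi> (z + w) w \<partial>lborel) = (\<integral>\<^sup>+w. \<Phi> (z + (w + - (z/2))) (w + - (z/2)) \<partial>lborel)"
      by (rule nn_integral_translate[OF m2, symmetric])
    moreover have "z + (w + - (z/2)) = w + z/2" for w by (simp add: field_simps)
    ultimately show "(\<integral>\<^sup>+w. \<Phi> (z + w) w \<partial>lborel) = (\<integral>\<^sup>+w. \<Phi> (w + z / 2) (w - z / 2) \<partial>lborel)" by (simp add: add.commute)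
  qed
  also have "\<dots> = (\<integral>\<^sup>+w. \<integral>\<^sup>+z. \<Phi> (w + z / 2) (w - z / 2) \<partial>lborel \<partial>lborel)"
    using lborel_pair.Fubini'[OF m4] by simp
  finally show ?thesis .
qed

section \<open>Power series integrated over discs\<close>

text \<open>On a disc a power series converges uniformly, so sums and integrals may be exchanged;
  the whole plane is reached afterwards by monotone convergence in \<open>R\<close>. The flat weight
  \<open>s = 0\<close> is used much later, to estimate the growth of a logarithm.\<close>

definition disc_weight :: "real \<Rightarrow> real \<Rightarrow> complex \<Rightarrow> real" where
  "disc_weight s R z = indicator (ball 0 R) z * exp (- s * (norm z)\<^sup>2)"

definition disc_moment :: "real \<Rightarrow> real \<Rightarrow> nat \<Rightarrow> real" where
  "disc_moment s R n = (\<integral>z. disc_weight s R z * norm z ^ (2 * n) \<partial>lborel)"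

lemma measurable_cnj [measurable (raw)]:
  "f \<in> borel_measurable M \<Longrightarrow> (\<lambda>x. cnj (f x)) \<in> borel_measurable M"
  by (rule borel_measurable_continuous_on[where f = cnj]) (auto intro: continuous_intros)

lemma disc_weight_measurable [measurable]: "disc_weight s R \<in> borel_measurable borel"
  unfolding disc_weight_def[abs_def]
  by (intro borel_measurable_times borel_measurable_indicator borel_measurable_continuous_onI continuous_intros) auto

lemma disc_weight_nonneg [simp]: "disc_weight s R z \<ge> 0"
  by (auto simp: disc_weight_def)

lemma disc_weight_eq_0: "norm z \<ge> R \<Longrightarrow> disc_weight s R z = 0"
  by (auto simp: disc_weight_def)

lemma disc_weight_le: "disc_weight s R z \<le> exp (\<bar>s\<bar> * R\<^sup>2) * indicator (ball 0 R) z"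
proof (cases "norm z < R")
  case True
  have "- s * (norm z)\<^sup>2 \<le> \<bar>s\<bar> * (norm z)\<^sup>2" by (intro mult_right_mono) auto
  also have "\<dots> \<le> \<bar>s\<bar> * R\<^sup>2" using True by (intro mult_left_mono power_mono) auto
  finally show ?thesis using True by (auto simp: disc_weight_def)
qed (auto simp: disc_weight_def)

lemma integrable_disc_const: "integrable lborel (\<lambda>z::complex. c * indicator (ball 0 R) z :: real)"
  using emeasure_bounded_finite[OF bounded_ball, of "0::complex" R]
  by (intro integrable_mult_right integrable_real_indicator) (simp_all add: less_top)

lemma integrable_disc_weight:
  fixes h :: "complex \<Rightarrow> 'a::{banach,second_countable_topology}"
  assumes [measurable]: "h \<in> borel_measurable borel" and B: "\<And>z. norm z < R \<Longrightarrow> norm (h z) \<le> B"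
  shows "integrable lborel (\<lambda>z. disc_weight s R z *\<^sub>R h z)"
proof (rule Bochner_Integration.integrable_bound[OF integrable_disc_const[of "exp (\<bar>s\<bar> * R\<^sup>2) * B" R]])
  show "AE z in lborel. norm (disc_weight s R z *\<^sub>R h z) \<le> norm (exp (\<bar>s\<bar> * R\<^sup>2) * B * indicator (ball 0 R) z :: real)"
  proof (rule AE_I2)
    fix z :: complex
    show "norm (disc_weight s R z *\<^sub>R h z) \<le> norm (exp (\<bar>s\<bar> * R\<^sup>2) * B * indicator (ball 0 R) z :: real)"
    proof (cases "norm z < R")
      case True
      then have "0 \<le> B" using B[OF True] norm_ge_zero order_trans by blast
      moreover have "disc_weight s R z \<le> exp (\<bar>s\<bar> * R\<^sup>2)" using True disc_weight_le[of s R z] by simp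
      ultimately have "disc_weight s R z * norm (h z) \<le> exp (\<bar>s\<bar> * R\<^sup>2) * B"
        using B[OF True] by (intro mult_mono) simp_all
      then show ?thesis using True \<open>0 \<le> B\<close> by simp
    qed (auto simp: disc_weight_eq_0)
  qed
qed measurable

lemma disc_moment_nonneg: "disc_moment s R n \<ge> 0"
  unfolding disc_moment_def by (intro Bochner_Integration.integral_nonneg) auto

lemma disc_integral_rotate:
  fixes h :: "complex \<Rightarrow> complex"
  assumes [measurable]: "h \<in> borel_measurable borel" and w: "norm w = 1" "Re w \<noteq> -1"
  shows "(\<integral>z. disc_weight s R z *\<^sub>R h (w * z) \<partial>lborel) = (\<integral>z. disc_weight s R z *\<^sub>R h z \<partial>lborel)"
proof -
  have "(\<integral>z. disc_weight s R z *\<^sub>R h z \<partial>lborel) = (\<integral>z. disc_weight s R z *\<^sub>R h z \<partial>distr lborel borel ((*) w))"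
    by (simp add: lborel_rotate[OF w])
  also have "\<dots> = (\<integral>z. disc_weight s R (w * z) *\<^sub>R h (w * z) \<partial>lborel)"
    by (subst integral_distr) auto
  also have "\<dots> = (\<integral>z. disc_weight s R z *\<^sub>R h (w * z) \<partial>lborel)"
    using w by (simp add: disc_weight_def norm_mult indicator_def)
  finally show ?thesis by simp
qed

text \<open>A rotation preserves the weight but multiplies the integrand by a phase, which is
  nontrivial unless the exponents agree.\<close>

lemma disc_orthogonal:
  "(\<integral>z. disc_weight s R z *\<^sub>R (z ^ n * cnj z ^ m) \<partial>lborel) = (if n = m then of_real (disc_moment s R n) else 0)"
proof (cases "n = m")
  case True
  have "(\<integral>z. disc_weight s R z *\<^sub>R (z ^ n * cnj z ^ n) \<partial>lborel)
      = (\<integral>z. complex_of_real (disc_weight s R z * norm z ^ (2 * n)) \<partial>lborel)"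
    by (intro Bochner_Integration.integral_cong)
       (auto simp: power_mult_distrib[symmetric] complex_norm_square[symmetric] power_mult scaleR_conv_of_real)
  also have "\<dots> = of_real (disc_moment s R n)" unfolding disc_moment_def by (rule integral_complex_of_real)
  finally show ?thesis using True by simp
next
  case False
  define I where "I = (\<integral>z. disc_weight s R z *\<^sub>R (z ^ n * cnj z ^ m) \<partial>lborel)"
  define k where "k = int n - int m"
  have k: "k \<noteq> 0" using False unfolding k_def by simp
  \<comment> \<open>With this angle the phase picked up is \<open>cis 1\<close>, and |\<theta>| <= 1
    < pi/2 keeps the rotation away from the excluded half turn.\<close>
  define \<theta> where "\<theta> = (1 / of_int k :: real)"
  have abs1: "\<bar>\<theta>\<bar> \<le> 1" using k unfolding \<theta>_def by (simp add: abs_divide field_simps)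
  define w where "w = cis \<theta>"
  have "cos \<theta> > 0" using abs1 pi_gt3 by (intro cos_gt_zero_pi) auto
  then have w: "norm w = 1" "Re w \<noteq> -1" unfolding w_def by auto
  have "w ^ n * cnj w ^ m = cis (of_int k * \<theta>)"
    unfolding w_def k_def cis_cnj Complex.DeMoivre cis_mult by (simp add: algebra_simps)
  also have "of_int k * \<theta> = 1" using k unfolding \<theta>_def by simp
  finally have ww: "w ^ n * cnj w ^ m = cis 1" .
  have "I = (\<integral>z. disc_weight s R z *\<^sub>R ((w * z) ^ n * cnj (w * z) ^ m) \<partial>lborel)"
    unfolding I_def by (rule disc_integral_rotate[OF _ w, symmetric]) measurable
  also have "\<dots> = (\<integral>z. cis 1 * (disc_weight s R z *\<^sub>R (z ^ n * cnj z ^ m)) \<partial>lborel)"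
    by (intro Bochner_Integration.integral_cong) (auto simp: ww[symmetric] power_mult_distrib algebra_simps)
  also have "\<dots> = cis 1 * I" unfolding I_def by (rule integral_mult_right_zero)
  finally have "(1 - cis 1) * I = 0" by (simp add: algebra_simps)
  moreover have "cis 1 \<noteq> 1"
  proof
    assume "cis 1 = 1" then have "sin (1::real) = 0" by (simp add: complex_eq_iff)
    moreover have "sin (1::real) > 0" using pi_gt3 by (intro sin_gt_zero) auto
    ultimately show False by simp
  qed
  ultimately show ?thesis using False unfolding I_def by auto
qed

lemma borel_measurable_eval_fps:
  fixes F :: "complex fps"
  assumes "fps_conv_radius F = \<infinity>"
  shows "eval_fps F \<in> borel_measurable borel"
  using continuous_on_eval_fps[of F] assms by (auto intro: borel_measurable_continuous_onI)

lemma norm_partial_eval_fps_le: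
  fixes F :: "complex fps"
  assumes "fps_conv_radius F = \<infinity>" "norm z \<le> R"
  shows "norm (\<Sum>n<k. fps_nth F n * z ^ n) \<le> (\<Sum>n. norm (fps_nth F n) * R ^ n)"
proof -
  have "0 \<le> R" using assms(2) norm_ge_zero order_trans by blast
  then have s: "summable (\<lambda>n. norm (fps_nth F n) * R ^ n)"
    using norm_summable_fps[of "of_real R" F] assms(1) by (simp add: norm_mult norm_power)
  have "norm (\<Sum>n<k. fps_nth F n * z ^ n) \<le> (\<Sum>n<k. norm (fps_nth F n) * R ^ n)"
    using assms(2) by (intro sum_norm_le) (auto simp: norm_mult norm_power intro!: mult_left_mono power_mono)
  also have "\<dots> \<le> (\<Sum>n. norm (fps_nth F n) * R ^ n)"
    using s \<open>0 \<le> R\<close> by (intro sum_le_suminf) auto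
  finally show ?thesis .
qed

lemma norm_eval_fps_le:
  fixes F :: "complex fps"
  assumes "fps_conv_radius F = \<infinity>" "norm z \<le> R"
  shows "norm (eval_fps F z) \<le> (\<Sum>n. norm (fps_nth F n) * R ^ n)"
proof -
  have "(\<lambda>n. fps_nth F n * z ^ n) sums eval_fps F z" using assms by (intro sums_eval_fps) auto
  then have "(\<lambda>k. norm (\<Sum>n<k. fps_nth F n * z ^ n)) \<longlonglongrightarrow> norm (eval_fps F z)"
    unfolding sums_def by (intro tendsto_norm)
  then show ?thesis by (rule Lim_bounded) (use norm_partial_eval_fps_le[OF assms] in auto)
qed

text \<open>Dominated convergence, the majorant being the series of absolute values at radius
  \<open>R\<close>. The factor \<open>h\<close> will be a conjugate power, which extracts a
  coefficient, and then the conjugate function itself, which gives Parseval.\<close>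

lemma disc_sums_eval_fps:
  fixes F :: "complex fps" and h :: "complex \<Rightarrow> complex"
  assumes F: "fps_conv_radius F = \<infinity>" and [measurable]: "h \<in> borel_measurable borel"
    and B: "\<And>z. norm z < R \<Longrightarrow> norm (h z) \<le> B"
  shows "(\<lambda>n. fps_nth F n * (\<integral>z. disc_weight s R z *\<^sub>R (z ^ n * h z) \<partial>lborel))
    sums (\<integral>z. disc_weight s R z *\<^sub>R (eval_fps F z * h z) \<partial>lborel)"
proof -
  note [measurable] = borel_measurable_eval_fps[OF F]
  define C where "C = (\<Sum>n. norm (fps_nth F n) * R ^ n)"
  have int: "integrable lborel (\<lambda>z. disc_weight s R z *\<^sub>R (z ^ n * h z))" for n
  proof (rule integrable_disc_weight[where B = "R ^ n * B"])
    fix z :: complex assume "norm z < R"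
    moreover from this have "0 < R" using norm_ge_zero[of z] by linarith
    ultimately show "norm (z ^ n * h z) \<le> R ^ n * B"
      unfolding norm_mult norm_power using B[of z] by (intro mult_mono power_mono) auto
  qed measurable
  have "(\<lambda>k. \<integral>z. disc_weight s R z *\<^sub>R ((\<Sum>n<k. fps_nth F n * z ^ n) * h z) \<partial>lborel)
     \<longlonglongrightarrow> (\<integral>z. disc_weight s R z *\<^sub>R (eval_fps F z * h z) \<partial>lborel)"
  proof (rule integral_dominated_convergence[where w = "\<lambda>z. exp (\<bar>s\<bar> * R\<^sup>2) * (C * B) * indicator (ball 0 R) z"])
    show "integrable lborel (\<lambda>z::complex. exp (\<bar>s\<bar> * R\<^sup>2) * (C * B) * indicator (ball 0 R) z :: real)"
      by (rule integrable_disc_const)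
    show "AE z in lborel. (\<lambda>k. disc_weight s R z *\<^sub>R ((\<Sum>n<k. fps_nth F n * z ^ n) * h z))
       \<longlonglongrightarrow> disc_weight s R z *\<^sub>R (eval_fps F z * h z)"
    proof (rule AE_I2)
      fix z :: complex
      have "(\<lambda>k. \<Sum>n<k. fps_nth F n * z ^ n) \<longlonglongrightarrow> eval_fps F z"
        using sums_eval_fps[of z F] F unfolding sums_def by simp
      then show "(\<lambda>k. disc_weight s R z *\<^sub>R ((\<Sum>n<k. fps_nth F n * z ^ n) * h z))
       \<longlonglongrightarrow> disc_weight s R z *\<^sub>R (eval_fps F z * h z)"
        by (intro tendsto_scaleR tendsto_mult tendsto_const)
    qed
    fix k
    show "AE z in lborel. norm (disc_weight s R z *\<^sub>R ((\<Sum>n<k. fps_nth F n * z ^ n) * h z))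
       \<le> exp (\<bar>s\<bar> * R\<^sup>2) * (C * B) * indicator (ball 0 R) z"
    proof (rule AE_I2)
      fix z :: complex
      show "norm (disc_weight s R z *\<^sub>R ((\<Sum>n<k. fps_nth F n * z ^ n) * h z))
       \<le> exp (\<bar>s\<bar> * R\<^sup>2) * (C * B) * indicator (ball 0 R) z"
      proof (cases "norm z < R")
        case True
        have C: "norm (\<Sum>n<k. fps_nth F n * z ^ n) \<le> C"
          unfolding C_def using True norm_partial_eval_fps_le[OF F, of z R k] by simp
        then have "0 \<le> C" by (rule order_trans[OF norm_ge_zero])
        with C have "norm ((\<Sum>n<k. fps_nth F n * z ^ n) * h z) \<le> C * B"
          unfolding norm_mult using B[OF True] by (intro mult_mono) auto
        moreover from this have "0 \<le> C * B" using norm_ge_zero order_trans by blast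
        moreover have "disc_weight s R z \<le> exp (\<bar>s\<bar> * R\<^sup>2)" using True disc_weight_le[of s R z] by simp
        ultimately have "disc_weight s R z * norm ((\<Sum>n<k. fps_nth F n * z ^ n) * h z) \<le> exp (\<bar>s\<bar> * R\<^sup>2) * (C * B)"
          by (intro mult_mono) simp_all
        then show ?thesis using True by simp
      qed (auto simp: disc_weight_eq_0)
    qed
  qed measurable
  moreover have "(\<integral>z. disc_weight s R z *\<^sub>R ((\<Sum>n<k. fps_nth F n * z ^ n) * h z) \<partial>lborel)
     = (\<Sum>n<k. fps_nth F n * (\<integral>z. disc_weight s R z *\<^sub>R (z ^ n * h z) \<partial>lborel))" for k
  proof -
    have "(\<integral>z. disc_weight s R z *\<^sub>R ((\<Sum>n<k. fps_nth F n * z ^ n) * h z) \<partial>lborel)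
      = (\<integral>z. (\<Sum>n<k. fps_nth F n * (disc_weight s R z *\<^sub>R (z ^ n * h z))) \<partial>lborel)"
      unfolding sum_distrib_right scaleR_sum_right mult_scaleR_right mult.assoc ..
    also have "\<dots> = (\<Sum>n<k. fps_nth F n * (\<integral>z. disc_weight s R z *\<^sub>R (z ^ n * h z) \<partial>lborel))"
      by (subst Bochner_Integration.integral_sum) (simp_all only: integrable_mult_right int integral_mult_right_zero)
    finally show ?thesis .
  qed
  ultimately show ?thesis unfolding sums_def by simp
qed

lemma disc_coefficient:
  fixes F :: "complex fps"
  assumes F: "fps_conv_radius F = \<infinity>"
  shows "(\<integral>z. disc_weight s R z *\<^sub>R (eval_fps F z * cnj z ^ m) \<partial>lborel) = fps_nth F m * of_real (disc_moment s R m)"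
proof -
  have "(\<lambda>n. fps_nth F n * (\<integral>z. disc_weight s R z *\<^sub>R (z ^ n * cnj z ^ m) \<partial>lborel))
    sums (\<integral>z. disc_weight s R z *\<^sub>R (eval_fps F z * cnj z ^ m) \<partial>lborel)"
    by (rule disc_sums_eval_fps[OF F, where B = "R ^ m"]) (auto simp: norm_power intro!: power_mono)
  moreover have "(\<lambda>n. fps_nth F n * (\<integral>z. disc_weight s R z *\<^sub>R (z ^ n * cnj z ^ m) \<partial>lborel))
     = (\<lambda>n. if n = m then fps_nth F m * of_real (disc_moment s R m) else 0)"
    by (auto simp: disc_orthogonal)
  ultimately show ?thesis using sums_unique2[OF _ sums_single[of m "\<lambda>_. fps_nth F m * of_real (disc_moment s R m)"]] by simp
qed

lemma disc_parseval:
  fixes F :: "complex fps"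
  assumes F: "fps_conv_radius F = \<infinity>"
  shows "(\<lambda>n. (norm (fps_nth F n))\<^sup>2 * disc_moment s R n) sums (\<integral>z. disc_weight s R z * (norm (eval_fps F z))\<^sup>2 \<partial>lborel)"
proof -
  note [measurable] = borel_measurable_eval_fps[OF F]
  have "(\<lambda>n. fps_nth F n * (\<integral>z. disc_weight s R z *\<^sub>R (z ^ n * cnj (eval_fps F z)) \<partial>lborel))
    sums (\<integral>z. disc_weight s R z *\<^sub>R (eval_fps F z * cnj (eval_fps F z)) \<partial>lborel)"
  proof (rule disc_sums_eval_fps[OF F])
    show "norm (cnj (eval_fps F z)) \<le> (\<Sum>n. norm (fps_nth F n) * R ^ n)" if "norm z < R" for z
      using norm_eval_fps_le[OF F, of z R] that by simp
  qed measurable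
  moreover have "(\<integral>z. disc_weight s R z *\<^sub>R (z ^ n * cnj (eval_fps F z)) \<partial>lborel) = cnj (fps_nth F n) * of_real (disc_moment s R n)" for n
  proof -
    have "(\<integral>z. disc_weight s R z *\<^sub>R (z ^ n * cnj (eval_fps F z)) \<partial>lborel)
       = (\<integral>z. cnj (disc_weight s R z *\<^sub>R (eval_fps F z * cnj z ^ n)) \<partial>lborel)"
      by (intro Bochner_Integration.integral_cong refl) (simp add: mult.commute)
    also have "\<dots> = cnj (\<integral>z. disc_weight s R z *\<^sub>R (eval_fps F z * cnj z ^ n) \<partial>lborel)"
    proof (rule integral_bounded_linear[OF bounded_linear_cnj], rule integrable_disc_weight)
      fix z :: complex assume "norm z < R"
      then show "norm (eval_fps F z * cnj z ^ n) \<le> (\<Sum>n. norm (fps_nth F n) * R ^ n) * R ^ n"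
        using norm_eval_fps_le[OF F, of z R] order_trans[OF norm_ge_zero norm_eval_fps_le[OF F, of z R]]
        unfolding norm_mult norm_power complex_mod_cnj
        by (intro mult_mono power_mono) auto
    qed measurable
    finally show ?thesis by (simp add: disc_coefficient[OF F])
  qed
  ultimately have "(\<lambda>n. fps_nth F n * (cnj (fps_nth F n) * of_real (disc_moment s R n)))
    sums (\<integral>z. disc_weight s R z *\<^sub>R (eval_fps F z * cnj (eval_fps F z)) \<partial>lborel)" by simp
  moreover have "(\<integral>z. disc_weight s R z *\<^sub>R (eval_fps F z * cnj (eval_fps F z)) \<partial>lborel)
     = of_real (\<integral>z. disc_weight s R z * (norm (eval_fps F z))\<^sup>2 \<partial>lborel)"
    by (subst integral_complex_of_real[symmetric], intro Bochner_Integration.integral_cong refl)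
       (simp only: complex_norm_square[symmetric] scaleR_conv_of_real of_real_mult)
  moreover have "fps_nth F n * (cnj (fps_nth F n) * of_real (disc_moment s R n)) = of_real ((norm (fps_nth F n))\<^sup>2 * disc_moment s R n)" for n
    unfolding of_real_mult complex_norm_square by (simp only: mult.assoc)
  ultimately show ?thesis by (simp only: sums_of_real_iff)
qed

lemma nn_integral_discs:
  fixes h :: "complex \<Rightarrow> real"
  assumes [measurable]: "h \<in> borel_measurable borel" and h: "\<And>z. h z \<ge> 0"
  shows "(\<integral>\<^sup>+z. ennreal (exp (- s * (norm z)\<^sup>2) * h z) \<partial>lborel) = (SUP k. \<integral>\<^sup>+z. ennreal (disc_weight s (real k) z * h z) \<partial>lborel)"
proof -
  have "(SUP k. ennreal (disc_weight s (real k) z * h z)) = ennreal (exp (- s * (norm z)\<^sup>2) * h z)" for z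
  proof (rule antisym)
    show "(SUP k. ennreal (disc_weight s (real k) z * h z)) \<le> ennreal (exp (- s * (norm z)\<^sup>2) * h z)"
      using h by (intro SUP_least ennreal_leI mult_right_mono) (auto simp: disc_weight_def indicator_def)
    obtain k where "norm z < real k" using reals_Archimedean2 by blast
    then have "ennreal (exp (- s * (norm z)\<^sup>2) * h z) = ennreal (disc_weight s (real k) z * h z)" by (simp add: disc_weight_def)
    then show "ennreal (exp (- s * (norm z)\<^sup>2) * h z) \<le> (SUP k. ennreal (disc_weight s (real k) z * h z))"
      by (auto intro: SUP_upper)
  qed
  then have "(\<integral>\<^sup>+z. ennreal (exp (- s * (norm z)\<^sup>2) * h z) \<partial>lborel) = (\<integral>\<^sup>+z. (SUP k. ennreal (disc_weight s (real k) z * h z)) \<partial>lborel)"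
    by simp
  also have "\<dots> = (SUP k. \<integral>\<^sup>+z. ennreal (disc_weight s (real k) z * h z) \<partial>lborel)"
    using h by (intro nn_integral_monotone_convergence_SUP)
      (auto simp: incseq_def le_fun_def disc_weight_def indicator_def intro!: ennreal_leI mult_right_mono)
  finally show ?thesis .
qed

lemma nn_integral_disc_parseval:
  fixes F :: "complex fps"
  assumes F: "fps_conv_radius F = \<infinity>"
  shows "(\<integral>\<^sup>+z. ennreal (disc_weight s R z * (norm (eval_fps F z))\<^sup>2) \<partial>lborel)
    = (\<Sum>n. ennreal ((norm (fps_nth F n))\<^sup>2) * (\<integral>\<^sup>+z. ennreal (disc_weight s R z * (norm z ^ (2 * n))) \<partial>lborel))"
proof -
  note [measurable] = borel_measurable_eval_fps[OF F]
  have "integrable lborel (\<lambda>z. disc_weight s R z *\<^sub>R (norm (eval_fps F z))\<^sup>2)"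
    using norm_eval_fps_le[OF F, of _ R]
    by (intro integrable_disc_weight[where B = "(\<Sum>n. norm (fps_nth F n) * R ^ n)\<^sup>2"]) (auto intro!: power_mono)
  then have "(\<integral>\<^sup>+z. ennreal (disc_weight s R z * (norm (eval_fps F z))\<^sup>2) \<partial>lborel)
     = ennreal (\<integral>z. disc_weight s R z * (norm (eval_fps F z))\<^sup>2 \<partial>lborel)"
    by (intro nn_integral_eq_integral) auto
  also have "\<dots> = (\<Sum>n. ennreal ((norm (fps_nth F n))\<^sup>2 * disc_moment s R n))"
    using disc_parseval[OF F, of s R] disc_moment_nonneg
    by (simp add: sums_iff suminf_ennreal2)
  also have "\<dots> = (\<Sum>n. ennreal ((norm (fps_nth F n))\<^sup>2) * (\<integral>\<^sup>+z. ennreal (disc_weight s R z * (norm z ^ (2 * n))) \<partial>lborel))"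
  proof -
    have "integrable lborel (\<lambda>z::complex. disc_weight s R z *\<^sub>R (norm z ^ (2*n)))" for n
      by (intro integrable_disc_weight[where B = "R ^ (2*n)"]) (auto intro!: power_mono)
    then have "(\<integral>\<^sup>+z. ennreal (disc_weight s R z * (norm z ^ (2 * n))) \<partial>lborel) = ennreal (disc_moment s R n)" for n
      unfolding disc_moment_def by (intro nn_integral_eq_integral) auto
    then show ?thesis by (simp add: ennreal_mult' disc_moment_nonneg)
  qed
  finally show ?thesis .
qed

text \<open>Stated in \<open>ennreal\<close>, so that the same identity both decides integrability
  and computes the norm. The parameter \<open>s\<close> is 1 for the mass, 2 for the fourth power,
  and 1/2 for the relative coordinate of two points.\<close>

theorem gauss_parseval:
  fixes F :: "complex fps"
  assumes F: "fps_conv_radius F = \<infinity>" and s: "s > 0"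
  shows "(\<integral>\<^sup>+z. ennreal (exp (- s * (norm z)\<^sup>2) * (norm (eval_fps F z))\<^sup>2) \<partial>lborel)
    = (\<Sum>n. ennreal ((norm (fps_nth F n))\<^sup>2 * (pi * fact n / s ^ Suc n)))"
proof -
  note [measurable] = borel_measurable_eval_fps[OF F]
  define J where "J k n = (\<integral>\<^sup>+z. ennreal (disc_weight s (real k) z * (norm (z::complex) ^ (2 * n))) \<partial>lborel)" for k n
  have inc: "incseq (\<lambda>k. J k n)" for n unfolding J_def
    by (auto simp: incseq_def disc_weight_def indicator_def intro!: nn_integral_mono ennreal_leI mult_right_mono)
  have "(\<integral>\<^sup>+z. ennreal (exp (- s * (norm z)\<^sup>2) * (norm (eval_fps F z))\<^sup>2) \<partial>lborel)
     = (SUP k. \<integral>\<^sup>+z. ennreal (disc_weight s (real k) z * (norm (eval_fps F z))\<^sup>2) \<partial>lborel)"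
    by (rule nn_integral_discs) auto
  also have "\<dots> = (SUP k. \<Sum>n. ennreal ((norm (fps_nth F n))\<^sup>2) * J k n)"
    unfolding J_def by (simp add: nn_integral_disc_parseval[OF F])
  also have "\<dots> = (\<Sum>n. SUP k. ennreal ((norm (fps_nth F n))\<^sup>2) * J k n)"
    using inc by (intro ennreal_suminf_SUP_eq[symmetric]) (auto simp: incseq_def intro!: mult_left_mono)
  also have "\<dots> = (\<Sum>n. ennreal ((norm (fps_nth F n))\<^sup>2) * (SUP k. J k n))"
    by (simp add: SUP_mult_left_ennreal)
  finally have *: "(\<integral>\<^sup>+z. ennreal (exp (- s * (norm z)\<^sup>2) * (norm (eval_fps F z))\<^sup>2) \<partial>lborel)
    = (\<Sum>n. ennreal ((norm (fps_nth F n))\<^sup>2) * (SUP k. J k n))" .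
  have "(SUP k. J k n) = ennreal (pi * fact n / s ^ Suc n)" for n
    unfolding J_def using nn_integral_discs[of "\<lambda>z. norm z ^ (2*n)" s] radial_moment[OF s, of n] by (simp add: mult.commute)
  with * show ?thesis by (simp only: ennreal_mult'[OF zero_le_power2])
qed

section \<open>The functionals as power series\<close>

definition fock :: "complex fps \<Rightarrow> bool" where
  "fock F \<longleftrightarrow> summable (\<lambda>n. fact n * (norm (fps_nth F n))\<^sup>2)"

definition fock1 :: "complex fps \<Rightarrow> bool" where
  "fock1 F \<longleftrightarrow> summable (\<lambda>n. real n * (fact n * (norm (fps_nth F n))\<^sup>2))"

definition mass :: "complex fps \<Rightarrow> real" where
  "mass F = pi * (\<Sum>n. fact n * (norm (fps_nth F n))\<^sup>2)"

definition ang :: "complex fps \<Rightarrow> real" where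
  "ang F = pi * (\<Sum>n. real n * (fact n * (norm (fps_nth F n))\<^sup>2))"

definition ham :: "complex fps \<Rightarrow> real" where
  "ham F = pi\<^sup>2 * (\<Sum>n. fact n / 2 ^ n * (norm (fps_nth (F * F) n))\<^sup>2)"

definition state :: "complex fps \<Rightarrow> complex \<Rightarrow> complex" where
  "state F z = complex_of_real (exp (- (norm z)\<^sup>2 / 2)) * eval_fps F z"

lemma fock1_imp_fock: assumes "fock1 F" shows "fock F"
  unfolding fock_def
proof (rule summable_comparison_test_ev)
  show "summable (\<lambda>n. real n * (fact n * (norm (fps_nth F n))\<^sup>2))" using assms by (simp add: fock1_def)
  show "\<forall>\<^sub>F n in sequentially. norm (fact n * (norm (fps_nth F n))\<^sup>2) \<le> real n * (fact n * (norm (fps_nth F n))\<^sup>2)"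
    using eventually_ge_at_top[of 1]
  proof eventually_elim
    case (elim n)
    have "1 * (fact n * (norm (fps_nth F n))\<^sup>2) \<le> real n * (fact n * (norm (fps_nth F n))\<^sup>2)"
      using elim by (intro mult_right_mono) auto
    then show ?case by simp
  qed
qed

lemma exp_sums_even: "(\<lambda>n. (r::real) ^ (2 * n) / fact n) sums exp (r\<^sup>2)"
proof -
  have "(\<lambda>n. (r\<^sup>2) ^ n /\<^sub>R fact n) = (\<lambda>n. r ^ (2 * n) / fact n)"
    unfolding power_mult real_scaleR_def divide_inverse by (simp only: mult.commute[of "inverse _"])
  then show ?thesis using exp_converges[of "r\<^sup>2"] by simp
qed

text \<open>Young's inequality; \<open>t\<close> is chosen of order \<open>exp (r\<^sup>2 / 2)\<close> below.\<close>

lemma power_term_le: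
  fixes a r t :: real
  assumes "t > 0" "r \<ge> 0" "a \<ge> 0"
  shows "a * r ^ n \<le> (t * (fact n * a\<^sup>2) + r ^ (2 * n) / fact n / t) / 2"
proof -
  define x where "x = t * fact n * a"
  have "0 \<le> (x - r ^ n)\<^sup>2 / (2 * t * fact n)" using assms by simp
  also have "\<dots> = (x\<^sup>2 - 2 * x * r ^ n + r ^ (2 * n)) / (2 * t * fact n)"
    by (simp add: power2_diff power_mult[symmetric] mult.commute)
  also have "\<dots> = (t * (fact n * a\<^sup>2) + r ^ (2 * n) / fact n / t) / 2 - a * r ^ n"
    using assms unfolding x_def by (simp add: field_simps power2_eq_square)
  finally show ?thesis by simp
qed

lemma fock_summable_norm:
  assumes "fock F" "r \<ge> 0"
  shows "summable (\<lambda>n. norm (fps_nth F n) * r ^ n)"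
proof (rule summable_comparison_test')
  show "summable (\<lambda>n. (1 * (fact n * (norm (fps_nth F n))\<^sup>2) + r ^ (2 * n) / fact n / 1) / 2)"
    using assms(1) exp_sums_even[of r] unfolding fock_def sums_iff by (auto intro!: summable_divide summable_add)
  show "norm (norm (fps_nth F n) * r ^ n) \<le> (1 * (fact n * (norm (fps_nth F n))\<^sup>2) + r ^ (2 * n) / fact n / 1) / 2" for n
    using power_term_le[of 1 r "norm (fps_nth F n)" n] assms(2) by simp
qed

lemma fock_conv_radius:
  assumes "fock F" shows "fps_conv_radius F = \<infinity>"
  unfolding fps_conv_radius_def
proof (rule conv_radius_inftyI'')
  fix z :: complex
  show "summable (\<lambda>n. fps_nth F n * z ^ n)"
    using fock_summable_norm[OF assms, of "norm z"] by (intro summable_norm_cancel[of "\<lambda>n. fps_nth F n * z ^ n"]) (simp add: norm_mult norm_power)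
qed

lemma norm_state: "norm (state F z) = exp (- (norm z)\<^sup>2 / 2) * norm (eval_fps F z)"
  unfolding state_def norm_mult by simp

lemma norm_state_power2: "(norm (state F z))\<^sup>2 = exp (- 1 * (norm z)\<^sup>2) * (norm (eval_fps F z))\<^sup>2"
  unfolding norm_state power_mult_distrib exp_of_nat_mult[symmetric] by simp

lemma state_measurable: assumes "fock F" shows "state F \<in> borel_measurable borel"
  unfolding state_def[abs_def]
  by (intro borel_measurable_times borel_measurable_eval_fps[OF fock_conv_radius[OF assms]]
      borel_measurable_of_real borel_measurable_continuous_onI continuous_intros) auto

lemma summable_imp_tail_less:
  fixes f :: "nat \<Rightarrow> real"
  assumes "summable f" "e > 0"
  shows "\<exists>N. \<bar>\<Sum>n. f (n + N)\<bar> < e"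
  using suminf_exist_split[OF assms(2,1)] by auto

text \<open>The parameter \<open>t\<close> balances the two terms of Young's inequality. With E =
  exp (|z|^2 / 2), the choice t = E bounds the state uniformly, and t = E / d makes the contribution
  of a tail of squared norm below d^2 at most E * d.\<close>

lemma norm_tail_le:
  assumes F: "fock F" and t: "t > 0"
  shows "norm (eval_fps F z - (\<Sum>n<N. fps_nth F n * z ^ n))
    \<le> (t * (\<Sum>n. fact (n + N) * (norm (fps_nth F (n + N)))\<^sup>2) + exp ((norm z)\<^sup>2) / t) / 2"
proof -
  have s: "summable (\<lambda>n. fps_nth F n * z ^ n)" using fock_conv_radius[OF F] by (intro summable_fps) auto
  have eq: "eval_fps F z - (\<Sum>n<N. fps_nth F n * z ^ n) = (\<Sum>n. fps_nth F (n + N) * z ^ (n + N))"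
    unfolding eval_fps_def using suminf_minus_initial_segment[OF s, of N] by simp
  have s1: "summable (\<lambda>n. fact (n + N) * (norm (fps_nth F (n + N)))\<^sup>2)"
    using F unfolding fock_def by (rule summable_ignore_initial_segment)
  have e: "summable (\<lambda>n. norm z ^ (2 * n) / fact n)" "(\<Sum>n. norm z ^ (2 * n) / fact n) = exp ((norm z)\<^sup>2)"
    using exp_sums_even[of "norm z"] by (auto simp: sums_iff)
  have s2: "summable (\<lambda>n. norm z ^ (2 * (n + N)) / fact (n + N))"
    using e(1) by (rule summable_ignore_initial_segment)
  have s3: "(\<lambda>n. (t * (fact (n + N) * (norm (fps_nth F (n + N)))\<^sup>2) + norm z ^ (2 * (n + N)) / fact (n + N) / t) / 2)
     sums ((t * (\<Sum>n. fact (n + N) * (norm (fps_nth F (n + N)))\<^sup>2) + (\<Sum>n. norm z ^ (2 * (n + N)) / fact (n + N)) / t) / 2)"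
    by (intro sums_divide sums_add sums_mult summable_sums s1 s2)
  have "norm (\<Sum>n. fps_nth F (n + N) * z ^ (n + N)) \<le> (\<Sum>n. (t * (fact (n + N) * (norm (fps_nth F (n + N)))\<^sup>2) + norm z ^ (2 * (n + N)) / fact (n + N) / t) / 2)"
    using power_term_le[OF t norm_ge_zero norm_ge_zero]
    by (intro norm_suminf_le sums_summable[OF s3]) (simp only: norm_mult norm_power)
  also have "\<dots> = (t * (\<Sum>n. fact (n + N) * (norm (fps_nth F (n + N)))\<^sup>2) + (\<Sum>n. norm z ^ (2 * (n + N)) / fact (n + N)) / t) / 2"
    using s3 by (simp only: sums_iff)
  also have "(\<Sum>n. norm z ^ (2 * (n + N)) / fact (n + N)) \<le> exp ((norm z)\<^sup>2)"
    using suminf_minus_initial_segment[OF e(1), of N] e(2) by (simp add: sum_nonneg)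
  finally show ?thesis unfolding eq using t by (simp add: divide_right_mono)
qed

lemma state_bounded:
  assumes F: "fock F"
  shows "\<exists>B. \<forall>z. norm (state F z) \<le> B"
proof (intro exI allI)
  fix z :: complex
  define A where "A = (\<Sum>n. fact n * (norm (fps_nth F n))\<^sup>2)"
  define E where "E = exp ((norm z)\<^sup>2 / 2)"
  have E: "E > 0" "exp ((norm z)\<^sup>2) = E * E" "exp (- (norm z)\<^sup>2 / 2) = 1 / E"
    unfolding E_def by (auto simp: exp_add[symmetric] exp_minus field_simps)
  have "norm (eval_fps F z) \<le> (E * A + exp ((norm z)\<^sup>2) / E) / 2"
    using norm_tail_le[OF F \<open>E > 0\<close>, of z 0] unfolding A_def by simp
  also have "\<dots> = E * ((A + 1) / 2)" using E by (simp add: field_simps)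
  finally have "norm (state F z) \<le> 1 / E * (E * ((A + 1) / 2))" unfolding norm_state E(3) using E(1) by (intro mult_left_mono) auto
  then show "norm (state F z) \<le> (A + 1) / 2" using E(1) by simp
qed

text \<open>A polynomial part dies against the Gaussian and the tail is uniformly small. Decay,
  rather than boundedness, is what later yields the strict bound |\<beta>| < 1/2.\<close>

lemma state_tendsto_0:
  assumes F: "fock F"
  shows "(state F \<longlongrightarrow> 0) at_infinity"
proof (rule tendstoI)
  fix e :: real assume e: "e > 0"
  define d where "d = e / 2"
  have d: "d > 0" using e unfolding d_def by simp
  obtain N where N: "\<bar>\<Sum>n. fact (n + N) * (norm (fps_nth F (n + N)))\<^sup>2\<bar> < d\<^sup>2"
    using summable_imp_tail_less[of "\<lambda>n. fact n * (norm (fps_nth F n))\<^sup>2" "d\<^sup>2"] F d unfolding fock_def by auto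
  define G where "G z = exp (- (norm z)\<^sup>2 / 2) * (\<Sum>n<N. norm (fps_nth F n) * norm z ^ n)" for z :: complex
  have le: "norm (state F z) \<le> d + G z" for z
  proof -
    define E where "E = exp ((norm z)\<^sup>2 / 2)"
    have E: "E > 0" "exp ((norm z)\<^sup>2) = E * E" "exp (- (norm z)\<^sup>2 / 2) = 1 / E"
      unfolding E_def by (auto simp: exp_add[symmetric] exp_minus field_simps)
    have "norm (eval_fps F z - (\<Sum>n<N. fps_nth F n * z ^ n)) \<le> (E / d * (\<Sum>n. fact (n + N) * (norm (fps_nth F (n + N)))\<^sup>2) + exp ((norm z)\<^sup>2) / (E / d)) / 2"
      using norm_tail_le[OF F, of "E / d" z N] E d by simp
    also have "\<dots> \<le> (E / d * d\<^sup>2 + exp ((norm z)\<^sup>2) / (E / d)) / 2"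
      using N E d by (intro divide_right_mono add_right_mono mult_left_mono) auto
    also have "\<dots> = E * d" unfolding E(2) using E(1) d by (simp add: field_simps power2_eq_square)
    finally have "norm (eval_fps F z - (\<Sum>n<N. fps_nth F n * z ^ n)) \<le> E * d" .
    moreover have "norm (\<Sum>n<N. fps_nth F n * z ^ n) \<le> (\<Sum>n<N. norm (fps_nth F n) * norm z ^ n)"
      by (rule sum_norm_le) (simp add: norm_mult norm_power)
    ultimately have "norm (eval_fps F z) \<le> E * d + (\<Sum>n<N. norm (fps_nth F n) * norm z ^ n)"
      using norm_triangle_ineq[of "eval_fps F z - (\<Sum>n<N. fps_nth F n * z ^ n)" "\<Sum>n<N. fps_nth F n * z ^ n"] by simp
    then have "1 / E * norm (eval_fps F z) \<le> 1 / E * (E * d + (\<Sum>n<N. norm (fps_nth F n) * norm z ^ n))"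
      using E(1) by (intro mult_left_mono) auto
    then show ?thesis unfolding norm_state G_def E(3) using E(1) by (simp add: field_simps)
  qed
  have "((\<lambda>r::real. exp (- r\<^sup>2 / 2) * (\<Sum>n<N. norm (fps_nth F n) * r ^ n)) \<longlongrightarrow> 0) at_top"
  proof -
    have "((\<lambda>r::real. exp (- r\<^sup>2 / 2) * r ^ n) \<longlongrightarrow> 0) at_top" for n by real_asymp
    then have "((\<lambda>r::real. \<Sum>n<N. norm (fps_nth F n) * (exp (- r\<^sup>2 / 2) * r ^ n)) \<longlongrightarrow> (\<Sum>n<N. norm (fps_nth F n) * 0)) at_top"
      by (intro tendsto_sum tendsto_mult tendsto_const)
    then show ?thesis by (simp add: sum_distrib_left mult.left_commute)
  qed
  then have "(G \<longlongrightarrow> 0) at_infinity"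
    unfolding G_def by (rule filterlim_compose[OF _ filterlim_norm_at_top])
  then have "\<forall>\<^sub>F z in at_infinity. G z < d"
    by (rule order_tendstoD(2)) (use d in simp)
  then show "\<forall>\<^sub>F z in at_infinity. dist (state F z) 0 < e"
  proof eventually_elim
    case (elim z)
    then show ?case using le[of z] unfolding d_def by simp
  qed
qed

lemma nn_integral_state:
  assumes F: "fps_conv_radius F = \<infinity>"
  shows "(\<integral>\<^sup>+z. ennreal ((norm (state F z))\<^sup>2) \<partial>lborel) = (\<Sum>n. ennreal (pi * (fact n * (norm (fps_nth F n))\<^sup>2)))"
  unfolding norm_state_power2 gauss_parseval[OF F zero_less_one] by (simp add: mult_ac)

lemma eval_fps_X_mult:
  fixes F :: "complex fps"
  assumes "fps_conv_radius F = \<infinity>"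
  shows "eval_fps (fps_X * F) z = z * eval_fps F z" "fps_conv_radius (fps_X * F) = \<infinity>"
  using assms fps_conv_radius_mult[of fps_X F] by (auto simp: eval_fps_mult)

text \<open>Multiplication by z shifts coefficients, so the second moment is the squared norm of
  \<open>fps_X * F\<close>. Its weight n + 1 exceeds that of \<open>ang\<close> by one mass, which
  is exactly what P subtracts.\<close>

lemma nn_integral_state_norm:
  assumes F: "fps_conv_radius F = \<infinity>"
  shows "(\<integral>\<^sup>+z. ennreal ((norm z)\<^sup>2 * (norm (state F z))\<^sup>2) \<partial>lborel) = (\<Sum>n. ennreal (pi * (real (Suc n) * (fact n * (norm (fps_nth F n))\<^sup>2))))"
proof -
  have "(\<integral>\<^sup>+z. ennreal ((norm z)\<^sup>2 * (norm (state F z))\<^sup>2) \<partial>lborel) = (\<integral>\<^sup>+z. ennreal ((norm (state (fps_X * F) z))\<^sup>2) \<partial>lborel)"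
    unfolding norm_state eval_fps_X_mult(1)[OF F] norm_mult power_mult_distrib by (simp only: mult_ac)
  also have "\<dots> = (\<Sum>n. ennreal (pi * (fact n * (norm (fps_nth (fps_X * F) n))\<^sup>2)))"
    by (rule nn_integral_state) (rule eval_fps_X_mult[OF F])
  also have "\<dots> = (\<Sum>n. ennreal (pi * (fact (n + 1) * (norm (fps_nth (fps_X * F) (n + 1)))\<^sup>2)))"
    by (subst suminf_offset[where i = 1]) (auto intro: summableI)
  finally show ?thesis by (simp add: mult_ac)
qed

lemma suminf_ennreal_cmult:
  fixes f :: "nat \<Rightarrow> real"
  assumes "\<And>n. f n \<ge> 0" "summable f" "c \<ge> 0"
  shows "(\<Sum>n. ennreal (c * f n)) = ennreal (c * suminf f)"
  using assms by (subst suminf_ennreal2) (auto simp: suminf_mult summable_mult)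

lemma fock_nn_mass:
  assumes "fock F"
  shows "(\<integral>\<^sup>+z. ennreal ((norm (state F z))\<^sup>2) \<partial>lborel) = ennreal (mass F)"
  using assms unfolding nn_integral_state[OF fock_conv_radius[OF assms]] mass_def fock_def
  by (intro suminf_ennreal_cmult) auto

lemma summable_nn_integral_state:
  assumes F: "fps_conv_radius F = \<infinity>" and "integrable lborel (\<lambda>z. (norm (state F z))\<^sup>2)"
  shows "fock F"
proof -
  have "(\<integral>\<^sup>+z. ennreal ((norm (state F z))\<^sup>2) \<partial>lborel) < \<infinity>"
    using assms(2) by (simp add: integrable_iff_bounded)
  then have "summable (\<lambda>n. pi * (fact n * (norm (fps_nth F n))\<^sup>2))"
    unfolding nn_integral_state[OF F] by (intro summable_suminf_not_top) (auto simp: less_top)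
  then show ?thesis unfolding fock_def by (simp add: summable_cmult_iff)
qed

lemma bargmann_fock_iff: "u \<in> bargmann_fock \<longleftrightarrow> (\<exists>F. fock F \<and> u = state F)"
proof
  assume "u \<in> bargmann_fock"
  then obtain f where f: "f holomorphic_on UNIV" "\<And>z. u z = complex_of_real (exp (- (norm z)\<^sup>2 / 2)) * f z"
    and int: "integrable lborel (\<lambda>z. (norm (u z))\<^sup>2)" unfolding bargmann_fock_def by auto
  have f': "f holomorphic_on eball 0 \<infinity>" using f(1) by simp
  have ev: "eval_fps (fps_expansion f 0) z = f z" for z using eval_fps_expansion'[OF f', of z] by simp
  have cr: "fps_conv_radius (fps_expansion f 0) = \<infinity>" using conv_radius_fps_expansion[OF f'] by simp
  have u: "u = state (fps_expansion f 0)" unfolding state_def by (auto simp: ev f(2))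
  then show "\<exists>F. fock F \<and> u = state F" using summable_nn_integral_state[OF cr] int by auto
next
  assume "\<exists>F. fock F \<and> u = state F"
  then obtain F where F: "fock F" "u = state F" by auto
  note [measurable] = state_measurable[OF F(1)]
  have "integrable lborel (\<lambda>z. (norm (u z))\<^sup>2)"
    unfolding F(2) integrable_iff_bounded using fock_nn_mass[OF F(1)] by simp
  moreover have "eval_fps F holomorphic_on UNIV" using fock_conv_radius[OF F(1)] by (intro holomorphic_on_eval_fps) auto
  ultimately show "u \<in> bargmann_fock" unfolding bargmann_fock_def F(2) state_def by auto
qed

lemma mass_nonneg: "fock F \<Longrightarrow> mass F \<ge> 0"
  unfolding mass_def fock_def by (intro mult_nonneg_nonneg suminf_nonneg) auto

lemma ang_nonneg: "fock1 F \<Longrightarrow> ang F \<ge> 0"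
  unfolding ang_def fock1_def by (intro mult_nonneg_nonneg suminf_nonneg) auto

lemma Mass_state: assumes "fock F" shows "Mass (state F) = mass F"
proof -
  note [measurable] = state_measurable[OF assms]
  have "Mass (state F) = enn2real (\<integral>\<^sup>+z. ennreal ((norm (state F z))\<^sup>2) \<partial>lborel)"
    unfolding Mass_def by (rule integral_eq_nn_integral) auto
  then show ?thesis by (simp add: fock_nn_mass[OF assms] mass_nonneg[OF assms])
qed

lemma fock1_nn:
  assumes "fock1 F"
  shows "(\<integral>\<^sup>+z. ennreal ((norm z)\<^sup>2 * (norm (state F z))\<^sup>2) \<partial>lborel) = ennreal (mass F + ang F)"
proof -
  have F: "fock F" by (rule fock1_imp_fock[OF assms])
  have s: "(\<lambda>n. real (Suc n) * (fact n * (norm (fps_nth F n))\<^sup>2)) sums ((\<Sum>n. fact n * (norm (fps_nth F n))\<^sup>2) + (\<Sum>n. real n * (fact n * (norm (fps_nth F n))\<^sup>2)))"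
    using sums_add[OF summable_sums summable_sums, OF F[unfolded fock_def] assms[unfolded fock1_def]] by (simp add: algebra_simps)
  have "(\<integral>\<^sup>+z. ennreal ((norm z)\<^sup>2 * (norm (state F z))\<^sup>2) \<partial>lborel) = ennreal (pi * (\<Sum>n. real (Suc n) * (fact n * (norm (fps_nth F n))\<^sup>2)))"
    using s unfolding nn_integral_state_norm[OF fock_conv_radius[OF F]] by (intro suminf_ennreal_cmult) (auto simp: sums_iff)
  then show ?thesis using s unfolding sums_iff mass_def ang_def by (simp add: algebra_simps)
qed

lemma fock1_iff_integrable:
  assumes "fock F"
  shows "fock1 F \<longleftrightarrow> (\<integral>\<^sup>+z. ennreal ((norm z)\<^sup>2 * (norm (state F z))\<^sup>2) \<partial>lborel) < \<infinity>"
proof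
  assume "(\<integral>\<^sup>+z. ennreal ((norm z)\<^sup>2 * (norm (state F z))\<^sup>2) \<partial>lborel) < \<infinity>"
  then have "summable (\<lambda>n. pi * (real (Suc n) * (fact n * (norm (fps_nth F n))\<^sup>2)))"
    unfolding nn_integral_state_norm[OF fock_conv_radius[OF assms]] by (intro summable_suminf_not_top) (auto simp: less_top)
  then have "summable (\<lambda>n. real (Suc n) * (fact n * (norm (fps_nth F n))\<^sup>2))" by (simp add: summable_cmult_iff)
  then show "fock1 F" unfolding fock1_def
    by (rule summable_comparison_test') (auto intro!: mult_right_mono simp: abs_mult)
qed (simp add: fock1_nn)

lemma nn_integral_weighted:
  assumes "fock1 F"
  shows "(\<integral>\<^sup>+z. ennreal ((1 + (norm z)\<^sup>2) * (norm (state F z))\<^sup>2) \<partial>lborel) = ennreal (2 * mass F + ang F)"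
proof -
  have F: "fock F" by (rule fock1_imp_fock[OF assms])
  note [measurable] = state_measurable[OF F]
  have "(\<integral>\<^sup>+z. ennreal ((1 + (norm z)\<^sup>2) * (norm (state F z))\<^sup>2) \<partial>lborel)
     = (\<integral>\<^sup>+z. ennreal ((norm (state F z))\<^sup>2) + ennreal ((norm z)\<^sup>2 * (norm (state F z))\<^sup>2) \<partial>lborel)"
    by (intro nn_integral_cong) (simp add: ennreal_plus[symmetric] algebra_simps del: ennreal_plus)
  also have "\<dots> = ennreal (mass F) + ennreal (mass F + ang F)"
    by (subst nn_integral_add) (auto simp: fock_nn_mass[OF F] fock1_nn[OF assms])
  finally show ?thesis using mass_nonneg[OF F] ang_nonneg[OF assms] by (simp add: ennreal_plus[symmetric] del: ennreal_plus)
qed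

lemma integral_weighted:
  assumes "fock1 F"
  shows "(\<integral>z. (1 + (norm z)\<^sup>2) * (norm (state F z))\<^sup>2 \<partial>lborel) = 2 * mass F + ang F"
proof -
  have F: "fock F" by (rule fock1_imp_fock[OF assms])
  note [measurable] = state_measurable[OF F]
  show ?thesis using mass_nonneg[OF F] ang_nonneg[OF assms]
    by (subst integral_eq_nn_integral) (auto simp: nn_integral_weighted[OF assms] simp del: ennreal_plus)
qed

lemma bargmann_fock_21_iff: "u \<in> bargmann_fock_21 \<longleftrightarrow> (\<exists>F. fock1 F \<and> u = state F)"
proof -
  have "integrable lborel (\<lambda>z. (1 + (norm z)\<^sup>2) * (norm (state F z))\<^sup>2) \<longleftrightarrow> fock1 F" if F: "fock F" for F
  proof
    note [measurable] = state_measurable[OF F]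
    assume "integrable lborel (\<lambda>z. (1 + (norm z)\<^sup>2) * (norm (state F z))\<^sup>2)"
    then have *: "(\<integral>\<^sup>+z. ennreal ((1 + (norm z)\<^sup>2) * (norm (state F z))\<^sup>2) \<partial>lborel) < \<infinity>"
      by (simp add: integrable_iff_bounded abs_mult)
    have "(\<integral>\<^sup>+z. ennreal ((norm z)\<^sup>2 * (norm (state F z))\<^sup>2) \<partial>lborel) \<le> (\<integral>\<^sup>+z. ennreal ((1 + (norm z)\<^sup>2) * (norm (state F z))\<^sup>2) \<partial>lborel)"
      by (intro nn_integral_mono ennreal_leI mult_right_mono) auto
    with * show "fock1 F" unfolding fock1_iff_integrable[OF F] by (rule le_less_trans[rotated])
  next
    note [measurable] = state_measurable[OF F]
    assume "fock1 F"
    then show "integrable lborel (\<lambda>z. (1 + (norm z)\<^sup>2) * (norm (state F z))\<^sup>2)"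
      by (simp add: integrable_iff_bounded abs_mult nn_integral_weighted)
  qed
  then show ?thesis unfolding bargmann_fock_21_def using bargmann_fock_iff[of u] fock1_imp_fock by blast
qed

lemma norm_state_power4: 
  assumes "fps_conv_radius F = \<infinity>"
  shows "(norm (state F z)) ^ 4 = exp (- 2 * (norm z)\<^sup>2) * (norm (eval_fps (F * F) z))\<^sup>2"
proof -
  have "norm (state F z) ^ 4 = (exp (- (norm z)\<^sup>2 / 2)) ^ 4 * (norm (eval_fps F z)) ^ 4"
    unfolding norm_state power_mult_distrib ..
  also have "(exp (- (norm z)\<^sup>2 / 2)) ^ 4 = exp (- 2 * (norm z)\<^sup>2)"
    unfolding exp_of_nat_mult[symmetric] by simp
  also have "(norm (eval_fps F z)) ^ 4 = (norm (eval_fps (F * F) z))\<^sup>2"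
    using assms by (simp add: eval_fps_mult norm_mult power_mult_distrib power2_eq_square power4_eq_xxxx)
  finally show ?thesis .
qed

lemma conv_radius_square:
  fixes F :: "complex fps" assumes "fps_conv_radius F = \<infinity>" shows "fps_conv_radius (F * F) = \<infinity>"
  using fps_conv_radius_mult[of F F] assms by simp

text \<open>A bounded square-integrable function has a finite fourth moment. Hence the series of
  \<open>ham\<close> converges on the whole Fock space, and only \<open>ang\<close> can make the
  energy infinite.\<close>

lemma nn_integral_state4:
  assumes "fock F"
  shows "(\<integral>\<^sup>+z. ennreal (norm (state F z) ^ 4) \<partial>lborel) = ennreal (ham F / (2 * pi))"
    and "summable (\<lambda>n. fact n / 2 ^ n * (norm (fps_nth (F * F) n))\<^sup>2)"
proof -
  note cr = fock_conv_radius[OF assms]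
  note [measurable] = state_measurable[OF assms]
  have eq: "(\<integral>\<^sup>+z. ennreal (norm (state F z) ^ 4) \<partial>lborel) = (\<Sum>n. ennreal (pi / 2 * (fact n / 2 ^ n * (norm (fps_nth (F * F) n))\<^sup>2)))"
    unfolding norm_state_power4[OF cr] gauss_parseval[OF conv_radius_square[OF cr] zero_less_numeral] by (simp add: mult_ac)
  obtain B where B: "\<And>z. norm (state F z) \<le> B" using state_bounded[OF assms] by auto
  have "(\<integral>\<^sup>+z. ennreal (norm (state F z) ^ 4) \<partial>lborel) \<le> (\<integral>\<^sup>+z. ennreal (B\<^sup>2) * ennreal ((norm (state F z))\<^sup>2) \<partial>lborel)"
  proof (intro nn_integral_mono)
    fix z
    have "norm (state F z) ^ 4 = (norm (state F z))\<^sup>2 * (norm (state F z))\<^sup>2" by (simp add: power2_eq_square power4_eq_xxxx)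
    also have "\<dots> \<le> B\<^sup>2 * (norm (state F z))\<^sup>2" using B by (intro mult_right_mono power_mono) auto
    finally show "ennreal (norm (state F z) ^ 4) \<le> ennreal (B\<^sup>2) * ennreal ((norm (state F z))\<^sup>2)"
      by (simp add: ennreal_mult'[symmetric] ennreal_leI)
  qed
  also have "\<dots> < \<infinity>" by (subst nn_integral_cmult) (auto simp: fock_nn_mass[OF assms] ennreal_mult'[symmetric])
  finally have "summable (\<lambda>n. pi / 2 * (fact n / 2 ^ n * (norm (fps_nth (F * F) n))\<^sup>2))"
    unfolding eq by (intro summable_suminf_not_top) (auto simp: less_top)
  then show s: "summable (\<lambda>n. fact n / 2 ^ n * (norm (fps_nth (F * F) n))\<^sup>2)" by (subst (asm) summable_cmult_iff) auto
  show "(\<integral>\<^sup>+z. ennreal (norm (state F z) ^ 4) \<partial>lborel) = ennreal (ham F / (2 * pi))"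
    unfolding eq using s by (subst suminf_ennreal_cmult) (auto simp: ham_def power2_eq_square)
qed

lemma ham_nonneg: "fock F \<Longrightarrow> ham F \<ge> 0"
  unfolding ham_def using nn_integral_state4(2) by (intro mult_nonneg_nonneg suminf_nonneg) auto

lemma Ham_state: assumes "fock F" shows "ereal (8 * pi) * Ham (state F) = ereal (ham F)"
proof -
  have "ext_integral lborel (\<lambda>z. norm (state F z) ^ 4) = ereal (ham F / (2 * pi))"
    unfolding ext_integral_def nn_integral_state4(1)[OF assms] using ham_nonneg[OF assms]
    by (simp add: ennreal_neg zero_ennreal.rep_eq)
  then show ?thesis unfolding Ham_def by simp
qed

lemma Ang_state_fock1: assumes "fock1 F" shows "Ang (state F) = ereal (ang F)"
proof -
  have F: "fock F" by (rule fock1_imp_fock[OF assms])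
  note [measurable] = state_measurable[OF F]
  define P where "P = (\<integral>\<^sup>+z. ennreal (((norm z)\<^sup>2 - 1) * (norm (state F z))\<^sup>2) \<partial>lborel)"
  define N where "N = (\<integral>\<^sup>+z. ennreal (- (((norm z)\<^sup>2 - 1) * (norm (state F z))\<^sup>2)) \<partial>lborel)"
  have "P \<le> (\<integral>\<^sup>+z. ennreal ((norm z)\<^sup>2 * (norm (state F z))\<^sup>2) \<partial>lborel)"
    unfolding P_def by (intro nn_integral_mono ennreal_leI mult_right_mono) auto
  also have "\<dots> < top" by (simp add: fock1_nn[OF assms])
  finally obtain p where p: "P = ennreal p" "p \<ge> 0" by (cases P) auto
  have "N \<le> (\<integral>\<^sup>+z. ennreal ((norm (state F z))\<^sup>2) \<partial>lborel)"
    unfolding N_def by (intro nn_integral_mono ennreal_leI) (auto simp: algebra_simps)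
  also have "\<dots> < top" by (simp add: fock_nn_mass[OF F])
  finally obtain n where n: "N = ennreal n" "n \<ge> 0" by (cases N) auto
  \<comment> \<open>Adding the mass on one side and the second moment on the other avoids
    subtraction in \<open>ennreal\<close>; the identity then holds pointwise, by the sign of |z|^2 -
    1.\<close>
  have "P + ennreal (mass F) = N + ennreal (mass F + ang F)"
    unfolding P_def N_def fock_nn_mass[OF F, symmetric] fock1_nn[OF assms, symmetric]
  proof (subst (1 2) nn_integral_add[symmetric], measurable, intro nn_integral_cong)
    fix z
    define a b where "a = (norm z)\<^sup>2" "b = (norm (state F z))\<^sup>2"
    have ab: "a \<ge> 0" "b \<ge> 0" unfolding a_b_def by auto
    show "ennreal (((norm z)\<^sup>2 - 1) * (norm (state F z))\<^sup>2) + ennreal ((norm (state F z))\<^sup>2) =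
      ennreal (- (((norm z)\<^sup>2 - 1) * (norm (state F z))\<^sup>2)) + ennreal ((norm z)\<^sup>2 * (norm (state F z))\<^sup>2)"
      unfolding a_b_def[symmetric]
    proof (cases "a \<ge> 1")
      case True
      then have "b \<le> a * b" using mult_right_mono[OF True ab(2)] by simp
      then show "ennreal ((a - 1) * b) + ennreal b = ennreal (- ((a - 1) * b)) + ennreal (a * b)"
        using ab by (simp add: ennreal_neg ennreal_plus[symmetric] algebra_simps mult_right_mono del: ennreal_plus)
    next
      case False
      then have "(1 - a) * b \<ge> 0" "(a - 1) * b \<le> 0" using ab by (auto intro: mult_nonneg_nonneg mult_nonpos_nonneg)
      then show "ennreal ((a - 1) * b) + ennreal b = ennreal (- ((a - 1) * b)) + ennreal (a * b)"
        using ab by (simp add: ennreal_neg ennreal_plus[symmetric] algebra_simps del: ennreal_plus)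
    qed
  qed
  then have "p + mass F = n + (mass F + ang F)"
    using p n mass_nonneg[OF F] ang_nonneg[OF assms] by (simp add: ennreal_plus[symmetric] del: ennreal_plus)
  then show ?thesis unfolding Ang_def ext_integral_def P_def[symmetric] N_def[symmetric] p(1) n(1)
    using p n by (simp add: algebra_simps)
qed

lemma ennreal_add_le: "ennreal (x + y) \<le> ennreal x + ennreal y"
proof (cases "x \<ge> 0 \<and> y \<ge> 0")
  case False
  then have "x + y \<le> x \<or> x + y \<le> y" by auto
  then show ?thesis using ennreal_leI[of "x + y" x] ennreal_leI[of "x + y" y]
    by (auto intro: order_trans add_increasing add_increasing2)
qed simp

lemma Ang_state_not_fock1: assumes "fock F" "\<not> fock1 F" shows "Ang (state F) = \<infinity>"
proof -
  note F = assms(1)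
  note [measurable] = state_measurable[OF F]
  define P where "P = (\<integral>\<^sup>+z. ennreal (((norm z)\<^sup>2 - 1) * (norm (state F z))\<^sup>2) \<partial>lborel)"
  define N where "N = (\<integral>\<^sup>+z. ennreal (- (((norm z)\<^sup>2 - 1) * (norm (state F z))\<^sup>2)) \<partial>lborel)"
  have "N \<le> (\<integral>\<^sup>+z. ennreal ((norm (state F z))\<^sup>2) \<partial>lborel)"
    unfolding N_def by (intro nn_integral_mono ennreal_leI) (auto simp: algebra_simps)
  also have "\<dots> < top" by (simp add: fock_nn_mass[OF F])
  finally obtain n where n: "N = ennreal n" "n \<ge> 0" by (cases N) auto
  have "(\<integral>\<^sup>+z. ennreal ((norm z)\<^sup>2 * (norm (state F z))\<^sup>2) \<partial>lborel) = top"
    using assms(2) unfolding fock1_iff_integrable[OF F] by (simp add: less_top[symmetric])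
  moreover have "(\<integral>\<^sup>+z. ennreal ((norm z)\<^sup>2 * (norm (state F z))\<^sup>2) \<partial>lborel) \<le> P + ennreal (mass F)"
    unfolding P_def fock_nn_mass[OF F, symmetric]
  proof (subst nn_integral_add[symmetric], measurable, intro nn_integral_mono)
    fix z
    have "ennreal ((norm z)\<^sup>2 * (norm (state F z))\<^sup>2) = ennreal (((norm z)\<^sup>2 - 1) * (norm (state F z))\<^sup>2 + (norm (state F z))\<^sup>2)"
      by (simp add: algebra_simps)
    also have "\<dots> \<le> ennreal (((norm z)\<^sup>2 - 1) * (norm (state F z))\<^sup>2) + ennreal ((norm (state F z))\<^sup>2)"
      by (rule ennreal_add_le)
    finally show "ennreal ((norm z)\<^sup>2 * (norm (state F z))\<^sup>2) \<le> ennreal (((norm z)\<^sup>2 - 1) * (norm (state F z))\<^sup>2) + ennreal ((norm (state F z))\<^sup>2)" .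
  qed
  ultimately have "P = top" by (simp add: top_unique)
  then show ?thesis unfolding Ang_def ext_integral_def P_def[symmetric] N_def[symmetric] n(1) using n(2) by simp
qed

lemma Gfun_state:
  assumes "\<mu> > 0"
  shows "fock1 F \<Longrightarrow> Gfun \<mu> (state F) = ereal (ham F + \<mu> * ang F)"
    and "fock F \<Longrightarrow> \<not> fock1 F \<Longrightarrow> Gfun \<mu> (state F) = \<infinity>"
  using assms by (auto simp: Gfun_def Ham_state Ang_state_fock1 Ang_state_not_fock1 fock1_imp_fock)

section \<open>The Fock inner product and the adjoint pair z, d/dz\<close>

text \<open>The Fock inner product without its factor pi, linear in the first argument. The weight
  n! makes multiplication by \<open>fps_X\<close> and \<open>fps_deriv\<close> adjoint to each
  other.\<close>

definition ip :: "complex fps \<Rightarrow> complex fps \<Rightarrow> complex" where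
  "ip F G = (\<Sum>n. fact n * fps_nth F n * cnj (fps_nth G n))"

lemma ip_summable:
  assumes "fock F" "fock G"
  shows "summable (\<lambda>n. fact n * fps_nth F n * cnj (fps_nth G n))"
proof (rule summable_norm_cancel, rule summable_comparison_test')
  show "summable (\<lambda>n. fact n * (norm (fps_nth F n))\<^sup>2 + fact n * (norm (fps_nth G n))\<^sup>2)"
    using assms unfolding fock_def by (rule summable_add)
  fix n
  have "2 * (norm (fps_nth F n) * norm (fps_nth G n)) \<le> (norm (fps_nth F n))\<^sup>2 + (norm (fps_nth G n))\<^sup>2"
    using sum_squares_bound[of "norm (fps_nth F n)" "norm (fps_nth G n)"] by (simp add: mult.assoc)
  moreover have "0 \<le> norm (fps_nth F n) * norm (fps_nth G n)" by simp
  ultimately have "norm (fps_nth F n) * norm (fps_nth G n) \<le> (norm (fps_nth F n))\<^sup>2 + (norm (fps_nth G n))\<^sup>2" by linarith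
  then have "fact n * (norm (fps_nth F n) * norm (fps_nth G n)) \<le> fact n * ((norm (fps_nth F n))\<^sup>2 + (norm (fps_nth G n))\<^sup>2)"
    by (rule mult_left_mono) simp
  then show "norm (norm (fact n * fps_nth F n * cnj (fps_nth G n))) \<le> fact n * (norm (fps_nth F n))\<^sup>2 + fact n * (norm (fps_nth G n))\<^sup>2"
    by (simp add: norm_mult algebra_simps)
qed

lemma fock_add: assumes "fock F" "fock G" shows "fock (F + G)"
  unfolding fock_def
proof (rule summable_comparison_test')
  show "summable (\<lambda>n. 2 * (fact n * (norm (fps_nth F n))\<^sup>2) + 2 * (fact n * (norm (fps_nth G n))\<^sup>2))"
    using assms unfolding fock_def by (intro summable_add summable_mult)
  fix n
  have "(norm (fps_nth F n + fps_nth G n))\<^sup>2 \<le> (norm (fps_nth F n) + norm (fps_nth G n))\<^sup>2"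
    by (intro power_mono norm_triangle_ineq) auto
  also have "\<dots> \<le> 2 * (norm (fps_nth F n))\<^sup>2 + 2 * (norm (fps_nth G n))\<^sup>2"
    using sum_squares_bound[of "norm (fps_nth F n)" "norm (fps_nth G n)"] by (simp add: power2_sum)
  finally have "fact n * (norm (fps_nth F n + fps_nth G n))\<^sup>2 \<le> fact n * (2 * (norm (fps_nth F n))\<^sup>2 + 2 * (norm (fps_nth G n))\<^sup>2)"
    by (rule mult_left_mono) simp
  then show "norm (fact n * (norm (fps_nth (F + G) n))\<^sup>2) \<le> 2 * (fact n * (norm (fps_nth F n))\<^sup>2) + 2 * (fact n * (norm (fps_nth G n))\<^sup>2)"
    by (simp add: algebra_simps)
qed

lemma fock_cmult: "fock F \<Longrightarrow> fock (fps_const c * F)"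
proof -
  assume "fock F"
  then have "summable (\<lambda>n. (norm c)\<^sup>2 * (fact n * (norm (fps_nth F n))\<^sup>2))"
    unfolding fock_def by (rule summable_mult)
  then show ?thesis unfolding fock_def by (simp add: norm_mult power_mult_distrib mult.left_commute)
qed

lemma fock_deriv: "fock (fps_deriv F) \<longleftrightarrow> fock1 F"
proof -
  have "real (Suc n) * (fact (Suc n) * (norm (fps_nth F (Suc n)))\<^sup>2) = fact n * (norm (fps_nth (fps_deriv F) n))\<^sup>2" for n
    by (simp add: norm_mult power_mult_distrib power2_eq_square algebra_simps flip: of_nat_Suc)
  then show ?thesis unfolding fock_def fock1_def
    by (subst (2) summable_Suc_iff[symmetric]) (simp only:)
qed

lemma fock_X_mult: "fock1 F \<Longrightarrow> fock (fps_X * F)"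
proof -
  assume F: "fock1 F"
  have "summable (\<lambda>n. real n * (fact n * (norm (fps_nth F n))\<^sup>2) + fact n * (norm (fps_nth F n))\<^sup>2)"
    using F fock1_imp_fock[OF F] unfolding fock_def fock1_def by (rule summable_add)
  then have "summable (\<lambda>n. fact (Suc n) * (norm (fps_nth (fps_X * F) (Suc n)))\<^sup>2)"
    by (simp add: algebra_simps)
  then show ?thesis unfolding fock_def by (subst summable_Suc_iff[symmetric])
qed

lemma fock1_add: "fock1 F \<Longrightarrow> fock1 G \<Longrightarrow> fock1 (F + G)"
  by (simp add: fock_deriv[symmetric] fock_add)

lemma fock1_cmult: "fock1 F \<Longrightarrow> fock1 (fps_const c * F)"
  by (simp add: fock_deriv[symmetric] fock_cmult)

lemma ip_add_left: "fock F \<Longrightarrow> fock G \<Longrightarrow> fock H \<Longrightarrow> ip (F + G) H = ip F H + ip G H"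
  unfolding ip_def by (subst suminf_add) (auto intro: ip_summable[unfolded mult.assoc] simp: algebra_simps)

lemma ip_cmult_left: "fock F \<Longrightarrow> fock H \<Longrightarrow> ip (fps_const c * F) H = c * ip F H"
  unfolding ip_def by (subst suminf_mult[symmetric]) (auto intro: ip_summable[unfolded mult.assoc] simp: mult_ac)

lemma ip_cnj: "fock F \<Longrightarrow> fock G \<Longrightarrow> cnj (ip F G) = ip G F"
proof -
  assume "fock F" "fock G"
  then have "(\<lambda>n. cnj (fact n * fps_nth F n * cnj (fps_nth G n))) sums cnj (ip F G)"
    unfolding ip_def sums_cnj by (intro summable_sums ip_summable)
  then show ?thesis unfolding ip_def by (simp add: sums_iff mult_ac)
qed

lemma ip_add_right: "fock F \<Longrightarrow> fock G \<Longrightarrow> fock H \<Longrightarrow> ip H (F + G) = ip H F + ip H G"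
  using ip_add_left[of F G H] ip_cnj by (metis complex_cnj_add fock_add)

lemma ip_cmult_right: "fock F \<Longrightarrow> fock H \<Longrightarrow> ip H (fps_const c * F) = cnj c * ip H F"
  using ip_cmult_left[of F H c] ip_cnj by (metis complex_cnj_mult fock_cmult)

lemma ip_X_left:
  assumes "fock1 F" "fock1 G"
  shows "ip (fps_X * F) G = ip F (fps_deriv G)"
proof -
  have "(\<lambda>n. fact n * fps_nth (fps_X * F) n * cnj (fps_nth G n)) sums ip (fps_X * F) G"
    unfolding ip_def using assms by (intro summable_sums ip_summable fock_X_mult fock1_imp_fock)
  then have "(\<lambda>n. fact (Suc n) * fps_nth (fps_X * F) (Suc n) * cnj (fps_nth G (Suc n))) sums ip (fps_X * F) G"
    by (subst sums_Suc_iff) simp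
  then show ?thesis unfolding ip_def[of F] by (simp add: sums_iff mult_ac)
qed

lemma ip_X_right:
  assumes "fock1 F" "fock1 G"
  shows "ip G (fps_X * F) = ip (fps_deriv G) F"
  using ip_X_left[OF assms] assms ip_cnj by (metis fock_X_mult fock1_imp_fock fock_deriv)

lemma mass_eq_ip: assumes "fock F" shows "complex_of_real (mass F) = pi * ip F F"
proof -
  have "(\<lambda>n. complex_of_real (fact n * (norm (fps_nth F n))\<^sup>2)) sums of_real (\<Sum>n. fact n * (norm (fps_nth F n))\<^sup>2)"
    using assms unfolding fock_def sums_of_real_iff by (rule summable_sums)
  then have "ip F F = of_real (\<Sum>n. fact n * (norm (fps_nth F n))\<^sup>2)" unfolding ip_def sums_iff of_real_mult complex_norm_square
    by (simp add: mult.assoc)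
  then show ?thesis by (simp add: mass_def)
qed

lemma ang_eq_mass_deriv: "fock1 F \<Longrightarrow> ang F = mass (fps_deriv F)"
proof -
  assume F: "fock1 F"
  have "real (Suc n) * (fact (Suc n) * (norm (fps_nth F (Suc n)))\<^sup>2) = fact n * (norm (fps_nth (fps_deriv F) n))\<^sup>2" for n
    by (simp add: norm_mult power_mult_distrib power2_eq_square algebra_simps flip: of_nat_Suc)
  moreover have "(\<lambda>n. real n * (fact n * (norm (fps_nth F n))\<^sup>2)) sums (\<Sum>n. real n * (fact n * (norm (fps_nth F n))\<^sup>2))"
    using F unfolding fock1_def by (rule summable_sums)
  then have "(\<lambda>n. real (Suc n) * (fact (Suc n) * (norm (fps_nth F (Suc n)))\<^sup>2)) sums (\<Sum>n. real n * (fact n * (norm (fps_nth F n))\<^sup>2))"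
    by (subst sums_Suc_iff) simp
  ultimately show ?thesis unfolding ang_def mass_def by (simp only: sums_iff)
qed

section \<open>Series with geometric decay in the Fock norm\<close>

text \<open>Unlike \<open>fock\<close>, this class is stable under differentiation and under
  multiplication by polynomials, so operators can be iterated on it freely. It contains exp
  (\<alpha> z + \<beta> z^2) whenever |\<beta>| < 1/2.\<close>

definition decay :: "complex fps \<Rightarrow> bool" where
  "decay F \<longleftrightarrow> (\<exists>C \<theta>. 0 < \<theta> \<and> \<theta> < 1 \<and> (\<forall>n. sqrt (fact n) * norm (fps_nth F n) \<le> C * \<theta> ^ n))"

lemma decayI: "0 < \<theta> \<Longrightarrow> \<theta> < 1 \<Longrightarrow> (\<And>n. sqrt (fact n) * norm (fps_nth F n) \<le> C * \<theta> ^ n) \<Longrightarrow> decay F"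
  unfolding decay_def by blast

lemma decayE:
  assumes "decay F"
  obtains C \<theta> where "0 < \<theta>" "\<theta> < 1" "0 \<le> C" "\<And>n. sqrt (fact n) * norm (fps_nth F n) \<le> C * \<theta> ^ n"
proof -
  obtain C \<theta> where *: "0 < \<theta>" "\<theta> < 1" "\<And>n. sqrt (fact n) * norm (fps_nth F n) \<le> C * \<theta> ^ n"
    using assms unfolding decay_def by blast
  have "0 \<le> sqrt (fact 0) * norm (fps_nth F 0)" by simp
  also have "\<dots> \<le> C" using *(3)[of 0] by simp
  finally show ?thesis using that * by blast
qed

lemma decay_fock: assumes "decay F" shows "fock F"
  unfolding fock_def
proof -
  obtain C \<theta> where *: "0 < \<theta>" "\<theta> < 1" "0 \<le> C" "\<And>n. sqrt (fact n) * norm (fps_nth F n) \<le> C * \<theta> ^ n"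
    using assms by (rule decayE) blast
  show "summable (\<lambda>n. fact n * (norm (fps_nth F n))\<^sup>2)"
  proof (rule summable_comparison_test')
    show "summable (\<lambda>n. C\<^sup>2 * (\<theta>\<^sup>2) ^ n)" using * by (intro summable_mult summable_geometric) (simp add: power_less_one_iff abs_square_less_1)
    fix n
    have "fact n * (norm (fps_nth F n))\<^sup>2 = (sqrt (fact n) * norm (fps_nth F n))\<^sup>2" by (simp add: power_mult_distrib)
    also have "\<dots> \<le> (C * \<theta> ^ n)\<^sup>2" using * by (intro power_mono) auto
    also have "\<dots> = C\<^sup>2 * (\<theta>\<^sup>2) ^ n" by (simp add: power_mult_distrib power_mult[symmetric] mult.commute)
    finally show "norm (fact n * (norm (fps_nth F n))\<^sup>2) \<le> C\<^sup>2 * (\<theta>\<^sup>2) ^ n" by simp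
  qed
qed

lemma power_times_Suc_bounded:
  assumes "0 < q" "q < (1::real)"
  shows "\<exists>B\<ge>0. \<forall>n. real (Suc n) * q ^ n \<le> B"
proof -
  have "(\<lambda>n. real (Suc n) * q ^ n) \<longlonglongrightarrow> 0" using assms by real_asymp
  then have "Bseq (\<lambda>n. real (Suc n) * q ^ n)" by (rule convergentI[THEN convergent_imp_Bseq])
  then obtain B where "B > 0" "\<And>n. norm (real (Suc n) * q ^ n) \<le> B" unfolding Bseq_def by blast
  then show ?thesis by (intro exI[of _ B]) (auto simp: abs_le_iff)
qed

lemma decay_weaken:
  assumes F: "decay F" and G: "\<And>n. sqrt (fact n) * norm (fps_nth G n) \<le> real (Suc n) * (\<Sum>k\<in>{n - 1..n + 1}. sqrt (fact k) * norm (fps_nth F k))"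
  shows "decay G"
proof -
  obtain C \<theta> where *: "0 < \<theta>" "\<theta> < 1" "0 \<le> C" "\<And>n. sqrt (fact n) * norm (fps_nth F n) \<le> C * \<theta> ^ n"
    using F by (rule decayE) blast
  \<comment> \<open>Half of the exponential decay is given up to absorb the factor n + 1.\<close>
  define \<eta> where "\<eta> = sqrt \<theta>"
  have \<eta>: "0 < \<eta>" "\<eta> < 1" "\<eta> * \<eta> = \<theta>" unfolding \<eta>_def using * by auto
  obtain B where B: "B \<ge> 0" "\<And>n. real (Suc n) * \<eta> ^ n \<le> B" using power_times_Suc_bounded[OF \<eta>(1,2)] by blast
  show ?thesis
  proof (rule decayI[OF \<eta>(1,2)])
    fix n
    have "(\<Sum>k\<in>{n - 1..n + 1}. sqrt (fact k) * norm (fps_nth F k)) \<le> (\<Sum>k\<in>{n - 1..n + 1}. C / \<theta> * \<theta> ^ n)"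
    proof (rule sum_mono)
      fix k assume k: "k \<in> {n - 1..n + 1}"
      have "\<theta> ^ k * \<theta> \<le> \<theta> ^ n" unfolding power_Suc2[symmetric] using k * by (intro power_decreasing) auto
      then have "C * \<theta> ^ k \<le> C * (\<theta> ^ n / \<theta>)" using * by (intro mult_left_mono) (auto simp: field_simps)
      then show "sqrt (fact k) * norm (fps_nth F k) \<le> C / \<theta> * \<theta> ^ n" using *(4)[of k] by simp
    qed
    also have "\<dots> = real (card {n - 1..n + 1}) * (C / \<theta> * \<theta> ^ n)" by (rule sum_constant)
    also have "\<dots> \<le> 3 * (C / \<theta> * \<theta> ^ n)" using * by (intro mult_right_mono) auto
    finally have "sqrt (fact n) * norm (fps_nth G n) \<le> real (Suc n) * (3 * (C / \<theta> * \<theta> ^ n))"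
      using G[of n] by (meson mult_left_mono of_nat_0_le_iff order_trans)
    also have "\<dots> = 3 * C / \<theta> * (real (Suc n) * \<eta> ^ n) * \<eta> ^ n" unfolding \<eta>(3)[symmetric] power_mult_distrib by (simp add: field_simps)
    also have "\<dots> \<le> 3 * C / \<theta> * B * \<eta> ^ n" using B * \<eta> by (intro mult_right_mono mult_left_mono) auto
    finally show "sqrt (fact n) * norm (fps_nth G n) \<le> 3 * C / \<theta> * B * \<eta> ^ n" .
  qed
qed

lemma decay_deriv: assumes "decay F" shows "decay (fps_deriv F)"
proof (rule decay_weaken[OF assms])
  fix n
  have "sqrt (fact n) * norm (fps_nth (fps_deriv F) n) = sqrt (fact n) * (real (Suc n) * norm (fps_nth F (n + 1)))"
    by (simp add: norm_mult flip: of_nat_Suc)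
  also have "\<dots> \<le> real (Suc n) * (sqrt (fact (n + 1)) * norm (fps_nth F (n + 1)))"
  proof -
    have "sqrt (fact n) \<le> sqrt (fact (n + 1))" by (intro real_sqrt_le_mono fact_mono) auto
    then have "sqrt (fact n) * norm (fps_nth F (n + 1)) \<le> sqrt (fact (n + 1)) * norm (fps_nth F (n + 1))" by (rule mult_right_mono) simp
    then have "real (Suc n) * (sqrt (fact n) * norm (fps_nth F (n + 1))) \<le> real (Suc n) * (sqrt (fact (n + 1)) * norm (fps_nth F (n + 1)))" by (rule mult_left_mono) simp
    then show ?thesis by (simp add: mult_ac)
  qed
  also have "\<dots> \<le> real (Suc n) * (\<Sum>k\<in>{n - 1..n + 1}. sqrt (fact k) * norm (fps_nth F k))"
    by (intro mult_left_mono member_le_sum) auto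
  finally show "sqrt (fact n) * norm (fps_nth (fps_deriv F) n) \<le> real (Suc n) * (\<Sum>k\<in>{n - 1..n + 1}. sqrt (fact k) * norm (fps_nth F k))" .
qed

lemma decay_X_mult: assumes "decay F" shows "decay (fps_X * F)"
proof (rule decay_weaken[OF assms])
  fix n
  show "sqrt (fact n) * norm (fps_nth (fps_X * F) n) \<le> real (Suc n) * (\<Sum>k\<in>{n - 1..n + 1}. sqrt (fact k) * norm (fps_nth F k))"
  proof (cases n)
    case 0 then show ?thesis by (simp add: sum_nonneg)
  next
    case (Suc m)
    have "sqrt (fact n) * norm (fps_nth (fps_X * F) n) = sqrt (real n) * (sqrt (fact m) * norm (fps_nth F m))"
      unfolding Suc by (simp add: real_sqrt_mult)
    also have "\<dots> \<le> real (Suc n) * (sqrt (fact m) * norm (fps_nth F m))"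
    proof (rule mult_right_mono)
      have "real n \<le> (real (Suc n))\<^sup>2" by (simp add: power2_eq_square algebra_simps)
      then show "sqrt (real n) \<le> real (Suc n)" by (rule real_le_lsqrt[rotated]) auto
    qed simp
    also have "\<dots> \<le> real (Suc n) * (\<Sum>k\<in>{n - 1..n + 1}. sqrt (fact k) * norm (fps_nth F k))"
      by (intro mult_left_mono member_le_sum) (auto simp: Suc)
    finally show ?thesis .
  qed
qed

lemma decay_cmult: assumes "decay F" shows "decay (fps_const c * F)"
proof -
  obtain C \<theta> where *: "0 < \<theta>" "\<theta> < 1" "0 \<le> C" "\<And>n. sqrt (fact n) * norm (fps_nth F n) \<le> C * \<theta> ^ n"
    using assms by (rule decayE) blast
  show ?thesis
  proof (rule decayI[OF *(1,2), where C = "norm c * C"])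
    fix n show "sqrt (fact n) * norm (fps_nth (fps_const c * F) n) \<le> norm c * C * \<theta> ^ n"
      using mult_left_mono[OF *(4)[of n], of "norm c"] by (simp add: norm_mult mult_ac)
  qed
qed

lemma decay_add: assumes "decay F" "decay G" shows "decay (F + G)"
proof -
  obtain C \<theta> where F: "0 < \<theta>" "\<theta> < 1" "0 \<le> C" "\<And>n. sqrt (fact n) * norm (fps_nth F n) \<le> C * \<theta> ^ n"
    using assms(1) by (rule decayE) blast
  obtain D \<eta> where G: "0 < \<eta>" "\<eta> < 1" "0 \<le> D" "\<And>n. sqrt (fact n) * norm (fps_nth G n) \<le> D * \<eta> ^ n"
    using assms(2) by (rule decayE) blast
  show ?thesis
  proof (rule decayI[of "max \<theta> \<eta>" _ "C + D"])
    fix n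
    have "sqrt (fact n) * norm (fps_nth (F + G) n) \<le> sqrt (fact n) * (norm (fps_nth F n) + norm (fps_nth G n))"
      by (intro mult_left_mono) (auto simp: norm_triangle_ineq)
    also have "\<dots> \<le> C * \<theta> ^ n + D * \<eta> ^ n" using F(4)[of n] G(4)[of n] by (simp add: algebra_simps)
    also have "\<dots> \<le> C * max \<theta> \<eta> ^ n + D * max \<theta> \<eta> ^ n" using F G by (intro add_mono mult_left_mono power_mono) auto
    finally show "sqrt (fact n) * norm (fps_nth (F + G) n) \<le> (C + D) * max \<theta> \<eta> ^ n" by (simp add: algebra_simps)
  qed (use F G in auto)
qed

lemma decay_0: "decay 0" by (rule decayI[of "1/2" _ 0]) auto

lemma decay_poly: assumes "decay F" shows "decay (fps_of_poly p * F)"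
proof (induction p)
  case (pCons a p)
  have "fps_of_poly (pCons a p) * F = fps_const a * F + fps_X * (fps_of_poly p * F)"
    by (simp add: fps_of_poly_pCons algebra_simps)
  then show ?case using pCons by (simp add: decay_add decay_cmult decay_X_mult assms)
qed (simp add: decay_0)

lemma decay_fock1: "decay F \<Longrightarrow> fock1 F"
  using decay_deriv decay_fock fock_deriv by blast

text \<open>The equation is a recursion linking three consecutive coefficients. After normalisation
  by sqrt (n!) the term with \<alpha> gains a factor 1 / sqrt (n + 2) and is negligible, so two
  steps contract by essentially 2 |\<beta>| < 1.\<close>

lemma decay_ode:
  fixes e :: "complex fps"
  assumes ode: "fps_deriv e = (fps_const \<alpha> + fps_const (2 * \<beta>) * fps_X) * e" and \<beta>: "norm \<beta> < 1 / 2"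
  shows "decay e"
proof -
  define x where "x n = sqrt (fact n) * norm (fps_nth e n)" for n
  define b where "b = norm \<beta>"
  have b: "0 \<le> b" "b < 1 / 2" using \<beta> unfolding b_def by auto
  have rec: "x (n + 2) \<le> norm \<alpha> / sqrt (real (n + 2)) * x (n + 1) + 2 * b * x n" for n
  proof -
    have "of_nat (n + 2) * fps_nth e (n + 2) = fps_nth (fps_deriv e) (n + 1)" by simp
    also have "\<dots> = \<alpha> * fps_nth e (n + 1) + 2 * \<beta> * fps_nth e n"
      unfolding ode by (simp add: distrib_right mult.assoc)
    finally have "real (n + 2) * norm (fps_nth e (n + 2)) = norm (\<alpha> * fps_nth e (n + 1) + 2 * \<beta> * fps_nth e n)"
      by (metis norm_mult norm_of_nat)
    also have "\<dots> \<le> norm \<alpha> * norm (fps_nth e (n + 1)) + 2 * b * norm (fps_nth e n)"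
      unfolding b_def by (rule norm_triangle_le) (simp add: norm_mult)
    finally have *: "norm (fps_nth e (n + 2)) \<le> (norm \<alpha> * norm (fps_nth e (n + 1)) + 2 * b * norm (fps_nth e n)) / real (n + 2)"
      by (simp add: field_simps)
    define s where "s = sqrt (real (n + 2))"
    define t where "t = sqrt (real (n + 1))"
    have st: "s > 0" "t > 0" "t \<le> s" "s * s = real (n + 2)" unfolding s_def t_def by auto
    have f2: "sqrt (fact (n + 2)) = s * sqrt (fact (n + 1))"
      unfolding s_def by (simp add: real_sqrt_mult)
    have f1: "sqrt (fact (n + 1)) = t * sqrt (fact n)"
      unfolding t_def by (simp add: real_sqrt_mult)
    have "x (n + 2) \<le> s * sqrt (fact (n + 1)) * ((norm \<alpha> * norm (fps_nth e (n + 1)) + 2 * b * norm (fps_nth e n)) / (s * s))"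
      unfolding x_def f2 st(4) using * st by (intro mult_left_mono) auto
    also have "\<dots> = norm \<alpha> / s * x (n + 1) + 2 * b * x n * (t / s)"
      unfolding x_def f1 using st(1,2) by (simp add: field_simps)
    also have "\<dots> \<le> norm \<alpha> / s * x (n + 1) + 2 * b * x n * 1"
      using st b by (intro add_left_mono mult_left_mono) (auto simp: x_def)
    finally show ?thesis unfolding s_def by simp
  qed
  \<comment> \<open>Its square lies halfway between 2 |\<beta>| and 1; the remaining slack
    \<epsilon> absorbs the term with \<alpha>.\<close>
  define \<theta> where "\<theta> = sqrt ((1 + 2 * b) / 2)"
  have \<theta>: "0 < \<theta>" "\<theta> < 1" "\<theta> * \<theta> = (1 + 2 * b) / 2" unfolding \<theta>_def using b by auto
  define \<epsilon> where "\<epsilon> = (1 - 2 * b) / 2"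
  have \<epsilon>: "\<epsilon> > 0" "\<epsilon> + 2 * b = \<theta> * \<theta>" unfolding \<epsilon>_def \<theta>(3) using b by (auto simp: field_simps)
  have "(\<lambda>n. norm \<alpha> / sqrt (real (n + 2))) \<longlonglongrightarrow> 0" by real_asymp
  then have "\<forall>\<^sub>F n in sequentially. norm \<alpha> / sqrt (real (n + 2)) < \<epsilon>" using \<epsilon>(1) by (rule order_tendstoD(2))
  then obtain K where K: "\<And>n. n \<ge> K \<Longrightarrow> norm \<alpha> / sqrt (real (n + 2)) < \<epsilon>" unfolding eventually_sequentially by blast
  define C where "C = (\<Sum>k\<le>K + 1. x k / \<theta> ^ k)"
  have C0: "C \<ge> 0" unfolding C_def x_def using \<theta> by (intro sum_nonneg) auto
  have small: "x n \<le> C * \<theta> ^ n" if "n \<le> K + 1" for n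
  proof -
    have "x n / \<theta> ^ n \<le> C" unfolding C_def using that \<theta> by (intro member_le_sum[of n "{..K+1}" "\<lambda>k. x k / \<theta> ^ k"]) (auto simp: x_def)
    then show ?thesis using \<theta> by (simp add: field_simps)
  qed
  have all: "x n \<le> C * \<theta> ^ n" for n
  proof (induction n rule: less_induct)
    case (less n)
    show ?case
    proof (cases "n \<le> K + 1")
      case False
      define m where "m = n - 2"
      have m: "n = m + 2" "m \<ge> K" using False unfolding m_def by auto
      have h: "x (m + 1) \<le> C * \<theta> ^ (m + 1)" "x m \<le> C * \<theta> ^ m" by (rule less.IH, simp add: m)+
      have "x n \<le> norm \<alpha> / sqrt (real (m + 2)) * x (m + 1) + 2 * b * x m" unfolding m using rec by blast
      also have "\<dots> \<le> \<epsilon> * (C * \<theta> ^ (m + 1)) + 2 * b * (C * \<theta> ^ m)"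
        using K[OF m(2)] h b \<epsilon> by (intro add_mono mult_mono) (auto simp: x_def)
      also have "\<dots> \<le> \<epsilon> * (C * \<theta> ^ m) + 2 * b * (C * \<theta> ^ m)"
        using \<epsilon> C0 \<theta> by (intro add_right_mono mult_left_mono power_decreasing) auto
      also have "\<dots> = C * \<theta> ^ m * (\<epsilon> + 2 * b)" by (simp add: algebra_simps)
      also have "\<dots> = C * \<theta> ^ n" unfolding m \<epsilon>(2) by (simp add: power_add power2_eq_square)
      finally show ?thesis .
    qed (use small in blast)
  qed
  show ?thesis using all unfolding x_def by (intro decayI[OF \<theta>(1,2)]) auto
qed

text \<open>The power series of \<open>\<Sum>\<^sub>k cnj (h\<^sub>k) * g\<^bsup>(k)\<^esup>(z)\<close>, i.e. of \<open>h\<close> with conjugated coefficients,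
  viewed as a differential operator of infinite order, applied to \<open>g\<close>.\<close>

definition pairing :: "complex fps \<Rightarrow> complex fps \<Rightarrow> complex fps" where
  "pairing h g = Abs_fps (\<lambda>j. ip g (fps_X ^ j * h) / fact j)"

lemma decay_X_power_mult: "decay h \<Longrightarrow> decay (fps_X ^ j * h)"
  by (induction j) (auto simp: mult.assoc decay_X_mult)

lemma pairing_add_left: "decay h \<Longrightarrow> decay k \<Longrightarrow> decay g \<Longrightarrow> pairing (h + k) g = pairing h g + pairing k g"
  by (simp add: pairing_def fps_eq_iff distrib_left ip_add_right decay_fock decay_X_power_mult add_divide_distrib)

lemma pairing_cmult_left: "decay h \<Longrightarrow> decay g \<Longrightarrow> pairing (fps_const c * h) g = fps_const (cnj c) * pairing h g"
  by (simp add: pairing_def fps_eq_iff mult.left_commute[of _ "fps_const c"] ip_cmult_right decay_fock decay_X_power_mult)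

lemma pairing_add_right: "decay h \<Longrightarrow> decay k \<Longrightarrow> decay g \<Longrightarrow> pairing h (g + k) = pairing h g + pairing h k"
  by (simp add: pairing_def fps_eq_iff ip_add_left decay_fock decay_X_power_mult add_divide_distrib)

lemma pairing_cmult_right: "decay h \<Longrightarrow> decay g \<Longrightarrow> pairing h (fps_const c * g) = fps_const c * pairing h g"
  by (simp add: pairing_def fps_eq_iff ip_cmult_left decay_fock decay_X_power_mult)

text \<open>Multiplying the symbol of the operator by z composes the operator with d/dz. No decay is
  involved, as this only shifts the index of the defining family.\<close>

lemma pairing_X_left: "pairing (fps_X * h) g = fps_deriv (pairing h g)"
proof (rule fps_ext)
  fix j
  have *: "fps_X ^ j * (fps_X * h) = fps_X ^ Suc j * h" by (simp only: power_Suc2 mult.assoc)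
  show "fps_nth (pairing (fps_X * h) g) j = fps_nth (fps_deriv (pairing h g)) j"
    unfolding pairing_def fps_deriv_nth fps_nth_Abs_fps * Suc_eq_plus1[symmetric] fact_Suc
    by (simp del: of_nat_Suc power_Suc)
qed

lemma pairing_deriv_right: "decay h \<Longrightarrow> decay g \<Longrightarrow> pairing h (fps_deriv g) = fps_deriv (pairing h g)"
  unfolding pairing_X_left[symmetric]
proof (rule fps_ext)
  fix j assume "decay h" "decay g"
  then have "ip g (fps_X * (fps_X ^ j * h)) = ip (fps_deriv g) (fps_X ^ j * h)"
    by (intro ip_X_right decay_fock1 decay_X_power_mult)
  then show "fps_nth (pairing h (fps_deriv g)) j = fps_nth (pairing (fps_X * h) g) j"
    unfolding pairing_def fps_nth_Abs_fps by (simp only: mult.left_commute[of fps_X])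
qed

text \<open>The commutation rule of a differential operator with multiplication by z: the commutator
  is the operator whose symbol is differentiated.\<close>

lemma pairing_X_right:
  assumes "decay h" "decay g"
  shows "pairing h (fps_X * g) = fps_X * pairing h g + pairing (fps_deriv h) g"
proof (rule fps_ext)
  fix j
  have *: "ip (fps_X * g) (fps_X ^ j * h) = ip g (fps_deriv (fps_X ^ j * h))"
    using assms by (intro ip_X_left decay_fock1 decay_X_power_mult)
  show "fps_nth (pairing h (fps_X * g)) j = fps_nth (fps_X * pairing h g + pairing (fps_deriv h) g) j"
  proof (cases j)
    case 0 then show ?thesis using * by (simp add: pairing_def)
  next
    case (Suc m)
    have d: "fps_deriv (fps_X ^ j * h) = fps_const (of_nat j) * (fps_X ^ m * h) + fps_X ^ j * fps_deriv h"
      unfolding Suc fps_deriv_mult fps_deriv_power by (simp add: algebra_simps fps_of_nat del: power_Suc of_nat_Suc)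
    have "ip (fps_X * g) (fps_X ^ j * h) = of_nat j * ip g (fps_X ^ m * h) + ip g (fps_X ^ j * fps_deriv h)"
      unfolding * d using assms by (simp add: ip_add_right ip_cmult_right decay_fock decay_X_power_mult decay_deriv decay_cmult)
    then show ?thesis unfolding pairing_def Suc by (simp add: field_simps del: of_nat_Suc power_Suc)
  qed
qed

section \<open>The sharp inequality\<close>

definition moment :: "complex fps \<Rightarrow> complex" where
  "moment F = (\<integral>z. of_real ((norm (state F z))\<^sup>2) * z \<partial>lborel)"

lemma state_integrals:
  assumes "fock1 F"
  shows "integrable lborel (\<lambda>z. (norm (state F z))\<^sup>2)" "(\<integral>z. (norm (state F z))\<^sup>2 \<partial>lborel) = mass F"
    and "integrable lborel (\<lambda>z. (norm z)\<^sup>2 * (norm (state F z))\<^sup>2)" "(\<integral>z. (norm z)\<^sup>2 * (norm (state F z))\<^sup>2 \<partial>lborel) = mass F + ang F"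
    and "integrable lborel (\<lambda>z. complex_of_real ((norm (state F z))\<^sup>2) * z)"
proof -
  have F: "fock F" by (rule fock1_imp_fock[OF assms])
  note [measurable] = state_measurable[OF F]
  have m: "0 \<le> mass F" "0 \<le> mass F + ang F" using mass_nonneg[OF F] ang_nonneg[OF assms] by auto
  show i1: "integrable lborel (\<lambda>z. (norm (state F z))\<^sup>2)"
    by (simp add: integrable_iff_bounded fock_nn_mass[OF F])
  show "(\<integral>z. (norm (state F z))\<^sup>2 \<partial>lborel) = mass F"
    using Mass_state[OF F] by (simp add: Mass_def)
  show i2: "integrable lborel (\<lambda>z. (norm z)\<^sup>2 * (norm (state F z))\<^sup>2)"
    by (simp add: integrable_iff_bounded fock1_nn[OF assms] del: ennreal_plus)
  show "(\<integral>z. (norm z)\<^sup>2 * (norm (state F z))\<^sup>2 \<partial>lborel) = mass F + ang F"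
    using m by (subst integral_eq_nn_integral) (auto simp: fock1_nn[OF assms] simp del: ennreal_plus)
  show "integrable lborel (\<lambda>z. complex_of_real ((norm (state F z))\<^sup>2) * z)"
  proof (rule Bochner_Integration.integrable_bound[OF Bochner_Integration.integrable_add[OF i1 i2]])
    show "AE z in lborel. norm (complex_of_real ((norm (state F z))\<^sup>2) * z) \<le> norm ((norm (state F z))\<^sup>2 + (norm z)\<^sup>2 * (norm (state F z))\<^sup>2)"
    proof (rule AE_I2)
      fix z :: complex
      have "norm z \<le> 1 + (norm z)\<^sup>2"
        using sum_squares_bound[of 1 "norm z"] norm_ge_zero[of z] unfolding mult_1_right power_one by linarith
      then have "(norm (state F z))\<^sup>2 * norm z \<le> (norm (state F z))\<^sup>2 * (1 + (norm z)\<^sup>2)"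
        by (intro mult_left_mono) auto
      moreover have "norm ((norm (state F z))\<^sup>2 + (norm z)\<^sup>2 * (norm (state F z))\<^sup>2) = (norm (state F z))\<^sup>2 + (norm z)\<^sup>2 * (norm (state F z))\<^sup>2"
        by (simp add: abs_of_nonneg)
      ultimately show "norm (complex_of_real ((norm (state F z))\<^sup>2) * z) \<le> norm ((norm (state F z))\<^sup>2 + (norm z)\<^sup>2 * (norm (state F z))\<^sup>2)"
        by (simp add: norm_mult norm_power algebra_simps)
    qed
  qed measurable
qed

lemma mass_X_mult: assumes "fock1 F" shows "mass (fps_X * F) = mass F + ang F"
proof -
  have F: "fock F" by (rule fock1_imp_fock[OF assms])
  have "ennreal (mass (fps_X * F)) = (\<integral>\<^sup>+z. ennreal ((norm (state (fps_X * F) z))\<^sup>2) \<partial>lborel)"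
    by (rule fock_nn_mass[OF fock_X_mult[OF assms], symmetric])
  also have "\<dots> = (\<integral>\<^sup>+z. ennreal ((norm z)\<^sup>2 * (norm (state F z))\<^sup>2) \<partial>lborel)"
    unfolding norm_state eval_fps_X_mult(1)[OF fock_conv_radius[OF F]] norm_mult power_mult_distrib by (simp only: mult_ac)
  finally show ?thesis unfolding fock1_nn[OF assms]
    using mass_nonneg[OF fock_X_mult[OF assms]] mass_nonneg[OF F] ang_nonneg[OF assms] by (simp del: ennreal_plus)
qed

lemma norm_add_mult_square:
  fixes a b c :: complex
  shows "(norm (a + c * b))\<^sup>2 = (norm a)\<^sup>2 + 2 * Re (c * (b * cnj a)) + (norm c)\<^sup>2 * (norm b)\<^sup>2"
  unfolding cmod_power2 by (simp add: power2_eq_square algebra_simps)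

lemma mass_add:
  assumes "fock F" "fock G"
  shows "mass (F + fps_const c * G) = mass F + 2 * pi * Re (c * ip G F) + (norm c)\<^sup>2 * mass G"
proof -
  note s = summable_sums[OF ip_summable[OF assms(2,1)]]
  have "(\<lambda>n. Re (c * (fact n * fps_nth G n * cnj (fps_nth F n)))) sums Re (c * ip G F)"
    unfolding ip_def by (intro sums_Re sums_mult s)
  note s2 = sums_add[OF sums_add[OF summable_sums[OF assms(1)[unfolded fock_def]] sums_mult[OF this, of 2]]
      sums_mult[OF summable_sums[OF assms(2)[unfolded fock_def]], of "(norm c)\<^sup>2"]]
  have "fact n * (norm (fps_nth (F + fps_const c * G) n))\<^sup>2 =
     fact n * (norm (fps_nth F n))\<^sup>2 + 2 * Re (c * (fact n * fps_nth G n * cnj (fps_nth F n))) + (norm c)\<^sup>2 * (fact n * (norm (fps_nth G n))\<^sup>2)" for n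
  proof -
    have "c * (fact n * fps_nth G n * cnj (fps_nth F n)) = of_real (fact n) * (c * (fps_nth G n * cnj (fps_nth F n)))"
      by simp
    moreover have "Re (of_real r * x) = r * Re x" for r x by simp
    ultimately have *: "Re (c * (fact n * fps_nth G n * cnj (fps_nth F n))) = fact n * Re (c * (fps_nth G n * cnj (fps_nth F n)))"
      by metis
    show ?thesis unfolding * fps_add_nth fps_mult_left_const_nth norm_add_mult_square by (simp only: distrib_left mult_ac)
  qed
  then have "(\<lambda>n. fact n * (norm (fps_nth (F + fps_const c * G) n))\<^sup>2) sums
     ((\<Sum>n. fact n * (norm (fps_nth F n))\<^sup>2) + 2 * Re (c * ip G F) + (norm c)\<^sup>2 * (\<Sum>n. fact n * (norm (fps_nth G n))\<^sup>2))"
    using s2 by simp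
  then have "(\<Sum>n. fact n * (norm (fps_nth (F + fps_const c * G) n))\<^sup>2) = 
     (\<Sum>n. fact n * (norm (fps_nth F n))\<^sup>2) + 2 * Re (c * ip G F) + (norm c)\<^sup>2 * (\<Sum>n. fact n * (norm (fps_nth G n))\<^sup>2)"
    unfolding sums_iff by blast
  then show ?thesis unfolding mass_def by (simp only: distrib_left mult_ac)
qed

text \<open>Polarisation: the mass of (1 + c z) f is computed once as an integral and once as a
  series, and the terms linear in \<open>c\<close> are compared.\<close>

lemma moment_eq_ip: assumes "fock1 F" shows "moment F = pi * ip (fps_X * F) F"
proof -
  have F: "fock F" by (rule fock1_imp_fock[OF assms])
  note I = state_integrals[OF assms]
  have *: "Re (c * moment F) = Re (c * (pi * ip (fps_X * F) F))" for c
  proof -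
    let ?G = "F + fps_const c * (fps_X * F)"
    have G: "fock ?G" by (intro fock_add F fock_cmult fock_X_mult assms)
    have st: "state ?G z = state F z + c * (z * state F z)" for z
    proof -
      have cr: "fps_conv_radius F = \<infinity>" by (rule fock_conv_radius[OF F])
      have cr2: "fps_conv_radius (fps_const c * (fps_X * F)) = \<infinity>" by (intro fock_conv_radius fock_cmult fock_X_mult assms)
      have "eval_fps ?G z = eval_fps F z + c * (z * eval_fps F z)"
        using cr cr2 eval_fps_X_mult[OF cr] by (simp add: eval_fps_add eval_fps_mult)
      then show ?thesis unfolding state_def by (simp add: algebra_simps)
    qed
    have pt: "(norm (state ?G z))\<^sup>2 = (norm (state F z))\<^sup>2 + 2 * Re (c * (of_real ((norm (state F z))\<^sup>2) * z)) + (norm c)\<^sup>2 * ((norm z)\<^sup>2 * (norm (state F z))\<^sup>2)" for z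
      unfolding st norm_add_mult_square complex_norm_square by (simp add: norm_mult power_mult_distrib mult_ac)
    have "mass ?G = (\<integral>z. (norm (state ?G z))\<^sup>2 \<partial>lborel)" using Mass_state[OF G] by (simp add: Mass_def)
    also have "\<dots> = mass F + 2 * Re (c * moment F) + (norm c)\<^sup>2 * (mass F + ang F)"
    proof -
      have i5: "integrable lborel (\<lambda>z. Re (c * (of_real ((norm (state F z))\<^sup>2) * z)))"
        using I(5) by (intro integrable_Re integrable_mult_right)
      have e5: "(\<integral>z. Re (c * (of_real ((norm (state F z))\<^sup>2) * z)) \<partial>lborel) = Re (c * moment F)"
        unfolding moment_def using I(5) by (subst integral_Re) (auto intro: integrable_mult_right simp del: of_real_power)
      have "has_bochner_integral lborel (\<lambda>z. (norm (state F z))\<^sup>2 + 2 * Re (c * (of_real ((norm (state F z))\<^sup>2) * z)) + (norm c)\<^sup>2 * ((norm z)\<^sup>2 * (norm (state F z))\<^sup>2))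
        (mass F + 2 * Re (c * moment F) + (norm c)\<^sup>2 * (mass F + ang F))"
        by (intro has_bochner_integral_add has_bochner_integral_mult_right has_bochner_integral_iff[THEN iffD2] conjI I i5 e5)
      then show ?thesis unfolding pt by (rule has_bochner_integral_integral_eq)
    qed
    finally show ?thesis using mass_add[OF F fock_X_mult[OF assms], of c] mass_X_mult[OF assms] by (simp add: algebra_simps)
  qed
  show ?thesis
  proof (rule complex_eqI)
    show "Re (moment F) = Re (pi * ip (fps_X * F) F)" using *[of 1] by simp
    show "Im (moment F) = Im (pi * ip (fps_X * F) F)" using *[of "-\<i>"] by simp
  qed
qed

section \<open>Two points in centre and relative coordinates\<close>

definition relative :: "complex fps \<Rightarrow> complex \<Rightarrow> complex \<Rightarrow> complex" where
  "relative F w z = eval_fps F (w + z / 2) * eval_fps F (w - z / 2)"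

definition relative_fps :: "complex fps \<Rightarrow> complex \<Rightarrow> complex fps" where
  "relative_fps F w = fps_expansion (relative F w) 0"

lemma relative_fps:
  assumes "fps_conv_radius F = \<infinity>"
  shows "fps_conv_radius (relative_fps F w) = \<infinity>" "eval_fps (relative_fps F w) z = relative F w z"
    "fps_nth (relative_fps F w) 0 = (eval_fps F w)\<^sup>2" "odd n \<Longrightarrow> fps_nth (relative_fps F w) n = 0"
proof -
  have ef: "eval_fps F holomorphic_on UNIV" using assms by (intro holomorphic_on_eval_fps) auto
  have "(\<lambda>z. w + z / 2) holomorphic_on UNIV" "(\<lambda>z. w - z / 2) holomorphic_on UNIV"
    by (auto intro!: holomorphic_intros)
  from this[THEN holomorphic_on_compose_gen[OF _ ef]]
  have "(\<lambda>z. eval_fps F (w + z / 2) * eval_fps F (w - z / 2)) holomorphic_on UNIV"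
    unfolding o_def by (intro holomorphic_on_mult) auto
  then have h: "relative F w holomorphic_on eball 0 \<infinity>" unfolding relative_def[abs_def] by simp
  show cr: "fps_conv_radius (relative_fps F w) = \<infinity>"
    using conv_radius_fps_expansion[OF h] by (simp add: relative_fps_def)
  show ev: "eval_fps (relative_fps F w) z = relative F w z" for z
    using eval_fps_expansion'[OF h, of z] by (simp add: relative_fps_def)
  show "fps_nth (relative_fps F w) 0 = (eval_fps F w)\<^sup>2"
    using ev[of 0] by (simp add: eval_fps_at_0 relative_def power2_eq_square)
  \<comment> \<open>The series of the reflected function; since \<open>relative\<close> is even, it
    must coincide with the original one, which kills the odd coefficients.\<close>
  define H where "H = Abs_fps (\<lambda>n. (-1) ^ n * fps_nth (relative_fps F w) n)"
  have s: "(\<lambda>n. fps_nth H n * z ^ n) sums relative F w (- z)" for z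
    using sums_eval_fps[of "- z" "relative_fps F w"] cr ev[of "-z"] unfolding H_def
    by (simp add: power_minus[of z] mult_ac)
  have crH: "fps_conv_radius H = \<infinity>" unfolding fps_conv_radius_def
    by (rule conv_radius_inftyI'') (use s sums_summable in blast)
  have "eval_fps H z = eval_fps (relative_fps F w) z" for z
    using s[of z] ev[of z] unfolding eval_fps_def sums_iff by (simp add: relative_def mult.commute)
  then have "H = relative_fps F w" using cr crH by (intro eval_fps_eqD) auto
  then have "(-1) ^ n * fps_nth (relative_fps F w) n = fps_nth (relative_fps F w) n" unfolding H_def
    by (metis fps_nth_Abs_fps)
  then show "odd n \<Longrightarrow> fps_nth (relative_fps F w) n = 0" by simp
qed

text \<open>Let a_n be the weighted squared coefficients of the relative function. The weight |z|^2
  / 2 turns a_n into (n + 1) a_n, so the difference of the two sides is the sum of (n - 2) a_n over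
  n >= 1, the terms at n = 0 cancelling exactly. The only negative contribution, n = 1, vanishes by
  evenness, and equality leaves n = 0 and n = 2.\<close>

lemma relative_gap:
  assumes F: "fps_conv_radius F = \<infinity>"
  defines "L \<equiv> \<lambda>w. (\<integral>\<^sup>+z. ennreal (exp (- (1/2) * (norm z)\<^sup>2) * ((norm z)\<^sup>2 / 2 * (norm (relative F w z))\<^sup>2)) \<partial>lborel) + ennreal (4 * pi * norm (eval_fps F w) ^ 4)"
    and "R \<equiv> \<lambda>w. 3 * (\<integral>\<^sup>+z. ennreal (exp (- (1/2) * (norm z)\<^sup>2) * (norm (relative F w z))\<^sup>2) \<partial>lborel)"
  shows "R w \<le> L w" and "(\<And>z. relative F w z = (eval_fps F w)\<^sup>2 + z\<^sup>2 * h) \<Longrightarrow> L w = R w"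
    and "L w = R w \<Longrightarrow> R w < \<infinity> \<Longrightarrow> \<exists>h. \<forall>z. relative F w z = (eval_fps F w)\<^sup>2 + z\<^sup>2 * h"
proof -
  define G where "G = relative_fps F w"
  note G = relative_fps[OF F, where w = w, folded G_def]
  define a where "a n = pi * fact n * 2 ^ Suc n * (norm (fps_nth G n))\<^sup>2" for n
  have a0: "a n \<ge> 0" for n unfolding a_def by simp
  have aodd: "a n = 0" if "odd n" for n using G(4)[OF that] unfolding a_def by simp
  have I0: "(\<integral>\<^sup>+z. ennreal (exp (- (1/2) * (norm z)\<^sup>2) * (norm (relative F w z))\<^sup>2) \<partial>lborel) = (\<Sum>n. ennreal (a n))"
  proof -
    have "(norm (fps_nth G n))\<^sup>2 * (pi * fact n / (1/2) ^ Suc n) = a n" for n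
      unfolding a_def by (simp only: power_one_over divide_divide_eq_right div_by_1 mult_ac)
    then show ?thesis unfolding G(2)[symmetric] using gauss_parseval[OF G(1), of "1/2"] by (simp only:)
  qed
  have "(\<integral>\<^sup>+z. ennreal (exp (- (1/2) * (norm z)\<^sup>2) * ((norm z)\<^sup>2 / 2 * (norm (relative F w z))\<^sup>2)) \<partial>lborel)
     = (\<integral>\<^sup>+z. ennreal (1/2) * ennreal (exp (- (1/2) * (norm z)\<^sup>2) * (norm (eval_fps (fps_X * G) z))\<^sup>2) \<partial>lborel)"
    unfolding eval_fps_X_mult(1)[OF G(1)] G(2)[symmetric]
    by (intro nn_integral_cong, subst ennreal_mult'[symmetric]) (simp_all add: norm_mult power_mult_distrib)
  also have "\<dots> = ennreal (1/2) * (\<Sum>n. ennreal ((norm (fps_nth (fps_X * G) n))\<^sup>2 * (pi * fact n / (1/2) ^ Suc n)))"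
  proof -
    note [measurable] = borel_measurable_eval_fps[OF eval_fps_X_mult(2)[OF G(1)]]
    have m: "(\<lambda>z. ennreal (exp (- (1/2) * (norm z)\<^sup>2) * (norm (eval_fps (fps_X * G) z))\<^sup>2)) \<in> borel_measurable lborel"
      by measurable
    have half: "(0::real) < 1/2" by simp
    show ?thesis unfolding nn_integral_cmult[OF m] gauss_parseval[OF eval_fps_X_mult(2)[OF G(1)] half] ..
  qed
  also have "\<dots> = (\<Sum>n. ennreal ((1/2) * ((norm (fps_nth (fps_X * G) n))\<^sup>2 * (pi * fact n / (1/2) ^ Suc n))))"
    by (subst ennreal_suminf_cmult[symmetric]) (simp only: ennreal_mult'[symmetric])
  also have "\<dots> = (\<Sum>n. ennreal ((1/2) * ((norm (fps_nth (fps_X * G) (n + 1)))\<^sup>2 * (pi * fact (n + 1) / (1/2) ^ Suc (n + 1)))))"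
    by (subst suminf_offset[where i = 1]) (auto intro: summableI)
  also have "\<dots> = (\<Sum>n. ennreal (real (Suc n) * a n))"
  proof (intro suminf_cong arg_cong[of _ _ ennreal])
    fix n
    have "(1/2) * ((norm (fps_nth (fps_X * G) (n + 1)))\<^sup>2 * (pi * fact (n + 1) / (1/2) ^ Suc (n + 1)))
       = (1/2) * ((norm (fps_nth G n))\<^sup>2 * (pi * (real (Suc n) * fact n) * (2 * 2 ^ Suc n)))"
      by (simp add: power_one_over)
    then show "(1/2) * ((norm (fps_nth (fps_X * G) (n + 1)))\<^sup>2 * (pi * fact (n + 1) / (1/2) ^ Suc (n + 1))) = real (Suc n) * a n"
      unfolding a_def by simp
  qed
  finally have I1: "(\<integral>\<^sup>+z. ennreal (exp (- (1/2) * (norm z)\<^sup>2) * ((norm z)\<^sup>2 / 2 * (norm (relative F w z))\<^sup>2)) \<partial>lborel) = (\<Sum>n. ennreal (real (Suc n) * a n))" .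
  have a00: "2 * a 0 = 4 * pi * norm (eval_fps F w) ^ 4" unfolding a_def G(3) by (simp add: norm_power power_mult[symmetric])
  \<comment> \<open>The termwise excess of the left side over the right side, nonnegative because a
    1 = 0.\<close>
  define d where "d n = (if n = 0 then 0 else (real n - 2) * a n)" for n
  have d0: "d n \<ge> 0" for n
  proof -
    have "n = 0 \<or> n = 1 \<or> n \<ge> 2" by auto
    then show ?thesis using a0[of n] aodd[of 1] unfolding d_def by auto
  qed
  have "(\<lambda>n. if n = 0 then ennreal (2 * a 0) else 0) sums ennreal (2 * a 0)"
    using sums_single[of 0 "\<lambda>_. ennreal (2 * a 0)"] by simp
  then have "L w = (\<Sum>n. ennreal (real (Suc n) * a n)) + (\<Sum>n. if n = 0 then ennreal (2 * a 0) else 0)"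
    unfolding L_def I1 a00[symmetric] by (simp add: sums_iff)
  also have "\<dots> = (\<Sum>n. ennreal (real (Suc n) * a n) + (if n = 0 then ennreal (2 * a 0) else 0))"
    by (intro suminf_add summableI)
  also have "\<dots> = (\<Sum>n. 3 * ennreal (a n) + ennreal (d n))"
  proof (intro suminf_cong)
    fix n
    show "ennreal (real (Suc n) * a n) + (if n = 0 then ennreal (2 * a 0) else 0) = 3 * ennreal (a n) + ennreal (d n)"
    proof (cases "n = 0")
      case True
      have "ennreal (a 0) + ennreal (2 * a 0) = ennreal 3 * ennreal (a 0)"
        using a0[of 0] by (subst ennreal_plus[symmetric]) (auto simp: ennreal_mult'[symmetric] simp del: ennreal_plus ennreal_numeral)
      then show ?thesis using True by (simp add: d_def)
    next
      case False
      have "ennreal 3 * ennreal (a n) + ennreal (d n) = ennreal (3 * a n + d n)"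
        using a0[of n] d0[of n] by (subst ennreal_plus) (auto simp: ennreal_mult' simp del: ennreal_numeral)
      also have "3 * a n + d n = real (Suc n) * a n" using False by (simp add: d_def algebra_simps)
      finally show ?thesis using False by simp
    qed
  qed
  also have "\<dots> = (\<Sum>n. 3 * ennreal (a n)) + (\<Sum>n. ennreal (d n))"
    by (intro suminf_add[symmetric] summableI)
  also have "(\<Sum>n. 3 * ennreal (a n)) = R w" unfolding R_def I0 by simp
  finally have LR: "L w = R w + (\<Sum>n. ennreal (d n))" .
  then show "R w \<le> L w" by simp
  show "L w = R w" if h: "\<And>z. relative F w z = (eval_fps F w)\<^sup>2 + z\<^sup>2 * h"
  proof -
    have "eval_fps (fps_const ((eval_fps F w)\<^sup>2) + fps_X ^ 2 * fps_const h) z = eval_fps G z" for z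
      unfolding G(2) h by (subst eval_fps_add) (auto simp: eval_fps_mult intro!: less_le_trans[OF _ fps_conv_radius_mult])
    moreover have "fps_conv_radius (fps_const ((eval_fps F w)\<^sup>2) + fps_X ^ 2 * fps_const h) > 0"
      by (rule less_le_trans[OF _ fps_conv_radius_add], rule min_less_iff_conj[THEN iffD2], rule conjI, simp, rule less_le_trans[OF _ fps_conv_radius_mult]) simp
    ultimately have "G = fps_const ((eval_fps F w)\<^sup>2) + fps_X ^ 2 * fps_const h"
      using G(1) by (intro eval_fps_eqD[symmetric]) auto
    then have "fps_nth G n = 0" if "n > 2" for n using that by (simp add: fps_X_power_mult_nth)
    then have "d n = 0" for n using aodd[of 1] unfolding d_def a_def by (cases "n > 2") (auto simp: not_less le_Suc_eq numeral_2_eq_2)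
    then show ?thesis using LR by simp
  qed
  show "\<exists>h. \<forall>z. relative F w z = (eval_fps F w)\<^sup>2 + z\<^sup>2 * h" if "L w = R w" "R w < \<infinity>"
  proof -
    have "(\<Sum>n. ennreal (d n)) = 0" using LR that by (metis add.right_neutral ennreal_add_left_cancel infinity_ennreal_def less_irrefl)
    then have "ennreal (d n) = 0" for n by (subst (asm) suminf_eq_zero_iff) (auto intro: summableI)
    then have d: "d n = 0" for n using d0[of n] by (intro antisym) (simp_all add: ennreal_eq_0_iff)
    have g: "fps_nth G n = 0" if "n \<noteq> 0" "n \<noteq> 2" for n
      using d[of n] that unfolding d_def a_def by auto
    have "relative F w z = (eval_fps F w)\<^sup>2 + z\<^sup>2 * fps_nth G 2" for z
    proof -
      have "relative F w z = (\<Sum>n. fps_nth G n * z ^ n)" unfolding G(2)[symmetric] eval_fps_def ..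
      also have "\<dots> = (\<Sum>n\<in>{0, 2}. fps_nth G n * z ^ n)" by (rule suminf_finite) (auto simp: g)
      finally show ?thesis using G(3) by simp
    qed
    then show ?thesis by blast
  qed
qed

lemma norm_diff_square:
  fixes z w :: complex
  shows "(norm (z - w))\<^sup>2 = (norm z)\<^sup>2 + (-2) * Re (cnj w * z) + (norm w)\<^sup>2"
  unfolding cmod_power2 by (simp add: power2_eq_square algebra_simps)

lemma parallelogram:
  fixes z w :: complex
  shows "(norm (w + z / 2))\<^sup>2 + (norm (w - z / 2))\<^sup>2 = 2 * (norm w)\<^sup>2 + (norm z)\<^sup>2 / 2"
  unfolding cmod_power2 by (simp add: power2_eq_square algebra_simps)

lemma relative_state:
  "exp (- 2 * (norm w)\<^sup>2) * (exp (- (1/2) * (norm z)\<^sup>2) * (norm (relative F w z))\<^sup>2)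
    = (norm (state F (w + z / 2)))\<^sup>2 * (norm (state F (w - z / 2)))\<^sup>2"
proof -
  have "exp (- 2 * (norm w)\<^sup>2) * exp (- (1/2) * (norm z)\<^sup>2) = exp (- 1 * (norm (w + z / 2))\<^sup>2) * exp (- 1 * (norm (w - z / 2))\<^sup>2)"
    using parallelogram[of w z] by (simp add: exp_add[symmetric])
  then have "exp (- 2 * (norm w)\<^sup>2) * exp (- (1/2) * (norm z)\<^sup>2) * ((norm (eval_fps F (w + z / 2)))\<^sup>2 * (norm (eval_fps F (w - z / 2)))\<^sup>2)
     = exp (- 1 * (norm (w + z / 2))\<^sup>2) * exp (- 1 * (norm (w - z / 2))\<^sup>2) * ((norm (eval_fps F (w + z / 2)))\<^sup>2 * (norm (eval_fps F (w - z / 2)))\<^sup>2)"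
    by (rule arg_cong)
  then show ?thesis unfolding norm_state_power2 relative_def norm_mult power_mult_distrib
    by (simp only: mult_ac)
qed

lemma has_bochner_integral_nonneg:
  fixes h :: "'a \<Rightarrow> real"
  assumes "has_bochner_integral M h x" "\<And>z. h z \<ge> 0" shows "x \<ge> 0"
  using has_bochner_integral_integral_eq[OF assms(1)] Bochner_Integration.integral_nonneg[of M h] assms(2) by simp

text \<open>Expand |z - w|^2 under the product measure: each square contributes M (M + P), the mixed
  term -2 |Q|^2, and the sum is halved. This is how the moment enters the inequality.\<close>

lemma pair_integral:
  assumes "fock1 F"
  shows "(\<integral>\<^sup>+w. \<integral>\<^sup>+z. ennreal ((norm (state F z))\<^sup>2 * (norm (state F w))\<^sup>2) \<partial>lborel \<partial>lborel) = ennreal ((mass F)\<^sup>2)"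
    and "(\<integral>\<^sup>+w. \<integral>\<^sup>+z. ennreal ((norm (z - w))\<^sup>2 / 2 * ((norm (state F z))\<^sup>2 * (norm (state F w))\<^sup>2)) \<partial>lborel \<partial>lborel)
      = ennreal (mass F * (mass F + ang F) - (norm (moment F))\<^sup>2)"
    and "0 \<le> mass F * (mass F + ang F) - (norm (moment F))\<^sup>2"
proof -
  have F: "fock F" by (rule fock1_imp_fock[OF assms])
  note [measurable] = state_measurable[OF F]
  note I = state_integrals[OF assms]
  define M P Q where "M = mass F" "P = ang F" "Q = moment F"
  define q where "q z = (norm (state F z))\<^sup>2" for z
  have q0: "q z \<ge> 0" for z unfolding q_def by simp
  have M0: "M \<ge> 0" unfolding M_P_Q_def using mass_nonneg[OF F] .
  have nn_hb: "(\<integral>\<^sup>+z. ennreal (h z) \<partial>lborel) = ennreal x" if "has_bochner_integral lborel h x" "\<And>z. h z \<ge> 0"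
    for h :: "complex \<Rightarrow> real" and x
    using that by (subst nn_integral_eq_integral) (auto simp: has_bochner_integral_iff)
  have "(\<integral>\<^sup>+w. \<integral>\<^sup>+z. ennreal (q z * q w) \<partial>lborel \<partial>lborel) = (\<integral>\<^sup>+w. ennreal (M * q w) \<partial>lborel)"
  proof (intro nn_integral_cong nn_hb)
    fix w show "has_bochner_integral lborel (\<lambda>z. q z * q w) (M * q w)"
      unfolding q_def M_P_Q_def by (intro has_bochner_integral_mult_left has_bochner_integral_iff[THEN iffD2] conjI I)
  qed (simp add: q0)
  also have "\<dots> = ennreal (M * M)"
  proof (rule nn_hb)
    show "has_bochner_integral lborel (\<lambda>w. M * q w) (M * M)"
      unfolding q_def M_P_Q_def by (intro has_bochner_integral_mult_right has_bochner_integral_iff[THEN iffD2] conjI I)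
  qed (simp add: q0 M0)
  finally show "(\<integral>\<^sup>+w. \<integral>\<^sup>+z. ennreal ((norm (state F z))\<^sup>2 * (norm (state F w))\<^sup>2) \<partial>lborel \<partial>lborel) = ennreal ((mass F)\<^sup>2)"
    unfolding q_def M_P_Q_def by (simp add: power2_eq_square)
  have hb_mom: "has_bochner_integral lborel (\<lambda>z. Re (c * (of_real (q z) * z))) (Re (c * Q))" for c
    unfolding q_def M_P_Q_def moment_def
    using integrable_mult_right[OF I(5), of c]
    by (auto simp only: has_bochner_integral_iff integrable_Re integral_Re integral_mult_right_zero)
  define g where "g w = 1 / 2 * ((M + P) * q w + (-2) * Re (Q * cnj (of_real (q w) * w)) + M * ((norm w)\<^sup>2 * q w))" for w
  have hb1: "has_bochner_integral lborel (\<lambda>z. (norm (z - w))\<^sup>2 / 2 * (q z * q w)) (g w)" for w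
  proof -
    have "has_bochner_integral lborel (\<lambda>z. q w / 2 * ((norm z)\<^sup>2 * q z + (-2) * Re (cnj w * (of_real (q z) * z)) + (norm w)\<^sup>2 * q z))
       (q w / 2 * ((M + P) + (-2) * Re (cnj w * Q) + (norm w)\<^sup>2 * M))"
      unfolding q_def[symmetric] using I hb_mom[of "cnj w"]
      by (intro has_bochner_integral_mult_right has_bochner_integral_add)
        (auto simp only: has_bochner_integral_iff q_def M_P_Q_def)
    moreover have "(norm (z - w))\<^sup>2 / 2 * (q z * q w) = q w / 2 * ((norm z)\<^sup>2 * q z + (-2) * Re (cnj w * (of_real (q z) * z)) + (norm w)\<^sup>2 * q z)" for z
      unfolding norm_diff_square by (simp add: algebra_simps) (simp add: field_simps)
    moreover have "q w / 2 * ((M + P) + (-2) * Re (cnj w * Q) + (norm w)\<^sup>2 * M) = g w"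
      unfolding g_def by (simp add: algebra_simps)
    ultimately show ?thesis by (simp only:)
  qed
  then have nn1: "(\<integral>\<^sup>+z. ennreal ((norm (z - w))\<^sup>2 / 2 * (q z * q w)) \<partial>lborel) = ennreal (g w)" for w
    using q0 by (intro nn_hb) auto
  have g0: "g w \<ge> 0" for w
    using has_bochner_integral_nonneg[OF hb1] q0 by (auto intro: mult_nonneg_nonneg)
  have hb2: "has_bochner_integral lborel g (1/2 * ((M + P) * M + (-2) * Re (Q * cnj Q) + M * (M + P)))"
  proof -
    have "has_bochner_integral lborel (\<lambda>w. Re (cnj Q * (of_real (q w) * w))) (Re (cnj Q * Q))" by (rule hb_mom)
    moreover have "Re (cnj Q * (of_real (q w) * w)) = Re (Q * cnj (of_real (q w) * w))" for w by (simp add: algebra_simps)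
    ultimately have h: "has_bochner_integral lborel (\<lambda>w. Re (Q * cnj (of_real (q w) * w))) (Re (Q * cnj Q))" by (simp only: mult.commute)
    show ?thesis unfolding g_def using I h
      by (intro has_bochner_integral_mult_right has_bochner_integral_add)
        (auto simp only: has_bochner_integral_iff q_def M_P_Q_def)
  qed
  have val: "1/2 * ((M + P) * M + (-2) * Re (Q * cnj Q) + M * (M + P)) = M * (M + P) - (norm Q)\<^sup>2"
  proof -
    have "Re (Q * cnj Q) = (norm Q)\<^sup>2" by (metis Re_complex_of_real complex_norm_square)
    then show ?thesis by (simp add: algebra_simps)
  qed
  show "(\<integral>\<^sup>+w. \<integral>\<^sup>+z. ennreal ((norm (z - w))\<^sup>2 / 2 * ((norm (state F z))\<^sup>2 * (norm (state F w))\<^sup>2)) \<partial>lborel \<partial>lborel)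
      = ennreal (mass F * (mass F + ang F) - (norm (moment F))\<^sup>2)"
    using nn_hb[OF hb2 g0] unfolding val nn1[symmetric] unfolding q_def M_P_Q_def .
  show "0 \<le> mass F * (mass F + ang F) - (norm (moment F))\<^sup>2"
    using has_bochner_integral_nonneg[OF hb2] g0 val unfolding M_P_Q_def by simp
qed

lemma AE_eq_of_nn_integral_eq:
  fixes f g :: "'a \<Rightarrow> ennreal"
  assumes [measurable]: "f \<in> borel_measurable M" "g \<in> borel_measurable M"
    and le: "\<And>x. f x \<le> g x" and eq: "(\<integral>\<^sup>+x. f x \<partial>M) = (\<integral>\<^sup>+x. g x \<partial>M)" and fin: "(\<integral>\<^sup>+x. f x \<partial>M) < \<infinity>"
  shows "AE x in M. f x = g x \<and> f x < \<infinity>"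
proof -
  have "(\<integral>\<^sup>+x. g x - f x \<partial>M) = (\<integral>\<^sup>+x. g x \<partial>M) - (\<integral>\<^sup>+x. f x \<partial>M)"
    using le fin by (intro nn_integral_diff) auto
  also have "\<dots> = 0" using eq fin by (simp add: less_top)
  finally have "AE x in M. g x - f x = 0" by (subst (asm) nn_integral_0_iff_AE) auto
  moreover have "AE x in M. f x \<noteq> \<infinity>" using fin by (intro nn_integral_PInf_AE) auto
  ultimately show ?thesis
  proof eventually_elim
    case (elim x)
    then show ?case using le[of x] by (auto simp: less_top diff_eq_0_iff_ennreal)
  qed
qed

lemma AE_imp_all_closed:
  fixes f g :: "complex \<Rightarrow> complex"
  assumes "continuous_on UNIV f" "continuous_on UNIV g" "AE x in lborel. f x = g x"
  shows "f x = g x"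
proof -
  define U where "U = {x. f x \<noteq> g x}"
  have "open U" unfolding U_def using assms(1,2) by (intro open_Collect_neq) auto
  have "U \<in> null_sets lborel"
    using assms(3) borel_open[OF \<open>open U\<close>] unfolding U_def by (subst AE_iff_null_sets) auto
  then have "negligible U" unfolding negligible_iff_null_sets by (rule null_sets_completionI)
  then have "U = {}" using \<open>open U\<close> open_not_negligible by blast
  then show ?thesis unfolding U_def by blast
qed

text \<open>\<open>relative_gap\<close> is integrated over the centre \<open>w\<close> against exp
  (-2 |w|^2). By the parallelogram law the weights recombine into |u|^2 at both points, so one side
  becomes 3 M^2 and the other M (M + P) - |Q|^2 + 2 \<open>ham\<close>; half the difference is the
  defect.\<close>

theorem energy_gap:
  assumes "fock1 F"
  defines "defect \<equiv> ham F + (mass F * ang F - (norm (moment F))\<^sup>2) / 2 - (mass F)\<^sup>2"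
    and "rank2 \<equiv> (\<forall>w. \<exists>h. \<forall>z. relative F w z = (eval_fps F w)\<^sup>2 + z\<^sup>2 * h)"
  shows "defect \<ge> 0" "defect = 0 \<longleftrightarrow> rank2"
proof -
  have F: "fock F" by (rule fock1_imp_fock[OF assms(1)])
  have cr: "fps_conv_radius F = \<infinity>" by (rule fock_conv_radius[OF F])
  note [measurable] = state_measurable[OF F] borel_measurable_eval_fps[OF cr]
  have [measurable]: "(\<lambda>(w, z). relative F w z) \<in> borel_measurable (borel \<Otimes>\<^sub>M borel)"
    unfolding relative_def by measurable
  define L where "L w = (\<integral>\<^sup>+z. ennreal (exp (- (1/2) * (norm z)\<^sup>2) * ((norm z)\<^sup>2 / 2 * (norm (relative F w z))\<^sup>2)) \<partial>lborel) + ennreal (4 * pi * norm (eval_fps F w) ^ 4)" for w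
  define R where "R w = 3 * (\<integral>\<^sup>+z. ennreal (exp (- (1/2) * (norm z)\<^sup>2) * (norm (relative F w z))\<^sup>2) \<partial>lborel)" for w
  note gap = relative_gap[OF cr, folded L_def R_def]
  define W where "W w = ennreal (exp (- 2 * (norm (w::complex))\<^sup>2))" for w
  have [measurable]: "W \<in> borel_measurable borel" "L \<in> borel_measurable borel" "R \<in> borel_measurable borel"
    unfolding W_def L_def R_def by measurable
  define X where "X = mass F * (mass F + ang F) - (norm (moment F))\<^sup>2"
  have X0: "X \<ge> 0" unfolding X_def by (rule pair_integral(3)[OF assms(1)])
  have IR: "(\<integral>\<^sup>+w. W w * R w \<partial>lborel) = ennreal (3 * (mass F)\<^sup>2)"
  proof -
    have "W w * R w = 3 * (\<integral>\<^sup>+z. ennreal ((norm (state F (w + z / 2)))\<^sup>2 * (norm (state F (w - z / 2)))\<^sup>2) \<partial>lborel)" for w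
    proof -
      have "W w * R w = 3 * (W w * (\<integral>\<^sup>+z. ennreal (exp (- (1/2) * (norm z)\<^sup>2) * (norm (relative F w z))\<^sup>2) \<partial>lborel))"
        unfolding R_def by (simp only: mult.left_commute)
      also have "W w * (\<integral>\<^sup>+z. ennreal (exp (- (1/2) * (norm z)\<^sup>2) * (norm (relative F w z))\<^sup>2) \<partial>lborel)
         = (\<integral>\<^sup>+z. W w * ennreal (exp (- (1/2) * (norm z)\<^sup>2) * (norm (relative F w z))\<^sup>2) \<partial>lborel)"
        by (rule nn_integral_cmult[symmetric]) measurable
      also have "\<dots> = (\<integral>\<^sup>+z. ennreal ((norm (state F (w + z / 2)))\<^sup>2 * (norm (state F (w - z / 2)))\<^sup>2) \<partial>lborel)"
        unfolding W_def relative_state[symmetric] by (intro nn_integral_cong ennreal_mult'[symmetric]) simp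
      finally show ?thesis .
    qed
    then have "(\<integral>\<^sup>+w. W w * R w \<partial>lborel) = 3 * (\<integral>\<^sup>+w. \<integral>\<^sup>+z. ennreal ((norm (state F (w + z / 2)))\<^sup>2 * (norm (state F (w - z / 2)))\<^sup>2) \<partial>lborel \<partial>lborel)"
      by (simp only:) (rule nn_integral_cmult, measurable)
    also have "(\<integral>\<^sup>+w. \<integral>\<^sup>+z. ennreal ((norm (state F (w + z / 2)))\<^sup>2 * (norm (state F (w - z / 2)))\<^sup>2) \<partial>lborel \<partial>lborel)
       = (\<integral>\<^sup>+w. \<integral>\<^sup>+z. ennreal ((norm (state F z))\<^sup>2 * (norm (state F w))\<^sup>2) \<partial>lborel \<partial>lborel)"
      by (rule nn_integral_relative[symmetric]) measurable
    also have "3 * \<dots> = ennreal 3 * ennreal ((mass F)\<^sup>2)" unfolding pair_integral(1)[OF assms(1)] by simp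
    finally show ?thesis by (simp only: ennreal_mult'[symmetric] zero_le_numeral)
  qed
  have IL: "(\<integral>\<^sup>+w. W w * L w \<partial>lborel) = ennreal (X + 2 * ham F)"
  proof -
    have "W w * L w = (\<integral>\<^sup>+z. ennreal ((norm z)\<^sup>2 / 2 * ((norm (state F (w + z / 2)))\<^sup>2 * (norm (state F (w - z / 2)))\<^sup>2)) \<partial>lborel) + ennreal (4 * pi) * ennreal (norm (state F w) ^ 4)" for w
    proof -
      have "W w * (\<integral>\<^sup>+z. ennreal (exp (- (1/2) * (norm z)\<^sup>2) * ((norm z)\<^sup>2 / 2 * (norm (relative F w z))\<^sup>2)) \<partial>lborel)
         = (\<integral>\<^sup>+z. W w * ennreal (exp (- (1/2) * (norm z)\<^sup>2) * ((norm z)\<^sup>2 / 2 * (norm (relative F w z))\<^sup>2)) \<partial>lborel)"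
        by (rule nn_integral_cmult[symmetric]) measurable
      also have "\<dots> = (\<integral>\<^sup>+z. ennreal ((norm z)\<^sup>2 / 2 * ((norm (state F (w + z / 2)))\<^sup>2 * (norm (state F (w - z / 2)))\<^sup>2)) \<partial>lborel)"
      proof (intro nn_integral_cong)
        fix z
        have "W w * ennreal (exp (- (1/2) * (norm z)\<^sup>2) * ((norm z)\<^sup>2 / 2 * (norm (relative F w z))\<^sup>2))
          = ennreal (exp (- 2 * (norm w)\<^sup>2) * (exp (- (1/2) * (norm z)\<^sup>2) * ((norm z)\<^sup>2 / 2 * (norm (relative F w z))\<^sup>2)))"
          unfolding W_def by (rule ennreal_mult'[symmetric]) simp
        also have "exp (- 2 * (norm w)\<^sup>2) * (exp (- (1/2) * (norm z)\<^sup>2) * ((norm z)\<^sup>2 / 2 * (norm (relative F w z))\<^sup>2))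
          = (norm z)\<^sup>2 / 2 * (exp (- 2 * (norm w)\<^sup>2) * (exp (- (1/2) * (norm z)\<^sup>2) * (norm (relative F w z))\<^sup>2))"
          by (simp only: mult_ac)
        finally show "W w * ennreal (exp (- (1/2) * (norm z)\<^sup>2) * ((norm z)\<^sup>2 / 2 * (norm (relative F w z))\<^sup>2))
          = ennreal ((norm z)\<^sup>2 / 2 * ((norm (state F (w + z / 2)))\<^sup>2 * (norm (state F (w - z / 2)))\<^sup>2))" unfolding relative_state .
      qed
      moreover have "W w * ennreal (4 * pi * norm (eval_fps F w) ^ 4) = ennreal (4 * pi) * ennreal (norm (state F w) ^ 4)"
        unfolding norm_state_power4[OF cr] W_def using cr
        by (simp add: ennreal_mult'[symmetric] eval_fps_mult norm_mult power_mult_distrib power2_eq_square power4_eq_xxxx mult_ac)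
      ultimately show ?thesis unfolding L_def distrib_left by simp
    qed
    then have "(\<integral>\<^sup>+w. W w * L w \<partial>lborel) = (\<integral>\<^sup>+w. \<integral>\<^sup>+z. ennreal ((norm z)\<^sup>2 / 2 * ((norm (state F (w + z / 2)))\<^sup>2 * (norm (state F (w - z / 2)))\<^sup>2)) \<partial>lborel \<partial>lborel)
       + (\<integral>\<^sup>+w. ennreal (4 * pi) * ennreal (norm (state F w) ^ 4) \<partial>lborel)"
      by (simp only:) (rule nn_integral_add, measurable)
    also have "(\<integral>\<^sup>+w. \<integral>\<^sup>+z. ennreal ((norm z)\<^sup>2 / 2 * ((norm (state F (w + z / 2)))\<^sup>2 * (norm (state F (w - z / 2)))\<^sup>2)) \<partial>lborel \<partial>lborel)
       = (\<integral>\<^sup>+w. \<integral>\<^sup>+z. ennreal ((norm (z - w))\<^sup>2 / 2 * ((norm (state F z))\<^sup>2 * (norm (state F w))\<^sup>2)) \<partial>lborel \<partial>lborel)"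
    proof -
      have e: "(w + z / 2) - (w - z / 2) = z" for z w :: complex by simp
      have m: "(\<lambda>(z, w). ennreal ((norm (z - w))\<^sup>2 / 2 * ((norm (state F z))\<^sup>2 * (norm (state F w))\<^sup>2))) \<in> borel_measurable (borel \<Otimes>\<^sub>M borel)"
        by measurable
      show ?thesis using nn_integral_relative[OF m] unfolding e by (rule sym)
    qed
    also have "\<dots> = ennreal X" unfolding X_def by (rule pair_integral(2)[OF assms(1)])
    also have "(\<integral>\<^sup>+w. ennreal (4 * pi) * ennreal (norm (state F w) ^ 4) \<partial>lborel) = ennreal (4 * pi) * ennreal (ham F / (2 * pi))"
      unfolding nn_integral_state4(1)[OF F, symmetric] by (rule nn_integral_cmult) measurable
    also have "\<dots> = ennreal (2 * ham F)" by (simp add: ennreal_mult'[symmetric])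
    also have "ennreal X + \<dots> = ennreal (X + 2 * ham F)" using X0 ham_nonneg[OF F] by simp
    finally show ?thesis .
  qed
  have le: "W w * R w \<le> W w * L w" for w by (intro mult_left_mono gap(1)) simp
  have def_eq: "2 * defect = X + 2 * ham F - 3 * (mass F)\<^sup>2" unfolding defect_def X_def by (simp add: power2_eq_square field_simps)
  have "ennreal (3 * (mass F)\<^sup>2) \<le> ennreal (X + 2 * ham F)"
    unfolding IL[symmetric] IR[symmetric] by (intro nn_integral_mono le)
  then show "defect \<ge> 0" using X0 ham_nonneg[OF F] def_eq by (simp del: ennreal_plus)
  show "defect = 0 \<longleftrightarrow> rank2"
  proof
    assume rank2
    have "L w = R w" for w
    proof -
      obtain h where "\<And>z. relative F w z = (eval_fps F w)\<^sup>2 + z\<^sup>2 * h" using \<open>rank2\<close> unfolding rank2_def by blast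
      then show ?thesis by (rule gap(2))
    qed
    then have "ennreal (3 * (mass F)\<^sup>2) = ennreal (X + 2 * ham F)" using IL IR by (simp del: ennreal_plus)
    then show "defect = 0" using X0 ham_nonneg[OF F] def_eq by (simp del: ennreal_plus)
  next
    assume "defect = 0"
    then have "3 * (mass F)\<^sup>2 = X + 2 * ham F" using def_eq by simp
    then have "(\<integral>\<^sup>+w. W w * R w \<partial>lborel) = (\<integral>\<^sup>+w. W w * L w \<partial>lborel)" unfolding IL IR by simp
    then have "AE w in lborel. W w * R w = W w * L w \<and> W w * R w < \<infinity>"
    proof (intro AE_eq_of_nn_integral_eq le)
      show "(\<integral>\<^sup>+w. W w * R w \<partial>lborel) < \<infinity>" unfolding IR by simp
    qed auto
    then have ae: "AE w in lborel. \<exists>h. \<forall>z. relative F w z = (eval_fps F w)\<^sup>2 + z\<^sup>2 * h"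
    proof eventually_elim
      case (elim w)
      have "L w = R w" using elim unfolding W_def by (auto simp: ennreal_mult_cancel_left)
      moreover have "R w < \<infinity>" using elim unfolding W_def by (auto simp: ennreal_mult_less_top)
      ultimately show ?case by (rule gap(3))
    qed
    \<comment> \<open>Evaluating at z = 1 identifies the unknown \<open>h\<close> with a continuous
      function of \<open>w\<close>, so the identity, known for almost every centre, extends to all
      of them.\<close>
    have all: "relative F w z = (eval_fps F w)\<^sup>2 + z\<^sup>2 * (relative F w 1 - (eval_fps F w)\<^sup>2)" for w z
    proof (rule AE_imp_all_closed[where f = "\<lambda>w. relative F w z"])
      have c: "continuous_on UNIV (eval_fps F)" using continuous_on_eval_fps[of F] cr by simp
      have c2: "continuous_on UNIV (\<lambda>w. relative F w z)" for z unfolding relative_def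
        by (intro continuous_on_mult continuous_on_compose2[OF c] continuous_intros) auto
      show "continuous_on UNIV (\<lambda>w. relative F w z)" by (rule c2)
      show "continuous_on UNIV (\<lambda>w. (eval_fps F w)\<^sup>2 + z\<^sup>2 * (relative F w 1 - (eval_fps F w)\<^sup>2))"
        by (intro continuous_intros c c2)
      show "AE w in lborel. relative F w z = (eval_fps F w)\<^sup>2 + z\<^sup>2 * (relative F w 1 - (eval_fps F w)\<^sup>2)"
        using ae by eventually_elim auto
    qed
    then show rank2 unfolding rank2_def by blast
  qed
qed

section \<open>The equality case\<close>

text \<open>Comparing the pairs (x, y) and (x + y, 0), which have the same midpoint, gives k x * k y
  = k (x + y) * k 0; differentiating in y at 0 gives a linear differential equation.\<close>

lemma midpoint_square_imp_exp:
  fixes K :: "complex fps"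
  assumes cr: "fps_conv_radius K = \<infinity>"
    and eq: "\<And>x y. eval_fps K x * eval_fps K y = (eval_fps K ((x + y) / 2))\<^sup>2"
  shows "\<exists>C c. K = fps_const C * fps_exp c"
proof -
  define k where "k = eval_fps K"
  have e: "k x * k y = (k ((x + y) / 2))\<^sup>2" for x y using eq unfolding k_def .
  have m: "k x * k y = k (x + y) * k 0" for x y using e[of x y] e[of "x + y" 0] by simp
  have d: "(k has_field_derivative eval_fps (fps_deriv K) x) (at x)" for x
    unfolding k_def using cr by (intro has_field_derivative_eval_fps) auto
  show ?thesis
  proof (cases "k 0 = 0")
    case True
    have "k x = 0" for x using e[of "2 * x" 0] True by simp
    then have "K = 0" using cr unfolding k_def by (intro eval_fps_eqD) auto
    then show ?thesis by (intro exI[of _ 0]) simp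
  next
    case False
    define c where "c = eval_fps (fps_deriv K) 0 / k 0"
    have "eval_fps (fps_deriv K) x = c * k x" for x
    proof -
      have "((\<lambda>y. k x * k y) has_field_derivative k x * eval_fps (fps_deriv K) 0) (at 0)"
        by (intro DERIV_cmult d)
      moreover have "((\<lambda>y. k (x + y) * k 0) has_field_derivative eval_fps (fps_deriv K) x * k 0) (at 0)"
      proof (rule DERIV_cmult_right)
        have "((+) x has_field_derivative 1) (at 0)" by (auto intro!: derivative_eq_intros)
        then show "((\<lambda>y. k (x + y)) has_field_derivative eval_fps (fps_deriv K) x) (at 0)"
          using DERIV_chain2[of k "eval_fps (fps_deriv K) x" "(+) x" 0 1 UNIV] d[of x] by simp
      qed
      moreover have "(\<lambda>y. k x * k y) = (\<lambda>y. k (x + y) * k 0)" by (rule ext) (rule m)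
      ultimately have "k x * eval_fps (fps_deriv K) 0 = eval_fps (fps_deriv K) x * k 0"
        using DERIV_unique by metis
      then show ?thesis using False unfolding c_def by (simp add: field_simps)
    qed
    then have "eval_fps (fps_deriv K) x = eval_fps (fps_const c * K) x" for x
      unfolding k_def using cr by (simp add: eval_fps_mult)
    moreover have "fps_conv_radius (fps_const c * K) > 0"
      using fps_conv_radius_mult[of "fps_const c" K] cr by simp
    moreover have "fps_conv_radius (fps_deriv K) > 0"
      using fps_conv_radius_deriv[of K] cr by simp
    ultimately have "fps_deriv K = fps_const c * K" by (intro eval_fps_eqD) auto
    then show ?thesis using fps_exp_unique_ODE[of K c] by blast
  qed
qed

text \<open>The translates of combinations of 1 and z. Pure exponentials are included by
  \<open>A = 0\<close>, which is what a zero-free equality case produces.\<close>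

definition coherent :: "complex \<Rightarrow> complex \<Rightarrow> complex \<Rightarrow> complex fps" where
  "coherent A B c = (fps_const A * fps_X + fps_const B) * fps_exp c"

lemma eval_coherent: "eval_fps (coherent A B c) z = (A * z + B) * exp (c * z)" "fps_conv_radius (coherent A B c) = \<infinity>"
proof -
  have 1: "fps_conv_radius (fps_const A * fps_X) = \<infinity>" using fps_conv_radius_mult[of "fps_const A" fps_X] by simp
  then have 2: "fps_conv_radius (fps_const A * fps_X + fps_const B) = \<infinity>"
    using fps_conv_radius_add[of "fps_const A * fps_X" "fps_const B"] by simp
  show "fps_conv_radius (coherent A B c) = \<infinity>"
    unfolding coherent_def using fps_conv_radius_mult[of "fps_const A * fps_X + fps_const B" "fps_exp c"] 2 by simp
  show "eval_fps (coherent A B c) z = (A * z + B) * exp (c * z)"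
    unfolding coherent_def using 1 2 by (simp add: eval_fps_mult eval_fps_add)
qed

text \<open>At a zero \<open>z\<^sub>0\<close> of \<open>f\<close> the relation forces \<open>f (s + t) * f (s - t) = f s\<^sup>2 * (1 - t\<^sup>2 / s\<^sup>2)\<close> (with \<open>z\<^sub>0\<close> as origin),
  so dividing \<open>f\<close> by its zero leaves a function with \<open>k (s + t) * k (s - t) = k s\<^sup>2\<close>, an exponential.\<close>

lemma rank2_imp_coherent:
  assumes cr: "fps_conv_radius F = \<infinity>"
    and rank2: "\<forall>w. \<exists>h. \<forall>z. relative F w z = (eval_fps F w)\<^sup>2 + z\<^sup>2 * h"
  shows "\<exists>A B c. F = coherent A B c"
proof -
  define f where "f = eval_fps F"
  have r: "\<exists>h. \<forall>t. f (s + t) * f (s - t) = (f s)\<^sup>2 + t\<^sup>2 * h" for s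
  proof -
    obtain h where h: "\<And>z. relative F s z = (eval_fps F s)\<^sup>2 + z\<^sup>2 * h" using rank2 by blast
    have "f (s + t) * f (s - t) = (f s)\<^sup>2 + t\<^sup>2 * (4 * h)" for t
      using h[of "2 * t"] unfolding relative_def f_def by (simp add: power_mult_distrib)
    then show ?thesis by blast
  qed
  show ?thesis
  proof (cases "\<exists>z0. f z0 = 0")
    case False
    have "f (s + t) * f (s - t) = (f s)\<^sup>2" for s t
    proof -
      obtain h where h: "\<And>t. f (s + t) * f (s - t) = (f s)\<^sup>2 + t\<^sup>2 * h" using r by blast
      \<comment> \<open>Otherwise the quadratic in t on the right has a root, and f would have a
        zero.\<close>
      have "h = 0"
      proof (rule ccontr)
        assume "h \<noteq> 0"
        then have "f (s + csqrt (- (f s)\<^sup>2 / h)) * f (s - csqrt (- (f s)\<^sup>2 / h)) = 0" by (simp add: h)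
        then show False using False by auto
      qed
      then show ?thesis using h by simp
    qed
    from this[of "(x + y) / 2" "(x - y) / 2" for x y]
    have "f x * f y = (f ((x + y) / 2))\<^sup>2" for x y
      by (simp add: add_divide_distrib[symmetric] diff_divide_distrib[symmetric])
    then obtain C c where "F = fps_const C * fps_exp c" using midpoint_square_imp_exp[OF cr] unfolding f_def by blast
    then have "F = coherent 0 C c" unfolding coherent_def by simp
    then show ?thesis by blast
  next
    case True
    then obtain z0 where z0: "f z0 = 0" by blast
    define g where "g s = f (s + z0)" for s
    have hf: "f holomorphic_on UNIV" unfolding f_def using cr by (intro holomorphic_on_eval_fps) auto
    have hg: "g holomorphic_on eball 0 \<infinity>"
    proof -
      have "(\<lambda>s. s + z0) holomorphic_on UNIV" by (auto intro!: holomorphic_intros)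
      from holomorphic_on_compose_gen[OF this hf] show ?thesis unfolding g_def[abs_def] o_def by simp
    qed
    define G where "G = fps_expansion g 0"
    have crG: "fps_conv_radius G = \<infinity>" using conv_radius_fps_expansion[OF hg] by (simp add: G_def)
    have evG: "eval_fps G z = g z" for z using eval_fps_expansion'[OF hg, of z] by (simp add: G_def)
    \<comment> \<open>The translated function divided by z. A multiple zero needs no separate
      treatment: the exponential obtained for the quotient then has constant 0.\<close>
    define K where "K = fps_shift 1 G"
    have crK: "fps_conv_radius K = \<infinity>" unfolding K_def using crG by simp
    have G0: "fps_nth G 0 = 0" using evG[of 0] z0 by (simp add: eval_fps_at_0 g_def)
    then have GK: "G = fps_X * K" unfolding K_def by (intro fps_ext) (simp add: G0)
    have gk: "g s = s * eval_fps K s" for s unfolding evG[symmetric] GK using crK by (simp add: eval_fps_mult)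
    define k where "k = eval_fps K"
    have ck: "continuous_on UNIV k" unfolding k_def using continuous_on_eval_fps[of K] crK by simp
    have base: "k (s + t) * k (s - t) = (k s)\<^sup>2" if s: "s \<noteq> 0" "s + t \<noteq> 0" "s - t \<noteq> 0" for s t
    proof -
      obtain h where h: "\<And>t. f ((s + z0) + t) * f ((s + z0) - t) = (f (s + z0))\<^sup>2 + t\<^sup>2 * h" using r by blast
      have h': "g (s + t) * g (s - t) = (g s)\<^sup>2 + t\<^sup>2 * h" for t using h[of t] unfolding g_def by (simp add: algebra_simps)
      have "(g s)\<^sup>2 + s\<^sup>2 * h = 0" using h'[of s] z0 by (simp add: g_def)
      then have "s\<^sup>2 * ((k s)\<^sup>2 + h) = 0" unfolding gk k_def by (simp add: power_mult_distrib algebra_simps)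
      then have "h = - (k s)\<^sup>2" using s(1) by (simp add: add_eq_0_iff)
      then have "((s + t) * (s - t)) * (k (s + t) * k (s - t)) = ((s + t) * (s - t)) * (k s)\<^sup>2"
        using h'[of t] unfolding gk k_def by (simp add: power2_eq_square algebra_simps)
      then show ?thesis using s by simp
    qed
    \<comment> \<open>The exceptional points form a null set in x for each y, and then in y.
      Continuity removes them, one variable at a time.\<close>
    have "k x * k y = (k ((x + y) / 2))\<^sup>2" for x y
    proof -
      have *: "k x * k y = (k ((x + y) / 2))\<^sup>2" if "x \<noteq> 0" "y \<noteq> 0" "x + y \<noteq> 0" for x y
        using base[of "(x + y) / 2" "(x - y) / 2"] that
        by (simp add: add_divide_distrib[symmetric] diff_divide_distrib[symmetric])
      have c1: "continuous_on UNIV (\<lambda>x. k x * k y)" "continuous_on UNIV (\<lambda>x. (k ((x + y) / 2))\<^sup>2)" for y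
        by (intro continuous_intros continuous_on_compose2[OF ck]; auto)+
      have **: "k x * k y = (k ((x + y) / 2))\<^sup>2" if "y \<noteq> 0" for x y
      proof (rule AE_imp_all_closed[OF c1])
        have "{0, - y} \<in> null_sets lborel" by (intro finite_imp_null_set_lborel) auto
        then have "AE x in lborel. x \<notin> {0, - y}" by (rule AE_not_in)
        then show "AE x in lborel. k x * k y = (k ((x + y) / 2))\<^sup>2"
          by eventually_elim (use that * in \<open>auto simp: add_eq_0_iff2\<close>)
      qed
      have "k y * k x = (k ((y + x) / 2))\<^sup>2" for x y
      proof (rule AE_imp_all_closed[OF c1])
        have "{0} \<in> null_sets (lborel :: complex measure)" by (intro finite_imp_null_set_lborel) auto
        then have "AE y::complex in lborel. y \<notin> {0}" by (rule AE_not_in)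
        then show "AE y in lborel. k y * k x = (k ((y + x) / 2))\<^sup>2"
          by eventually_elim (use ** in \<open>auto simp: mult.commute add.commute\<close>)
      qed
      then show ?thesis .
    qed
    then obtain C c where K: "K = fps_const C * fps_exp c" using midpoint_square_imp_exp[OF crK] unfolding k_def by blast
    define A where "A = C * exp (- c * z0)"
    have "f z = (A * z + (- z0 * A)) * exp (c * z)" for z
    proof -
      have "f z = g (z - z0)" unfolding g_def by simp
      also have "\<dots> = (z - z0) * (C * exp (c * (z - z0)))" unfolding gk K using fps_conv_radius_exp[of c] by (simp add: eval_fps_mult)
      also have "\<dots> = (z - z0) * (C * (exp (- c * z0) * exp (c * z)))" by (simp add: exp_add[symmetric] algebra_simps)
      also have "\<dots> = (A * z + (- z0 * A)) * exp (c * z)" unfolding A_def by (simp add: algebra_simps)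
      finally show ?thesis .
    qed
    then have "F = coherent A (- z0 * A) c"
      using cr unfolding f_def by (intro eval_fps_eqD) (auto simp: eval_coherent)
    then show ?thesis by blast
  qed
qed

lemma coherent_rank2: "\<forall>w. \<exists>h. \<forall>z. relative (coherent A B c) w z = (eval_fps (coherent A B c) w)\<^sup>2 + z\<^sup>2 * h"
proof (intro allI exI)
  fix w z
  have "exp (c * (w + z / 2)) * exp (c * (w - z / 2)) = exp (c * w) * exp (c * w)"
    by (simp add: exp_add[symmetric] algebra_simps)
  moreover have "relative (coherent A B c) w z = ((A * (w + z / 2) + B) * (A * (w - z / 2) + B)) * (exp (c * (w + z / 2)) * exp (c * (w - z / 2)))"
    unfolding relative_def eval_coherent by (simp only: mult_ac)
  ultimately have "relative (coherent A B c) w z = ((A * (w + z / 2) + B) * (A * (w - z / 2) + B)) * (exp (c * w) * exp (c * w))"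
    by simp
  then show "relative (coherent A B c) w z = (eval_fps (coherent A B c) w)\<^sup>2 + z\<^sup>2 * (- A\<^sup>2 / 4 * (exp (c * w) * exp (c * w)))"
    unfolding eval_coherent by (simp add: power2_eq_square field_simps)
qed

lemma decay_exp: "decay (fps_exp (c::complex))"
proof (rule decay_ode[where \<beta> = 0])
  show "fps_deriv (fps_exp c) = (fps_const c + fps_const (2 * 0) * fps_X) * fps_exp c" by simp
qed simp

lemma decay_coherent: "decay (coherent A B c)"
proof -
  have "coherent A B c = fps_const A * (fps_X * fps_exp c) + fps_const B * fps_exp c"
    unfolding coherent_def by (simp add: algebra_simps)
  then show ?thesis by (simp add: decay_add decay_cmult decay_X_mult decay_exp)
qed

lemma ip_exp: "ip (fps_exp c) (fps_exp c) = of_real (exp ((norm c)\<^sup>2))"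
proof -
  have "fact n * fps_nth (fps_exp c) n * cnj (fps_nth (fps_exp c) n) = (c * cnj c) ^ n /\<^sub>R fact n" for n
    by (simp add: power_mult_distrib scaleR_conv_of_real field_simps)
  then have "ip (fps_exp c) (fps_exp c) = exp (c * cnj c)"
    unfolding ip_def using exp_converges[of "c * cnj c"] by (simp add: sums_iff)
  then show ?thesis unfolding complex_norm_square[symmetric] exp_of_real .
qed

text \<open>With B' = A * cnj c + B the series is (A (z - cnj c) + B') exp (c z), and (z - cnj c)
  exp (c z) is orthogonal to exp (c z). In these coordinates the mass is diagonal and the moment is
  the displacement plus one interference term.\<close>

lemma
  fixes A B c :: complex
  defines "F \<equiv> coherent A B c" and "\<kappa> \<equiv> pi * exp ((norm c)\<^sup>2)" and "B' \<equiv> A * cnj c + B"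
  shows coherent_mass: "mass F = \<kappa> * ((norm A)\<^sup>2 + (norm B')\<^sup>2)"
    and coherent_moment: "moment F = cnj c * mass F + \<kappa> * (cnj A * B')"
    and coherent_ang: "ang F = (norm c)\<^sup>2 * mass F + 2 * \<kappa> * Re (c * (cnj A * B')) + \<kappa> * (norm A)\<^sup>2"
proof -
  define e where "e = fps_exp c"
  have de: "fps_deriv e = fps_const c * e" unfolding e_def by simp
  have F: "F = fps_const A * (fps_X * e) + fps_const B * e" unfolding F_def coherent_def e_def by (simp add: algebra_simps)
  have dec: "decay e" "decay F" "decay (fps_X * e)" unfolding F_def e_def by (auto simp: decay_exp decay_coherent decay_X_mult)
  note fk = decay_fock[OF dec(1)] decay_fock[OF dec(2)] decay_fock[OF dec(3)] decay_fock1[OF dec(1)] decay_fock1[OF dec(2)]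
  have ee: "ip e e = of_real (exp ((norm c)\<^sup>2))" unfolding e_def by (rule ip_exp)
  have Xe: "ip (fps_X * e) e = cnj c * ip e e" using fk by (simp add: ip_X_left de ip_cmult_right)
  have "ip F e = A * ip (fps_X * e) e + B * ip e e" unfolding F using fk
    by (simp add: ip_add_left ip_cmult_left fock_cmult)
  then have Fe: "ip F e = B' * ip e e" unfolding Xe B'_def by (simp add: algebra_simps)
  have dF: "fps_deriv F = fps_const c * F + fps_const A * e" unfolding F by (simp add: de algebra_simps)
  have FX: "ip F (fps_X * e) = c * ip F e + A * ip e e"
    using fk by (simp add: ip_X_right dF ip_add_left ip_cmult_left fock_cmult)
  have "ip F F = cnj A * ip F (fps_X * e) + cnj B * ip F e"
    by (subst (2) F) (use fk in \<open>simp add: ip_add_right ip_cmult_right fock_cmult\<close>)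
  also have "\<dots> = (A * cnj A + B' * cnj B') * ip e e" unfolding FX Fe B'_def by (simp add: algebra_simps)
  finally have FF: "ip F F = of_real (((norm A)\<^sup>2 + (norm B')\<^sup>2) * exp ((norm c)\<^sup>2))"
    unfolding ee by (simp only: complex_norm_square[symmetric] of_real_add of_real_mult)
  then show m: "mass F = \<kappa> * ((norm A)\<^sup>2 + (norm B')\<^sup>2)"
    using mass_eq_ip[OF fk(2)] unfolding \<kappa>_def by (simp only: of_real_mult[symmetric] of_real_eq_iff mult_ac)
  have "moment F = pi * ip F (fps_deriv F)" using moment_eq_ip[OF fk(5)] fk by (simp add: ip_X_left)
  also have "ip F (fps_deriv F) = cnj c * ip F F + cnj A * ip F e"
    unfolding dF using fk by (simp add: ip_add_right ip_cmult_right fock_cmult)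
  finally show "moment F = cnj c * mass F + \<kappa> * (cnj A * B')"
    using mass_eq_ip[OF fk(2)] unfolding Fe ee \<kappa>_def by (simp add: algebra_simps)
  have "ang F = mass (fps_const A * e + fps_const c * F)" using ang_eq_mass_deriv[OF fk(5)] by (simp add: dF add.commute)
  also have "\<dots> = mass (fps_const A * e) + 2 * pi * Re (c * ip F (fps_const A * e)) + (norm c)\<^sup>2 * mass F"
    by (intro mass_add fock_cmult fk)
  also have "mass (fps_const A * e) = \<kappa> * (norm A)\<^sup>2"
  proof -
    have "ip (fps_const A * e) (fps_const A * e) = A * (cnj A * ip e e)"
      using fk by (simp add: ip_cmult_left ip_cmult_right fock_cmult)
    then have "complex_of_real (mass (fps_const A * e)) = of_real (\<kappa> * (norm A)\<^sup>2)"
      unfolding mass_eq_ip[OF fock_cmult[OF fk(1)]] \<kappa>_def of_real_mult complex_norm_square ee by (simp only: mult_ac)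
    then show ?thesis by (simp only: of_real_eq_iff)
  qed
  also have "c * ip F (fps_const A * e) = of_real (exp ((norm c)\<^sup>2)) * (c * (cnj A * B'))"
  proof -
    have "ip F (fps_const A * e) = cnj A * ip F e" using fk by (simp add: ip_cmult_right)
    then show ?thesis unfolding Fe ee by (simp only: mult_ac)
  qed
  also have "Re \<dots> = exp ((norm c)\<^sup>2) * Re (c * (cnj A * B'))" by simp
  finally show "ang F = (norm c)\<^sup>2 * mass F + 2 * \<kappa> * Re (c * (cnj A * B')) + \<kappa> * (norm A)\<^sup>2"
    unfolding \<kappa>_def by (simp only: mult_ac add_ac)
qed

section \<open>Minimisers for \<open>\<mu> \<ge> 1/2\<close>\<close>

definition energy :: "real \<Rightarrow> complex fps \<Rightarrow> real" where
  "energy \<mu> F = ham F + \<mu> * ang F"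

definition ground :: "real \<Rightarrow> complex fps \<Rightarrow> bool" where
  "ground \<mu> F \<longleftrightarrow> fock1 F \<and> mass F = 1 \<and> (\<forall>G. fock1 G \<longrightarrow> mass G = 1 \<longrightarrow> energy \<mu> F \<le> energy \<mu> G)"

text \<open>The quantity compared with \<delta>^2 is the weighted norm from
  \<open>integral_weighted\<close>, written in coefficients.\<close>

definition local_ground :: "real \<Rightarrow> complex fps \<Rightarrow> bool" where
  "local_ground \<mu> F \<longleftrightarrow> fock1 F \<and> mass F = 1 \<and>
     (\<exists>\<delta>>0. \<forall>G. fock1 G \<longrightarrow> mass G = 1 \<longrightarrow> 2 * mass (F - G) + ang (F - G) < \<delta>\<^sup>2 \<longrightarrow> energy \<mu> F \<le> energy \<mu> G)"

definition monomial :: "complex \<Rightarrow> nat \<Rightarrow> complex fps" where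
  "monomial a n = fps_const a * fps_X ^ n"

lemma monomial_nth: "fps_nth (monomial a n) k = (if k = n then a else 0)"
  by (simp add: monomial_def)

lemma fock1_finite: "(\<And>n. n \<notin> A \<Longrightarrow> fps_nth F n = 0) \<Longrightarrow> finite A \<Longrightarrow> fock1 F"
  unfolding fock1_def by (rule summable_finite[of A]) auto

lemma fock1_monomial: "fock1 (monomial a n)"
  by (rule fock1_finite[of "{n}"]) (auto simp: monomial_nth)

lemma mass_monomial: "mass (monomial a n) = pi * fact n * (norm a)\<^sup>2"
  unfolding mass_def by (subst suminf_finite[of "{n}"]) (auto simp: monomial_nth)

lemma ang_monomial: "ang (monomial a n) = real n * mass (monomial a n)"
  unfolding mass_monomial unfolding ang_def by (subst suminf_finite[of "{n}"]) (auto simp: monomial_nth)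

lemma monomial_mult: "monomial a n * monomial b m = monomial (a * b) (n + m)"
  unfolding monomial_def by (simp add: power_add algebra_simps)

lemma ham_monomial: "ham (monomial a n) = pi\<^sup>2 * fact (2 * n) / 4 ^ n * norm a ^ 4"
proof -
  have e: "(norm (a * a))\<^sup>2 = norm a ^ 4" "(2::real) ^ (n + n) = 4 ^ n"
    by (simp_all add: norm_mult power2_eq_square power4_eq_xxxx power_add power_mult_distrib[symmetric])
  show ?thesis unfolding ham_def monomial_mult
    by (subst suminf_finite[of "{n + n}"]) (auto simp: monomial_nth e mult_2)
qed

lemma energy_nonneg: "fock1 F \<Longrightarrow> \<mu> > 0 \<Longrightarrow> energy \<mu> F \<ge> 0"
  unfolding energy_def using ham_nonneg ang_nonneg fock1_imp_fock by simp

lemma exists_normalised: "\<exists>a. mass (monomial a n) = 1"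
proof (intro exI)
  show "mass (monomial (of_real (1 / sqrt (pi * fact n))) n) = 1"
    unfolding mass_monomial norm_of_real by (simp add: power_divide)
qed

text \<open>Outside \<open>fock1\<close> the energy is infinite while constants have finite energy,
  so restricting the competition to \<open>fock1\<close> changes nothing.\<close>

lemma global_minimizer_iff:
  assumes mu: "\<mu> > 0"
  shows "global_minimizer \<mu> u \<longleftrightarrow> (\<exists>F. ground \<mu> F \<and> u = state F)"
proof
  assume g: "global_minimizer \<mu> u"
  then obtain F where F: "fock F" "u = state F" unfolding global_minimizer_def bargmann_fock_iff by blast
  have le: "Gfun \<mu> u \<le> Gfun \<mu> (state G)" if "fock1 G" "mass G = 1" for G
    using g that Mass_state[OF fock1_imp_fock] fock1_imp_fock[OF that(1)]
    unfolding global_minimizer_def Ball_def bargmann_fock_iff by metis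
  have f1: "fock1 F"
  proof (rule ccontr)
    assume "\<not> fock1 F"
    then have "Gfun \<mu> u = \<infinity>" using F Gfun_state(2)[OF mu F(1)] by simp
    moreover obtain a where a: "mass (monomial a 0) = 1" using exists_normalised by blast
    ultimately show False using le[OF fock1_monomial a] unfolding Gfun_state(1)[OF mu fock1_monomial] by simp
  qed
  moreover have "mass F = 1" using g F Mass_state[OF F(1)] unfolding global_minimizer_def by simp
  moreover have "energy \<mu> F \<le> energy \<mu> G" if "fock1 G" "mass G = 1" for G
    using le[OF that] unfolding F(2) Gfun_state(1)[OF mu f1] Gfun_state(1)[OF mu that(1)] energy_def by simp
  ultimately show "\<exists>F. ground \<mu> F \<and> u = state F" using F(2) unfolding ground_def by blast
next
  assume "\<exists>F. ground \<mu> F \<and> u = state F"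
  then obtain F where F: "fock1 F" "mass F = 1" "u = state F"
    and le: "\<And>G. fock1 G \<Longrightarrow> mass G = 1 \<Longrightarrow> energy \<mu> F \<le> energy \<mu> G" unfolding ground_def by blast
  note fF = fock1_imp_fock[OF F(1)]
  have "Gfun \<mu> u \<le> Gfun \<mu> v" if "v \<in> bargmann_fock" "Mass v = 1" for v
  proof -
    obtain G where G: "fock G" "v = state G" using \<open>v \<in> bargmann_fock\<close> bargmann_fock_iff by blast
    then have m: "mass G = 1" using that(2) Mass_state by simp
    show ?thesis
    proof (cases "fock1 G")
      case True
      then show ?thesis using le[OF True m] unfolding F(3) G(2) Gfun_state(1)[OF mu F(1)] Gfun_state(1)[OF mu True] energy_def by simp
    qed (simp add: G Gfun_state(2)[OF mu])
  qed
  then show "global_minimizer \<mu> u" unfolding global_minimizer_def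
    using bargmann_fock_iff fF F Mass_state[OF fF] by auto
qed

lemma fps_diff_conv: "F - G = F + fps_const (-1) * (G :: complex fps)"
  by (simp add: fps_const_neg[symmetric] del: fps_const_neg)

lemma fock1_diff: "fock1 F \<Longrightarrow> fock1 G \<Longrightarrow> fock1 (F - G)"
  unfolding fps_diff_conv by (intro fock1_add fock1_cmult)

lemma state_diff: "fock F \<Longrightarrow> fock G \<Longrightarrow> state (F - G) z = state F z - state G z"
  unfolding state_def using fock_conv_radius[of F] fock_conv_radius[of G] by (simp add: eval_fps_diff algebra_simps)

lemma local_minimizer_imp:
  assumes mu: "\<mu> > 0" and "local_minimizer \<mu> u"
  shows "\<exists>F. local_ground \<mu> F \<and> u = state F"
proof -
  obtain F where F: "fock1 F" "u = state F" using assms(2) unfolding local_minimizer_def bargmann_fock_21_iff by blast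
  note fF = fock1_imp_fock[OF F(1)]
  have m: "mass F = 1" using assms(2) F(2) Mass_state[OF fF] unfolding local_minimizer_def by simp
  obtain \<delta> where d: "\<delta> > 0" and min: "\<And>v. v \<in> bargmann_fock_21 \<Longrightarrow> Mass v = 1 \<Longrightarrow>
     (\<integral>z. (1 + (norm z)\<^sup>2) * (norm (u z - v z))\<^sup>2 \<partial>lborel) < \<delta>\<^sup>2 \<Longrightarrow> Gfun \<mu> u \<le> Gfun \<mu> v"
    using assms(2) unfolding local_minimizer_def by blast
  have "energy \<mu> F \<le> energy \<mu> G" if G: "fock1 G" "mass G = 1" "2 * mass (F - G) + ang (F - G) < \<delta>\<^sup>2" for G
  proof -
    have "Gfun \<mu> u \<le> Gfun \<mu> (state G)"
    proof (rule min)
      show "state G \<in> bargmann_fock_21" using G(1) bargmann_fock_21_iff by blast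
      show "Mass (state G) = 1" using G Mass_state fock1_imp_fock by simp
      show "(\<integral>z. (1 + (norm z)\<^sup>2) * (norm (u z - state G z))\<^sup>2 \<partial>lborel) < \<delta>\<^sup>2"
        using integral_weighted[OF fock1_diff[OF F(1) G(1)]] G(3) unfolding F(2) by (simp add: state_diff fF fock1_imp_fock[OF G(1)])
    qed
    then show ?thesis unfolding F(2) Gfun_state(1)[OF mu F(1)] Gfun_state(1)[OF mu G(1)] energy_def by simp
  qed
  then show ?thesis using F m d unfolding local_ground_def by blast
qed

lemma ground_imp_local: "ground \<mu> F \<Longrightarrow> local_ground \<mu> F"
  unfolding ground_def local_ground_def by (auto intro: exI[of _ 1])

text \<open>At mass one and \<mu> = 1/2 the energy is 1 + |Q|^2 / 2 + defect, both corrections being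
  nonnegative; equality asks for each of them to vanish.\<close>

lemma energy_half_ge:
  assumes "fock1 F" "mass F = 1"
  shows "energy (1/2) F \<ge> 1" "energy (1/2) F = 1 \<longleftrightarrow> moment F = 0 \<and> (\<exists>A B c. F = coherent A B c)"
proof -
  define D where "D = ham F + (mass F * ang F - (norm (moment F))\<^sup>2) / 2 - (mass F)\<^sup>2"
  note g = energy_gap[OF assms(1), folded D_def]
  have D: "energy (1/2) F = 1 + (norm (moment F))\<^sup>2 / 2 + D" unfolding D_def energy_def assms(2) by (simp add: field_simps)
  show "energy (1/2) F \<ge> 1" using g(1) unfolding D by simp
  have cr: "fps_conv_radius F = \<infinity>" using fock_conv_radius fock1_imp_fock assms(1) by blast
  have "energy (1/2) F = 1 \<longleftrightarrow> (norm (moment F))\<^sup>2 = 0 \<and> D = 0" using g(1) zero_le_power2[of "norm (moment F)"] unfolding D by linarith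
  also have "\<dots> \<longleftrightarrow> moment F = 0 \<and> (\<exists>A B c. F = coherent A B c)"
    unfolding g(2) using rank2_imp_coherent[OF cr] coherent_rank2 by auto
  finally show "energy (1/2) F = 1 \<longleftrightarrow> moment F = 0 \<and> (\<exists>A B c. F = coherent A B c)" .
qed

lemma ham_normalised_monomial: "mass (monomial a n) = 1 \<Longrightarrow> ham (monomial a n) = fact (2 * n) / ((fact n)\<^sup>2 * 4 ^ n)"
proof -
  assume "mass (monomial a n) = 1"
  then have "(norm a)\<^sup>2 = 1 / (pi * fact n)" unfolding mass_monomial by (simp add: field_simps)
  moreover have "norm a ^ 4 = ((norm a)\<^sup>2)\<^sup>2" by simp
  ultimately have "norm a ^ 4 = 1 / (pi * fact n)\<^sup>2" by (simp only: power_one_over)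
  then show ?thesis unfolding ham_monomial by (simp add: power_mult_distrib)
qed

lemma ground_half: "ground (1/2) F \<longleftrightarrow> fock1 F \<and> mass F = 1 \<and> energy (1/2) F = 1"
proof -
  obtain a where a: "mass (monomial a 0) = 1" using exists_normalised by blast
  have "energy (1/2) (monomial a 0) = 1" unfolding energy_def using ham_normalised_monomial[OF a] by (simp add: ang_monomial)
  then show ?thesis unfolding ground_def using energy_half_ge(1) fock1_monomial a by (metis order.antisym)
qed

lemma ang_eq_0_imp:
  assumes "fock1 F" "ang F = 0" shows "F = monomial (fps_nth F 0) 0"
proof -
  have "(\<Sum>n. real n * (fact n * (norm (fps_nth F n))\<^sup>2)) = 0" using assms(2) unfolding ang_def by simp
  then have "real n * (fact n * (norm (fps_nth F n))\<^sup>2) = 0" for n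
    using assms(1) unfolding fock1_def by (subst (asm) suminf_eq_zero_iff) auto
  then have z: "n = 0 \<or> fps_nth F n = 0" for n by auto
  show ?thesis
  proof (rule fps_ext)
    fix n show "fps_nth F n = fps_nth (monomial (fps_nth F 0) 0) n" using z[of n] by (auto simp: monomial_nth)
  qed
qed

text \<open>The excess over the energy at 1/2 is (\<mu> - 1/2) P, and P vanishes only on
  constants.\<close>

lemma ground_large:
  assumes "\<mu> > 1/2"
  shows "ground \<mu> F \<longleftrightarrow> (\<exists>a. F = monomial a 0 \<and> mass F = 1)"
proof -
  have en: "energy \<mu> G = energy (1/2) G + (\<mu> - 1/2) * ang G" for G unfolding energy_def by (simp add: algebra_simps)
  have e0: "energy \<mu> (monomial a 0) = 1" if "mass (monomial a 0) = 1" for a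
    unfolding energy_def using ham_normalised_monomial[OF that] by (simp add: ang_monomial)
  have ge: "energy \<mu> G \<ge> 1" if "fock1 G" "mass G = 1" for G
    unfolding en using energy_half_ge(1)[OF that] ang_nonneg[OF that(1)] assms by (simp add: add_increasing2)
  show ?thesis
  proof
    assume g: "ground \<mu> F"
    obtain a where a: "mass (monomial a 0) = 1" using exists_normalised by blast
    have F: "fock1 F" "mass F = 1" "energy \<mu> F \<le> 1" using g e0[OF a] fock1_monomial a unfolding ground_def by metis+
    have "(\<mu> - 1/2) * ang F \<le> 0" using F(3) energy_half_ge(1)[OF F(1,2)] unfolding en by linarith
    then have "ang F = 0" using ang_nonneg[OF F(1)] assms by (simp add: mult_le_0_iff)
    then show "\<exists>a. F = monomial a 0 \<and> mass F = 1" using ang_eq_0_imp F by blast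
  next
    assume "\<exists>a. F = monomial a 0 \<and> mass F = 1"
    then show "ground \<mu> F" unfolding ground_def using e0 ge fock1_monomial by auto
  qed
qed

section \<open>Rotation orbits in terms of coefficients\<close>

lemma state_monomial: "state (monomial a n) z = of_real (exp (- (norm z)\<^sup>2 / 2)) * (a * z ^ n)"
  unfolding state_def monomial_def by (subst eval_fps_mult) auto

lemma norm_normalised: "mass (monomial a n) = 1 \<longleftrightarrow> norm a = 1 / sqrt (pi * fact n)"
proof -
  have "mass (monomial a n) = 1 \<longleftrightarrow> (norm a)\<^sup>2 = (1 / sqrt (pi * fact n))\<^sup>2"
    unfolding mass_monomial by (simp add: power_divide field_simps)
  then show ?thesis by (simp add: power2_eq_iff_nonneg)
qed

lemma norm_eq_iff_cis: "norm a = r \<longleftrightarrow> r \<ge> 0 \<and> (\<exists>t. a = of_real r * cis t)"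
proof
  assume "norm a = r"
  then have "a = of_real r * cis (Arg a)" using rcis_cmod_Arg[of a] by (simp add: rcis_def)
  then show "r \<ge> 0 \<and> (\<exists>t. a = of_real r * cis t)" using \<open>norm a = r\<close> norm_ge_zero by blast
qed (auto simp: norm_mult)

lemma norm_cis_mult: "norm (cis t * z) = norm z" by (simp add: norm_mult)

text \<open>Both kinds of rotation act on a monomial through a single phase, recorded by
  \<open>g\<close>. Once every phase is attained, the orbit is a full circle of
  coefficients.\<close>

lemma cis_orbit:
  assumes "r \<ge> 0" "\<And>t. \<exists>\<gamma> \<theta>. g \<gamma> \<theta> = t"
  shows "{f (of_real r * cis (g \<gamma> \<theta>)) | \<gamma> \<theta>. True} = {f a | a. norm a = r}"
proof (intro set_eqI iffI)
  fix x assume "x \<in> {f (of_real r * cis (g \<gamma> \<theta>)) | \<gamma> \<theta>. True}"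
  then obtain \<gamma> \<theta> where "x = f (of_real r * cis (g \<gamma> \<theta>))" by blast
  moreover have "norm (of_real r * cis (g \<gamma> \<theta>)) = r" using assms(1) by (simp add: norm_mult)
  ultimately show "x \<in> {f a | a. norm a = r}" by blast
next
  fix x assume "x \<in> {f a | a. norm a = r}"
  then obtain a where a: "x = f a" "norm a = r" by blast
  then obtain t where t: "a = of_real r * cis t" using norm_eq_iff_cis by blast
  obtain \<gamma> \<theta> where "g \<gamma> \<theta> = t" using assms(2) by blast
  then have "x = f (of_real r * cis (g \<gamma> \<theta>))" using a t by simp
  then show "x \<in> {f (of_real r * cis (g \<gamma> \<theta>)) | \<gamma> \<theta>. True}" by blast
qed

lemma orbit_phi0: "rotation_orbit phi0 = {state (monomial a 0) | a. mass (monomial a 0) = 1}"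
proof -
  have *: "(\<lambda>z. cis \<gamma> * phi0 (cis \<theta> * z)) = state (monomial (of_real (1 / sqrt (pi * fact 0)) * cis \<gamma>) 0)" for \<gamma> \<theta>
    unfolding phi0_def norm_cis_mult by (rule ext) (simp add: state_monomial)
  show ?thesis unfolding rotation_orbit_def * norm_normalised
    by (rule cis_orbit[where g = "\<lambda>\<gamma> \<theta>. \<gamma>"]) auto
qed

lemma orbit_phi1: "rotation_orbit phi1 = {state (monomial a 1) | a. mass (monomial a 1) = 1}"
proof -
  have *: "(\<lambda>z. cis \<gamma> * phi1 (cis \<theta> * z)) = state (monomial (of_real (1 / sqrt (pi * fact 1)) * cis (\<gamma> + \<theta>)) 1)" for \<gamma> \<theta>
    unfolding phi1_def norm_cis_mult by (rule ext) (simp add: state_monomial cis_mult[symmetric])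
  have "\<exists>\<gamma> \<theta>. \<gamma> + \<theta> = t" for t :: real by (rule exI[of _ t], rule exI[of _ 0]) simp
  then show ?thesis unfolding rotation_orbit_def * norm_normalised
    by (intro cis_orbit[where g = "(+)"]) auto
qed

definition psi_amp :: "real \<Rightarrow> real" where
  "psi_amp b = exp (- (1 / 2) * (b / (1 + b\<^sup>2))\<^sup>2) / sqrt (pi * (1 + b\<^sup>2))"

definition psi_fps :: "real \<Rightarrow> real \<Rightarrow> real \<Rightarrow> complex fps" where
  "psi_fps b \<gamma> \<theta> = coherent (of_real (psi_amp b) * cis (\<gamma> + \<theta>))
     (- of_real (psi_amp b) * cis \<gamma> * of_real (b * (2 + b\<^sup>2) / (1 + b\<^sup>2))) (of_real (b / (1 + b\<^sup>2)) * cis \<theta>)"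

lemma state_psi_fps: "state (psi_fps b \<gamma> \<theta>) = (\<lambda>z. cis \<gamma> * psi b (cis \<theta> * z))"
proof (rule ext)
  fix z
  define d s where "d = complex_of_real (b / (1 + b\<^sup>2))" "s = complex_of_real (b * (2 + b\<^sup>2) / (1 + b\<^sup>2))"
  have h: "psi b (cis \<theta> * z) = of_real (psi_amp b) * (cis \<theta> * z - s) * (exp (d * (cis \<theta> * z)) * of_real (exp (- (norm z)\<^sup>2 / 2)))"
    unfolding psi_def norm_cis_mult psi_amp_def d_s_def exp_diff by (simp add: exp_of_real[symmetric] exp_minus field_simps)
  show "state (psi_fps b \<gamma> \<theta>) z = cis \<gamma> * psi b (cis \<theta> * z)"
    unfolding h psi_fps_def d_s_def[symmetric] state_def eval_coherent cis_mult[symmetric] by (simp add: algebra_simps)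
qed

lemma orbit_psi: "rotation_orbit (psi b) = {state (psi_fps b \<gamma> \<theta>) | \<gamma> \<theta>. True}"
  unfolding rotation_orbit_def state_psi_fps ..

lemma psi_amp_pos: "psi_amp b > 0"
  unfolding psi_amp_def by (intro divide_pos_pos) (auto intro!: mult_pos_pos add_pos_nonneg)

lemma psi_amp_sq: "pi * exp ((b / (1 + b\<^sup>2))\<^sup>2) * (psi_amp b)\<^sup>2 = 1 / (1 + b\<^sup>2)"
proof -
  define d where "d = b / (1 + b\<^sup>2)"
  have p: "1 + b\<^sup>2 > 0" by (simp add: add_pos_nonneg)
  have "(exp (- (1/2) * d\<^sup>2))\<^sup>2 = exp (- d\<^sup>2)" unfolding exp_of_nat_mult[symmetric] by simp
  then have "(psi_amp b)\<^sup>2 = exp (- d\<^sup>2) / (pi * (1 + b\<^sup>2))"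
    unfolding psi_amp_def d_def[symmetric] power_divide using p by simp
  then have "pi * exp (d\<^sup>2) * (psi_amp b)\<^sup>2 = (exp (d\<^sup>2) * exp (- d\<^sup>2)) / (1 + b\<^sup>2)" by simp
  then show ?thesis unfolding d_def[symmetric] exp_minus_inverse .
qed

text \<open>In the orthogonal coordinates of a coherent series, \<open>b\<close> is |B'| / |A|, and
  the exponent b / (1 + b^2) is the displacement that cancels the interference term of the moment.
  This is where the constants of \<psi> come from.\<close>

lemma psi_fps_ground: "ground (1/2) (psi_fps b \<gamma> \<theta>)"
proof -
  define d where "d = b / (1 + b\<^sup>2)"
  define k where "k = psi_amp b"
  define A B c where "A = of_real k * cis (\<gamma> + \<theta>)" "B = - of_real k * cis \<gamma> * of_real (b * (2 + b\<^sup>2) / (1 + b\<^sup>2))" "c = of_real d * cis \<theta>"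
  have p: "1 + b\<^sup>2 > 0" by (simp add: add_pos_nonneg)
  have F: "psi_fps b \<gamma> \<theta> = coherent A B c" unfolding psi_fps_def A_B_c_def k_def d_def ..
  have nc: "(norm c)\<^sup>2 = d\<^sup>2" unfolding A_B_c_def by (simp add: norm_mult)
  have kk: "pi * exp ((norm c)\<^sup>2) * k\<^sup>2 = 1 / (1 + b\<^sup>2)" unfolding nc d_def k_def by (rule psi_amp_sq)
  have "d - b * (2 + b\<^sup>2) / (1 + b\<^sup>2) = (b - b * (2 + b\<^sup>2)) / (1 + b\<^sup>2)" unfolding d_def by (simp add: diff_divide_distrib)
  also have "b - b * (2 + b\<^sup>2) = - b * (1 + b\<^sup>2)" by (simp add: algebra_simps)
  finally have ds: "d - b * (2 + b\<^sup>2) / (1 + b\<^sup>2) = - b" using p by simp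
  have "A * cnj c + B = of_real k * cis \<gamma> * of_real (d - b * (2 + b\<^sup>2) / (1 + b\<^sup>2))"
  proof -
    have "A * cnj c = of_real k * of_real d * (cis (\<gamma> + \<theta>) * cis (- \<theta>))"
      unfolding A_B_c_def complex_cnj_mult complex_cnj_complex_of_real cis_cnj by (simp only: mult_ac)
    also have "cis (\<gamma> + \<theta>) * cis (- \<theta>) = cis \<gamma>" by (simp add: cis_mult)
    finally show ?thesis unfolding A_B_c_def(2) of_real_diff by (simp only: algebra_simps mult_minus_left mult_minus_right) simp
  qed
  then have B': "A * cnj c + B = - of_real (k * b) * cis \<gamma>" unfolding ds by simp
  have nA: "(norm A)\<^sup>2 = k\<^sup>2" "(norm (A * cnj c + B))\<^sup>2 = k\<^sup>2 * b\<^sup>2" unfolding B' unfolding A_B_c_def by (simp_all add: norm_mult power_mult_distrib)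
  have m: "mass (coherent A B c) = 1"
  proof -
    have "mass (coherent A B c) = pi * exp ((norm c)\<^sup>2) * k\<^sup>2 * (1 + b\<^sup>2)" unfolding coherent_mass nA by (simp add: algebra_simps)
    then show ?thesis unfolding kk using p by simp
  qed
  have "moment (coherent A B c) = cnj c + of_real (pi * exp ((norm c)\<^sup>2)) * (cnj A * (- of_real (k * b) * cis \<gamma>))"
    unfolding coherent_moment m B' by simp
  also have "cnj A * (- of_real (k * b) * cis \<gamma>) = - of_real (k\<^sup>2 * b) * cis (- \<theta>)"
    unfolding A_B_c_def by (simp add: cis_cnj cis_mult power2_eq_square)
  also have "of_real (pi * exp ((norm c)\<^sup>2)) * (- of_real (k\<^sup>2 * b) * cis (- \<theta>)) = - of_real (pi * exp ((norm c)\<^sup>2) * k\<^sup>2 * b) * cis (- \<theta>)"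
    by (simp add: mult_ac)
  also have "pi * exp ((norm c)\<^sup>2) * k\<^sup>2 * b = d" unfolding kk d_def by simp
  also have "cnj c + - of_real d * cis (- \<theta>) = 0" unfolding A_B_c_def by (simp add: cis_cnj)
  finally have mom: "moment (coherent A B c) = 0" .
  have f1: "fock1 (coherent A B c)" by (rule decay_fock1[OF decay_coherent])
  show ?thesis unfolding F ground_half using f1 m energy_half_ge(2)[OF f1 m] mom by blast
qed

lemma ground_half_coherent:
  assumes "ground (1/2) F"
  obtains A B c where "F = coherent A B c" "mass F = 1"
    "pi * exp ((norm c)\<^sup>2) * ((norm A)\<^sup>2 + (norm (A * cnj c + B))\<^sup>2) = 1"
    "cnj c = - (of_real (pi * exp ((norm c)\<^sup>2)) * (cnj A * (A * cnj c + B)))"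
proof -
  have F: "fock1 F" "mass F = 1" "energy (1/2) F = 1" using assms unfolding ground_half by auto
  obtain A B c where c: "F = coherent A B c" "moment F = 0" using energy_half_ge(2)[OF F(1,2)] F(3) by blast
  show ?thesis
  proof (rule that[OF c(1) F(2)])
    show "pi * exp ((norm c)\<^sup>2) * ((norm A)\<^sup>2 + (norm (A * cnj c + B))\<^sup>2) = 1"
      using F(2) unfolding c(1) coherent_mass .
    show "cnj c = - (of_real (pi * exp ((norm c)\<^sup>2)) * (cnj A * (A * cnj c + B)))"
      using c(2) F(2) coherent_moment[of A B c] unfolding c(1) by (simp add: add_eq_0_iff2)
  qed
qed

lemma coherent_0: "coherent A B 0 = monomial A 1 + monomial B 0"
  unfolding coherent_def monomial_def by simp

text \<open>Two equations remain, mass one and moment zero. The second determines \<open>c\<close>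
  from A and B', the first fixes |A| as a function of b = |B'| / |A|, and the arguments of A and
  \<open>c\<close> provide the two rotation angles.\<close>

lemma ground_half_cases:
  assumes "ground (1/2) F"
  shows "(\<exists>a. F = monomial a 0) \<or> (\<exists>b\<ge>0. \<exists>\<gamma> \<theta>. F = psi_fps b \<gamma> \<theta>)"
proof -
  obtain A B c where F: "F = coherent A B c" "mass F = 1"
    and m: "pi * exp ((norm c)\<^sup>2) * ((norm A)\<^sup>2 + (norm (A * cnj c + B))\<^sup>2) = 1"
    and q: "cnj c = - (of_real (pi * exp ((norm c)\<^sup>2)) * (cnj A * (A * cnj c + B)))"
    using assms by (rule ground_half_coherent)
  show ?thesis
  proof (cases "A = 0")
    case True
    then have "c = 0" using q by simp
    then show ?thesis using F True coherent_0 by (auto simp: monomial_def)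
  next
    case False
    define \<kappa> where "\<kappa> = pi * exp ((norm c)\<^sup>2)"
    have kp: "\<kappa> > 0" unfolding \<kappa>_def by simp
    define B' where "B' = A * cnj c + B"
    \<comment> \<open>The only modulus left free by the two equations; it is nonnegative, which
      matches the range of the family.\<close>
    define b where "b = norm B' / norm A"
    have b0: "b \<ge> 0" unfolding b_def by simp
    have p: "1 + b\<^sup>2 > 0" by (simp add: add_pos_nonneg)
    have nB: "norm B' = b * norm A" unfolding b_def using False by simp
    have m': "\<kappa> * (norm A)\<^sup>2 = 1 / (1 + b\<^sup>2)"
      using m unfolding \<kappa>_def[symmetric] B'_def[symmetric] nB using p by (simp add: field_simps power_mult_distrib)
    have q': "cnj c = - (of_real \<kappa> * (cnj A * B'))" using q unfolding \<kappa>_def B'_def .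
    define d where "d = b / (1 + b\<^sup>2)"
    have "norm c = norm (cnj c)" by simp
    also have "\<dots> = \<kappa> * (norm A * norm B')" unfolding q' norm_minus_cancel norm_mult using kp by simp
    also have "\<dots> = \<kappa> * (norm A)\<^sup>2 * b" unfolding nB by (simp add: power2_eq_square)
    finally have nc: "norm c = d" unfolding m' d_def by simp
    obtain \<theta> where c: "c = of_real d * cis \<theta>" using nc norm_eq_iff_cis by blast
    have "norm A = psi_amp b"
    proof -
      have "\<kappa> * (norm A)\<^sup>2 = \<kappa> * (psi_amp b)\<^sup>2" unfolding m' using psi_amp_sq[of b] unfolding \<kappa>_def nc d_def by simp
      then have "(norm A)\<^sup>2 = (psi_amp b)\<^sup>2" using kp by simp
      then show ?thesis using psi_amp_pos[of b] by (simp add: power2_eq_iff_nonneg)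
    qed
    then obtain t where t: "A = of_real (psi_amp b) * cis t" using norm_eq_iff_cis by blast
    define \<gamma> where "\<gamma> = t - \<theta>"
    have A: "A = of_real (psi_amp b) * cis (\<gamma> + \<theta>)" unfolding t \<gamma>_def by simp
    have "A * cnj c = - (of_real \<kappa> * (A * cnj A) * B')" unfolding q' by (simp add: mult_ac)
    also have "of_real \<kappa> * (A * cnj A) = complex_of_real (1 / (1 + b\<^sup>2))"
      unfolding complex_norm_square[symmetric] of_real_mult[symmetric] m' ..
    finally have "of_real (1 + b\<^sup>2) * (A * cnj c) = - (of_real ((1 + b\<^sup>2) * (1 / (1 + b\<^sup>2))) * B')"
      unfolding of_real_mult by (simp only: mult_minus_right mult.assoc)
    also have "(1 + b\<^sup>2) * (1 / (1 + b\<^sup>2)) = 1" using p by simp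
    finally have B: "B = - of_real (2 + b\<^sup>2) * (A * cnj c)" unfolding B'_def by (simp add: algebra_simps) (metis add.commute add_diff_cancel_left' diff_minus_eq_add eq_neg_iff_add_eq_0 group_cancel.add2)
    have "A * cnj c = of_real (psi_amp b) * cis \<gamma> * of_real d"
      unfolding A c by (simp add: cis_cnj cis_mult)
    then have B2: "B = - of_real (psi_amp b) * cis \<gamma> * of_real (b * (2 + b\<^sup>2) / (1 + b\<^sup>2))"
    proof -
      have "complex_of_real (b * (2 + b\<^sup>2) / (1 + b\<^sup>2)) = of_real (2 + b\<^sup>2) * of_real d"
        unfolding d_def by (simp only: of_real_mult[symmetric] times_divide_eq_right mult.commute)
      then show ?thesis unfolding B \<open>A * cnj c = of_real (psi_amp b) * cis \<gamma> * of_real d\<close>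
        by (simp only: mult_minus_left mult_minus_right mult_ac)
    qed
    have "F = psi_fps b \<gamma> \<theta>" unfolding F(1) psi_fps_def by (subst c, subst A, subst B2) (simp add: d_def)
    then show ?thesis using b0 by blast
  qed
qed

lemma psi_fps_0: "psi_fps 0 \<gamma> \<theta> = monomial (of_real (1 / sqrt (pi * fact 1)) * cis (\<gamma> + \<theta>)) 1"
  unfolding psi_fps_def coherent_def monomial_def psi_amp_def by simp

lemma ground_half_set:
  "{u. global_minimizer (1 / 2) u} =
     rotation_orbit phi0 \<union> rotation_orbit phi1 \<union> (\<Union>b\<in>{0..}. rotation_orbit (psi b))"
proof -
  have zero: "ground (1/2) (monomial a 0)" if "mass (monomial a 0) = 1" for a
    unfolding ground_half energy_def using that ham_normalised_monomial[OF that] by (simp add: fock1_monomial ang_monomial)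
  have one: "\<exists>\<gamma> \<theta>. monomial a 1 = psi_fps 0 \<gamma> \<theta>" if m: "mass (monomial a 1) = 1" for a
  proof -
    obtain t where "a = of_real (1 / sqrt (pi * fact 1)) * cis t" using m unfolding norm_normalised norm_eq_iff_cis by blast
    then have "monomial a 1 = psi_fps 0 t 0" unfolding psi_fps_0 by simp
    then show ?thesis by blast
  qed
  show ?thesis
  proof (intro set_eqI iffI)
    fix u assume "u \<in> {u. global_minimizer (1/2) u}"
    then obtain F where F: "ground (1/2) F" "u = state F" using global_minimizer_iff[of "1/2"] by auto
    then have "mass F = 1" unfolding ground_def by simp
    then show "u \<in> rotation_orbit phi0 \<union> rotation_orbit phi1 \<union> (\<Union>b\<in>{0..}. rotation_orbit (psi b))"
      using ground_half_cases[OF F(1)] unfolding F(2) orbit_phi0 orbit_psi by auto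
  next
    fix u assume "u \<in> rotation_orbit phi0 \<union> rotation_orbit phi1 \<union> (\<Union>b\<in>{0..}. rotation_orbit (psi b))"
    then consider a where "u = state (monomial a 0)" "mass (monomial a 0) = 1"
      | a where "u = state (monomial a 1)" "mass (monomial a 1) = 1" | b \<gamma> \<theta> where "u = state (psi_fps b \<gamma> \<theta>)"
      unfolding orbit_phi0 orbit_phi1 orbit_psi by blast
    then have "\<exists>F. ground (1/2) F \<and> u = state F"
    proof cases
      case 1 then show ?thesis using zero by blast
    next
      case (2 a)
      then obtain \<gamma> \<theta> where "monomial a 1 = psi_fps 0 \<gamma> \<theta>" using one by blast
      then show ?thesis using 2 psi_fps_ground by metis
    next
      case 3 then show ?thesis using psi_fps_ground by blast
    qed
    then show "u \<in> {u. global_minimizer (1/2) u}" using global_minimizer_iff[of "1/2"] by auto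
  qed
qed

lemma ground_large_set:
  assumes "\<mu> > 1/2" shows "{u. global_minimizer \<mu> u} = rotation_orbit phi0"
  unfolding orbit_phi0 using global_minimizer_iff[of \<mu>] ground_large[OF assms] assms by auto

text \<open>On the minimisers at 1/2 the moment condition turns \<open>ang\<close> into 1 - \<kappa>
  |B'|^2 - |c|^2, so z is the one of largest angular momentum. This identifies the limit of
  competitors as \<mu> tends to 1/2 from below.\<close>

lemma ground_half_ang_ge_1:
  assumes "ground (1/2) F" "ang F \<ge> 1"
  shows "\<exists>a. F = monomial a 1"
proof -
  obtain A B c where F: "F = coherent A B c" "mass F = 1"
    and m: "pi * exp ((norm c)\<^sup>2) * ((norm A)\<^sup>2 + (norm (A * cnj c + B))\<^sup>2) = 1"
    and q: "cnj c = - (of_real (pi * exp ((norm c)\<^sup>2)) * (cnj A * (A * cnj c + B)))"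
    using assms(1) by (rule ground_half_coherent)
  define \<kappa> B' where "\<kappa> = pi * exp ((norm c)\<^sup>2)" "B' = A * cnj c + B"
  have kp: "\<kappa> > 0" unfolding \<kappa>_B'_def by simp
  have "of_real (\<kappa> * Re (c * (cnj A * B'))) = of_real (Re (c * (of_real \<kappa> * (cnj A * B'))))"
    by (simp add: algebra_simps)
  also have "of_real \<kappa> * (cnj A * B') = - cnj c" using arg_cong[OF q, of uminus] unfolding \<kappa>_B'_def by (simp only: minus_minus)
  also have "Re (c * - cnj c) = - (norm c)\<^sup>2" 
    unfolding mult_minus_right complex_norm_square[symmetric] by (simp only: uminus_complex.sel Re_complex_of_real)
  finally have re: "\<kappa> * Re (c * (cnj A * B')) = - (norm c)\<^sup>2" by (simp only: of_real_eq_iff)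
  have "ang F = (norm c)\<^sup>2 * mass F + 2 * \<kappa> * Re (c * (cnj A * B')) + \<kappa> * (norm A)\<^sup>2"
    unfolding F(1) \<kappa>_B'_def by (rule coherent_ang)
  also have "\<dots> = \<kappa> * (norm A)\<^sup>2 - (norm c)\<^sup>2" unfolding F(2) using re by simp
  also have "\<dots> = 1 - \<kappa> * (norm B')\<^sup>2 - (norm c)\<^sup>2" using m unfolding \<kappa>_B'_def[symmetric] by (simp add: algebra_simps)
  finally have "\<kappa> * (norm B')\<^sup>2 + (norm c)\<^sup>2 \<le> 0" using assms(2) by linarith
  moreover have "\<kappa> * (norm B')\<^sup>2 \<ge> 0" using kp by simp
  ultimately have "(norm c)\<^sup>2 = 0" "\<kappa> * (norm B')\<^sup>2 = 0" using zero_le_power2[of "norm c"] by linarith+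
  then have "c = 0" "B' = 0" using kp by auto
  then have "B = 0" unfolding \<kappa>_B'_def by simp
  then show ?thesis unfolding F(1) \<open>c = 0\<close> coherent_0 by (auto simp: monomial_def)
qed

section \<open>Compactness and the vortex near \<open>\<mu> = 1/2\<close>\<close>

lemma weight_le_1:
  assumes "fock F" "mass F = 1" shows "pi * (fact n * (norm (fps_nth F n))\<^sup>2) \<le> 1"
proof -
  have "(\<Sum>k\<in>{n}. fact k * (norm (fps_nth F k))\<^sup>2) \<le> (\<Sum>k. fact k * (norm (fps_nth F k))\<^sup>2)"
    using assms(1) unfolding fock_def by (intro sum_le_suminf) auto
  then have "pi * (fact n * (norm (fps_nth F n))\<^sup>2) \<le> pi * (\<Sum>k. fact k * (norm (fps_nth F k))\<^sup>2)"
    by (intro mult_left_mono) auto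
  then show ?thesis using assms(2) unfolding mass_def by simp
qed

lemma coefficient_le_1:
  assumes "fock F" "mass F = 1" shows "norm (fps_nth F n) \<le> 1"
proof -
  have "1 * 1 \<le> pi * fact n" using pi_ge_two fact_ge_1[of n] by (intro mult_mono) auto
  then have "1 * (norm (fps_nth F n))\<^sup>2 \<le> pi * fact n * (norm (fps_nth F n))\<^sup>2" by (intro mult_right_mono) auto
  also have "\<dots> \<le> 1" using weight_le_1[OF assms, of n] by (simp add: mult.assoc)
  finally show ?thesis by (simp add: abs_square_le_1)
qed

lemma diagonal_subsequence:
  fixes c :: "nat \<Rightarrow> nat \<Rightarrow> complex"
  assumes "\<And>k n. norm (c k n) \<le> 1"
  shows "\<exists>r. strict_mono r \<and> (\<forall>n. convergent (\<lambda>k. c (r k) n))"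
proof -
  define P where "P n r = convergent (\<lambda>k. c (r k) n)" for n and r :: "nat \<Rightarrow> nat"
  interpret subseqs P
  proof
    fix n and s :: "nat \<Rightarrow> nat"
    have "bounded (range (\<lambda>k. c (s k) n))" unfolding bounded_iff using assms by auto
    then obtain l r where "strict_mono r" "((\<lambda>k. c (s k) n) \<circ> r) \<longlonglongrightarrow> l"
      using bounded_imp_convergent_subsequence by blast
    then show "\<exists>r'. strict_mono r' \<and> P n (s \<circ> r')" unfolding P_def convergent_def o_def by blast
  qed
  have "P n diagseq" for n
  proof -
    have "P n (diagseq \<circ> ((+) (Suc n)))"
    proof (rule diagseq_holds)
      fix r s :: "nat \<Rightarrow> nat" and n
      assume "strict_mono r" "P n s"
      then show "P n (s \<circ> r)" unfolding P_def convergent_def o_def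
        using LIMSEQ_subseq_LIMSEQ[of "\<lambda>k. c (s k) n" _ r] by (auto simp: o_def)
    qed
    then have "convergent (\<lambda>k. c (diagseq (k + Suc n)) n)" unfolding P_def by (simp add: o_def add.commute)
    then show ?thesis unfolding P_def by (subst (asm) convergent_ignore_initial_segment)
  qed
  then show ?thesis using subseq_diagseq unfolding P_def by blast
qed

lemma tendsto_partial:
  fixes F :: "nat \<Rightarrow> complex fps"
  assumes "\<And>n. (\<lambda>k. fps_nth (F k) n) \<longlonglongrightarrow> fps_nth G n"
  shows "(\<lambda>k. \<Sum>n<K. w n * (norm (fps_nth (F k) n))\<^sup>2) \<longlonglongrightarrow> (\<Sum>n<K. w n * (norm (fps_nth G n))\<^sup>2)"
    and "(\<lambda>k. \<Sum>n<K. w n * (norm (fps_nth (F k * F k) n))\<^sup>2) \<longlonglongrightarrow> (\<Sum>n<K. w n * (norm (fps_nth (G * G) n))\<^sup>2)"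
  unfolding fps_mult_nth by (intro tendsto_intros assms)+

lemma summable_of_bounded_partial:
  fixes f :: "nat \<Rightarrow> real"
  assumes "\<And>n. f n \<ge> 0" "\<And>K. (\<Sum>n<K. f n) \<le> B"
  shows "summable f" "suminf f \<le> B"
proof -
  show "summable f" by (rule summableI_nonneg_bounded[OF assms])
  then show "suminf f \<le> B" using assms(2) by (rule suminf_le_const)
qed

text \<open>Bounded angular momentum prevents mass from escaping to high modes, so the limit has full mass.\<close>

lemma fock_compactness:
  fixes F :: "nat \<Rightarrow> complex fps"
  assumes F: "\<And>k. fock1 (F k)" "\<And>k. mass (F k) = 1" "\<And>k. ang (F k) \<le> B"
  obtains r G where "strict_mono r" "fock1 G" "mass G = 1" "\<forall>n. (\<lambda>k. fps_nth (F (r k)) n) \<longlonglongrightarrow> fps_nth G n"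
    "\<forall>\<mu> x l. \<mu> \<ge> 0 \<longrightarrow> (\<forall>k. energy \<mu> (F (r k)) \<le> x k) \<longrightarrow> x \<longlonglongrightarrow> l \<longrightarrow> energy \<mu> G \<le> l"
proof -
  have fF: "fock (F k)" for k using F(1) fock1_imp_fock by blast
  obtain r where r: "strict_mono r" "\<And>n. convergent (\<lambda>k. fps_nth (F (r k)) n)"
    using diagonal_subsequence[of "\<lambda>k. fps_nth (F k)"] coefficient_le_1[OF fF F(2)] by blast
  define G where "G = Abs_fps (\<lambda>n. lim (\<lambda>k. fps_nth (F (r k)) n))"
  have lim: "(\<lambda>k. fps_nth (F (r k)) n) \<longlonglongrightarrow> fps_nth G n" for n
    unfolding G_def using r(2) by (simp add: convergent_LIMSEQ_iff)
  note part = tendsto_partial[of "\<lambda>k. F (r k)", OF lim]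
  have mass_part: "(\<Sum>n<K. fact n * (norm (fps_nth (F k) n))\<^sup>2) \<le> 1 / pi" for k K
  proof -
    have "(\<Sum>n<K. fact n * (norm (fps_nth (F k) n))\<^sup>2) \<le> (\<Sum>n. fact n * (norm (fps_nth (F k) n))\<^sup>2)"
      using fF unfolding fock_def by (intro sum_le_suminf) auto
    also have "\<dots> = 1 / pi" using F(2)[of k] unfolding mass_def by (simp add: field_simps)
    finally show ?thesis .
  qed
  have ang_part: "(\<Sum>n<K. real n * fact n * (norm (fps_nth (F k) n))\<^sup>2) \<le> ang (F k) / pi" for k K
  proof -
    have "(\<Sum>n<K. real n * (fact n * (norm (fps_nth (F k) n))\<^sup>2)) \<le> (\<Sum>n. real n * (fact n * (norm (fps_nth (F k) n))\<^sup>2))"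
      using F(1) unfolding fock1_def by (intro sum_le_suminf) auto
    then show ?thesis unfolding ang_def by (simp add: field_simps)
  qed
  have G1: "(\<Sum>n<K. fact n * (norm (fps_nth G n))\<^sup>2) \<le> 1 / pi" for K
    by (rule LIMSEQ_le_const2[OF part(1)]) (use mass_part in auto)
  have G2: "(\<Sum>n<K. real n * fact n * (norm (fps_nth G n))\<^sup>2) \<le> B / pi" for K
  proof (rule LIMSEQ_le_const2[OF part(1)], intro exI allI impI)
    fix k
    have "ang (F (r k)) / pi \<le> B / pi" using F(3) by (intro divide_right_mono) auto
    then show "(\<Sum>n<K. real n * fact n * (norm (fps_nth (F (r k)) n))\<^sup>2) \<le> B / pi" using ang_part order_trans by blast
  qed
  have fG1: "fock1 G" unfolding fock1_def
    by (rule summable_of_bounded_partial(1)[where B = "B / pi"]) (use G2 in \<open>auto simp: mult.assoc\<close>)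
  then have fG: "fock G" by (rule fock1_imp_fock)
  have mass_le: "mass G \<le> 1"
  proof -
    have "(\<Sum>n. fact n * (norm (fps_nth G n))\<^sup>2) \<le> 1 / pi"
      by (rule summable_of_bounded_partial(2)) (use G1 in auto)
    then show ?thesis unfolding mass_def by (simp add: field_simps)
  qed
  \<comment> \<open>Modes above \<open>K\<close> carry at most B / (K + 1) of the mass, uniformly
    along the sequence, because each unit there costs at least K + 1 units of angular
    momentum.\<close>
  have mass_ge: "1 - B / real (Suc K) \<le> mass G" for K
  proof -
    have low: "(1 - B / real (Suc K)) / pi \<le> (\<Sum>n<Suc K. fact n * (norm (fps_nth (F k) n))\<^sup>2)" for k
    proof -
      define w where "w n = fact n * (norm (fps_nth (F k) n))\<^sup>2" for n
      have w0: "w n \<ge> 0" for n unfolding w_def by simp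
      have s: "summable w" "summable (\<lambda>n. real n * w n)" using fF[of k] F(1)[of k] unfolding fock_def fock1_def w_def by auto
      have "(\<Sum>n. real (Suc K) * w (n + Suc K)) \<le> (\<Sum>n. real (n + Suc K) * w (n + Suc K))"
        using s w0 by (intro suminf_le mult_right_mono summable_mult summable_ignore_initial_segment) auto
      also have "\<dots> \<le> (\<Sum>n. real n * w n)"
        using suminf_minus_initial_segment[OF s(2), of "Suc K"] w0 by (simp add: sum_nonneg del: sum.lessThan_Suc)
      also have "\<dots> = ang (F k) / pi" unfolding ang_def w_def by simp
      also have "\<dots> \<le> B / pi" using F(3) by (intro divide_right_mono) auto
      also have "(\<Sum>n. real (Suc K) * w (n + Suc K)) = real (Suc K) * (\<Sum>n. w (n + Suc K))"
        using s(1) by (intro suminf_mult summable_ignore_initial_segment)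
      finally have "(\<Sum>n. w (n + Suc K)) \<le> B / pi / real (Suc K)"
        by (subst pos_le_divide_eq) (simp_all only: mult.commute of_nat_0_less_iff zero_less_Suc)
      also have "B / pi / real (Suc K) = B / real (Suc K) / pi" by (simp only: divide_divide_eq_left mult.commute)
      finally have "(\<Sum>n. w (n + Suc K)) \<le> B / real (Suc K) / pi" .
      moreover have "(\<Sum>n. w n) = 1 / pi" using F(2)[of k] unfolding mass_def w_def by (simp add: field_simps)
      ultimately show ?thesis using suminf_minus_initial_segment[OF s(1), of "Suc K"] unfolding w_def[symmetric]
        by (simp add: diff_divide_distrib del: sum.lessThan_Suc of_nat_Suc)
    qed
    have "(1 - B / real (Suc K)) / pi \<le> (\<Sum>n<Suc K. fact n * (norm (fps_nth G n))\<^sup>2)"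
      by (rule LIMSEQ_le_const[OF part(1)]) (use low in blast)
    also have "\<dots> \<le> (\<Sum>n. fact n * (norm (fps_nth G n))\<^sup>2)" using fG unfolding fock_def by (intro sum_le_suminf) auto
    finally show ?thesis unfolding mass_def by (simp only: pos_divide_le_eq[OF pi_gt_zero] mult.commute)
  qed
  have "(\<lambda>K. 1 - B / real (Suc K)) \<longlonglongrightarrow> 1" by real_asymp
  then have "1 \<le> mass G" by (rule LIMSEQ_le_const2) (use mass_ge in blast)
  with mass_le have mG: "mass G = 1" by simp
  \<comment> \<open>Truncated energies depend continuously on finitely many coefficients and stay
    below the energy, whence lower semicontinuity. The bound \<open>x\<close> may vary with k, and
    \<mu> is free, so that one subsequence can be used at several values of \<mu>.\<close>
  have lsc: "energy \<mu> G \<le> l" if "\<mu> \<ge> 0" "\<And>k. energy \<mu> (F (r k)) \<le> x k" "x \<longlonglongrightarrow> l" for \<mu> x l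
  proof -
    define S where "S H K = pi\<^sup>2 * (\<Sum>n<K. fact n / 2 ^ n * (norm (fps_nth (H * H) n))\<^sup>2) + \<mu> * (pi * (\<Sum>n<K. real n * fact n * (norm (fps_nth H n))\<^sup>2))" for H :: "complex fps" and K
    have S_le: "S H K \<le> energy \<mu> H" if "fock1 H" for H K
    proof -
      have "(\<Sum>n<K. fact n / 2 ^ n * (norm (fps_nth (H * H) n))\<^sup>2) \<le> (\<Sum>n. fact n / 2 ^ n * (norm (fps_nth (H * H) n))\<^sup>2)"
        using nn_integral_state4(2)[OF fock1_imp_fock[OF that]] by (intro sum_le_suminf) auto
      moreover have "(\<Sum>n<K. real n * (fact n * (norm (fps_nth H n))\<^sup>2)) \<le> (\<Sum>n. real n * (fact n * (norm (fps_nth H n))\<^sup>2))"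
        using that unfolding fock1_def by (intro sum_le_suminf) auto
      ultimately show ?thesis unfolding S_def energy_def ham_def ang_def mult.assoc using \<open>\<mu> \<ge> 0\<close>
        by (intro add_mono mult_left_mono) auto
    qed
    have "S G K \<le> l" for K
    proof (rule LIMSEQ_le)
      show "(\<lambda>k. S (F (r k)) K) \<longlonglongrightarrow> S G K" unfolding S_def by (intro tendsto_intros part)
      show "x \<longlonglongrightarrow> l" by fact
      show "\<exists>N. \<forall>k\<ge>N. S (F (r k)) K \<le> x k" using S_le[OF F(1)] that(2) order_trans by blast
    qed
    moreover have "S G \<longlonglongrightarrow> energy \<mu> G"
      unfolding S_def energy_def ham_def ang_def mult.assoc
      using nn_integral_state4(2)[OF fG] fG1 unfolding fock1_def
      by (intro tendsto_add tendsto_mult tendsto_const summable_LIMSEQ)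
    ultimately show ?thesis by (intro LIMSEQ_le_const2) auto
  qed
  show ?thesis by (rule that[OF r(1) fG1 mG]) (use lim lsc in auto)
qed

lemma exists_ground:
  assumes "\<mu> > 0" shows "\<exists>F. ground \<mu> F"
proof -
  define V where "V = {energy \<mu> F | F. fock1 F \<and> mass F = 1}"
  obtain a where "mass (monomial a 0) = 1" using exists_normalised by blast
  then have ne: "V \<noteq> {}" unfolding V_def using fock1_monomial by blast
  have bdd: "bdd_below V" unfolding V_def by (rule bdd_belowI[of _ 0]) (auto intro: energy_nonneg assms)
  have "\<exists>F. fock1 F \<and> mass F = 1 \<and> energy \<mu> F < Inf V + 1 / real (Suc k)" for k
  proof -
    have "Inf V < Inf V + 1 / real (Suc k)" by simp
    then show ?thesis unfolding cInf_less_iff[OF ne bdd] unfolding V_def by blast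
  qed
  then obtain F where F: "\<And>k. fock1 (F k)" "\<And>k. mass (F k) = 1" "\<And>k. energy \<mu> (F k) < Inf V + 1 / real (Suc k)"
    by metis
  have ang_le: "ang (F k) \<le> (Inf V + 1) / \<mu>" for k
  proof -
    have "\<mu> * ang (F k) \<le> energy \<mu> (F k)" unfolding energy_def using ham_nonneg[OF fock1_imp_fock[OF F(1)]] by simp
    also have "\<dots> \<le> Inf V + 1 / real (Suc k)" using F(3)[of k] by simp
    also have "\<dots> \<le> Inf V + 1" by simp
    finally show ?thesis using assms by (simp add: field_simps)
  qed
  obtain r G where r: "strict_mono r" and G: "fock1 G" "mass G = 1"
    and "\<forall>n. (\<lambda>k. fps_nth (F (r k)) n) \<longlonglongrightarrow> fps_nth G n"
    and lsc: "\<forall>\<mu> x l. \<mu> \<ge> 0 \<longrightarrow> (\<forall>k. energy \<mu> (F (r k)) \<le> x k) \<longrightarrow> x \<longlonglongrightarrow> l \<longrightarrow> energy \<mu> G \<le> l"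
    by (rule fock_compactness[of F, OF F(1,2) ang_le])
  have "energy \<mu> G \<le> Inf V"
  proof (rule lsc[rule_format])
    show "energy \<mu> (F (r k)) \<le> Inf V + 1 / real (Suc k)" for k
    proof -
      have "1 / real (Suc (r k)) \<le> 1 / real (Suc k)" using seq_suble[OF r, of k] by (simp add: field_simps)
      then show ?thesis using F(3)[of "r k"] by linarith
    qed
    show "(\<lambda>k. Inf V + 1 / real (Suc k)) \<longlonglongrightarrow> Inf V" by real_asymp
  qed (use assms in simp)
  then have "ground \<mu> G" unfolding ground_def using G cInf_lower[OF _ bdd] unfolding V_def by fastforce
  then show ?thesis by blast
qed

section \<open>Stability of z below \<mu> = 1/2\<close>

text \<open>A small \<open>d\<close> keeps almost all of the main term p at the price of a large
  multiple of |q|^2, which is affordable where q is itself a product of small coefficients.\<close>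

lemma norm_add_square_ge:
  fixes p q :: complex and d :: real
  assumes "0 < d"
  shows "(1 - d) * (norm p)\<^sup>2 - (1 / d - 1) * (norm q)\<^sup>2 \<le> (norm (p + q))\<^sup>2"
proof -
  have "(norm p - norm q)\<^sup>2 \<le> (norm (p + q))\<^sup>2"
    using norm_triangle_ineq2[of p "- q"] norm_triangle_ineq2[of q "- p"]
    by (simp add: abs_le_square_iff[symmetric] add.commute)
  moreover have "(norm p - norm q)\<^sup>2 - ((1 - d) * (norm p)\<^sup>2 - (1 / d - 1) * (norm q)\<^sup>2) = d * (norm p - norm q / d)\<^sup>2"
    using assms by (simp add: power2_eq_square field_simps)
  moreover have "d * (norm p - norm q / d)\<^sup>2 \<ge> 0" using assms by simp
  ultimately show ?thesis by linarith
qed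

text \<open>The x_n are the masses of the modes and e is the mass outside z. After substituting x1 =
  1 - e, the linear part is 5/1000 x0 + 10/1000 x2 + 1/4 x3 + 1/8 t, positive in every direction.
  Every possibly negative quadratic term carries a factor of at most 1/1000 and is absorbed.\<close>

lemma near_monomial_1_arith:
  fixes H A x0 x1 x2 x3 x4 t :: real
  assumes H: "H \<ge> 2 * (x0 * x1) + (1/2 * (x1 * x1) - x1 * (62/100 * x0 + 85/100 * x2))
     + (297/200 * (x1 * x2) - 99/2 * (x0 * x3)) + (1/2 * (x1 * x3) - (1/2 * (x0 * x4) + 3/4 * (x2 * x2)))"
    and A: "A \<ge> x1 + 2 * x2 + 3 * x3 + 4 * t" and tot: "x0 + x1 + x2 + x3 + t = 1"
    and x1: "x1 \<ge> 999 / 1000" and x4: "x4 \<le> t" and nn: "x0 \<ge> 0" "x2 \<ge> 0" "x3 \<ge> 0" "x4 \<ge> 0" "t \<ge> 0"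
  shows "7/8 \<le> H + 3/8 * A"
proof -
  define e where "e = x0 + x2 + x3 + t"
  have X1: "x1 = 1 - e" and t: "t = e - x0 - x2 - x3" using tot unfolding e_def by auto
  have e: "e \<ge> 0" "e \<le> 1/1000" using x1 nn unfolding e_def using tot by auto
  have b: "x0 \<le> 1/1000" "x2 \<le> 1/1000" using e(2) nn unfolding e_def by auto
  have id: "(2 * (x0 * x1) + (1/2 * (x1 * x1) - x1 * (62/100 * x0 + 85/100 * x2))
     + (297/200 * (x1 * x2) - 99/2 * (x0 * x3)) + (1/2 * (x1 * x3) - (1/2 * (x0 * x4) + 3/4 * (x2 * x2))))
     + 3/8 * (x1 + 2 * x2 + 3 * x3 + 4 * (e - x0 - x2 - x3)) - 7/8
    = 1/8 * e - 12/100 * x0 - 115/1000 * x2 + 1/8 * x3 + 1/2 * (e * e) - 138/100 * (x0 * e) - 635/1000 * (x2 * e)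
      - 1/2 * (x3 * e) - 99/2 * (x0 * x3) - 1/2 * (x0 * x4) - 3/4 * (x2 * x2)"
    unfolding X1 by (simp add: field_simps)
  have "x0 * e \<le> x0 * (1/1000)" "x2 * e \<le> x2 * (1/1000)" "x3 * e \<le> x3 * (1/1000)" "x0 * x3 \<le> 1/1000 * x3" "x2 * x2 \<le> 1/1000 * x2" "0 \<le> e * e"
    by (rule mult_left_mono[OF e(2) nn(1)] mult_left_mono[OF e(2) nn(2)] mult_left_mono[OF e(2) nn(3)]
        mult_right_mono[OF b(1) nn(3)] mult_right_mono[OF b(2) nn(2)] zero_le_square)+
  moreover have "x0 * x4 \<le> 1/1000 * t" using b nn x4 by (intro mult_mono) auto
  ultimately have "0 \<le> 1/8 * e - 12/100 * x0 - 115/1000 * x2 + 1/8 * x3 + 1/2 * (e * e) - 138/100 * (x0 * e) - 635/1000 * (x2 * e)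
      - 1/2 * (x3 * e) - 99/2 * (x0 * x3) - 1/2 * (x0 * x4) - 3/4 * (x2 * x2)"
    using e_def nn by linarith
  moreover have "7/8 \<le> H + 3/8 * A" if "S \<le> H" "A' \<le> A" "S + 3/8 * A' - 7/8 = R" "0 \<le> R" for S A' R
    using that by linarith
  ultimately show ?thesis using H A id unfolding t[symmetric] by blast
qed

text \<open>At \<open>\<mu> = 3/8\<close> the second variation at \<open>z\<close> is positive definite modulo phases; only the modes
  \<open>N \<le> 4\<close> of \<open>F * F\<close> are needed to see this.\<close>

lemma near_monomial_1:
  assumes F: "fock1 F" "mass F = 1" and x1: "pi * (norm (fps_nth F 1))\<^sup>2 \<ge> 1 - 1 / 1000"
  shows "energy (3/8) F \<ge> 7/8"
proof -
  define a where "a n = norm (fps_nth F n)" for n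
  have a0: "a n \<ge> 0" for n unfolding a_def by simp
  define x where "x n = pi * (fact n * (a n)\<^sup>2)" for n
  have x0: "x n \<ge> 0" for n unfolding x_def by simp
  have x1': "x 1 \<ge> 999 / 1000" using x1 unfolding x_def a_def by simp
  note fF = fock1_imp_fock[OF F(1)]
  have sx: "summable x" "summable (\<lambda>n. real n * x n)"
    using fF F(1) unfolding fock_def fock1_def x_def a_def by (auto intro: summable_mult simp: mult.left_commute[of _ pi])
  have sumx: "suminf x = 1" using F(2) fF unfolding mass_def fock_def x_def a_def by (subst suminf_mult) auto
  have angx: "(\<Sum>n. real n * x n) = ang F" using F(1) unfolding ang_def fock1_def x_def a_def
    by (simp add: mult.left_commute[of _ pi] suminf_mult)
  \<comment> \<open>All modes from 4 on are lumped together. Moving a unit of mass there from z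
    loses at most 1 of \<open>ham\<close> to first order and gains at least 3 in \<open>ang\<close>,
    so angular momentum alone pays for it as soon as \<mu> > 1/3; the value 3/8 leaves 1/8 to
    spare.\<close>
  define t where "t = (\<Sum>n. x (n + 4))"
  have st: "summable (\<lambda>n. x (n + 4))" "summable (\<lambda>n. real (n + 4) * x (n + 4))"
    by (rule summable_ignore_initial_segment[OF sx(1)], rule summable_ignore_initial_segment[OF sx(2)])
  have tot: "x 0 + x 1 + x 2 + x 3 + t = 1"
    using suminf_split_initial_segment[OF sx(1), of 4] unfolding sumx t_def by (simp add: eval_nat_numeral)
  have "4 * t = (\<Sum>n. 4 * x (n + 4))" unfolding t_def using st(1) by (simp add: suminf_mult)
  also have "\<dots> \<le> (\<Sum>n. real (n + 4) * x (n + 4))"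
    using st x0 by (intro suminf_le summable_mult mult_right_mono) auto
  finally have ang_ge: "ang F \<ge> x 1 + 2 * x 2 + 3 * x 3 + 4 * t"
    using suminf_split_initial_segment[OF sx(2), of 4] unfolding angx by (simp add: eval_nat_numeral)
  have x4: "x 4 \<le> t" unfolding t_def using sum_le_suminf[OF st(1), of "{0}"] x0 by simp
  define q where "q n = (norm (fps_nth (F * F) n))\<^sup>2" for n
  have "(\<Sum>n<5. fact n / 2 ^ n * q n) \<le> (\<Sum>n. fact n / 2 ^ n * q n)"
    using nn_integral_state4(2)[OF fF] unfolding q_def by (intro sum_le_suminf) auto
  moreover have "(\<Sum>n<5. fact n / 2 ^ n * q n) = q 0 + q 1 / 2 + q 2 / 2 + 3 / 4 * q 3 + 3 / 2 * q 4"
    by (simp add: eval_nat_numeral)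
  ultimately have ham_ge: "ham F \<ge> pi\<^sup>2 * (q 1 / 2 + q 2 / 2 + 3 / 4 * q 3 + 3 / 2 * q 4)"
    unfolding ham_def q_def[symmetric] using zero_le_power2[of "norm (fps_nth (F * F) 0)"] unfolding q_def[symmetric]
    by (intro mult_left_mono) auto
  let ?f = "fps_nth F"
  have sq: "fps_nth (F * F) 1 = 2 * (?f 0 * ?f 1)" "fps_nth (F * F) 2 = ?f 1 * ?f 1 + 2 * (?f 0 * ?f 2)"
    "fps_nth (F * F) 3 = 2 * (?f 1 * ?f 2) + 2 * (?f 0 * ?f 3)" "fps_nth (F * F) 4 = 2 * (?f 1 * ?f 3) + (2 * (?f 0 * ?f 4) + ?f 2 * ?f 2)"
    by (simp_all add: fps_mult_nth numeral_eq_Suc algebra_simps)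
  have q1: "q 1 = 4 * ((a 0)\<^sup>2 * (a 1)\<^sup>2)" unfolding q_def sq a_def by (simp add: norm_mult power_mult_distrib)
  \<comment> \<open>Squaring the reverse triangle inequality, where the case of a negative lower
    bound is trivial. The product a 0 * a 2 is the only coupling between modes that matters to
    second order.\<close>
  have q2: "q 2 \<ge> (a 1)\<^sup>2 * (a 1)\<^sup>2 - 4 * (a 1)\<^sup>2 * (a 0 * a 2)"
  proof -
    have "norm (?f 1 * ?f 1) - norm (2 * (?f 0 * ?f 2)) \<le> norm (fps_nth (F * F) 2)"
      unfolding sq using norm_diff_ineq by blast
    then have l: "(a 1)\<^sup>2 - 2 * (a 0 * a 2) \<le> norm (fps_nth (F * F) 2)" unfolding a_def by (simp add: norm_mult power2_eq_square)
    define s where "s = norm (fps_nth (F * F) 2)"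
    have "s \<ge> 0" unfolding s_def by simp
    define u v where "u = (a 1)\<^sup>2" "v = a 0 * a 2"
    have uv: "u \<ge> 0" "v \<ge> 0" unfolding u_v_def using a0 by auto
    have "u * u - 4 * u * v \<le> s\<^sup>2"
    proof (cases "u - 2 * v \<ge> 0")
      case True
      have "(u - 2 * v)\<^sup>2 \<le> s\<^sup>2" using l True unfolding s_def u_v_def by (intro power_mono) auto
      moreover have "(u - 2 * v)\<^sup>2 = u * u - 4 * u * v + 4 * (v * v)" by (simp add: power2_eq_square algebra_simps)
      ultimately show ?thesis using zero_le_square[of v] by linarith
    next
      case False
      then have "u * (u - 4 * v) \<le> 0" using uv by (intro mult_nonneg_nonpos) auto
      moreover have "u * (u - 4 * v) = u * u - 4 * u * v" by (simp add: algebra_simps)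
      ultimately show ?thesis using zero_le_power2[of s] by linarith
    qed
    then show ?thesis unfolding q_def s_def u_v_def by simp
  qed
  \<comment> \<open>The weight 1/100 leaves 297/200 of the product x1 x2, which the narrow margin in
    x2 requires; the large factor 99 only multiplies x0 x3.\<close>
  have q3: "q 3 \<ge> 99 / 100 * (4 * ((a 1)\<^sup>2 * (a 2)\<^sup>2)) - 99 * (4 * ((a 0)\<^sup>2 * (a 3)\<^sup>2))"
    using norm_add_square_ge[of "1/100" "2 * (?f 1 * ?f 2)" "2 * (?f 0 * ?f 3)"]
    unfolding q_def sq a_def by (simp add: norm_mult power_mult_distrib)
  have q4: "q 4 \<ge> 1 / 2 * (4 * ((a 1)\<^sup>2 * (a 3)\<^sup>2)) - (8 * ((a 0)\<^sup>2 * (a 4)\<^sup>2) + 2 * ((a 2)\<^sup>2 * (a 2)\<^sup>2))"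
  proof -
    have "(norm (2 * (?f 0 * ?f 4) + ?f 2 * ?f 2))\<^sup>2 \<le> (2 * (a 0 * a 4) + a 2 * a 2)\<^sup>2"
      unfolding a_def by (intro power_mono norm_triangle_le) (auto simp: norm_mult)
    also have "\<dots> \<le> 2 * (2 * (a 0 * a 4))\<^sup>2 + 2 * (a 2 * a 2)\<^sup>2"
      using sum_squares_bound[of "2 * (a 0 * a 4)" "a 2 * a 2"] by (simp add: power2_sum)
    also have "\<dots> = 8 * ((a 0)\<^sup>2 * (a 4)\<^sup>2) + 2 * ((a 2)\<^sup>2 * (a 2)\<^sup>2)" by (simp add: power_mult_distrib power2_eq_square)
    finally show ?thesis
      using norm_add_square_ge[of "1/2" "2 * (?f 1 * ?f 3)" "2 * (?f 0 * ?f 4) + ?f 2 * ?f 2"]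
      unfolding q_def sq a_def by (simp add: norm_mult power_mult_distrib)
  qed
  have xs: "(a 0)\<^sup>2 = x 0 / pi" "(a 1)\<^sup>2 = x 1 / pi" "(a 2)\<^sup>2 = x 2 / (2 * pi)" "(a 3)\<^sup>2 = x 3 / (6 * pi)" "(a 4)\<^sup>2 = x 4 / (24 * pi)"
    unfolding x_def by (simp_all add: fact_numeral field_simps)
  have p1: "pi\<^sup>2 * (q 1 / 2) = 2 * (x 0 * x 1)" unfolding q1 xs by (simp add: power2_eq_square)
  \<comment> \<open>The coefficient 62/100 has to stay below 5/8, the total available for x0, while
    half its inverse, about 0.807, has to fit under 86/100, the total available for x2.\<close>
  have cross: "2 * pi * (a 0 * a 2) \<le> 62/100 * x 0 + 85/100 * x 2"
  proof -
    have "0 \<le> 62/100 * pi * (a 0 - 100/62 * a 2)\<^sup>2" by simp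
    moreover have "62/100 * pi * (a 0 - 100/62 * a 2)\<^sup>2 = 62/100 * (pi * (a 0)\<^sup>2) + 100/62 * (pi * (a 2)\<^sup>2) - 2 * pi * (a 0 * a 2)"
      by (simp add: power2_eq_square algebra_simps)
    moreover have "100/62 * (pi * (a 2)\<^sup>2) \<le> 85/100 * (2 * (pi * (a 2)\<^sup>2))" by simp
    moreover have "x 0 = pi * (a 0)\<^sup>2" "x 2 = 2 * (pi * (a 2)\<^sup>2)" unfolding x_def by simp_all
    ultimately show ?thesis by linarith
  qed
  have p2: "pi\<^sup>2 * (q 2 / 2) \<ge> 1/2 * (x 1 * x 1) - x 1 * (62/100 * x 0 + 85/100 * x 2)"
  proof -
    have "pi\<^sup>2 * (q 2 / 2) \<ge> pi\<^sup>2 * (((a 1)\<^sup>2 * (a 1)\<^sup>2 - 4 * (a 1)\<^sup>2 * (a 0 * a 2)) / 2)"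
      using q2 by (intro mult_left_mono divide_right_mono) auto
    also have "pi\<^sup>2 * (((a 1)\<^sup>2 * (a 1)\<^sup>2 - 4 * (a 1)\<^sup>2 * (a 0 * a 2)) / 2) = 1/2 * (x 1 * x 1) - x 1 * (2 * pi * (a 0 * a 2))"
      unfolding xs by (simp add: power2_eq_square field_simps)
    finally show ?thesis using mult_left_mono[OF cross x0[of 1]] by linarith
  qed
  have p3: "pi\<^sup>2 * (3/4 * q 3) \<ge> 297/200 * (x 1 * x 2) - 99/2 * (x 0 * x 3)"
  proof -
    have "pi\<^sup>2 * (3/4 * q 3) \<ge> pi\<^sup>2 * (3/4 * (99 / 100 * (4 * ((a 1)\<^sup>2 * (a 2)\<^sup>2)) - 99 * (4 * ((a 0)\<^sup>2 * (a 3)\<^sup>2))))"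
      using q3 by (intro mult_left_mono) auto
    also have "pi\<^sup>2 * (3/4 * (99 / 100 * (4 * ((a 1)\<^sup>2 * (a 2)\<^sup>2)) - 99 * (4 * ((a 0)\<^sup>2 * (a 3)\<^sup>2)))) = 297/200 * (x 1 * x 2) - 99/2 * (x 0 * x 3)"
      unfolding xs by (simp add: power2_eq_square field_simps)
    finally show ?thesis .
  qed
  have p4: "pi\<^sup>2 * (3/2 * q 4) \<ge> 1/2 * (x 1 * x 3) - (1/2 * (x 0 * x 4) + 3/4 * (x 2 * x 2))"
  proof -
    have "pi\<^sup>2 * (3/2 * q 4) \<ge> pi\<^sup>2 * (3/2 * (1 / 2 * (4 * ((a 1)\<^sup>2 * (a 3)\<^sup>2)) - (8 * ((a 0)\<^sup>2 * (a 4)\<^sup>2) + 2 * ((a 2)\<^sup>2 * (a 2)\<^sup>2))))"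
      using q4 by (intro mult_left_mono) auto
    also have "pi\<^sup>2 * (3/2 * (1 / 2 * (4 * ((a 1)\<^sup>2 * (a 3)\<^sup>2)) - (8 * ((a 0)\<^sup>2 * (a 4)\<^sup>2) + 2 * ((a 2)\<^sup>2 * (a 2)\<^sup>2))))
       = 1/2 * (x 1 * x 3) - (1/2 * (x 0 * x 4) + 3/4 * (x 2 * x 2))"
      unfolding xs by (simp add: power2_eq_square field_simps)
    finally show ?thesis .
  qed
  have t0: "t \<ge> 0" using x4 x0[of 4] by linarith
  have "ham F \<ge> 2 * (x 0 * x 1) + (1/2 * (x 1 * x 1) - x 1 * (62/100 * x 0 + 85/100 * x 2))
     + (297/200 * (x 1 * x 2) - 99/2 * (x 0 * x 3)) + (1/2 * (x 1 * x 3) - (1/2 * (x 0 * x 4) + 3/4 * (x 2 * x 2)))"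
    using ham_ge p1 p2 p3 p4 unfolding distrib_left by linarith
  from near_monomial_1_arith[OF this ang_ge tot x1' x4 x0 x0 x0 x0 t0] show ?thesis unfolding energy_def .
qed

lemma energy_monomial_1: "mass (monomial a 1) = 1 \<Longrightarrow> energy \<mu> (monomial a 1) = 1/2 + \<mu>"
  unfolding energy_def using ham_normalised_monomial[of a 1] by (simp add: ang_monomial fact_numeral)

lemma energy_convex:
  assumes "\<mu>\<^sub>1 \<le> \<mu>" "\<mu> \<le> \<mu>\<^sub>2" "\<mu>\<^sub>1 < \<mu>\<^sub>2" "energy \<mu>\<^sub>1 F \<ge> 1/2 + \<mu>\<^sub>1" "energy \<mu>\<^sub>2 F \<ge> 1/2 + \<mu>\<^sub>2"
  shows "energy \<mu> F \<ge> 1/2 + \<mu>"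
proof -
  have "(\<mu>\<^sub>2 - \<mu>) * (1/2 + \<mu>\<^sub>1) + (\<mu> - \<mu>\<^sub>1) * (1/2 + \<mu>\<^sub>2) \<le> (\<mu>\<^sub>2 - \<mu>) * energy \<mu>\<^sub>1 F + (\<mu> - \<mu>\<^sub>1) * energy \<mu>\<^sub>2 F"
    using assms by (intro add_mono mult_left_mono) auto
  also have "\<dots> = (\<mu>\<^sub>2 - \<mu>\<^sub>1) * energy \<mu> F" unfolding energy_def by (simp add: algebra_simps)
  also have "(\<mu>\<^sub>2 - \<mu>) * (1/2 + \<mu>\<^sub>1) + (\<mu> - \<mu>\<^sub>1) * (1/2 + \<mu>\<^sub>2) = (\<mu>\<^sub>2 - \<mu>\<^sub>1) * (1/2 + \<mu>)" by (simp add: field_simps)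
  finally show ?thesis using assms(3) by simp
qed

text \<open>The number 1/2 + \<mu> is the energy of a normalised z, so this says that z is a
  minimiser without choosing a normalisation.\<close>

definition vortex_ground :: "real \<Rightarrow> bool" where
  "vortex_ground \<mu> \<longleftrightarrow> (\<forall>F. fock1 F \<longrightarrow> mass F = 1 \<longrightarrow> energy \<mu> F \<ge> 1/2 + \<mu>)"

lemma vortex_ground_iff: "vortex_ground \<mu> \<longleftrightarrow> (\<exists>a. ground \<mu> (monomial a 1))"
proof
  assume v: "vortex_ground \<mu>"
  obtain a where a: "mass (monomial a 1) = 1" using exists_normalised by blast
  have "ground \<mu> (monomial a 1)"
    using v a fock1_monomial unfolding ground_def vortex_ground_def energy_monomial_1[OF a] by blast
  then show "\<exists>a. ground \<mu> (monomial a 1)" by blast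
next
  assume "\<exists>a. ground \<mu> (monomial a 1)"
  then obtain a where g: "ground \<mu> (monomial a 1)" by blast
  then have "mass (monomial a 1) = 1" unfolding ground_def by blast
  then have e: "energy \<mu> (monomial a 1) = 1/2 + \<mu>" by (rule energy_monomial_1)
  show "vortex_ground \<mu>" using g unfolding ground_def vortex_ground_def e by blast
qed

text \<open>If z were beaten at a sequence of \<mu> tending to 1/2, each competitor would have P >
  1, because its energy at 1/2 is still at least 1. Its limit is then a minimiser at 1/2 with P >=
  1, that is z. Close to z the bounds at 3/8 and at 1/2 interpolate and contradict the
  assumption.\<close>

lemma vortex_ground_near_half: "\<exists>\<mu>. 3/8 \<le> \<mu> \<and> \<mu> < 1/2 \<and> vortex_ground \<mu>"
proof (rule ccontr)
  assume contra: "\<not> ?thesis"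
  \<comment> \<open>The offset 8 makes the sequence start at 3/8, the left end of the
    interpolation.\<close>
  define m where "m k = 1/2 - 1 / real (k + 8)" for k
  have m: "3/8 \<le> m k" "m k < 1/2" for k unfolding m_def by (auto simp: field_simps)
  have "\<exists>F. fock1 F \<and> mass F = 1 \<and> energy (m k) F < 1/2 + m k" for k
    using contra m[of k] unfolding vortex_ground_def by (meson not_le)
  then obtain F where F: "\<And>k. fock1 (F k)" "\<And>k. mass (F k) = 1" "\<And>k. energy (m k) (F k) < 1/2 + m k" by metis
  have half: "energy (1/2) (F k) \<ge> 1" for k using energy_half_ge(1)[OF F(1,2)] .
  have split: "energy (1/2) (F k) = energy (m k) (F k) + (1/2 - m k) * ang (F k)" for k unfolding energy_def by (simp add: algebra_simps)
  have ang_gt: "ang (F k) > 1" for k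
  proof -
    have "1 - (1/2 + m k) < energy (1/2) (F k) - energy (m k) (F k)" using half[of k] F(3)[of k] by linarith
    then have "(1/2 - m k) * 1 < (1/2 - m k) * ang (F k)" unfolding split by simp
    then show ?thesis using m(2)[of k] by (simp only: mult_less_cancel_left_pos diff_gt_0_iff_gt)
  qed
  have ang_le: "ang (F k) \<le> 8/3" for k
  proof -
    have "3/8 * ang (F k) \<le> m k * ang (F k)" using m(1) ang_gt[of k] by (intro mult_right_mono) auto
    also have "\<dots> \<le> energy (m k) (F k)" unfolding energy_def using ham_nonneg[OF fock1_imp_fock[OF F(1)]] by simp
    also have "\<dots> \<le> 1" using F(3)[of k] m(2)[of k] by linarith
    finally show ?thesis by simp
  qed
  obtain r G where r: "strict_mono r" and G: "fock1 G" "mass G = 1"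
    and lim: "\<forall>n. (\<lambda>k. fps_nth (F (r k)) n) \<longlonglongrightarrow> fps_nth G n"
    and lsc: "\<forall>\<mu> x l. \<mu> \<ge> 0 \<longrightarrow> (\<forall>k. energy \<mu> (F (r k)) \<le> x k) \<longrightarrow> x \<longlonglongrightarrow> l \<longrightarrow> energy \<mu> G \<le> l"
    by (rule fock_compactness[of F, OF F(1,2) ang_le])
  have mr: "(\<lambda>k. m (r k)) \<longlonglongrightarrow> 1/2"
  proof -
    have "m \<longlonglongrightarrow> 1/2" unfolding m_def by real_asymp
    then show ?thesis using r LIMSEQ_subseq_LIMSEQ unfolding o_def by blast
  qed
  have "energy (1/2) G \<le> 1/2 + 1/2 + (1/2 - 1/2) * (8/3)"
  proof (rule lsc[rule_format])
    show "energy (1/2) (F (r k)) \<le> 1/2 + m (r k) + (1/2 - m (r k)) * (8/3)" for k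
    proof -
      have "(1/2 - m (r k)) * ang (F (r k)) \<le> (1/2 - m (r k)) * (8/3)" using ang_le m(2)[of "r k"] by (intro mult_left_mono) auto
      then show ?thesis using F(3)[of "r k"] split[of "r k"] by linarith
    qed
    show "(\<lambda>k. 1/2 + m (r k) + (1/2 - m (r k)) * (8/3)) \<longlonglongrightarrow> 1/2 + 1/2 + (1/2 - 1/2) * (8/3)"
      by (intro tendsto_intros mr)
  qed simp
  then have e1: "energy (1/2) G = 1" using energy_half_ge(1)[OF G] by simp
  then have gr: "ground (1/2) G" unfolding ground_half using G by simp
  \<comment> \<open>The bound ang > 1 cannot be passed to the limit directly, \<open>ang\<close>
    being only lower semicontinuous. The equivalent upper bound on \<open>ham\<close>, the energy at
    \<mu> = 0, can, and the known value of the energy of G at 1/2 converts it back.\<close>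
  have "energy 0 G \<le> 1/2"
  proof (rule lsc[rule_format])
    show "energy 0 (F (r k)) \<le> 1/2" for k
    proof -
      have "m (r k) * 1 \<le> m (r k) * ang (F (r k))" using ang_gt[of "r k"] m(1)[of "r k"] by (intro mult_left_mono) auto
      then show ?thesis using F(3)[of "r k"] unfolding energy_def by simp
    qed
  qed simp_all
  then have "ang G \<ge> 1" using e1 unfolding energy_def by simp
  then obtain a where a: "G = monomial a 1" using ground_half_ang_ge_1[OF gr] by blast
  have cv: "(\<lambda>k. pi * (norm (fps_nth (F (r k)) 1))\<^sup>2) \<longlonglongrightarrow> pi * (norm (fps_nth G 1))\<^sup>2" by (intro tendsto_intros lim[rule_format])
  have "pi * (norm (fps_nth G 1))\<^sup>2 = 1" using G(2) unfolding a mass_monomial by (simp add: monomial_nth)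
  then have "1 - 1/1000 < pi * (norm (fps_nth G 1))\<^sup>2" by simp
  from order_tendstoD(1)[OF cv this]
  have "\<forall>\<^sub>F k in sequentially. pi * (norm (fps_nth (F (r k)) 1))\<^sup>2 > 1 - 1/1000" .
  then obtain k where "pi * (norm (fps_nth (F (r k)) 1))\<^sup>2 > 1 - 1/1000" using eventually_happens trivial_limit_sequentially by blast
  then have e38: "energy (3/8) (F (r k)) \<ge> 1/2 + 3/8" using near_monomial_1[OF F(1,2), of "r k"] by simp
  have e12: "energy (1/2) (F (r k)) \<ge> 1/2 + 1/2" using half by simp
  have "energy (m (r k)) (F (r k)) \<ge> 1/2 + m (r k)"
    by (rule energy_convex[OF m(1) less_imp_le[OF m(2)] _ e38 e12]) simp
  then show False using F(3)[of "r k"] by simp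
qed

text \<open>Strictly inside an interval on which the affine difference to the energy of z is
  nonnegative at both ends, a tie forces ties at both ends. Hence P = 1 and F is a minimiser at 1/2,
  so it is z.\<close>

lemma vortex_ground_above:
  assumes v: "vortex_ground \<mu>\<^sub>1" and mu: "\<mu>\<^sub>1 < \<mu>" "\<mu> < 1/2"
  shows "ground \<mu> F \<longleftrightarrow> (\<exists>a. F = monomial a 1 \<and> mass F = 1)"
proof -
  have h: "energy (1/2) H \<ge> 1/2 + 1/2" if "fock1 H" "mass H = 1" for H using energy_half_ge(1)[OF that] by simp
  have v1: "energy \<mu>\<^sub>1 H \<ge> 1/2 + \<mu>\<^sub>1" if "fock1 H" "mass H = 1" for H using v that unfolding vortex_ground_def by blast
  have vm: "energy \<mu> H \<ge> 1/2 + \<mu>" if "fock1 H" "mass H = 1" for H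
    using mu by (intro energy_convex[OF _ _ _ v1[OF that] h[OF that]]) linarith+
  show ?thesis
  proof
    assume g: "ground \<mu> F"
    then have F: "fock1 F" "mass F = 1" unfolding ground_def by auto
    obtain a where a: "mass (monomial a 1) = 1" using exists_normalised by blast
    have "energy \<mu> F \<le> 1/2 + \<mu>" using g fock1_monomial a unfolding ground_def by (metis energy_monomial_1)
    then have *: "(1/2 - \<mu>\<^sub>1) * energy \<mu> F \<le> (1/2 - \<mu>\<^sub>1) * (1/2 + \<mu>)" using mu by (intro mult_left_mono) auto
    have "(1/2 - \<mu>\<^sub>1) * energy \<mu> F = (1/2 - \<mu>) * energy \<mu>\<^sub>1 F + (\<mu> - \<mu>\<^sub>1) * energy (1/2) F"
      unfolding energy_def by (simp add: field_simps)
    moreover have "(1/2 - \<mu>\<^sub>1) * (1/2 + \<mu>) = (1/2 - \<mu>) * (1/2 + \<mu>\<^sub>1) + (\<mu> - \<mu>\<^sub>1) * (1/2 + 1/2)" by (simp add: field_simps)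
    moreover have "(1/2 - \<mu>) * (1/2 + \<mu>\<^sub>1) \<le> (1/2 - \<mu>) * energy \<mu>\<^sub>1 F" "(\<mu> - \<mu>\<^sub>1) * (1/2 + 1/2) \<le> (\<mu> - \<mu>\<^sub>1) * energy (1/2) F"
      using mu v1[OF F] h[OF F] by (intro mult_left_mono; simp)+
    ultimately have "(1/2 - \<mu>) * (1/2 + \<mu>\<^sub>1) = (1/2 - \<mu>) * energy \<mu>\<^sub>1 F" "(\<mu> - \<mu>\<^sub>1) * (1/2 + 1/2) = (\<mu> - \<mu>\<^sub>1) * energy (1/2) F"
      using * by linarith+
    then have e: "energy \<mu>\<^sub>1 F = 1/2 + \<mu>\<^sub>1" "energy (1/2) F = 1" using mu by auto
    have "(1/2 - \<mu>\<^sub>1) * ang F = (1/2 - \<mu>\<^sub>1) * 1" using e unfolding energy_def by (simp add: algebra_simps)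
    then have "ang F = 1" using mu by simp
    then show "\<exists>a. F = monomial a 1 \<and> mass F = 1" using ground_half_ang_ge_1[of F] F e unfolding ground_half by auto
  next
    assume "\<exists>a. F = monomial a 1 \<and> mass F = 1"
    then show "ground \<mu> F" unfolding ground_def using vm fock1_monomial energy_monomial_1 by auto
  qed
qed

section \<open>First and second variations\<close>

text \<open>The dilation f(z / sqrt 2). It absorbs the weight 2^-n of the quartic form, so that
  \<open>ham\<close> becomes a Fock mass and the inner product calculus applies to it.\<close>

definition halve :: "complex fps \<Rightarrow> complex fps" where
  "halve F = fps_compose F (fps_const (of_real (1 / sqrt 2)) * fps_X)"

lemma halve_nth: "fps_nth (halve F) n = of_real ((1 / sqrt 2) ^ n) * fps_nth F n"
  unfolding halve_def fps_compose_linear by simp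

lemma halve_add: "halve (F + G) = halve F + halve G"
  by (simp add: fps_eq_iff halve_nth algebra_simps)

lemma halve_cmult: "halve (fps_const c * F) = fps_const c * halve F"
  by (simp add: fps_eq_iff halve_nth algebra_simps)

lemma halve_weight: "fact n * (norm (fps_nth (halve F) n))\<^sup>2 = fact n / 2 ^ n * (norm (fps_nth F n))\<^sup>2"
proof -
  have "((1 / sqrt 2) ^ n)\<^sup>2 = (1 / 2 :: real) ^ n" by (simp add: power_divide power_mult[symmetric] mult.commute[of n] power_mult)
  then show ?thesis unfolding halve_nth norm_mult norm_of_real power_mult_distrib power2_abs by (simp add: power_one_over)
qed

lemma ham_eq_mass: "ham F = pi * mass (halve (F * F))"
  unfolding ham_def mass_def halve_weight by (simp add: power2_eq_square)

text \<open>By polarisation a product is a combination of two squares, and for squares this is the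
  convergence of the series of \<open>ham\<close>.\<close>

lemma fock_halve_mult: assumes "fock F" "fock G" shows "fock (halve (F * G))"
proof -
  have sq: "fock (halve (H * H))" if "fock H" for H
    using nn_integral_state4(2)[OF that] unfolding fock_def halve_weight .
  have "F * G = fps_const (1/4) * ((F + G) * (F + G)) + fps_const (-1/4) * ((F + fps_const (-1) * G) * (F + fps_const (-1) * G))"
  proof -
    have "fps_const (1/4) * ((F + G) * (F + G)) + fps_const (-1/4) * ((F - G) * (F - G)) = fps_const (1/4) * ((F + G) * (F + G)) - fps_const (1/4) * ((F - G) * (F - G))"
      by (simp add: fps_const_neg[symmetric] del: fps_const_neg)
    also have "\<dots> = fps_const (1/4) * (4 * (F * G))" by (simp add: algebra_simps)
    also have "\<dots> = (fps_const (1/4) * fps_const 4) * (F * G)" by (simp add: numeral_fps_const)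
    finally show ?thesis unfolding fps_diff_conv[symmetric] by simp
  qed
  then show ?thesis using assms
    by (metis (no_types, lifting) sq halve_add halve_cmult fock_add fock_cmult)
qed

lemma mass_cmult: "fock F \<Longrightarrow> mass (fps_const c * F) = (norm c)\<^sup>2 * mass F"
proof -
  assume F: "fock F"
  have 1: "(\<lambda>n. fact n * (norm (fps_nth (fps_const c * F) n))\<^sup>2) = (\<lambda>n. (norm c)\<^sup>2 * (fact n * (norm (fps_nth F n))\<^sup>2))"
    by (auto simp: norm_mult power_mult_distrib)
  have 2: "(\<Sum>n. (norm c)\<^sup>2 * (fact n * (norm (fps_nth F n))\<^sup>2)) = (norm c)\<^sup>2 * (\<Sum>n. fact n * (norm (fps_nth F n))\<^sup>2)"
    using F unfolding fock_def by (rule suminf_mult)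
  show ?thesis unfolding mass_def 1 2 by (rule mult.left_commute)
qed

lemma ang_cmult: "fock1 F \<Longrightarrow> ang (fps_const c * F) = (norm c)\<^sup>2 * ang F"
  by (simp add: ang_eq_mass_deriv fock1_cmult mass_cmult fock_deriv)

lemma ham_cmult: "fock F \<Longrightarrow> ham (fps_const c * F) = norm c ^ 4 * ham F"
proof -
  assume F: "fock F"
  have "fps_const c * F * (fps_const c * F) = fps_const (c * c) * (F * F)" by (simp add: fps_const_mult[symmetric] mult_ac del: fps_const_mult)
  then show ?thesis unfolding ham_eq_mass
    by (simp only: halve_cmult mass_cmult[OF fock_halve_mult[OF F F]]) (simp add: norm_mult power2_eq_square power4_eq_xxxx)
qed

lemma ang_add:
  assumes "fock1 F" "fock1 G"
  shows "ang (F + fps_const c * G) = ang F + 2 * pi * Re (c * ip (fps_deriv G) (fps_deriv F)) + (norm c)\<^sup>2 * ang G"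
  using assms mass_add[of "fps_deriv F" "fps_deriv G" c] by (simp add: ang_eq_mass_deriv fock1_add fock1_cmult fock_deriv)

lemma ham_add:
  assumes F: "fock F" and D: "fock D"
  defines "A \<equiv> halve (F * F)" and "B \<equiv> halve (F * D)" and "C \<equiv> halve (D * D)"
  shows "ham (F + fps_const (of_real t) * D) = ham F + 4 * pi\<^sup>2 * Re (ip B A) * t
    + (2 * pi\<^sup>2 * Re (ip C A) + 4 * pi * mass B) * t\<^sup>2 + 4 * pi\<^sup>2 * Re (ip C B) * t ^ 3 + ham D * t ^ 4"
proof -
  let ?t = "fps_const (of_real t) :: complex fps"
  have f: "fock A" "fock B" "fock C" unfolding A_def B_def C_def by (intro fock_halve_mult F D)+
  have f2: "fock (fps_const 2 * B)" by (intro fock_cmult f)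
  have "(F + ?t * D) * (F + ?t * D) = F * F + ?t * (fps_const 2 * (F * D) + ?t * (D * D))"
    by (simp add: algebra_simps numeral_fps_const[symmetric])
  then have "halve ((F + ?t * D) * (F + ?t * D)) = A + ?t * (fps_const 2 * B + ?t * C)"
    unfolding A_def B_def C_def by (simp only: halve_add halve_cmult)
  then have "ham (F + ?t * D) = pi * mass (A + ?t * (fps_const 2 * B + ?t * C))" unfolding ham_eq_mass by simp
  also have "mass (A + ?t * (fps_const 2 * B + ?t * C)) = mass A + 2 * pi * Re (of_real t * ip (fps_const 2 * B + ?t * C) A)
     + (norm (complex_of_real t))\<^sup>2 * mass (fps_const 2 * B + ?t * C)"
    by (intro mass_add f f2 fock_add fock_cmult)
  also have "ip (fps_const 2 * B + ?t * C) A = 2 * ip B A + of_real t * ip C A"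
    using f f2 by (simp add: ip_add_left ip_cmult_left fock_cmult)
  also have "mass (fps_const 2 * B + ?t * C) = mass (fps_const 2 * B) + 2 * pi * Re (of_real t * ip C (fps_const 2 * B)) + (norm (complex_of_real t))\<^sup>2 * mass C"
    by (intro mass_add f f2)
  also have "ip C (fps_const 2 * B) = 2 * ip C B" using f by (simp add: ip_cmult_right)
  also have "mass (fps_const 2 * B) = 4 * mass B" using f by (simp add: mass_cmult)
  finally show ?thesis unfolding ham_eq_mass A_def[symmetric] C_def[symmetric]
    by (simp add: power2_eq_square power3_eq_cube power4_eq_xxxx algebra_simps)
qed

lemma polynomial_local_min:
  fixes a1 a2 a3 a4 :: real
  assumes "d > 0" and nn: "\<And>t. \<bar>t\<bar> < d \<Longrightarrow> 0 \<le> a1 * t + a2 * t\<^sup>2 + a3 * t ^ 3 + a4 * t ^ 4"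
  shows "a1 = 0" "a2 \<ge> 0"
proof -
  let ?f = "\<lambda>t. a1 * t + a2 * t\<^sup>2 + a3 * t ^ 3 + a4 * t ^ 4"
  have "(?f has_real_derivative a1) (at 0)" by (auto intro!: derivative_eq_intros)
  then show a1: "a1 = 0" by (rule DERIV_local_min[OF _ assms(1)]) (use nn in auto)
  have "((\<lambda>t. a2 + a3 * t + a4 * t\<^sup>2) \<longlongrightarrow> a2 + a3 * 0 + a4 * 0\<^sup>2) (at 0)" by (intro tendsto_intros)
  moreover have "\<forall>\<^sub>F t in at 0. 0 \<le> a2 + a3 * t + a4 * t\<^sup>2"
  proof -
    have "\<forall>\<^sub>F t in at (0::real). \<bar>t\<bar> < d \<and> t \<noteq> 0" unfolding eventually_at using assms(1) by (intro exI[of _ d]) auto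
    then show ?thesis
    proof eventually_elim
      case (elim t)
      have "a2 * t\<^sup>2 + a3 * t ^ 3 + a4 * t ^ 4 = t\<^sup>2 * (a2 + a3 * t + a4 * t\<^sup>2)"
        by (simp add: power2_eq_square power3_eq_cube power4_eq_xxxx algebra_simps)
      then have "0 \<le> t\<^sup>2 * (a2 + a3 * t + a4 * t\<^sup>2)" using nn[of t] elim a1 by simp
      then show ?case using elim by (simp add: zero_le_mult_iff)
    qed
  qed
  ultimately have "0 \<le> a2 + a3 * 0 + a4 * 0\<^sup>2" by (intro tendsto_lowerbound) auto
  then show "a2 \<ge> 0" by simp
qed

text \<open>\<open>ham\<close> is homogeneous of degree 4, \<open>mass\<close> and
  \<open>ang\<close> of degree 2. Rescaling F + t D to mass one and clearing denominators therefore
  leaves a polynomial inequality in t, free of the constraint.\<close>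

lemma local_ground_perturb:
  assumes "local_ground \<mu> F" and D: "fock1 D"
  shows "\<exists>d>0. \<forall>t. \<bar>t\<bar> < d \<longrightarrow> energy \<mu> F * (mass (F + fps_const (of_real t) * D))\<^sup>2
    \<le> ham (F + fps_const (of_real t) * D) + \<mu> * ang (F + fps_const (of_real t) * D) * mass (F + fps_const (of_real t) * D)"
proof -
  obtain \<delta> where F: "fock1 F" "mass F = 1" and \<delta>: "\<delta> > 0"
    and min: "\<And>G. fock1 G \<Longrightarrow> mass G = 1 \<Longrightarrow> 2 * mass (F - G) + ang (F - G) < \<delta>\<^sup>2 \<Longrightarrow> energy \<mu> F \<le> energy \<mu> G"
    using assms(1) unfolding local_ground_def by blast
  note fF = fock1_imp_fock[OF F(1)] and fD = fock1_imp_fock[OF D]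
  define r where "r = Re (ip D F)"
  define m where "m t = 1 + 2 * pi * r * t + mass D * t\<^sup>2" for t :: real
  have m: "mass (F + fps_const (of_real t) * D) = m t" for t
    unfolding mass_add[OF fF fD] F(2) m_def r_def by (simp add: algebra_simps)
  have m0: "(m \<longlongrightarrow> 1) (at 0)"
  proof -
    have "((\<lambda>t. 1 + 2 * pi * r * t + mass D * t\<^sup>2) \<longlongrightarrow> 1 + 2 * pi * r * 0 + mass D * 0\<^sup>2) (at 0)" by (intro tendsto_intros)
    then show ?thesis unfolding m_def by simp
  qed
  define s where "s t = 1 / sqrt (m t)" for t
  have s0: "(s \<longlongrightarrow> 1) (at 0)"
  proof -
    have "((\<lambda>t. 1 / sqrt (m t)) \<longlongrightarrow> 1 / sqrt 1) (at 0)" by (intro tendsto_intros m0) simp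
    then show ?thesis unfolding s_def by simp
  qed
  define G where "G t = fps_const (of_real (s t)) * (F + fps_const (of_real t) * D)" for t
  have diff: "F - G t = fps_const (of_real (1 - s t)) * F + fps_const (of_real (- (s t * t))) * D" for t
    unfolding G_def by (simp add: fps_eq_iff algebra_simps)
  \<comment> \<open>The squared distance of the rescaled competitor from F, written out so that its
    convergence to 0 is visible.\<close>
  define q where "q t = 2 * ((1 - s t)\<^sup>2 + 2 * pi * Re (of_real (- (s t * t)) * (of_real (1 - s t) * ip D F)) + (s t * t)\<^sup>2 * mass D)
    + ((1 - s t)\<^sup>2 * ang F + 2 * pi * Re (of_real (- (s t * t)) * (of_real (1 - s t) * ip (fps_deriv D) (fps_deriv F))) + (s t * t)\<^sup>2 * ang D)" for t
  have q: "2 * mass (F - G t) + ang (F - G t) = q t" for t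
  proof -
    have "mass (F - G t) = (1 - s t)\<^sup>2 + 2 * pi * Re (of_real (- (s t * t)) * (of_real (1 - s t) * ip D F)) + (s t * t)\<^sup>2 * mass D"
      unfolding diff mass_add[OF fock_cmult[OF fF] fD] ip_cmult_right[OF fF fD] mass_cmult[OF fF] F(2) complex_cnj_complex_of_real norm_of_real power2_abs by simp
    moreover have "ang (F - G t) = (1 - s t)\<^sup>2 * ang F + 2 * pi * Re (of_real (- (s t * t)) * (of_real (1 - s t) * ip (fps_deriv D) (fps_deriv F))) + (s t * t)\<^sup>2 * ang D"
    proof -
      have "fps_deriv (fps_const (of_real (1 - s t)) * F) = fps_const (of_real (1 - s t)) * fps_deriv F" by simp
      then show ?thesis unfolding diff ang_add[OF fock1_cmult[OF F(1)] D] ang_cmult[OF F(1)] norm_of_real power2_abs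
        using ip_cmult_right[of "fps_deriv F" "fps_deriv D"] F(1) D by (simp add: fock_deriv)
    qed
    ultimately show ?thesis unfolding q_def by simp
  qed
  have "((\<lambda>t. 2 * ((1 - s t)\<^sup>2 + 2 * pi * Re (of_real (- (s t * t)) * (of_real (1 - s t) * ip D F)) + (s t * t)\<^sup>2 * mass D)
    + ((1 - s t)\<^sup>2 * ang F + 2 * pi * Re (of_real (- (s t * t)) * (of_real (1 - s t) * ip (fps_deriv D) (fps_deriv F))) + (s t * t)\<^sup>2 * ang D))
    \<longlongrightarrow> 2 * ((1 - 1)\<^sup>2 + 2 * pi * Re (of_real (- (1 * 0)) * (of_real (1 - 1) * ip D F)) + (1 * 0)\<^sup>2 * mass D)
    + ((1 - 1)\<^sup>2 * ang F + 2 * pi * Re (of_real (- (1 * 0)) * (of_real (1 - 1) * ip (fps_deriv D) (fps_deriv F))) + (1 * 0)\<^sup>2 * ang D)) (at 0)"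
    by (intro tendsto_intros s0)
  then have q0: "(q \<longlongrightarrow> 0) (at 0)" unfolding q_def by simp
  have "\<forall>\<^sub>F t in at 0. q t < \<delta>\<^sup>2 \<and> m t > 0"
    using order_tendstoD(2)[OF q0, of "\<delta>\<^sup>2"] order_tendstoD(1)[OF m0, of 0] \<delta> by (simp add: eventually_conj)
  then obtain d where d: "d > 0" "\<And>t. t \<noteq> 0 \<Longrightarrow> \<bar>t\<bar> < d \<Longrightarrow> q t < \<delta>\<^sup>2 \<and> m t > 0" unfolding eventually_at by auto
  have "energy \<mu> F * (m t)\<^sup>2 \<le> ham (F + fps_const (of_real t) * D) + \<mu> * ang (F + fps_const (of_real t) * D) * m t" if t: "\<bar>t\<bar> < d" for t
  proof (cases "t = 0")
    case True then show ?thesis unfolding energy_def m_def by simp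
  next
    case False
    then have qm: "q t < \<delta>\<^sup>2" "m t > 0" using d(2) t by auto
    define H where "H = F + fps_const (of_real t) * D"
    have H: "fock1 H" "fock H" unfolding H_def by (auto intro: fock1_add fock1_cmult F D fock_add fock_cmult fF fD)
    have s2: "(s t)\<^sup>2 = 1 / m t" "s t ^ 4 = 1 / (m t)\<^sup>2"
    proof -
      show 1: "(s t)\<^sup>2 = 1 / m t" unfolding s_def using qm(2) by (simp add: power_divide)
      have "s t ^ 4 = ((s t)\<^sup>2)\<^sup>2" by simp
      then show "s t ^ 4 = 1 / (m t)\<^sup>2" unfolding 1 by (simp add: power_divide)
    qed
    have G: "fock1 (G t)" unfolding G_def H_def[symmetric] by (rule fock1_cmult[OF H(1)])
    have "mass (G t) = 1" unfolding G_def H_def[symmetric] mass_cmult[OF H(2)] norm_of_real power2_abs s2 unfolding H_def m using qm by simp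
    then have "energy \<mu> F \<le> energy \<mu> (G t)" using min[OF G] q qm by simp
    also have "\<dots> = ham H / (m t)\<^sup>2 + \<mu> * (ang H / m t)"
      unfolding energy_def G_def H_def[symmetric] ham_cmult[OF H(2)] ang_cmult[OF H(1)] norm_of_real power2_abs power_even_abs_numeral
      using s2 by simp
    finally have "energy \<mu> F * (m t)\<^sup>2 \<le> (ham H / (m t)\<^sup>2 + \<mu> * (ang H / m t)) * (m t)\<^sup>2" by (intro mult_right_mono) auto
    also have "\<dots> = ham H + \<mu> * ang H * m t" using qm by (simp add: field_simps power2_eq_square)
    finally show ?thesis unfolding H_def .
  qed
  then show ?thesis unfolding m using d(1) by blast
qed

text \<open>The coefficients of t and t^2 in that inequality. Orthogonality of D to F makes the mass
  stationary to first order, which removes the mixed terms from the second one.\<close>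

lemma local_ground_conditions:
  assumes lg: "local_ground \<mu> F" and D: "fock1 D"
  defines "E \<equiv> energy \<mu> F"
  shows "4 * pi\<^sup>2 * Re (ip (halve (F * D)) (halve (F * F))) + 2 * pi * \<mu> * Re (ip (fps_deriv D) (fps_deriv F))
      + 2 * pi * (\<mu> * ang F - 2 * E) * Re (ip D F) = 0"
    and "ip D F = 0 \<Longrightarrow> 0 \<le> 2 * pi\<^sup>2 * Re (ip (halve (D * D)) (halve (F * F))) + 4 * pi * mass (halve (F * D))
      + \<mu> * (ang D + ang F * mass D) - 2 * E * mass D"
proof -
  have F: "fock1 F" "mass F = 1" using lg unfolding local_ground_def by auto
  note fF = fock1_imp_fock[OF F(1)] and fD = fock1_imp_fock[OF D]
  define A B C where "A = halve (F * F)" "B = halve (F * D)" "C = halve (D * D)"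
  define a b u v where "a = Re (ip D F)" "b = Re (ip (fps_deriv D) (fps_deriv F))" "u = mass D" "v = ang D"
  obtain d where d: "d > 0" and le: "\<And>t. \<bar>t\<bar> < d \<Longrightarrow> E * (mass (F + fps_const (of_real t) * D))\<^sup>2
    \<le> ham (F + fps_const (of_real t) * D) + \<mu> * ang (F + fps_const (of_real t) * D) * mass (F + fps_const (of_real t) * D)"
    using local_ground_perturb[OF lg D] unfolding E_def by blast
  define a1 where "a1 = 4 * pi\<^sup>2 * Re (ip B A) + 2 * pi * \<mu> * b + 2 * pi * (\<mu> * ang F - 2 * E) * a"
  define a2 where "a2 = 2 * pi\<^sup>2 * Re (ip C A) + 4 * pi * mass B + \<mu> * (v + ang F * u + 4 * pi\<^sup>2 * a * b) - E * (2 * u + 4 * pi\<^sup>2 * a\<^sup>2)"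
  define a3 where "a3 = 4 * pi\<^sup>2 * Re (ip C B) + \<mu> * (2 * pi * b * u + 2 * pi * a * v) - E * (4 * pi * a * u)"
  define a4 where "a4 = ham D + \<mu> * v * u - E * u\<^sup>2"
  have nn: "0 \<le> a1 * t + a2 * t\<^sup>2 + a3 * t ^ 3 + a4 * t ^ 4" if t: "\<bar>t\<bar> < d" for t
  proof -
    have m: "mass (F + fps_const (of_real t) * D) = 1 + 2 * pi * a * t + u * t\<^sup>2"
      unfolding mass_add[OF fF fD] F(2) a_b_u_v_def by (simp add: algebra_simps)
    have n: "ang (F + fps_const (of_real t) * D) = ang F + 2 * pi * b * t + v * t\<^sup>2"
      unfolding ang_add[OF F(1) D] a_b_u_v_def by (simp add: algebra_simps)
    have h: "ham (F + fps_const (of_real t) * D) = (E - \<mu> * ang F) + 4 * pi\<^sup>2 * Re (ip B A) * t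
    + (2 * pi\<^sup>2 * Re (ip C A) + 4 * pi * mass B) * t\<^sup>2 + 4 * pi\<^sup>2 * Re (ip C B) * t ^ 3 + ham D * t ^ 4"
      unfolding ham_add[OF fF fD] A_B_C_def E_def energy_def by simp
    have "0 \<le> ham (F + fps_const (of_real t) * D) + \<mu> * ang (F + fps_const (of_real t) * D) * mass (F + fps_const (of_real t) * D)
       - E * (mass (F + fps_const (of_real t) * D))\<^sup>2" using le[OF t] by simp
    also have "\<dots> = a1 * t + a2 * t\<^sup>2 + a3 * t ^ 3 + a4 * t ^ 4"
      unfolding h m n a1_def a2_def a3_def a4_def
      by (simp add: power2_eq_square power3_eq_cube power4_eq_xxxx algebra_simps)
    finally show ?thesis .
  qed
  show "4 * pi\<^sup>2 * Re (ip (halve (F * D)) (halve (F * F))) + 2 * pi * \<mu> * Re (ip (fps_deriv D) (fps_deriv F))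
      + 2 * pi * (\<mu> * ang F - 2 * E) * Re (ip D F) = 0"
    using polynomial_local_min(1)[OF d nn] unfolding a1_def A_B_C_def a_b_u_v_def by simp
  show "0 \<le> 2 * pi\<^sup>2 * Re (ip (halve (D * D)) (halve (F * F))) + 4 * pi * mass (halve (F * D))
      + \<mu> * (ang D + ang F * mass D) - 2 * E * mass D" if "ip D F = 0"
    using polynomial_local_min(2)[OF d nn] that unfolding a2_def A_B_C_def a_b_u_v_def by simp
qed

section \<open>Instability of monomials\<close>

lemma ip_finite: "finite A \<Longrightarrow> (\<And>n. n \<notin> A \<Longrightarrow> fps_nth F n = 0) \<Longrightarrow> ip F G = (\<Sum>n\<in>A. fact n * fps_nth F n * cnj (fps_nth G n))"
  unfolding ip_def by (rule suminf_finite) auto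

lemma ip_monomial: "ip (monomial w j) F = fact j * w * cnj (fps_nth F j)"
  by (subst ip_finite[of "{j}"]) (auto simp: monomial_nth)

lemma halve_monomial: "halve (monomial w j) = monomial (of_real ((1 / sqrt 2) ^ j) * w) j"
  by (simp add: fps_eq_iff halve_nth monomial_nth)

lemma mass_halve_monomial: "mass (halve (monomial w j)) = pi * (fact j / 2 ^ j * (norm w)\<^sup>2)"
  unfolding mass_def halve_weight by (subst suminf_finite[of "{j}"]) (auto simp: monomial_nth)

text \<open>The second variation at \<open>z\<^sup>n\<close> in the direction \<open>z\<^sup>j\<close>.\<close>

lemma local_ground_monomial_mode:
  assumes lg: "local_ground \<mu> (monomial a n)" and j: "j \<noteq> n"
  shows "2 * fact (2 * n) / ((fact n)\<^sup>2 * 4 ^ n) + \<mu> * real n \<le> 4 * fact (n + j) / (fact n * fact j * 2 ^ (n + j)) + \<mu> * real j"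
proof -
  let ?F = "monomial a n" and ?D = "monomial 1 j"
  have m: "mass ?F = 1" using lg unfolding local_ground_def by simp
  have na: "(norm a)\<^sup>2 = 1 / (pi * fact n)" using m unfolding mass_monomial by (simp add: field_simps)
  have D: "mass ?D = pi * fact j" "ang ?D = real j * (pi * fact j)" unfolding ang_monomial by (simp_all add: mass_monomial)
  have angF: "ang ?F = real n" unfolding ang_monomial m by simp
  have "ip ?D ?F = 0" using j by (simp add: ip_monomial monomial_nth)
  from local_ground_conditions(2)[OF lg fock1_monomial this]
  have *: "0 \<le> 2 * pi\<^sup>2 * Re (ip (halve (?D * ?D)) (halve (?F * ?F))) + 4 * pi * mass (halve (?F * ?D))
      + \<mu> * (ang ?D + ang ?F * mass ?D) - 2 * energy \<mu> ?F * mass ?D" .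
  have i0: "ip (halve (?D * ?D)) (halve (?F * ?F)) = 0"
    unfolding monomial_mult halve_monomial ip_monomial using j by (simp add: monomial_nth)
  have "4 * pi * mass (halve (?F * ?D)) = pi * fact j * (4 * fact (n + j) / (fact n * fact j * 2 ^ (n + j)))"
    unfolding monomial_mult mass_halve_monomial using na by (simp add: field_simps)
  then have "0 \<le> pi * fact j * (4 * fact (n + j) / (fact n * fact j * 2 ^ (n + j)) + \<mu> * real j + \<mu> * real n - 2 * energy \<mu> ?F)"
    using * unfolding i0 D angF by (simp add: algebra_simps)
  moreover have "x \<ge> 0" if "0 \<le> pi * fact j * x" for x
    using that mult_pos_neg[of "pi * fact j" x] by (rule_tac ccontr) simp
  ultimately have "0 \<le> 4 * fact (n + j) / (fact n * fact j * 2 ^ (n + j)) + \<mu> * real j + \<mu> * real n - 2 * energy \<mu> ?F"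
    by blast
  moreover have "energy \<mu> ?F = fact (2 * n) / ((fact n)\<^sup>2 * 4 ^ n) + \<mu> * real n"
    unfolding energy_def angF ham_normalised_monomial[OF m] ..
  ultimately show ?thesis by simp
qed

text \<open>For \<open>z\<^sup>2\<close> single modes do not suffice; the coupled modes \<open>1\<close> and \<open>z\<^sup>4\<close>, with the phase that makes
  the interaction negative, destabilise it for every \<open>\<mu>\<close>.\<close>

lemma not_local_ground_monomial_2: assumes "\<mu> > 0" shows "\<not> local_ground \<mu> (monomial a 2)"
proof
  let ?F = "monomial a 2"
  assume lg: "local_ground \<mu> ?F"
  have m: "mass ?F = 1" using lg unfolding local_ground_def by simp
  have na: "(norm a)\<^sup>2 = 1 / (2 * pi)" using m unfolding mass_monomial by (simp add: field_simps fact_numeral)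
  then have a0: "a \<noteq> 0" by auto
  \<comment> \<open>The phase for which (a * a) * cnj y is negative, so that the coupling through
    z^4, the square of the base state, lowers the energy.\<close>
  define y where "y = - (a * a) / of_real ((norm a)\<^sup>2)"
  have ny: "norm y = 1" unfolding y_def using a0 by (simp add: norm_divide norm_mult power2_eq_square)
  \<comment> \<open>The two modes weigh 25 and 24 in units of pi. Being placed symmetrically about
    2, with the lower one slightly heavier, they give a negative coefficient to \<mu>; hence a
    contradiction for all \<mu> at once.\<close>
  let ?D = "monomial 5 0 + monomial y 4"
  have Dn: "fps_nth ?D k = (if k = 0 then 5 else if k = 4 then y else 0)" for k by (auto simp: monomial_nth)
  have fD: "fock1 ?D" by (intro fock1_add fock1_monomial)
  have mD: "mass ?D = 49 * pi" unfolding mass_def Dn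
    by (subst suminf_finite[of "{0, 4}"]) (auto simp: ny fact_numeral)
  have aD: "ang ?D = 96 * pi" unfolding ang_def Dn
    by (subst suminf_finite[of "{0, 4}"]) (auto simp: ny fact_numeral)
  have aF: "ang ?F = 2" unfolding ang_monomial m by simp
  have eF: "energy \<mu> ?F = 3/8 + 2 * \<mu>" unfolding energy_def aF ham_normalised_monomial[OF m] by (simp add: fact_numeral)
  have "ip ?D ?F = 0" by (subst ip_finite[of "{0, 4}"]) (auto simp: Dn monomial_nth)
  from local_ground_conditions(2)[OF lg fD this]
  have *: "0 \<le> 2 * pi\<^sup>2 * Re (ip (halve (?D * ?D)) (halve (?F * ?F))) + 4 * pi * mass (halve (?F * ?D))
      + \<mu> * (ang ?D + ang ?F * mass ?D) - 2 * energy \<mu> ?F * mass ?D" .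
  have FD: "?F * ?D = monomial (5 * a) 2 + monomial (a * y) 6" by (simp add: distrib_left monomial_mult mult.commute)
  have mB: "4 * pi * mass (halve (?F * ?D)) = 95/2 * pi"
  proof -
    have "(\<Sum>n. fact n / 2 ^ n * (norm (fps_nth (?F * ?D) n))\<^sup>2) = fact 2 / 2 ^ 2 * (25 * (norm a)\<^sup>2) + fact 6 / 2 ^ 6 * (norm a)\<^sup>2"
      unfolding FD by (subst suminf_finite[of "{2, 6}"]) (auto simp: monomial_nth norm_mult ny power_mult_distrib)
    also have "\<dots> = 95/4 * (norm a)\<^sup>2" by (simp add: fact_numeral)
    finally show ?thesis unfolding mass_def halve_weight na by simp
  qed
  have DD: "?D * ?D = monomial 25 0 + monomial (10 * y) 4 + monomial (y * y) 8"
    by (simp add: fps_eq_iff monomial_mult distrib_left distrib_right monomial_nth)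
  have iC: "Re (ip (halve (?D * ?D)) (halve (?F * ?F))) = - 15 / (2 * pi)"
  proof -
    have s4: "(1 / sqrt 2) ^ 4 = (1/4 :: real)" by (simp add: power_divide power4_eq_xxxx)
    have "ip (halve (?D * ?D)) (halve (?F * ?F)) = cnj (ip (halve (?F * ?F)) (halve (?D * ?D)))"
      by (intro ip_cnj[symmetric] fock_halve_mult fock1_imp_fock fock1_monomial fD)
    also have "ip (halve (?F * ?F)) (halve (?D * ?D)) = fact 4 * (of_real (1/4) * (a * a)) * cnj (of_real (1/4) * (10 * y))"
      unfolding monomial_mult[of a 2 a 2] halve_monomial ip_monomial halve_nth DD by (simp add: monomial_nth s4)
    also have "\<dots> = 15 * ((a * a) * cnj y)" by (simp add: fact_numeral)
    also have "(a * a) * cnj y = - of_real ((norm a)\<^sup>2)"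
    proof -
      have "(a * a) * cnj (a * a) = of_real ((norm a)\<^sup>2) * of_real ((norm a)\<^sup>2)"
        unfolding complex_norm_square by (simp add: mult_ac)
      moreover have "cnj y = - cnj (a * a) / of_real ((norm a)\<^sup>2)" unfolding y_def by simp
      moreover have "complex_of_real ((norm a)\<^sup>2) \<noteq> 0" using a0 by simp
      moreover have "- (N * N / N) = - N" if "N \<noteq> 0" for N :: complex using that by simp
      ultimately show ?thesis by (simp only: times_divide_eq_right mult_minus_right minus_divide_left[symmetric])
    qed
    finally show ?thesis unfolding na by simp
  qed
  have "0 \<le> pi * (- 17/4 - 2 * \<mu>)"
    using * unfolding iC mB mD aD aF eF by (simp add: power2_eq_square algebra_simps)
  moreover have "pi * (- 17/4 - 2 * \<mu>) < 0" using assms by (intro mult_pos_neg) auto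
  ultimately show False by simp
qed

text \<open>That is, the central binomial coefficient dominates 2^(n + 1). It holds at n = 3 as 20
  >= 16 but fails at n = 2, where 6 < 8, which is why z^2 is treated separately.\<close>

lemma central_binomial_ge: "n \<ge> 3 \<Longrightarrow> (2::real) ^ Suc n * (fact n)\<^sup>2 \<le> fact (2 * n)"
proof (induction n rule: nat_induct_at_least)
  case base show ?case by (simp add: fact_numeral)
next
  case (Suc n)
  have "(2::real) ^ Suc (Suc n) * (fact (Suc n))\<^sup>2 = 2 * (real (Suc n))\<^sup>2 * (2 ^ Suc n * (fact n)\<^sup>2)"
    by (simp add: power2_eq_square)
  also have "\<dots> \<le> 2 * (real (Suc n))\<^sup>2 * fact (2 * n)" using Suc.IH by (intro mult_left_mono) auto
  also have "\<dots> \<le> (real (2 * n + 2) * real (2 * n + 1)) * fact (2 * n)"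
    by (intro mult_right_mono) (auto simp: power2_eq_square algebra_simps)
  also have "\<dots> = fact (2 * Suc n)" by (simp add: algebra_simps)
  finally show ?case .
qed

lemma not_local_ground_monomial:
  assumes mu: "\<mu> > 0" "\<mu> < 1/2" and lg: "local_ground \<mu> (monomial a n)"
  shows "n = 1" "5/32 \<le> \<mu>"
proof -
  have n0: "n \<noteq> 0"
  proof
    assume "n = 0"
    \<comment> \<open>Against z^2, stability of the constant would require 2 <= 1 + 2 \<mu>.\<close>
    then show False using local_ground_monomial_mode[of \<mu> a n 2] lg mu by (simp add: fact_numeral)
  qed
  have n2: "n \<noteq> 2" using not_local_ground_monomial_2[OF mu(1)] lg by blast
  have n3: "\<not> n \<ge> 3"
  proof
    assume n: "n \<ge> 3"
    have "2 * fact (2 * n) / ((fact n)\<^sup>2 * 4 ^ n) + \<mu> * real n \<le> 4 / 2 ^ n"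
      using local_ground_monomial_mode[OF lg, of 0] n by simp
    moreover have "4 / 2 ^ n \<le> 2 * fact (2 * n) / ((fact n)\<^sup>2 * (4::real) ^ n)"
    proof -
      have four: "(4::real) ^ n = 2 ^ n * 2 ^ n" unfolding power_mult_distrib[symmetric] by simp
      have "4 / 2 ^ n = 2 * (2 ^ Suc n * (fact n)\<^sup>2) / ((fact n)\<^sup>2 * (4::real) ^ n)" unfolding four by simp
      also have "\<dots> \<le> 2 * fact (2 * n) / ((fact n)\<^sup>2 * (4::real) ^ n)"
        using central_binomial_ge[OF n] by (intro divide_right_mono mult_left_mono) auto
      finally show ?thesis .
    qed
    moreover have "\<mu> * real n > 0" using mu n by simp
    ultimately show False by linarith
  qed
  show n1: "n = 1" using n0 n2 n3 by linarith
  \<comment> \<open>Against z^5 the condition reads 1 + \<mu> <= 3/8 + 5 \<mu>, which is the origin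
    of 5/32.\<close>
  have "2 * fact (2 * n) / ((fact n)\<^sup>2 * 4 ^ n) + \<mu> * real n \<le> 4 * fact (n + 5) / (fact n * fact 5 * 2 ^ (n + 5)) + \<mu> * real 5"
    by (rule local_ground_monomial_mode[OF lg]) (simp add: n1)
  then show "5/32 \<le> \<mu>" unfolding n1 by (simp add: fact_numeral)
qed

section \<open>The Euler-Lagrange equation for Gaussian times polynomial\<close>

text \<open>This is f(z/2)^2, the result of moving one of the two halvings across the inner product.
  Its pairing with f is, up to a constant, the holomorphic projection of |u|^2 u.\<close>

definition squarehalf :: "complex fps \<Rightarrow> complex fps" where
  "squarehalf F = fps_compose (F * F) (fps_const (1/2) * fps_X)"

lemma halve_halve: "halve (halve (F * F)) = squarehalf F"
proof (rule fps_ext)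
  fix n
  have "complex_of_real ((1 / sqrt 2) ^ n) * of_real ((1 / sqrt 2) ^ n) = (1/2) ^ n"
    unfolding of_real_mult[symmetric] power_mult_distrib[symmetric] by simp
  then show "fps_nth (halve (halve (F * F))) n = fps_nth (squarehalf F) n"
    unfolding squarehalf_def fps_compose_linear halve_nth mult.assoc[symmetric] by simp
qed

lemma ip_halve:
  assumes "fock (halve p)" "fock (halve q)"
  shows "ip (halve p) (halve q) = cnj (ip (halve (halve q)) p)"
proof -
  have "(\<lambda>n. fact n * fps_nth (halve p) n * cnj (fps_nth (halve q) n)) sums ip (halve p) (halve q)"
    unfolding ip_def by (rule summable_sums[OF ip_summable[OF assms]])
  then have "(\<lambda>n. cnj (fact n * fps_nth (halve p) n * cnj (fps_nth (halve q) n))) sums cnj (ip (halve p) (halve q))"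
    unfolding sums_cnj .
  moreover have "cnj (fact n * fps_nth (halve p) n * cnj (fps_nth (halve q) n)) = fact n * fps_nth (halve (halve q)) n * cnj (fps_nth p n)" for n
    unfolding halve_nth by (simp add: mult_ac)
  ultimately have "(\<lambda>n. fact n * fps_nth (halve (halve q)) n * cnj (fps_nth p n)) sums cnj (ip (halve p) (halve q))" by (simp only:)
  then have "cnj (ip (halve p) (halve q)) = ip (halve (halve q)) p" unfolding ip_def[of "halve (halve q)"] by (rule sums_unique)
  then show ?thesis by (metis complex_cnj_cnj)
qed

lemma Re_of_real_mult: "Re (of_real r * z) = r * Re z"
  by simp

text \<open>The first variation is tested on monomials, which gives the equation coefficient by
  coefficient; the multiplier 2 E - \<mu> P comes from the normalisation of the competitors.\<close>

lemma euler_lagrange: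
  assumes lg: "local_ground \<mu> F" and dec: "decay F" "decay (squarehalf F)"
  shows "\<exists>lam::real. fps_const (of_real (2 * pi)) * pairing F (squarehalf F) = fps_const (of_real lam) * F - fps_const (of_real \<mu>) * (fps_X * fps_deriv F)"
proof -
  define lam where "lam = 2 * energy \<mu> F - \<mu> * ang F"
  define g where "g = squarehalf F"
  note fF = decay_fock[OF dec(1)]
  have XF: "fps_nth (fps_X * fps_deriv F) j = of_nat j * fps_nth F j" for j by (cases j) auto
  have "of_real (2 * pi) * ip g (fps_X ^ j * F) + of_real (\<mu> * real j - lam) * (fact j * fps_nth F j) = 0" (is "?Z = 0") for j
  proof -
    \<comment> \<open>The residual itself serves as the amplitude of the test direction, so the
      first variation becomes a positive multiple of |Z|^2 and must vanish.\<close>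
    define Z where "Z = ?Z"
    define D where "D = monomial Z j"
    have FD: "F * D = fps_const Z * (fps_X ^ j * F)" unfolding D_def monomial_def by (simp add: mult_ac)
    have "ip (halve (F * D)) (halve (F * F)) = cnj (ip g (F * D))"
      unfolding g_def halve_halve[symmetric] D_def by (intro ip_halve fock_halve_mult fF fock1_imp_fock fock1_monomial)
    also have "ip g (F * D) = cnj Z * ip g (fps_X ^ j * F)" unfolding FD g_def
      by (intro ip_cmult_right decay_fock decay_X_power_mult dec)
    finally have 1: "ip (halve (F * D)) (halve (F * F)) = Z * cnj (ip g (fps_X ^ j * F))" by simp
    have "ip (fps_deriv D) (fps_deriv F) = ip D (fps_X * fps_deriv F)"
      unfolding D_def by (intro ip_X_right[symmetric] decay_fock1 decay_deriv dec fock1_monomial)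
    then have 2: "ip (fps_deriv D) (fps_deriv F) = Z * cnj (of_real (real j) * (fact j * fps_nth F j))" unfolding D_def ip_monomial XF by (simp add: mult_ac)
    have 3: "ip D F = Z * cnj (fact j * fps_nth F j)" unfolding D_def ip_monomial by (simp add: mult_ac)
    have "4 * pi\<^sup>2 * Re (Z * cnj (ip g (fps_X ^ j * F))) + 2 * pi * \<mu> * Re (Z * cnj (of_real (real j) * (fact j * fps_nth F j)))
      + 2 * pi * (\<mu> * ang F - 2 * energy \<mu> F) * Re (Z * cnj (fact j * fps_nth F j)) = 0"
      using local_ground_conditions(1)[OF lg, of D] unfolding D_def using fock1_monomial 1[unfolded D_def] 2[unfolded D_def] 3[unfolded D_def] by simp
    moreover have "2 * pi * Re (Z * cnj Z) = 4 * pi\<^sup>2 * Re (Z * cnj (ip g (fps_X ^ j * F))) + 2 * pi * \<mu> * Re (Z * cnj (of_real (real j) * (fact j * fps_nth F j)))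
      + 2 * pi * (\<mu> * ang F - 2 * energy \<mu> F) * Re (Z * cnj (fact j * fps_nth F j))"
    proof -
      define I f where "I = ip g (fps_X ^ j * F)" "f = fact j * fps_nth F j"
      have "cnj Z = of_real (2 * pi) * cnj I + of_real (\<mu> * real j - lam) * cnj f"
        unfolding Z_def I_f_def by simp
      then have "Z * cnj Z = of_real (2 * pi) * (Z * cnj I) + of_real (\<mu> * real j - lam) * (Z * cnj f)"
        by (simp only: distrib_left mult_ac)
      then have eq: "Re (Z * cnj Z) = 2 * pi * Re (Z * cnj I) + (\<mu> * real j - lam) * Re (Z * cnj f)"
        by (simp only: plus_complex.sel Re_of_real_mult)
      have jf: "Re (Z * cnj (of_real (real j) * f)) = real j * Re (Z * cnj f)"
      proof -
        have "Z * cnj (of_real (real j) * f) = of_real (real j) * (Z * cnj f)" by (simp add: mult_ac)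
        then show ?thesis by (simp only: Re_of_real_mult)
      qed
      have "2 * pi * x = 4 * pi\<^sup>2 * a + 2 * pi * \<mu> * (j' * b) + 2 * pi * (m - 2 * E) * b"
        if "x = 2 * pi * a + (\<mu> * j' - (2 * E - m)) * b" for x a b j' m E
        unfolding that by (simp add: power2_eq_square algebra_simps)
      from this[OF eq[unfolded lam_def]] show ?thesis unfolding I_f_def[symmetric] jf .
    qed
    ultimately have "Re (Z * cnj Z) = 0" by simp
    then have "Z = 0" unfolding complex_norm_square[symmetric] Re_complex_of_real by simp
    then show ?thesis unfolding Z_def .
  qed
  then have *: "of_real (2 * pi) * ip g (fps_X ^ j * F) = of_real (lam - \<mu> * real j) * (fact j * fps_nth F j)" for j
    by (simp add: algebra_simps add_eq_0_iff2)
  have "fps_const (of_real (2 * pi)) * pairing F g = fps_const (of_real lam) * F - fps_const (of_real \<mu>) * (fps_X * fps_deriv F)"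
  proof (rule fps_ext)
    fix j
    have "fps_nth (fps_const (of_real (2 * pi)) * pairing F g) j = of_real (2 * pi) * ip g (fps_X ^ j * F) / fact j"
      unfolding pairing_def by simp
    also have "\<dots> = of_real (lam - \<mu> * real j) * fps_nth F j" unfolding * by simp
    finally show "fps_nth (fps_const (of_real (2 * pi)) * pairing F g) j = fps_nth (fps_const (of_real lam) * F - fps_const (of_real \<mu>) * (fps_X * fps_deriv F)) j"
      unfolding fps_sub_nth fps_mult_left_const_nth XF by (simp add: algebra_simps)
  qed
  then show ?thesis unfolding g_def by blast
qed

section \<open>Pairing polynomials times Gaussians\<close>

lemma fps_of_poly_deriv_mult:
  assumes "fps_deriv y = fps_of_poly l * y"
  shows "fps_deriv (fps_of_poly r * y) = fps_of_poly (pderiv r + r * l) * y"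
  using assms by (simp add: fps_of_poly_add fps_of_poly_mult fps_of_poly_pderiv algebra_simps)

lemma fps_of_poly_linear_mult:
  fixes y :: "complex fps" shows "fps_of_poly [:a, b:] * y = fps_const a * y + fps_const b * (fps_X * y)"
  by (simp add: fps_of_poly_pCons algebra_simps)

lemma fps_of_poly_affine_mult:
  fixes y :: "complex fps" shows
  "fps_of_poly (pcompose (pCons a q) [:t, 1:]) * y = fps_const a * y + (fps_X * (fps_of_poly (pcompose q [:t, 1:]) * y) + fps_const t * (fps_of_poly (pcompose q [:t, 1:]) * y))"
  by (simp add: pcompose_pCons fps_of_poly_add fps_of_poly_mult fps_of_poly_pCons fps_of_poly_smult algebra_simps)

text \<open>The key to excluding squeezed profiles: pairing Gaussians multiplies the quadratic exponent
  \<open>\<beta>\<close> by \<open>1 / (2 * (1 - 2 * \<beta> * cnj \<beta>))\<close>, and no \<open>\<beta> \<noteq> 0\<close> with modulus below \<open>1/2\<close> is a fixed point.\<close>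

lemma pairing_gauss:
  fixes e e2 :: "complex fps"
  assumes e: "fps_deriv e = fps_of_poly [:\<alpha>, 2 * \<beta>:] * e" and e2: "fps_deriv e2 = fps_of_poly [:\<alpha>, \<beta>:] * e2"
    and dec: "decay e" "decay e2" and \<beta>: "norm \<beta> < 1/2"
  defines "\<kappa> \<equiv> 1 - 2 * (\<beta> * cnj \<beta>)"
  shows "fps_deriv (pairing e e2) = fps_of_poly [:(\<alpha> + \<beta> * cnj \<alpha>) / \<kappa>, \<beta> / \<kappa>:] * pairing e e2"
    and "\<exists>r. pairing (fps_of_poly p * e) (fps_of_poly q * e2) = fps_of_poly r * pairing e e2"
proof -
  define Y where "Y = pairing e e2"
  have e': "fps_deriv e = fps_const \<alpha> * e + fps_const (2 * \<beta>) * (fps_X * e)"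
    unfolding e by (simp add: fps_of_poly_pCons algebra_simps)
  have e2': "fps_deriv e2 = fps_const \<alpha> * e2 + fps_const \<beta> * (fps_X * e2)"
    unfolding e2 by (simp add: fps_of_poly_pCons algebra_simps)
  \<comment> \<open>The commutator term involves the derivative of \<open>e\<close>, which its
    differential equation expresses by \<open>e\<close> and z \<open>e\<close>; on the left, z
    becomes d/dz. So multiplication by z on the right closes up into a first-order operator on the
    pairing.\<close>
  have Xstep: "pairing e (fps_X * k) = fps_X * pairing e k + fps_const (cnj \<alpha>) * pairing e k + fps_const (2 * cnj \<beta>) * fps_deriv (pairing e k)"
    if "decay k" for k
    using that dec(1) unfolding pairing_X_right[OF dec(1) that] e'
    by (simp add: pairing_add_left pairing_cmult_left decay_cmult decay_X_mult pairing_X_left add.assoc)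
  have k0: "\<kappa> \<noteq> 0"
  proof
    assume "\<kappa> = 0"
    then have "of_real (2 * (norm \<beta>)\<^sup>2) = (1::complex)" unfolding \<kappa>_def complex_norm_square[symmetric] by simp
    then have "2 * (norm \<beta>)\<^sup>2 = 1" using of_real_eq_iff[where 'a = complex, of "2 * (norm \<beta>)\<^sup>2" 1] by simp
    moreover have "(norm \<beta>)\<^sup>2 < (1/2)\<^sup>2" using \<beta> by (intro power_strict_mono) auto
    ultimately show False by (simp add: power2_eq_square)
  qed
  have "fps_deriv Y = pairing e (fps_deriv e2)" unfolding Y_def using dec by (simp add: pairing_deriv_right)
  also have "\<dots> = fps_const \<alpha> * Y + fps_const \<beta> * pairing e (fps_X * e2)"
    unfolding e2' Y_def using dec by (simp add: pairing_add_right pairing_cmult_right decay_cmult decay_X_mult)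
  also have "\<dots> = fps_const \<alpha> * Y + fps_const \<beta> * (fps_X * Y + fps_const (cnj \<alpha>) * Y + fps_const (2 * cnj \<beta>) * fps_deriv Y)"
    unfolding Xstep[OF dec(2)] Y_def ..
  finally have "fps_const \<kappa> * fps_deriv Y = fps_const (\<alpha> + \<beta> * cnj \<alpha>) * Y + fps_const \<beta> * (fps_X * Y)"
  proof -
    assume h: "fps_deriv Y = fps_const \<alpha> * Y + fps_const \<beta> * (fps_X * Y + fps_const (cnj \<alpha>) * Y + fps_const (2 * cnj \<beta>) * fps_deriv Y)"
    have "fps_const \<kappa> * fps_deriv Y = fps_deriv Y - fps_const (2 * (\<beta> * cnj \<beta>)) * fps_deriv Y"
      unfolding \<kappa>_def fps_const_sub[symmetric] by (simp add: left_diff_distrib)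
    also have "fps_const (2 * (\<beta> * cnj \<beta>)) = fps_const \<beta> * fps_const (2 * cnj \<beta>)" by (simp add: mult_ac)
    finally have "fps_const \<kappa> * fps_deriv Y + fps_const \<beta> * fps_const (2 * cnj \<beta>) * fps_deriv Y = fps_deriv Y" by simp
    also note h
    finally show ?thesis unfolding fps_const_add[symmetric] fps_const_mult[symmetric] by (simp only: distrib_left distrib_right mult.assoc add.assoc add_left_cancel add_right_cancel)
      (simp add: algebra_simps)
  qed
  then have "fps_const (1 / \<kappa>) * (fps_const \<kappa> * fps_deriv Y) = fps_const (1 / \<kappa>) * (fps_const (\<alpha> + \<beta> * cnj \<alpha>) * Y + fps_const \<beta> * (fps_X * Y))"
    by simp
  then have Y': "fps_deriv Y = fps_const ((\<alpha> + \<beta> * cnj \<alpha>) / \<kappa>) * Y + fps_const (\<beta> / \<kappa>) * (fps_X * Y)"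
    using k0 by (simp add: mult.assoc[symmetric] distrib_left add_divide_distrib)
  then have ode: "fps_deriv Y = fps_of_poly [:(\<alpha> + \<beta> * cnj \<alpha>) / \<kappa>, \<beta> / \<kappa>:] * Y"
    unfolding fps_of_poly_linear_mult .
  then show "fps_deriv (pairing e e2) = fps_of_poly [:(\<alpha> + \<beta> * cnj \<alpha>) / \<kappa>, \<beta> / \<kappa>:] * pairing e e2" unfolding Y_def .
  define l where "l = [:(\<alpha> + \<beta> * cnj \<alpha>) / \<kappa>, \<beta> / \<kappa>:]"
  have d: "fps_deriv (fps_of_poly r * Y) = fps_of_poly (pderiv r + r * l) * Y" for r
    by (rule fps_of_poly_deriv_mult) (use ode l_def in simp)
  have "\<exists>r. pairing e (fps_of_poly q * e2) = fps_of_poly r * Y"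
  proof (induction q)
    case 0
    have "pairing e (fps_of_poly 0 * e2) = fps_of_poly 0 * Y" by (simp add: pairing_def ip_def fps_eq_iff)
    then show ?case by blast
  next
    case (pCons a q)
    then obtain r where r: "pairing e (fps_of_poly q * e2) = fps_of_poly r * Y" by blast
    have "fps_of_poly (pCons a q) * e2 = fps_const a * e2 + fps_X * (fps_of_poly q * e2)"
      by (simp add: fps_of_poly_pCons algebra_simps)
    then have "pairing e (fps_of_poly (pCons a q) * e2) = fps_const a * Y + (fps_X * (fps_of_poly r * Y) + fps_const (cnj \<alpha>) * (fps_of_poly r * Y) + fps_const (2 * cnj \<beta>) * (fps_of_poly (pderiv r + r * l) * Y))"
      using dec unfolding Y_def[symmetric] by (simp only: pairing_add_right pairing_cmult_right decay_cmult decay_X_mult decay_poly Xstep r d) (simp only: Y_def)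
    also have "\<dots> = fps_of_poly ([:a:] + [:0, 1:] * r + [:cnj \<alpha>:] * r + [:2 * cnj \<beta>:] * (pderiv r + r * l)) * Y"
      by (simp only: fps_of_poly_add fps_of_poly_mult fps_of_poly_const fps_of_poly_fps_X fps_of_poly_pCons fps_of_poly_0 mult_zero_right mult_1_right add_0_left add_0_right fps_const_0_eq_0 fps_const_1_eq_1) (simp only: distrib_left distrib_right mult.assoc add.assoc mult_1_left mult_1_right fps_const_0_eq_0 mult_zero_left mult_zero_right add_0_left add_0_right)
    finally show ?case by blast
  qed
  then obtain r0 where r0: "pairing e (fps_of_poly q * e2) = fps_of_poly r0 * Y" by blast
  have "\<exists>r. pairing (fps_of_poly p * e) (fps_of_poly q * e2) = fps_of_poly r * Y"
  proof (induction p)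
    case 0
    have "pairing (fps_of_poly 0 * e) (fps_of_poly q * e2) = fps_of_poly 0 * Y" by (simp add: pairing_def ip_def fps_eq_iff)
    then show ?case by blast
  next
    case (pCons a p)
    then obtain r where r: "pairing (fps_of_poly p * e) (fps_of_poly q * e2) = fps_of_poly r * Y" by blast
    have "fps_of_poly (pCons a p) * e = fps_const a * e + fps_X * (fps_of_poly p * e)"
      by (simp add: fps_of_poly_pCons algebra_simps)
    then have "pairing (fps_of_poly (pCons a p) * e) (fps_of_poly q * e2) = fps_const (cnj a) * (fps_of_poly r0 * Y) + fps_of_poly (pderiv r + r * l) * Y"
      using dec by (simp only: pairing_add_left pairing_cmult_left decay_cmult decay_X_mult decay_poly pairing_X_left r r0 d)
    also have "\<dots> = fps_of_poly ([:cnj a:] * r0 + (pderiv r + r * l)) * Y"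
      by (simp only: fps_of_poly_add fps_of_poly_mult fps_of_poly_const distrib_right mult.assoc)
    finally show ?case by blast
  qed
  then show "\<exists>r. pairing (fps_of_poly p * e) (fps_of_poly q * e2) = fps_of_poly r * pairing e e2" unfolding Y_def .
qed

text \<open>Comparing logarithmic derivatives, l1 - l2 = R'/R - r'/r. The left side is a polynomial
  while the right side vanishes at infinity, so both are 0; in the proof denominators are cleared
  and degrees compared.\<close>

lemma gauss_exponent_unique:
  fixes y e :: "complex fps"
  assumes y: "fps_deriv y = fps_of_poly l1 * y" and e: "fps_deriv e = fps_of_poly l2 * e"
    and eq: "fps_of_poly r * y = fps_of_poly R * e" and nz: "r \<noteq> 0" "R \<noteq> 0" "e \<noteq> 0"
  shows "l1 = l2"
proof -
  have "fps_of_poly (pderiv r + r * l1) * y = fps_of_poly (pderiv R + R * l2) * e"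
    using arg_cong[OF eq, of fps_deriv] unfolding fps_of_poly_deriv_mult[OF y] fps_of_poly_deriv_mult[OF e] .
  then have "fps_of_poly r * (fps_of_poly (pderiv r + r * l1) * y) = fps_of_poly r * (fps_of_poly (pderiv R + R * l2) * e)" by simp
  then have "fps_of_poly (pderiv r + r * l1) * (fps_of_poly R * e) = fps_of_poly (r * (pderiv R + R * l2)) * e"
    unfolding eq[symmetric] by (simp add: fps_of_poly_mult mult_ac)
  then have "fps_of_poly ((pderiv r + r * l1) * R) * e = fps_of_poly (r * (pderiv R + R * l2)) * e"
    by (simp add: fps_of_poly_mult mult_ac)
  then have "(pderiv r + r * l1) * R = r * (pderiv R + R * l2)" using nz(3) by (simp add: fps_of_poly_eq_iff)
  then have *: "(r * R) * (l1 - l2) = r * pderiv R - pderiv r * R" by (simp add: algebra_simps)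
  show ?thesis
  proof (rule ccontr)
    assume "l1 \<noteq> l2"
    then have ne: "(r * R) * (l1 - l2) \<noteq> 0" using nz by simp
    have dg: "degree ((r * R) * (l1 - l2)) \<ge> degree r + degree R"
      using nz \<open>l1 \<noteq> l2\<close> by (simp add: degree_mult_eq)
    have "degree (r * pderiv R - pderiv r * R) < degree r + degree R \<or> r * pderiv R - pderiv r * R = 0"
    proof (cases "degree r = 0 \<and> degree R = 0")
      case True
      then have "pderiv r = 0" "pderiv R = 0" by (simp_all add: pderiv_eq_0_iff)
      then show ?thesis by simp
    next
      case False
      have "degree (r * pderiv R) < degree r + degree R \<or> r * pderiv R = 0"
        using degree_mult_le[of r "pderiv R"] by (cases "degree R = 0") (auto simp: degree_pderiv pderiv_eq_0_iff)
      moreover have "degree (pderiv r * R) < degree r + degree R \<or> pderiv r * R = 0"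
        using degree_mult_le[of "pderiv r" R] by (cases "degree r = 0") (auto simp: degree_pderiv pderiv_eq_0_iff)
      ultimately show ?thesis using degree_diff_le_max[of "r * pderiv R" "pderiv r * R"] False by (auto simp: max_def split: if_splits)
    qed
    then show False using * ne dg by auto
  qed
qed

text \<open>For \<beta> different from 0 the equation reads 1 = 2 (1 - 2 |\<beta>|^2), that is
  |\<beta>| = 1/2: precisely the borderline of the Fock space.\<close>

lemma poly_fixed_exponent:
  fixes \<beta> :: complex
  assumes "norm \<beta> < 1/2" "\<beta> / (1 - 2 * (\<beta> * cnj \<beta>)) = 2 * \<beta>"
  shows "\<beta> = 0"
proof (rule ccontr)
  assume b: "\<beta> \<noteq> 0"
  define k where "k = 1 - 2 * (\<beta> * cnj \<beta>)"
  have "k \<noteq> 0" using assms(2) b unfolding k_def by auto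
  then have "\<beta> = 2 * \<beta> * k" using assms(2) unfolding k_def[symmetric] by (simp add: field_simps)
  then have "\<beta> * 1 = \<beta> * (2 * k)" by (simp add: mult_ac)
  then have "2 * k = 1" using b mult_cancel_left[of \<beta> 1 "2 * k"] by simp
  then have "4 * (\<beta> * cnj \<beta>) = 1" unfolding k_def by (simp add: algebra_simps)
  then have "complex_of_real (4 * (norm \<beta>)\<^sup>2) = of_real 1" unfolding of_real_mult complex_norm_square by simp
  then have "4 * (norm \<beta>)\<^sup>2 = 1" by (simp only: of_real_eq_iff)
  moreover have "(norm \<beta>)\<^sup>2 < (1/2)\<^sup>2" using assms(1) by (intro power_strict_mono) auto
  ultimately show False by (simp add: power2_eq_square)
qed

text \<open>Pairing with exp (\<alpha> z) is translation by cnj \<alpha>, which explains the offset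
  2 cnj \<alpha> before and cnj \<alpha> after. A left factor z - cnj \<alpha> acts as d/dz -
  \<alpha>, which on multiples of exp (\<alpha> z) differentiates only the polynomial; so r is the
  conjugate of p, as a differential operator, applied to q. The bound N is free because the degree
  changes during the induction.\<close>

lemma pairing_exp:
  fixes \<alpha> :: complex
  defines "e \<equiv> fps_exp \<alpha>" and "s \<equiv> [:- cnj \<alpha>, 1:]" and "s2 \<equiv> [:- 2 * cnj \<alpha>, 1:]" and "Y \<equiv> pairing (fps_exp \<alpha>) (fps_exp \<alpha>)"
  shows "fps_deriv Y = fps_const \<alpha> * Y"
    and "\<exists>r. pairing (fps_of_poly (pcompose p s) * e) (fps_of_poly (pcompose q s2) * e) = fps_of_poly (pcompose r s) * Y \<and>
      (\<forall>N\<ge>degree p. \<forall>j. coeff r j = (\<Sum>i\<le>N. cnj (coeff p i) * (fact (i + j) / fact j) * coeff q (i + j)))"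
proof -
  have dec: "decay e" unfolding e_def by (rule decay_exp)
  have e': "fps_deriv e = fps_const \<alpha> * e" unfolding e_def by simp
  have Y: "Y = pairing e e" unfolding Y_def e_def ..
  show Y': "fps_deriv Y = fps_const \<alpha> * Y"
    unfolding Y using pairing_deriv_right[OF dec dec] dec by (simp add: e' pairing_cmult_right)
  have Xstep: "pairing e (fps_X * k) = fps_X * pairing e k + fps_const (cnj \<alpha>) * pairing e k" if "decay k" for k
    using that dec unfolding pairing_X_right[OF dec that] e' by (simp add: pairing_cmult_left)
  have d: "fps_deriv (fps_of_poly r * Y) = fps_of_poly (pderiv r) * Y + fps_const \<alpha> * (fps_of_poly r * Y)" for r
    by (simp add: fps_of_poly_pderiv Y' algebra_simps)
  have q: "pairing e (fps_of_poly (pcompose q s2) * e) = fps_of_poly (pcompose q s) * Y"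
  proof (induction q)
    case 0 show ?case by (simp add: pairing_def ip_def fps_eq_iff)
  next
    case (pCons a q)
    define k where "k = fps_of_poly (pcompose q s2) * e"
    have dk: "decay k" unfolding k_def by (rule decay_poly[OF dec])
    have "fps_of_poly (pcompose (pCons a q) s2) * e = fps_const a * e + (fps_X * k + fps_const (- 2 * cnj \<alpha>) * k)"
      unfolding k_def s2_def by (rule fps_of_poly_affine_mult)
    then have "pairing e (fps_of_poly (pcompose (pCons a q) s2) * e)
       = fps_const a * Y + (fps_X * pairing e k + fps_const (cnj \<alpha>) * pairing e k + fps_const (- 2 * cnj \<alpha>) * pairing e k)"
      using dec dk unfolding Y by (simp only: pairing_add_right pairing_cmult_right decay_add decay_cmult decay_X_mult Xstep)
    also have "\<dots> = fps_const a * Y + (fps_X * pairing e k + fps_const (- cnj \<alpha>) * pairing e k)"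
    proof -
      have "fps_const (cnj \<alpha>) * pairing e k + fps_const (- 2 * cnj \<alpha>) * pairing e k = fps_const (- cnj \<alpha>) * pairing e k"
        unfolding distrib_right[symmetric] fps_const_add by simp
      then show ?thesis by (simp only: add.assoc)
    qed
    also have "\<dots> = fps_of_poly (pcompose (pCons a q) s) * Y"
      unfolding k_def pCons s_def by (rule fps_of_poly_affine_mult[symmetric])
    finally show ?case .
  qed
  define g where "g = fps_of_poly (pcompose q s2) * e"
  have dg: "decay g" unfolding g_def by (rule decay_poly[OF dec])
  have "\<exists>r. pairing (fps_of_poly (pcompose p s) * e) g = fps_of_poly (pcompose r s) * Y \<and>
      (\<forall>N\<ge>degree p. \<forall>j. coeff r j = (\<Sum>i\<le>N. cnj (coeff p i) * (fact (i + j) / fact j) * coeff q (i + j)))"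
  proof (induction p)
    case 0
    have "pairing (fps_of_poly (pcompose 0 s) * e) g = fps_of_poly (pcompose 0 s) * Y" by (simp add: pairing_def ip_def fps_eq_iff)
    moreover have "\<forall>N\<ge>degree (0 :: complex poly). \<forall>j. coeff (0 :: complex poly) j = (\<Sum>i\<le>N. cnj (coeff 0 i) * (fact (i + j) / fact j) * coeff q (i + j))" by simp
    ultimately show ?case by blast
  next
    case (pCons a p)
    then obtain r where r: "pairing (fps_of_poly (pcompose p s) * e) g = fps_of_poly (pcompose r s) * Y"
      and c: "\<And>N j. N \<ge> degree p \<Longrightarrow> coeff r j = (\<Sum>i\<le>N. cnj (coeff p i) * (fact (i + j) / fact j) * coeff q (i + j))" by blast
    define h where "h = fps_of_poly (pcompose p s) * e"
    have dh: "decay h" unfolding h_def by (rule decay_poly[OF dec])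
    have "fps_of_poly (pcompose (pCons a p) s) * e = fps_const a * e + (fps_X * h + fps_const (- cnj \<alpha>) * h)"
      unfolding h_def s_def by (rule fps_of_poly_affine_mult)
    then have "pairing (fps_of_poly (pcompose (pCons a p) s) * e) g
       = fps_const (cnj a) * pairing e g + (fps_deriv (pairing h g) + fps_const (cnj (- cnj \<alpha>)) * pairing h g)"
      using dec dh dg by (simp only: pairing_add_left pairing_cmult_left decay_add decay_cmult decay_X_mult pairing_X_left)
    also have "pairing e g = fps_of_poly (pcompose q s) * Y" unfolding g_def by (rule q)
    also have "pairing h g = fps_of_poly (pcompose r s) * Y" unfolding h_def by (rule r)
    also have "fps_const (cnj a) * (fps_of_poly (pcompose q s) * Y) + (fps_deriv (fps_of_poly (pcompose r s) * Y) + fps_const (cnj (- cnj \<alpha>)) * (fps_of_poly (pcompose r s) * Y))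
       = fps_of_poly (pcompose (smult (cnj a) q + pderiv r) s) * Y"
    proof -
      have "pderiv (pcompose r s) = pcompose (pderiv r) s" unfolding pderiv_pcompose s_def by (simp add: pderiv_pCons)
      moreover have neg: "fps_const (cnj (- cnj \<alpha>)) * k = - (fps_const \<alpha> * k)" for k
        by (simp add: fps_const_neg[symmetric] del: fps_const_neg)
      ultimately show ?thesis unfolding d neg by (simp add: pcompose_add pcompose_smult fps_of_poly_add fps_of_poly_smult algebra_simps)
    qed
    finally have 1: "pairing (fps_of_poly (pcompose (pCons a p) s) * e) g = fps_of_poly (pcompose (smult (cnj a) q + pderiv r) s) * Y" .
    have 2: "coeff (smult (cnj a) q + pderiv r) j = (\<Sum>i\<le>N. cnj (coeff (pCons a p) i) * (fact (i + j) / fact j) * coeff q (i + j))"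
      if N: "N \<ge> degree (pCons a p)" for N j
    proof (cases N)
      case 0
      then have p0: "p = 0" using N by (auto split: if_splits)
      then have "coeff r j = 0" for j using c[of 0 j] by simp
      then show ?thesis unfolding 0 by (simp add: coeff_pderiv)
    next
      case (Suc M)
      have M: "M \<ge> degree p" using N Suc by (auto split: if_splits)
      have "coeff (pderiv r) j = (\<Sum>i\<le>M. cnj (coeff p i) * (fact (Suc i + j) / fact j) * coeff q (Suc i + j))"
        unfolding coeff_pderiv c[OF M] sum_distrib_left
        by (intro sum.cong refl) (simp add: field_simps del: of_nat_Suc)
      then show ?thesis unfolding Suc sum.atMost_Suc_shift by simp
    qed
    show ?case using 1 2 by blast
  qed
  then show "\<exists>r. pairing (fps_of_poly (pcompose p s) * e) (fps_of_poly (pcompose q s2) * e) = fps_of_poly (pcompose r s) * Y \<and>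
      (\<forall>N\<ge>degree p. \<forall>j. coeff r j = (\<Sum>i\<le>N. cnj (coeff p i) * (fact (i + j) / fact j) * coeff q (i + j)))" unfolding g_def .
qed

lemma coeff_pcompose_scale: "coeff (pcompose p [:0, c:]) n = c ^ n * coeff (p :: complex poly) n"
  by (induction p arbitrary: n) (auto simp: pcompose_pCons coeff_pCons split: nat.splits)

lemma fps_compose_scale_poly: "fps_compose (fps_of_poly p) (fps_const c * fps_X) = fps_of_poly (pcompose (p :: complex poly) [:0, c:])"
  by (simp add: fps_eq_iff fps_compose_linear coeff_pcompose_scale)

lemma pcompose_affine_cancel: "pcompose (pcompose p [:a, 1:]) [:- a, 1:] = (p :: complex poly)"
  unfolding pcompose_assoc[symmetric] by (simp add: pcompose_pCons)

lemma monomial_of_proportional: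
  fixes F :: "complex fps"
  assumes "fps_const (of_real lam) * F = fps_const (of_real \<mu>) * (fps_X * fps_deriv F)" "\<mu> \<noteq> 0" "F \<noteq> 0"
  shows "\<exists>a n. F = monomial a n"
proof -
  have XF: "fps_nth (fps_X * fps_deriv F) j = of_nat j * fps_nth F j" for j by (cases j) auto
  have *: "of_real (lam - \<mu> * real j) * fps_nth F j = 0" for j
    using arg_cong[OF assms(1), of "\<lambda>f. fps_nth f j"] by (simp add: XF algebra_simps)
  obtain n where n: "fps_nth F n \<noteq> 0" using assms(3) by (auto simp: fps_eq_iff)
  then have ln: "lam = \<mu> * real n" using *[of n] by (simp only: mult_eq_0_iff of_real_eq_0_iff) simp
  have "fps_nth F j = 0" if "j \<noteq> n" for j
  proof -
    have "\<mu> * (real n - real j) \<noteq> 0" using that assms(2) by simp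
    then show ?thesis using *[of j] unfolding ln by (simp only: mult_eq_0_iff of_real_eq_0_iff right_diff_distrib) auto
  qed
  then have "F = monomial (fps_nth F n) n" by (simp add: fps_eq_iff monomial_nth)
  then show ?thesis by blast
qed

lemma squarehalf_mult: "squarehalf (fps_of_poly p * e) = fps_of_poly (pcompose (p * p) [:0, 1/2:]) * squarehalf e"
proof -
  have "fps_of_poly p * e * (fps_of_poly p * e) = fps_of_poly (p * p) * (e * e)" by (simp add: fps_of_poly_mult mult_ac)
  then show ?thesis unfolding squarehalf_def fps_compose_scale_poly[symmetric] by (simp only:) (rule fps_compose_mult_distrib, simp)
qed

text \<open>Squaring and substituting z/2 keeps the linear exponent \<alpha> but halves the
  quadratic one. This mismatch is what the fixed point argument for \<beta> exploits.\<close>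

lemma squarehalf_ode:
  assumes e: "fps_deriv e = fps_of_poly [:\<alpha>, 2 * \<beta>:] * e"
  shows "fps_deriv (squarehalf e) = fps_of_poly [:\<alpha>, \<beta>:] * squarehalf e"
proof -
  have c: "fps_deriv (fps_const (1/2) * fps_X) = fps_const (1/2 :: complex)" by simp
  have h: "fps_const (1/2) * (2 * k) = k" for k :: "complex fps"
  proof -
    have "fps_const (1/2) * (2 * k) = (fps_const (1/2) * fps_const 2) * k" by (simp add: numeral_fps_const mult_ac)
    then show ?thesis by simp
  qed
  have d: "fps_deriv (e * e) = 2 * (fps_of_poly [:\<alpha>, 2 * \<beta>:] * (e * e))" using e by (simp add: algebra_simps)
  have "pcompose [:\<alpha>, 2 * \<beta>:] [:0, 1/2:] = [:\<alpha>, \<beta>:]" by (simp add: pcompose_pCons)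
  then have l: "fps_compose (fps_of_poly [:\<alpha>, 2 * \<beta>:]) (fps_const (1/2) * fps_X) = fps_of_poly [:\<alpha>, \<beta>:]"
    unfolding fps_compose_scale_poly by simp
  have two: "fps_compose 2 (fps_const (1/2) * fps_X) = (2 :: complex fps)" by (simp only: numeral_fps_const fps_const_compose)
  have "fps_deriv (squarehalf e) = 2 * (fps_of_poly [:\<alpha>, \<beta>:] * squarehalf e) * fps_const (1/2)"
    unfolding squarehalf_def fps_compose_deriv[of "fps_const (1/2) * fps_X :: complex fps", simplified] c[simplified] d
    by (simp add: fps_compose_mult_distrib l two fps_compose_deriv d)
  then show ?thesis using h by (simp add: mult_ac)
qed

lemma decay_ode_poly:
  assumes "fps_deriv e = fps_of_poly [:\<alpha>, 2 * \<beta>:] * e" "norm \<beta> < 1/2"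
  shows "decay e"
proof (rule decay_ode[OF _ assms(2)])
  show "fps_deriv e = (fps_const \<alpha> + fps_const (2 * \<beta>) * fps_X) * e" unfolding assms(1) by (simp add: fps_of_poly_pCons)
qed

lemma euler_lagrange_poly:
  assumes lg: "local_ground \<mu> (fps_of_poly P * e)" and e: "fps_deriv e = fps_of_poly [:\<alpha>, 2 * \<beta>:] * e" and \<beta>: "norm \<beta> < 1/2"
  shows "\<exists>lam::real. fps_const (of_real (2 * pi)) * pairing (fps_of_poly P * e) (fps_of_poly (pcompose (P * P) [:0, 1/2:]) * squarehalf e)
     = fps_of_poly (smult (of_real lam) P - smult (of_real \<mu>) (pCons 0 (pderiv P + P * [:\<alpha>, 2 * \<beta>:]))) * e
     \<and> fps_of_poly (smult (of_real lam) P - smult (of_real \<mu>) (pCons 0 (pderiv P + P * [:\<alpha>, 2 * \<beta>:]))) * e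
       = fps_const (of_real lam) * (fps_of_poly P * e) - fps_const (of_real \<mu>) * (fps_X * fps_deriv (fps_of_poly P * e))"
proof -
  have e2: "fps_deriv (squarehalf e) = fps_of_poly [:\<alpha>, 2 * (\<beta> / 2):] * squarehalf e" using squarehalf_ode[OF e] by simp
  have d: "decay e" by (rule decay_ode_poly[OF e \<beta>])
  have d2: "decay (squarehalf e)" by (rule decay_ode_poly[OF e2]) (use \<beta> in \<open>simp add: norm_divide\<close>)
  have eq: "fps_of_poly (smult (of_real lam) P - smult (of_real \<mu>) (pCons 0 (pderiv P + P * [:\<alpha>, 2 * \<beta>:]))) * e
       = fps_const (of_real lam) * (fps_of_poly P * e) - fps_const (of_real \<mu>) * (fps_X * fps_deriv (fps_of_poly P * e))" for lam
  proof -
    define D where "D = pderiv P + P * [:\<alpha>, 2 * \<beta>:]"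
    have "fps_of_poly (pCons 0 D) = fps_X * fps_of_poly D" by (simp add: fps_of_poly_pCons mult.commute)
    then show ?thesis unfolding fps_of_poly_deriv_mult[OF e] D_def[symmetric]
      by (simp add: fps_of_poly_diff fps_of_poly_smult algebra_simps)
  qed
  show ?thesis
    using euler_lagrange[OF lg] decay_poly[OF d] decay_poly[OF d2] unfolding squarehalf_mult eq by blast
qed

text \<open>If the cubic term vanishes, the equation is an eigenvalue equation for z d/dz and F is a
  monomial. Otherwise both sides are nonzero polynomials times Gaussians, and their exponents must
  agree.\<close>

lemma gauss_factor_trivial:
  assumes lg: "local_ground \<mu> F" and mu: "\<mu> > 0" and F: "F = fps_of_poly P * e"
    and e: "fps_deriv e = fps_of_poly [:\<alpha>, 2 * \<beta>:] * e" and \<beta>: "norm \<beta> < 1/2" and F0: "F \<noteq> 0"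
  shows "(\<exists>a n. F = monomial a n) \<or> \<beta> = 0"
proof -
  have e0: "e \<noteq> 0" using F F0 by auto
  note lg' = lg[unfolded F]
  obtain lam :: real and R where lam: "fps_const (of_real (2 * pi)) * pairing (fps_of_poly P * e) (fps_of_poly (pcompose (P * P) [:0, 1/2:]) * squarehalf e)
     = fps_of_poly R * e"
    and R2: "fps_of_poly R * e = fps_const (of_real lam) * F - fps_const (of_real \<mu>) * (fps_X * fps_deriv F)"
    using euler_lagrange_poly[OF lg' e \<beta>] unfolding F by blast
  have e2: "fps_deriv (squarehalf e) = fps_of_poly [:\<alpha>, 2 * (\<beta> / 2):] * squarehalf e" using squarehalf_ode[OF e] by simp
  have d: "decay e" by (rule decay_ode_poly[OF e \<beta>])
  have d2: "decay (squarehalf e)" by (rule decay_ode_poly[OF e2]) (use \<beta> in \<open>simp add: norm_divide\<close>)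
  define Y where "Y = pairing e (squarehalf e)"
  note G = pairing_gauss[OF e squarehalf_ode[OF e] d d2 \<beta>, folded Y_def]
  obtain r where r: "pairing (fps_of_poly P * e) (fps_of_poly (pcompose (P * P) [:0, 1/2:]) * squarehalf e) = fps_of_poly r * Y"
    using G(2) by blast
  define q where "q = smult (of_real (2 * pi)) r"
  have q: "fps_of_poly q * Y = fps_of_poly R * e" using lam unfolding r q_def by (simp add: fps_of_poly_smult mult_ac)
  show ?thesis
  proof (cases "R = 0")
    case True
    then have "fps_const (of_real lam) * F = fps_const (of_real \<mu>) * (fps_X * fps_deriv F)" using R2 by simp
    then show ?thesis using monomial_of_proportional[of lam F \<mu>] mu F0 by auto
  next
    case False
    have "fps_of_poly R \<noteq> 0" using False fps_of_poly_eq_iff[of R 0] by simp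
    then have "q \<noteq> 0" using q e0 by auto
    then have "[:(\<alpha> + \<beta> * cnj \<alpha>) / (1 - 2 * (\<beta> * cnj \<beta>)), \<beta> / (1 - 2 * (\<beta> * cnj \<beta>)):] = [:\<alpha>, 2 * \<beta>:]"
      using gauss_exponent_unique[OF G(1) e q _ False e0] by blast
    then have "\<beta> / (1 - 2 * (\<beta> * cnj \<beta>)) = 2 * \<beta>" by (auto dest!: arg_cong[where f = "\<lambda>p. coeff p 1"])
    then show ?thesis using poly_fixed_exponent[OF \<beta>] by blast
  qed
qed

text \<open>Let m be the lowest exponent and d the degree of p. The left side reaches degree 2 d -
  m, the right side at most d + 1, so p has at most two terms, with adjacent exponents. One term
  forces \<alpha> = 0. Two terms are compatible only for m = 0, and then the coefficients of degree
  0, 1 and 2 determine \<mu>.\<close>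

lemma stationary_shape:
  fixes p r :: "complex poly" and K \<mu> lam :: real and \<alpha> :: complex
  assumes p0: "p \<noteq> 0" and K: "K > 0" and mu: "\<mu> > 0"
    and r: "\<And>j. coeff r j = (\<Sum>i\<le>degree p. cnj (coeff p i) * (fact (i + j) / fact j) * ((1/2) ^ (i + j) * coeff (p * p) (i + j)))"
    and eq: "smult (of_real K) r = smult (of_real lam) p - smult (of_real \<mu>) ([:cnj \<alpha>, 1:] * (pderiv p + smult \<alpha> p))"
  shows "(\<exists>b d. \<alpha> = 0 \<and> p = monom b d) \<or> (\<exists>A B. p = [:A, B:] \<and> \<mu> = K * ((norm A)\<^sup>2 + (norm B)\<^sup>2) / 4)"
proof -
  define d where "d = degree p"
  define m where "m = (LEAST i. coeff p i \<noteq> 0)"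
  define B where "B = coeff p d"
  have B0: "B \<noteq> 0" unfolding B_def d_def using p0 by simp
  have m: "coeff p m \<noteq> 0" unfolding m_def using B0 unfolding B_def by (rule LeastI)
  have below: "coeff p i = 0" if "i < m" for i using not_less_Least[of i "\<lambda>i. coeff p i \<noteq> 0"] that unfolding m_def by blast
  have above: "coeff p i = 0" if "i > d" for i using that unfolding d_def by (rule coeff_eq_0)
  have md: "m \<le> d" using m above by (meson not_le)
  define R where "R = [:cnj \<alpha>, 1:] * (pderiv p + smult \<alpha> p)"
  have R0: "coeff R 0 = cnj \<alpha> * (coeff p 1 + \<alpha> * coeff p 0)" unfolding R_def by (simp add: coeff_pderiv)
  have RS: "coeff R (Suc j) = cnj \<alpha> * (of_nat (j + 2) * coeff p (j + 2) + \<alpha> * coeff p (Suc j)) + (of_nat (Suc j) * coeff p (Suc j) + \<alpha> * coeff p j)" for j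
    unfolding R_def by (simp add: coeff_pderiv)
  have c: "of_real K * coeff r j = of_real lam * coeff p j - of_real \<mu> * coeff R j" for j
    using arg_cong[OF eq, of "\<lambda>q. coeff q j"] unfolding R_def by simp
  have K0: "complex_of_real K \<noteq> 0" and mu0: "complex_of_real \<mu> \<noteq> 0" using K mu by auto
  have dpp: "degree (p * p) = 2 * d" unfolding d_def using p0 by (simp add: degree_mult_eq)
  have dm: "d \<le> Suc m"
  proof (rule ccontr)
    assume "\<not> d \<le> Suc m"
    then have lt: "Suc m < d" by simp
    \<comment> \<open>The top degree of r: only i = m contributes there, since smaller i lie below p
      and larger ones exceed the degree of p * p. The assumption puts it beyond d + 1.\<close>
    define j where "j = 2 * d - m"
    have "coeff r j = (\<Sum>i\<in>{m}. cnj (coeff p i) * (fact (i + j) / fact j) * ((1/2) ^ (i + j) * coeff (p * p) (i + j)))"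
      unfolding r d_def[symmetric]
    proof (rule sum.mono_neutral_right)
      show "\<forall>i\<in>{..d} - {m}. cnj (coeff p i) * (fact (i + j) / fact j) * ((1/2) ^ (i + j) * coeff (p * p) (i + j)) = 0"
      proof
        fix i assume i: "i \<in> {..d} - {m}"
        show "cnj (coeff p i) * (fact (i + j) / fact j) * ((1/2) ^ (i + j) * coeff (p * p) (i + j)) = 0"
        proof (cases "i < m")
          case False
          then have "i + j > degree (p * p)" using i lt unfolding dpp j_def by auto
          then have "coeff (p * p) (i + j) = 0" by (rule coeff_eq_0)
          then show ?thesis by simp
        qed (simp add: below)
      qed
    qed (use md in auto)
    also have "m + j = degree p + degree p" using lt unfolding j_def d_def by simp
    then have "coeff (p * p) (m + j) = B * B" unfolding B_def d_def by (simp only: coeff_mult_degree_sum)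
    then have "(\<Sum>i\<in>{m}. cnj (coeff p i) * (fact (i + j) / fact j) * ((1/2) ^ (i + j) * coeff (p * p) (i + j))) \<noteq> 0"
      using m B0 by simp
    finally have "coeff r j \<noteq> 0" .
    moreover have "coeff p j = 0" "coeff R j = 0"
    proof -
      obtain i where i: "j = Suc i" "i > d" by (rule that[of "2 * d - m - 1"]) (use lt j_def in auto)
      show "coeff p j = 0" using i by (simp add: above)
      show "coeff R j = 0" unfolding i(1) RS using i(2) by (simp add: above)
    qed
    ultimately show False using c[of j] K0 by simp
  qed
  show ?thesis
  proof (cases "m = d")
    case True
    have pm: "p = monom B d" unfolding poly_eq_iff coeff_monom B_def using above below True by (metis nat_neq_iff)
    have "coeff r (Suc d) = 0" unfolding r
    proof (rule sum.neutral, rule ballI)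
      fix i assume "i \<in> {..degree p}"
      have "coeff (p * p) (i + Suc d) = 0" if "i = d" using that dpp by (intro coeff_eq_0) auto
      moreover have "coeff p i = 0" if "i \<noteq> d" using that unfolding pm by simp
      ultimately show "cnj (coeff p i) * (fact (i + Suc d) / fact (Suc d)) * ((1/2) ^ (i + Suc d) * coeff (p * p) (i + Suc d)) = 0"
        by (cases "i = d") auto
    qed
    moreover have "coeff R (Suc d) = \<alpha> * B" unfolding RS by (simp add: above B_def)
    ultimately have "\<alpha> = 0" using c[of "Suc d"] B0 mu0 by (simp add: above)
    then show ?thesis using pm by blast
  next
    case False
    then have d: "d = Suc m" using md dm by simp
    define A where "A = coeff p m"
    have A0: "A \<noteq> 0" using m unfolding A_def .
    have pd: "p = monom A m + monom B (Suc m)"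
    proof (rule poly_eqI)
      fix i show "coeff p i = coeff (monom A m + monom B (Suc m)) i"
        using above[of i] below[of i] unfolding d A_def B_def coeff_add coeff_monom by (cases i "Suc m" rule: linorder_cases) (auto simp: less_Suc_eq)
    qed
    have pp: "p * p = monom (A * A) (2 * m) + monom (2 * A * B) (2 * m + 1) + monom (B * B) (2 * m + 2)"
    proof -
      have "p * p = monom A m * monom A m + (monom A m * monom B (Suc m) + monom A m * monom B (Suc m)) + monom B (Suc m) * monom B (Suc m)"
        unfolding pd by (simp only: distrib_left distrib_right mult.commute[of "monom B (Suc m)" "monom A m"] add.assoc)
      also have "\<dots> = monom (A * A) (m + m) + monom (A * B + A * B) (m + Suc m) + monom (B * B) (Suc m + Suc m)"
        by (simp only: mult_monom add_monom)
      also have "A * B + A * B = 2 * A * B" by simp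
      finally show ?thesis unfolding mult_2 by (simp only: add_Suc_right add_Suc add_0_right add_2_eq_Suc' Suc_eq_plus1[symmetric])
    qed
    have rj: "coeff r j = cnj A * (fact (m + j) / fact j) * ((1/2) ^ (m + j) * coeff (p * p) (m + j))
        + cnj B * (fact (Suc m + j) / fact j) * ((1/2) ^ (Suc m + j) * coeff (p * p) (Suc m + j))" for j
    proof -
      have "coeff r j = (\<Sum>i\<in>{m, Suc m}. cnj (coeff p i) * (fact (i + j) / fact j) * ((1/2) ^ (i + j) * coeff (p * p) (i + j)))"
        unfolding r d_def[symmetric] d by (rule sum.mono_neutral_right) (auto simp: below)
      also have "\<dots> = cnj (coeff p m) * (fact (m + j) / fact j) * ((1/2) ^ (m + j) * coeff (p * p) (m + j))
        + cnj (coeff p (Suc m)) * (fact (Suc m + j) / fact j) * ((1/2) ^ (Suc m + j) * coeff (p * p) (Suc m + j))" by simp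
      finally show ?thesis unfolding A_def B_def d .
    qed
    have ppc: "coeff (p * p) k = (if k = 2 * m then A * A else 0) + (if k = 2 * m + 1 then 2 * A * B else 0) + (if k = 2 * m + 2 then B * B else 0)" for k
      unfolding pp coeff_add coeff_monom by (simp add: eq_commute)
    have pS: "coeff p (m + 2) = 0" "coeff p (m + 3) = 0" "coeff p (Suc m) = B" "coeff p m = A"
      by (simp_all add: above d A_def[symmetric] B_def[unfolded d, symmetric])
    \<comment> \<open>At degree m + 2 each side has a single contribution, which ties \<alpha> to
      cnj A * B. As T is real, the conjugate relation holds with the same factor.\<close>
    define T where "T = complex_of_real (K * (fact (2 * m + 2) / fact (m + 2)) * (1/2) ^ (2 * m + 2))"
    have "of_real K * (cnj A * (fact (2 * m + 2) / fact (m + 2)) * ((1/2) ^ (2 * m + 2) * (B * B))) = - (of_real \<mu> * (\<alpha> * B))"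
    proof -
      have "coeff r (m + 2) = cnj A * (fact (2 * m + 2) / fact (m + 2)) * ((1/2) ^ (2 * m + 2) * (B * B))"
      proof -
        have i: "m + (m + 2) = 2 * m + 2" "Suc m + (m + 2) = 2 * m + 3" by simp_all
        have "coeff (p * p) (2 * m + 2) = B * B" "coeff (p * p) (2 * m + 3) = 0" unfolding ppc by simp_all
        then show ?thesis unfolding rj i by (simp only: mult_zero_right add_0_right)
      qed
      moreover have "coeff R (m + 2) = \<alpha> * B" using RS[of "Suc m"] pS by (simp add: numeral_eq_Suc)
      ultimately show ?thesis using c[of "m + 2"] pS by simp
    qed
    then have "B * (T * cnj A * B) = B * (- (of_real \<mu> * \<alpha>))" unfolding T_def by (simp add: mult_ac)
    then have top: "T * cnj A * B = - (of_real \<mu> * \<alpha>)" using B0 by (simp only: mult_cancel_left) simp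
    have "cnj T = T" unfolding T_def by (rule complex_cnj_complex_of_real)
    then have top': "T * A * cnj B = - (of_real \<mu> * cnj \<alpha>)" using arg_cong[OF top, of cnj] by simp
    show ?thesis
    proof (cases m)
      \<comment> \<open>Degree m - 1 gives a second relation between A * cnj B and cnj \<alpha>.
        Dividing by the first leaves 4 (k + 3) = 2 (2 k + 3), which is impossible.\<close>
      case (Suc k)
      have "of_real K * (cnj B * (fact (2 * k + 2) / fact k) * ((1/2) ^ (2 * k + 2) * (A * A))) = - (of_real \<mu> * (cnj \<alpha> * (of_nat m * A)))"
      proof -
        have "coeff r k = cnj B * (fact (2 * k + 2) / fact k) * ((1/2) ^ (2 * k + 2) * (A * A))"
        proof -
          have i: "m + k = 2 * k + 1" "Suc m + k = 2 * k + 2" using Suc by simp_all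
          have "coeff (p * p) (2 * k + 2) = A * A" "coeff (p * p) (2 * k + 1) = 0" unfolding ppc Suc by simp_all
          then show ?thesis unfolding rj i by (simp only: mult_zero_right add_0_left)
        qed
        moreover have "coeff R k = cnj \<alpha> * (of_nat m * A)"
          using R0 RS[of "k - 1"] pS(4) below[of k] below[of "k - 1"] Suc by (cases k) auto
        ultimately show ?thesis using c[of k] below[of k] Suc by simp
      qed
      moreover define x where "x = (fact (2 * k + 2) / fact k) * (1/2::real) ^ (2 * k + 2)"
      define y where "y = (fact (2 * m + 2) / fact (m + 2)) * (1/2::real) ^ (2 * m + 2)"
      have "of_real K * (cnj B * (fact (2 * k + 2) / fact k) * ((1/2) ^ (2 * k + 2) * (A * A))) = (A * (A * cnj B)) * of_real (K * x)"
        unfolding x_def by (simp only: of_real_mult of_real_divide of_real_fact of_real_power of_real_1 of_real_numeral mult_ac)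
      ultimately have "(A * (A * cnj B)) * of_real (K * x) = of_nat m * A * (- (of_real \<mu> * cnj \<alpha>))"
        by (simp only: mult_minus_right mult_ac)
      also have "\<dots> = (A * (A * cnj B)) * (of_nat m * T)" unfolding top'[symmetric] by (simp only: mult_ac)
      also have "of_nat m * T = of_real (K * (real m * y))" unfolding T_def y_def by (simp only: of_real_mult of_real_of_nat_eq mult_ac)
      finally have "complex_of_real (K * x) = of_real (K * (real m * y))" using A0 B0 unfolding mult_cancel_left by simp
      then have "K * x = K * (real m * y)" unfolding of_real_eq_iff .
      then have "x = real m * y" using K by (simp only: mult_cancel_left) auto
      moreover have "y = x * ((2 * real k + 4) * (2 * real k + 3) / ((real k + 3) * (real k + 2) * (real k + 1)) * (1/4))"
      proof -
        have "fact (2 * m + 2) = (2 * real k + 4) * (2 * real k + 3) * fact (2 * k + 2)"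
          unfolding Suc by (simp add: numeral_eq_Suc algebra_simps)
        moreover have "fact (m + 2) = (real k + 3) * (real k + 2) * (real k + 1) * fact k"
          unfolding Suc by (simp add: numeral_eq_Suc algebra_simps)
        moreover have "(1/2::real) ^ (2 * m + 2) = (1/2) ^ (2 * k + 2) * (1/4)" unfolding Suc by simp
        ultimately show ?thesis unfolding y_def x_def by (simp only: times_divide_times_eq times_divide_eq_left times_divide_eq_right divide_divide_eq_left mult_ac)
      qed
      moreover have "x \<noteq> 0" unfolding x_def by simp
      ultimately have "x * 1 = x * ((real k + 1) * ((2 * real k + 4) * (2 * real k + 3) / ((real k + 3) * (real k + 2) * (real k + 1)) * (1/4)))"
        unfolding Suc by (simp only: of_nat_Suc mult_1_right mult_ac add.commute)
      then have "1 = (real k + 1) * ((2 * real k + 4) * (2 * real k + 3) / ((real k + 3) * (real k + 2) * (real k + 1)) * (1/4))"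
        unfolding mult_left_cancel[OF \<open>x \<noteq> 0\<close>] .
      moreover have "(real k + 3) * (real k + 2) * (real k + 1) > 0" by (intro mult_pos_pos) auto
      ultimately have "4 * ((real k + 3) * (real k + 2) * (real k + 1)) = (real k + 1) * ((2 * real k + 4) * (2 * real k + 3))"
        by (simp add: field_simps)
      then have "((real k + 1) * (real k + 2)) * (4 * (real k + 3)) = ((real k + 1) * (real k + 2)) * (2 * (2 * real k + 3))"
        by (simp only: distrib_left distrib_right mult_ac)
      then have "4 * (real k + 3) = 2 * (2 * real k + 3)" by (simp only: mult_cancel_left) auto
      then show ?thesis by simp
    next
      \<comment> \<open>With \<alpha> eliminated by the relation at degree 2, the coefficients of
        degree 0 and 1 both contain the multiplier only through \<open>S\<close>; their difference
        is an equation for \<mu> alone.\<close>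
      case 0
      have T: "T = of_real (K / 4)" unfolding T_def 0 by (simp add: power2_eq_square)
      have p1: "p = [:A, B:]" unfolding pd 0 by (simp add: monom_0 monom_Suc)
      have r1: "coeff r 1 = cnj A * (A * B) + cnj B * (B * B) / 2" unfolding rj ppc 0 by (simp add: numeral_eq_Suc)
      have r0: "coeff r 0 = cnj A * (A * A) + cnj B * (A * B)" unfolding rj ppc 0 by (simp add: numeral_eq_Suc)
      have R1': "coeff R 1 = cnj \<alpha> * (\<alpha> * B) + (B + \<alpha> * A)" using RS[of 0] pS unfolding 0 by (simp add: numeral_eq_Suc)
      have R0': "coeff R 0 = cnj \<alpha> * (B + \<alpha> * A)" using R0 pS unfolding 0 by simp
      define S where "S = (of_real lam :: complex) - of_real \<mu> * (cnj \<alpha> * \<alpha>)"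
      have "of_real K * (cnj A * (A * B) + cnj B * (B * B) / 2) = of_real lam * B - of_real \<mu> * (cnj \<alpha> * (\<alpha> * B) + B) - of_real \<mu> * \<alpha> * A"
        using c[of 1] pS unfolding r1 R1' 0 by (simp add: algebra_simps)
      also have "of_real \<mu> * \<alpha> = - (T * cnj A * B)" unfolding top by simp
      finally have "B * (of_real K * (cnj A * A + cnj B * B / 2)) = B * (S - of_real \<mu> + T * (cnj A * A))"
        unfolding S_def by (simp add: algebra_simps)
      then have S1: "of_real K * (cnj A * A + cnj B * B / 2) = S - of_real \<mu> + T * (cnj A * A)" using B0 by (simp only: mult_cancel_left) simp
      have "of_real K * (cnj A * (A * A) + cnj B * (A * B)) = of_real lam * A - of_real \<mu> * (cnj \<alpha> * \<alpha> * A) - of_real \<mu> * cnj \<alpha> * B"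
        using c[of 0] pS unfolding r0 R0' 0 by (simp add: algebra_simps)
      also have "of_real \<mu> * cnj \<alpha> = - (T * A * cnj B)" unfolding top' by simp
      finally have "A * (of_real K * (cnj A * A + cnj B * B)) = A * (S + T * (cnj B * B))"
        unfolding S_def by (simp add: algebra_simps)
      then have S0: "of_real K * (cnj A * A + cnj B * B) = S + T * (cnj B * B)" using A0 by (simp only: mult_cancel_left) simp
      have "of_real \<mu> = T * (cnj A * A + cnj B * B)"
      proof -
        define a b where "a = cnj A * A" and "b = cnj B * B"
        have K4: "complex_of_real K = 4 * T" unfolding T by simp
        have "S = 4 * T * (a + b) - T * b" using S0 unfolding K4 a_def b_def by simp
        moreover have "of_real \<mu> = S + T * a - 4 * T * (a + b / 2)" using S1 unfolding K4 a_def b_def by simp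
        ultimately show ?thesis unfolding a_def[symmetric] b_def[symmetric] by (simp add: algebra_simps)
      qed
      then have "complex_of_real \<mu> = of_real (K / 4 * ((norm A)\<^sup>2 + (norm B)\<^sup>2))"
        unfolding T of_real_mult of_real_add complex_norm_square by (simp only: mult_ac)
      then have "\<mu> = K * ((norm A)\<^sup>2 + (norm B)\<^sup>2) / 4" unfolding of_real_eq_iff by simp
      then show ?thesis using p1 by blast
    qed
  qed
qed

text \<open>A pure exponential is fixed by \<open>squarehalf\<close>, so the equation becomes one
  for polynomials. Among its solutions, those that are not monomials are the coherent ones, which
  normalisation confines to \<mu> = 1/2.\<close>

lemma local_ground_poly_exp:
  assumes lg: "local_ground \<mu> (fps_of_poly P * fps_exp \<alpha>)" (is "local_ground \<mu> ?F") and mu: "\<mu> > 0" "\<mu> \<noteq> 1/2" and P0: "P \<noteq> 0"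
  shows "\<exists>a n. ?F = monomial a n"
proof -
  define e where "e = fps_exp \<alpha>"
  have e: "fps_deriv e = fps_of_poly [:\<alpha>, 2 * 0:] * e" unfolding e_def by (simp add: fps_of_poly_pCons)
  have e0: "e \<noteq> 0"
  proof
    assume "e = 0"
    then have "fps_nth e 0 = 0" by simp
    then show False unfolding e_def by simp
  qed
  have sq: "squarehalf e = e"
  proof -
    have "fps_deriv (squarehalf e) = fps_const \<alpha> * squarehalf e" using squarehalf_ode[OF e] by (simp add: fps_of_poly_pCons)
    then have "squarehalf e = fps_const (fps_nth (squarehalf e) 0) * fps_exp \<alpha>" unfolding fps_exp_unique_ODE .
    moreover have "fps_nth (squarehalf e) 0 = 1" unfolding squarehalf_def e_def by (simp add: fps_compose_linear)
    ultimately show ?thesis unfolding e_def by simp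
  qed
  define s where "s = [:- cnj \<alpha>, 1:]"
  define s2 where "s2 = [:- 2 * cnj \<alpha>, 1:]"
  \<comment> \<open>The polynomial re-expanded about cnj \<alpha>, the point at which
    \<open>pairing_exp\<close> takes its simple form.\<close>
  define p where "p = pcompose P [:cnj \<alpha>, 1:]"
  have Pp: "P = pcompose p s" unfolding p_def s_def pcompose_affine_cancel ..
  have p0: "p \<noteq> 0" using P0 Pp by auto
  define q where "q = pcompose (p * p) [:0, 1/2:]"
  have q: "pcompose (P * P) [:0, 1/2:] = pcompose q s2"
  proof -
    have "pcompose (P * P) [:0, 1/2:] = pcompose (p * p) (pcompose s [:0, 1/2:])" unfolding Pp pcompose_mult[symmetric] pcompose_assoc ..
    also have "pcompose s [:0, 1/2:] = pcompose [:0, 1/2:] s2" unfolding s_def s2_def by (simp add: pcompose_pCons)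
    finally show ?thesis unfolding q_def pcompose_assoc .
  qed
  define Y where "Y = pairing (fps_exp \<alpha>) (fps_exp \<alpha>)"
  define C where "C = exp ((norm \<alpha>)\<^sup>2)"
  have "Y = fps_const (fps_nth Y 0) * fps_exp \<alpha>" unfolding fps_exp_unique_ODE[symmetric] Y_def by (rule pairing_exp(1))
  moreover have "fps_nth Y 0 = of_real C" unfolding Y_def pairing_def C_def by (simp add: ip_exp)
  ultimately have Y: "Y = fps_const (of_real C) * e" unfolding e_def by simp
  obtain r where r: "pairing (fps_of_poly (pcompose p s) * e) (fps_of_poly (pcompose q s2) * e) = fps_of_poly (pcompose r s) * Y"
    and rc: "\<And>j. coeff r j = (\<Sum>i\<le>degree p. cnj (coeff p i) * (fact (i + j) / fact j) * coeff q (i + j))"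
    using pairing_exp(2)[where \<alpha> = \<alpha> and p = p and q = q, folded e_def s_def s2_def Y_def[unfolded e_def[symmetric]]] unfolding Y_def e_def by blast
  obtain lam where lam: "fps_const (of_real (2 * pi)) * pairing (fps_of_poly P * e) (fps_of_poly (pcompose (P * P) [:0, 1/2:]) * squarehalf e)
     = fps_of_poly (smult (of_real lam) P - smult (of_real \<mu>) (pCons 0 (pderiv P + P * [:\<alpha>, 2 * 0:]))) * e"
    using euler_lagrange_poly[OF lg[folded e_def] e] by auto
  define K where "K = 2 * pi * C"
  have K: "K > 0" unfolding K_def C_def by simp
  have "fps_of_poly (smult (of_real K) (pcompose r s)) * e = fps_of_poly (smult (of_real lam) P - smult (of_real \<mu>) (pCons 0 (pderiv P + P * [:\<alpha>, 2 * 0:]))) * e"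
    using lam unfolding sq q r[folded Pp] Y K_def by (simp add: fps_of_poly_smult mult_ac flip: fps_const_mult)
  then have "smult (of_real K) (pcompose r s) = smult (of_real lam) P - smult (of_real \<mu>) (pCons 0 (pderiv P + P * [:\<alpha>, 2 * 0:]))"
    using e0 by (simp only: mult_cancel_right fps_of_poly_eq_iff) simp
  then have eq: "pcompose (smult (of_real K) (pcompose r s)) [:cnj \<alpha>, 1:] = pcompose (smult (of_real lam) P - smult (of_real \<mu>) (pCons 0 (pderiv P + smult \<alpha> P))) [:cnj \<alpha>, 1:]"
    by simp
  have rr: "pcompose (pcompose r s) [:cnj \<alpha>, 1:] = r" unfolding s_def using pcompose_affine_cancel[of r "- cnj \<alpha>"] by simp
  have dp: "pcompose (pderiv P) [:cnj \<alpha>, 1:] = pderiv p" unfolding p_def pderiv_pcompose by (simp add: pderiv_pCons)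
  have eq': "smult (of_real K) r = smult (of_real lam) p - smult (of_real \<mu>) ([:cnj \<alpha>, 1:] * (pderiv p + smult \<alpha> p))"
    using eq unfolding pcompose_smult pcompose_diff pcompose_pCons pcompose_add rr dp p_def[symmetric] by simp
  have "(\<exists>b d. \<alpha> = 0 \<and> p = monom b d) \<or> (\<exists>A B. p = [:A, B:] \<and> \<mu> = K * ((norm A)\<^sup>2 + (norm B)\<^sup>2) / 4)"
    by (rule stationary_shape[OF p0 K mu(1) _ eq']) (simp add: rc q_def coeff_pcompose_scale)
  then show ?thesis
  proof (elim disjE exE conjE)
    fix b d assume "\<alpha> = 0" "p = monom b d"
    then have "?F = monomial b d" unfolding Pp s_def monomial_def by (simp add: fps_of_poly_monom)
    then show ?thesis by blast
  next
    \<comment> \<open>In these coordinates the mass is K (|A|^2 + |B|^2) / 2, so mass one gives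
      \<mu> = 1/2, the only value where a coherent state with two terms can be stationary.\<close>
    fix A B assume p1: "p = [:A, B:]" and m: "\<mu> = K * ((norm A)\<^sup>2 + (norm B)\<^sup>2) / 4"
    have "P = [:A - B * cnj \<alpha>, B:]" unfolding Pp p1 s_def by (simp add: pcompose_pCons)
    then have "?F = coherent B (A - B * cnj \<alpha>) \<alpha>" unfolding coherent_def by (simp add: fps_of_poly_pCons add.commute)
    moreover have "mass ?F = 1" using lg unfolding local_ground_def by simp
    ultimately have "pi * C * ((norm B)\<^sup>2 + (norm A)\<^sup>2) = 1" using coherent_mass[of B "A - B * cnj \<alpha>" \<alpha>] unfolding C_def by simp
    then have "K * ((norm A)\<^sup>2 + (norm B)\<^sup>2) = 2" unfolding K_def by (simp add: algebra_simps)
    then show ?thesis using m mu(2) by simp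
  qed
qed

lemma local_ground_gauss_imp_monomial:
  assumes lg: "local_ground \<mu> F" and mu: "\<mu> > 0" "\<mu> \<noteq> 1/2" and F: "F = fps_of_poly P * e"
    and e: "fps_deriv e = fps_of_poly [:\<alpha>, 2 * \<beta>:] * e" and \<beta>: "norm \<beta> < 1/2" and F0: "F \<noteq> 0"
  shows "\<exists>a n. F = monomial a n"
proof -
  consider "\<exists>a n. F = monomial a n" | "\<beta> = 0" using gauss_factor_trivial[OF lg mu(1) F e \<beta> F0] by blast
  then show ?thesis
  proof cases
    case 2
    then have "fps_deriv e = fps_const \<alpha> * e" using e by (simp add: fps_of_poly_pCons)
    then have "e = fps_const (fps_nth e 0) * fps_exp \<alpha>" unfolding fps_exp_unique_ODE .
    then have "F = fps_of_poly (smult (fps_nth e 0) P) * fps_exp \<alpha>" unfolding F by (metis fps_of_poly_smult mult.assoc mult.commute)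
    then show ?thesis using local_ground_poly_exp[of \<mu> "smult (fps_nth e 0) P" \<alpha>] lg mu F0 by auto
  qed
qed

section \<open>Finitely many zeros\<close>

text \<open>Each step removes one zero with its full multiplicity, so the number of distinct zeros
  drops and the last quotient has none; only then does it have an entire logarithm.\<close>

lemma finite_zeros_factor:
  fixes f :: "complex \<Rightarrow> complex"
  assumes "f holomorphic_on UNIV" "finite {z. f z = 0}"
  shows "\<exists>P h. P \<noteq> 0 \<and> h holomorphic_on UNIV \<and> (\<forall>z. h z \<noteq> 0 \<and> f z = poly P z * h z)"
  using assms
proof (induction "card {z. f z = 0}" arbitrary: f)
  case 0
  then have "f z \<noteq> 0" for z by auto
  then show ?case using 0 by (intro exI[of _ 1] exI[of _ f]) auto
next
  case (Suc n)
  have "card {z. f z = 0} \<noteq> 0" unfolding Suc(2)[symmetric] by (rule Suc_not_Zero)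
  then obtain a where a: "f a = 0" by (cases "{z. f z = 0} = {}") auto
  have "\<not> f constant_on UNIV"
  proof
    assume "f constant_on UNIV"
    then have "{z. f z = 0} = UNIV" using a unfolding constant_on_def by auto
    then show False using Suc(4) infinite_UNIV_char_0[where 'a = complex] by simp
  qed
  then obtain g r k where k: "0 < k" and r: "0 < r" and g: "g holomorphic_on ball a r"
    and fg: "\<And>w. w \<in> ball a r \<Longrightarrow> f w = (w - a) ^ k * g w" and g0: "\<And>w. w \<in> ball a r \<Longrightarrow> g w \<noteq> 0"
    using holomorphic_factor_zero_nonconstant[OF Suc(3) open_UNIV connected_UNIV UNIV_I a] by metis
  define h where "h z = (if z = a then g a else f z / (z - a) ^ k)" for z
  have hg: "h w = g w" if "w \<in> ball a r" for w unfolding h_def using fg[OF that] by simp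
  have "h holomorphic_on ball a r" by (rule holomorphic_transform[OF g]) (simp add: hg)
  moreover have "h holomorphic_on UNIV - {a}"
  proof (rule holomorphic_transform)
    show "(\<lambda>z. f z / (z - a) ^ k) holomorphic_on UNIV - {a}"
      using Suc(3) by (intro holomorphic_intros holomorphic_on_subset[OF Suc(3)]) auto
  qed (auto simp: h_def)
  ultimately have "h holomorphic_on ball a r \<union> (UNIV - {a})" by (intro holomorphic_on_Un) auto
  moreover have "ball a r \<union> (UNIV - {a}) = UNIV" using r by auto
  ultimately have hol: "h holomorphic_on UNIV" by simp
  have fh: "f z = (z - a) ^ k * h z" for z using a k unfolding h_def by (simp add: zero_power)
  have "{z. f z = 0} = insert a {z. h z = 0}" using fh a by auto
  moreover have "a \<notin> {z. h z = 0}" using g0[of a] r unfolding h_def by simp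
  ultimately have "n = card {z. h z = 0}" "finite {z. h z = 0}" using Suc(2,4) by auto
  then obtain P u where P: "P \<noteq> 0" "u holomorphic_on UNIV" "\<And>z. u z \<noteq> 0 \<and> h z = poly P z * u z" using Suc(1) hol by metis
  show ?case
  proof (intro exI conjI allI)
    show "[:- a, 1:] ^ k * P \<noteq> 0" using P(1) by simp
    show "u holomorphic_on UNIV" by (rule P)
    show "u z \<noteq> 0" for z using P(3) by blast
    show "f z = poly ([:- a, 1:] ^ k * P) z * u z" for z using fh[of z] P(3)[of z] by (simp add: mult.assoc)
  qed
qed

lemma poly_bounded_below_at_infinity:
  fixes P :: "complex poly"
  assumes "P \<noteq> 0" shows "\<exists>c>0. \<exists>r. \<forall>z. r \<le> norm z \<longrightarrow> c \<le> norm (poly P z)"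
proof (cases P)
  case (pCons a p)
  show ?thesis
  proof (cases "p = 0")
    case True
    then have "norm a > 0" using assms pCons by simp
    then show ?thesis unfolding pCons True by (intro exI[of _ "norm a"]) simp
  next
    case False
    from poly_infinity[OF this, of 1 a] show ?thesis unfolding pCons by (intro exI[of _ "1::real"]) simp
  qed
qed

text \<open>A one-sided bound suffices, as in the Borel-Caratheodory inequality: on the disc of
  radius R the function B - Re g is nonnegative, so its n-th moment is at most R^n times its
  integral, which involves only the constant coefficient. The n-th coefficient is therefore of order
  R^2 / R^n. Area integrals replace circle integrals, so that the disc moments above can be
  used.\<close>

lemma entire_log_growth_coefficients:
  fixes G :: "complex fps"
  assumes cr: "fps_conv_radius G = \<infinity>" and le: "\<And>z. Re (eval_fps G z) \<le> (norm z)\<^sup>2 / 2 + C" and n: "n \<ge> 3"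
  shows "fps_nth G n = 0"
proof -
  define g where "g = eval_fps G"
  define U where "U = Sigma_Algebra.measure lborel (ball (0::complex) 1)"
  have U: "U > 0" unfolding U_def by (rule content_ball_pos) simp
  have [measurable]: "g \<in> borel_measurable borel" unfolding g_def by (rule borel_measurable_eval_fps[OF cr])
  have n0: "n \<noteq> 0" using n by simp
  have bound: "norm (fps_nth G n) \<le> 8 / 3 * 4 ^ n * (R\<^sup>2 / 2 + C - Re (fps_nth G 0)) / R ^ 3" if R: "R \<ge> 1" for R :: real
  proof -
    define w where "w = disc_weight 0 R"
    have w: "w z = indicator (ball 0 R) z" for z unfolding w_def disc_weight_def by simp
    define M where "M = disc_moment 0 R"
    define B where "B = R\<^sup>2 / 2 + C"
    have "continuous_on (cball 0 R) g" unfolding g_def using cr by (intro continuous_on_eval_fps') auto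
    then have "compact (g ` cball 0 R)" by (rule compact_continuous_image) (rule compact_cball)
    then obtain A where A: "\<And>z. norm z \<le> R \<Longrightarrow> norm (g z) \<le> A" using bounded_iff compact_imp_bounded by (metis image_eqI mem_cball_0)
    have cn: "norm (cnj z ^ n) \<le> R ^ n" "norm (z ^ n) \<le> R ^ n" if "norm z < R" for z using that by (simp_all add: norm_power power_mono)
    have i1: "integrable lborel (\<lambda>z. w z *\<^sub>R (g z * cnj z ^ n))" unfolding w_def
    proof (rule integrable_disc_weight)
      show "norm (g z * cnj z ^ n) \<le> A * R ^ n" if "norm z < R" for z
        unfolding norm_mult using A[of z] cn[OF that] that by (intro mult_mono) (auto intro: order_trans[OF norm_ge_zero])
    qed measurable
    have i2: "integrable lborel (\<lambda>z. w z *\<^sub>R (cnj (g z) * cnj z ^ n))" unfolding w_def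
    proof (rule integrable_disc_weight)
      show "norm (cnj (g z) * cnj z ^ n) \<le> A * R ^ n" if "norm z < R" for z
        unfolding norm_mult using A[of z] cn[OF that] that by (intro mult_mono) (auto intro: order_trans[OF norm_ge_zero])
    qed measurable
    have i3: "integrable lborel (\<lambda>z. w z *\<^sub>R (cnj z ^ n))" unfolding w_def
      by (rule integrable_disc_weight[OF _ cn(1)]) (measurable, assumption?)
    have i4: "integrable lborel (\<lambda>z. w z *\<^sub>R g z)" unfolding w_def
      by (rule integrable_disc_weight[where B = A]) (auto intro: A)
    have i5: "integrable lborel w" using integrable_disc_weight[where h = "\<lambda>_. 1 :: real" and B = 1, of R 0] unfolding w_def by simp
    have 1: "(\<integral>z. w z *\<^sub>R (g z * cnj z ^ n) \<partial>lborel) = fps_nth G n * of_real (M n)"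
      unfolding w_def g_def M_def by (rule disc_coefficient[OF cr])
    have "(\<integral>z. w z *\<^sub>R (g z * z ^ n) \<partial>lborel) = 0"
    proof -
      have r: "fps_conv_radius (G * fps_X ^ n) = \<infinity>" using fps_conv_radius_mult[of G "fps_X ^ n"] cr by simp
      have "eval_fps (G * fps_X ^ n) z * cnj z ^ 0 = g z * z ^ n" for z unfolding g_def using cr by (simp add: eval_fps_mult)
      then show ?thesis using disc_coefficient[OF r, of 0 R 0] n0 unfolding w_def by simp
    qed
    then have 2: "(\<integral>z. w z *\<^sub>R (cnj (g z) * cnj z ^ n) \<partial>lborel) = 0"
      using Bochner_Integration.integral_cnj[of lborel "\<lambda>z. w z *\<^sub>R (g z * z ^ n)"] by simp
    have 3: "(\<integral>z. w z *\<^sub>R (cnj z ^ n) \<partial>lborel) = 0"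
      using disc_coefficient[of 1 0 R n] n0 unfolding w_def by simp
    have 4: "(\<integral>z. w z *\<^sub>R g z \<partial>lborel) = fps_nth G 0 * of_real (M 0)"
      using disc_coefficient[OF cr, of 0 R 0] unfolding w_def g_def M_def by simp
    have M0: "(\<integral>z. w z \<partial>lborel) = M 0" unfolding M_def disc_moment_def w_def by simp
    \<comment> \<open>Twice the real part is g + cnj g. Against cnj z ^ n with n > 0, both cnj g and
      constants integrate to 0, so subtracting B is free.\<close>
    have comb: "(\<integral>z. w z *\<^sub>R (of_real (2 * (Re (g z) - B)) * cnj z ^ n) \<partial>lborel) = fps_nth G n * of_real (M n)"
    proof -
      have "w z *\<^sub>R (of_real (2 * (Re (g z) - B)) * cnj z ^ n) = w z *\<^sub>R (g z * cnj z ^ n) + w z *\<^sub>R (cnj (g z) * cnj z ^ n) - of_real (2 * B) * (w z *\<^sub>R (cnj z ^ n))" for z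
      proof -
        have "complex_of_real (2 * (Re (g z) - B)) = g z + cnj (g z) - of_real (2 * B)" unfolding complex_add_cnj by simp
        then show ?thesis by (simp add: scaleR_conv_of_real algebra_simps)
      qed
      then have "(\<integral>z. w z *\<^sub>R (of_real (2 * (Re (g z) - B)) * cnj z ^ n) \<partial>lborel)
          = (\<integral>z. w z *\<^sub>R (g z * cnj z ^ n) + w z *\<^sub>R (cnj (g z) * cnj z ^ n) - of_real (2 * B) * (w z *\<^sub>R (cnj z ^ n)) \<partial>lborel)" by (simp only:)
      also have "\<dots> = fps_nth G n * of_real (M n) + 0 - of_real (2 * B) * 0"
        by (simp only: Bochner_Integration.integral_diff Bochner_Integration.integral_add integral_mult_right_zero
            Bochner_Integration.integrable_add integrable_mult_right i1 i2 i3 1 2 3)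
      finally show ?thesis by simp
    qed
    have Re4: "(\<integral>z. w z * Re (g z) \<partial>lborel) = Re (fps_nth G 0) * M 0"
      using integral_Re[OF i4] unfolding 4 by simp
    have i6: "integrable lborel (\<lambda>z. w z * Re (g z))" using integrable_Re[OF i4] by simp
    have "norm (fps_nth G n * of_real (M n)) \<le> (\<integral>z. (2 * R ^ n) * (B * w z - w z * Re (g z)) \<partial>lborel)"
      unfolding comb[symmetric]
    proof (rule order_trans[OF integral_norm_bound], rule integral_mono')
      show "integrable lborel (\<lambda>z. (2 * R ^ n) * (B * w z - w z * Re (g z)))" using i5 i6 by auto
      fix z :: complex
      show "norm (w z *\<^sub>R (of_real (2 * (Re (g z) - B)) * cnj z ^ n)) \<le> (2 * R ^ n) * (B * w z - w z * Re (g z))"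
      proof (cases "norm z < R")
        case True
        have "Re (g z) \<le> B"
        proof -
          have "(norm z)\<^sup>2 \<le> R\<^sup>2" using True by (intro power_mono) auto
          then show ?thesis using le[of z] unfolding g_def B_def by simp
        qed
        then have "norm (complex_of_real (2 * (Re (g z) - B))) = 2 * (B - Re (g z))" unfolding norm_of_real by simp
        then have "norm (w z *\<^sub>R (of_real (2 * (Re (g z) - B)) * cnj z ^ n)) = 2 * (B - Re (g z)) * norm (cnj z ^ n)"
          unfolding norm_scaleR norm_mult using True by (simp add: w)
        also have "\<dots> \<le> 2 * (B - Re (g z)) * R ^ n" using cn[OF True] \<open>Re (g z) \<le> B\<close> by (intro mult_left_mono) auto
        finally show ?thesis using True by (simp add: w algebra_simps)
      qed (simp add: w)
      then show "0 \<le> (2 * R ^ n) * (B * w z - w z * Re (g z))" by (rule order_trans[OF norm_ge_zero])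
    qed
    also have "\<dots> = 2 * R ^ n * (B - Re (fps_nth G 0)) * M 0"
    proof -
      have "(\<integral>z. (2 * R ^ n) * (B * w z - w z * Re (g z)) \<partial>lborel) = (2 * R ^ n) * (B * M 0 - Re (fps_nth G 0) * M 0)"
        by (simp only: Bochner_Integration.integral_diff integral_mult_right_zero integrable_mult_right i5 i6 M0 Re4)
      then show ?thesis by (simp add: algebra_simps)
    qed
    finally have up: "norm (fps_nth G n) * M n \<le> 2 * R ^ n * (B - Re (fps_nth G 0)) * M 0"
      using disc_moment_nonneg[of 0 R n] unfolding norm_mult M_def by simp
    have dim: "Sigma_Algebra.measure lborel (ball (0::complex) r) = r\<^sup>2 * U" if "r \<ge> 0" for r
      using content_ball_conv_unit_ball[OF that, of "0::complex"] unfolding U_def by simp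
    have M0': "M 0 = R\<^sup>2 * U" using dim[of R] R unfolding M0[symmetric] w by simp
    \<comment> \<open>Only the annulus between R/2 and R is kept; this produces the factors 3/4 and
      4 ^ n of the bound.\<close>
    have "(R / 2) ^ (2 * n) * (R\<^sup>2 * U - (R/2)\<^sup>2 * U) \<le> M n"
    proof -
      have ib: "integrable lborel (\<lambda>z::complex. indicator (ball 0 r) z :: real)" for r using integrable_disc_const[of 1 r] by simp
      have "(\<integral>z. (R / 2) ^ (2 * n) * (indicator (ball 0 R) z - indicator (ball (0::complex) (R/2)) z) \<partial>lborel) \<le> M n"
        unfolding M_def disc_moment_def
      proof (rule integral_mono)
        show "integrable lborel (\<lambda>z. (R / 2) ^ (2 * n) * (indicator (ball 0 R) z - indicator (ball (0::complex) (R/2)) z))"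
          using ib by auto
        have "integrable lborel (\<lambda>z. disc_weight 0 R z *\<^sub>R (norm z ^ (2 * n)))"
          by (rule integrable_disc_weight[where B = "R ^ (2 * n)"]) (auto simp: power_mono)
        then show "integrable lborel (\<lambda>z::complex. disc_weight 0 R z * norm z ^ (2 * n))" by simp
        fix z :: complex
        show "(R / 2) ^ (2 * n) * (indicator (ball 0 R) z - indicator (ball 0 (R/2)) z) \<le> disc_weight 0 R z * norm z ^ (2 * n)"
        proof (cases "norm z < R / 2 \<or> norm z \<ge> R")
          case True
          then show ?thesis using R by (auto simp: disc_weight_def indicator_def)
        next
          case False
          then have "(R / 2) ^ (2 * n) \<le> norm z ^ (2 * n)" using R by (intro power_mono) auto
          then show ?thesis using False by (simp add: disc_weight_def indicator_def)
        qed
      qed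
      moreover have "(\<integral>z. (R / 2) ^ (2 * n) * (indicator (ball 0 R) z - indicator (ball (0::complex) (R/2)) z) \<partial>lborel)
          = (R / 2) ^ (2 * n) * (R\<^sup>2 * U - (R/2)\<^sup>2 * U)"
        using ib dim[of R] dim[of "R/2"] R by simp
      ultimately show ?thesis by (simp only:)
    qed
    then have "norm (fps_nth G n) * ((R / 2) ^ (2 * n) * (R\<^sup>2 * U - (R/2)\<^sup>2 * U)) \<le> norm (fps_nth G n) * M n" by (intro mult_left_mono) auto
    also note up
    also have "(R / 2) ^ (2 * n) * (R\<^sup>2 * U - (R/2)\<^sup>2 * U) = R ^ n * (R\<^sup>2 * U) * (R ^ n * (3 / 4) / 4 ^ n)"
    proof -
      have "(4::real) ^ n = 2 ^ n * 2 ^ n" by (simp flip: power_mult_distrib)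
      then show ?thesis by (simp add: power_divide power_mult power2_eq_square power_mult_distrib field_simps)
    qed
    finally have "(R ^ n * (R\<^sup>2 * U)) * (norm (fps_nth G n) * (R ^ n * (3 / 4) / 4 ^ n)) \<le> (R ^ n * (R\<^sup>2 * U)) * (2 * (B - Re (fps_nth G 0)))"
      unfolding M0' by (simp only: mult_ac)
    moreover have "R ^ n * (R\<^sup>2 * U) > 0" using U R by simp
    ultimately have fin: "norm (fps_nth G n) * (R ^ n * (3 / 4) / 4 ^ n) \<le> 2 * (B - Re (fps_nth G 0))" by (rule mult_left_le_imp_le)
    \<comment> \<open>One power beyond the quadratic growth is enough, so all n >= 3 are handled by
      the same limit.\<close>
    have "R ^ 3 \<le> R ^ n" by (rule power_increasing[OF n R])
    then have "norm (fps_nth G n) * (R ^ 3 * (3 / 4) / 4 ^ n) \<le> norm (fps_nth G n) * (R ^ n * (3 / 4) / 4 ^ n)"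
      by (intro mult_left_mono divide_right_mono mult_right_mono) auto
    with fin have "norm (fps_nth G n) * (R ^ 3 * (3 / 4) / 4 ^ n) \<le> 2 * (B - Re (fps_nth G 0))" by (rule order_trans[rotated])
    then show ?thesis unfolding B_def using R by (simp add: field_simps)
  qed
  define K where "K = 8 / 3 * 4 ^ n * (1::real)"
  define D where "D = C - Re (fps_nth G 0)"
  have "eventually (\<lambda>R. norm (fps_nth G n) \<le> K * (R\<^sup>2 / 2 + D) / R ^ 3) at_top"
    using eventually_ge_at_top[of 1] by eventually_elim (use bound in \<open>simp add: K_def D_def algebra_simps\<close>)
  moreover have "((\<lambda>R. K * (R\<^sup>2 / 2 + D) / R ^ 3) \<longlongrightarrow> 0) at_top" by real_asymp
  ultimately have "norm (fps_nth G n) \<le> 0" by (intro tendsto_lowerbound) auto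
  then show ?thesis by simp
qed

text \<open>Away from a large disc the polynomial factor is bounded below, so decay of the state
  limits the real part of the logarithm to |z|^2 / 2 plus a constant, and the logarithm is
  quadratic. If |\<beta>| were at least 1/2, the state would not decay along a suitable ray.\<close>

lemma finite_zeros_gauss_poly:
  assumes F: "fock F" and fin: "finite {z. state F z = 0}"
  shows "\<exists>P e \<alpha> \<beta>. F = fps_of_poly P * e \<and> fps_deriv e = fps_of_poly [:\<alpha>, 2 * \<beta>:] * e \<and> norm \<beta> < 1/2"
proof -
  note crF = fock_conv_radius[OF F]
  have "eval_fps F holomorphic_on UNIV" using crF by (intro holomorphic_on_eval_fps) auto
  moreover have "{z. state F z = 0} = {z. eval_fps F z = 0}" unfolding state_def by simp
  ultimately obtain P h where P0: "P \<noteq> 0" and h: "h holomorphic_on UNIV" "\<And>z. h z \<noteq> 0" and Ph: "\<And>z. eval_fps F z = poly P z * h z"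
    using finite_zeros_factor[of "eval_fps F"] fin by metis
  obtain g where g: "g holomorphic_on UNIV" "\<And>z. exp (g z) = h z"
    using holomorphic_logarithm_exists[OF convex_UNIV open_UNIV h(1), of 0] h(2) by auto
  define G where "G = fps_expansion g 0"
  have g': "g holomorphic_on eball 0 \<infinity>" using g(1) by simp
  have ev: "eval_fps G z = g z" for z unfolding G_def using eval_fps_expansion'[OF g', of z] by simp
  have crG: "fps_conv_radius G = \<infinity>" unfolding G_def using conv_radius_fps_expansion[OF g'] by simp
  have ns: "norm (state F z) = norm (poly P z) * exp (Re (g z) - (norm z)\<^sup>2 / 2)" for z
    unfolding state_def Ph norm_mult g(2)[symmetric] norm_exp_eq_Re norm_of_real
    by (simp add: mult_ac flip: exp_add)
  obtain c r where c: "c > 0" "\<And>z. r \<le> norm z \<Longrightarrow> c \<le> norm (poly P z)" using poly_bounded_below_at_infinity[OF P0] by blast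
  have lim: "((\<lambda>z. exp (Re (g z) - (norm z)\<^sup>2 / 2)) \<longlongrightarrow> 0) at_infinity"
  proof (rule tendsto_sandwich[where f = "\<lambda>_. 0" and h = "\<lambda>z. norm (state F z) / c"])
    show "((\<lambda>z. norm (state F z) / c) \<longlongrightarrow> 0) at_infinity"
      using tendsto_divide[OF tendsto_norm[OF state_tendsto_0[OF F]] tendsto_const[of c]] c(1) by simp
    show "eventually (\<lambda>z. exp (Re (g z) - (norm z)\<^sup>2 / 2) \<le> norm (state F z) / c) at_infinity"
      unfolding eventually_at_infinity
    proof (intro exI allI impI)
      fix z :: complex assume "r \<le> norm z"
      then show "exp (Re (g z) - (norm z)\<^sup>2 / 2) \<le> norm (state F z) / c"
        unfolding ns using c(1) c(2)[of z] by (simp add: pos_le_divide_eq mult.commute)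
    qed
  qed auto
  have "eventually (\<lambda>z. exp (Re (g z) - (norm z)\<^sup>2 / 2) < 1) at_infinity" using order_tendstoD(2)[OF lim, of 1] by simp
  then obtain R where R: "\<And>z. R \<le> norm z \<Longrightarrow> Re (g z) \<le> (norm z)\<^sup>2 / 2" unfolding eventually_at_infinity by force
  have "continuous_on (cball 0 R) g" using holomorphic_on_imp_continuous_on[OF g(1)] by (rule continuous_on_subset) simp
  then have "compact (g ` cball 0 R)" by (rule compact_continuous_image) (rule compact_cball)
  then obtain A where A: "\<And>z. norm z \<le> R \<Longrightarrow> norm (g z) \<le> A" using bounded_iff compact_imp_bounded by (metis image_eqI mem_cball_0)
  have "Re (eval_fps G z) \<le> (norm z)\<^sup>2 / 2 + max A 0" for z
  proof (cases "norm z \<le> R")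
    case True
    have "Re (g z) \<le> A" using A[OF True] complex_Re_le_cmod[of "g z"] by simp
    then show ?thesis using max.cobounded1[of A 0] zero_le_power2[of "norm z"] unfolding ev by linarith
  qed (use R[of z] in \<open>simp add: ev\<close>)
  note G3 = entire_log_growth_coefficients[OF crG this]
  define \<alpha> \<beta> where "\<alpha> = fps_nth G 1" and "\<beta> = fps_nth G 2"
  have G: "G = fps_of_poly [:fps_nth G 0, \<alpha>, \<beta>:]"
  proof (rule fps_ext)
    fix n show "fps_nth G n = fps_nth (fps_of_poly [:fps_nth G 0, \<alpha>, \<beta>:]) n"
    proof (cases "n \<ge> 3")
      case True
      then show ?thesis using G3[of n] by (simp add: coeff_eq_0)
    next
      case False
      then have "n = 0 \<or> n = 1 \<or> n = 2" by auto
      then show ?thesis unfolding \<alpha>_def \<beta>_def by (auto simp: numeral_2_eq_2)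
    qed
  qed
  have gz: "g z = fps_nth G 0 + \<alpha> * z + \<beta> * z\<^sup>2" for z
    unfolding ev[symmetric] using arg_cong[OF G, of "\<lambda>G. eval_fps G z"] by (simp add: power2_eq_square algebra_simps)
  have \<beta>: "norm \<beta> < 1/2"
  proof (rule ccontr)
    assume big: "\<not> norm \<beta> < 1/2"
    \<comment> \<open>The direction in which the quadratic part of the logarithm grows
      fastest.\<close>
    obtain v where v: "norm v = 1" "\<beta> * v\<^sup>2 = of_real (norm \<beta>)"
    proof (rule that)
      define x where "x = cnj \<beta> / of_real (norm \<beta>)"
      have b0: "\<beta> \<noteq> 0" using big by auto
      have nx: "norm x = 1" unfolding x_def norm_divide using b0 by simp
      show "norm (csqrt x) = 1" by (simp add: norm_csqrt nx)
      have "\<beta> * x = of_real ((norm \<beta>)\<^sup>2) / of_real (norm \<beta>)" unfolding x_def complex_norm_square by simp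
      also have "\<dots> = of_real (norm \<beta>)" using b0 by (simp add: power2_eq_square)
      finally show "\<beta> * (csqrt x)\<^sup>2 = of_real (norm \<beta>)" by simp
    qed
    \<comment> \<open>The opposite direction gives the same quadratic part, so the sign can be
      chosen to make the linear part grow as well.\<close>
    obtain y where y: "norm y = 1" "\<beta> * y\<^sup>2 = of_real (norm \<beta>)" "Re (\<alpha> * y) \<ge> 0"
      by (cases "Re (\<alpha> * v) \<ge> 0") (use v in \<open>auto intro: that[of v] that[of "- v"]\<close>)
    have low: "exp (Re (fps_nth G 0)) \<le> exp (Re (g (of_real t * y)) - (norm (of_real t * y))\<^sup>2 / 2)" if t: "t \<ge> 0" for t :: real
    proof -
      have "Re (g (of_real t * y)) = Re (fps_nth G 0) + t * Re (\<alpha> * y) + t\<^sup>2 * norm \<beta>"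
      proof -
        have "g (of_real t * y) = fps_nth G 0 + of_real t * (\<alpha> * y) + of_real (t\<^sup>2) * (\<beta> * y\<^sup>2)"
          unfolding gz by (simp add: power_mult_distrib mult_ac)
        also have "\<dots> = fps_nth G 0 + of_real t * (\<alpha> * y) + of_real (t\<^sup>2 * norm \<beta>)" unfolding y(2) by simp
        finally show ?thesis by (simp only: plus_complex.sel Re_of_real_mult Re_complex_of_real)
      qed
      moreover have "t * Re (\<alpha> * y) \<ge> 0" using t y(3) by simp
      moreover have "t\<^sup>2 * norm \<beta> \<ge> t\<^sup>2 * (1/2)" using big by (intro mult_left_mono) auto
      moreover have "norm (of_real t * y) = t" using t y(1) by (simp add: norm_mult)
      ultimately show ?thesis by simp
    qed
    have "filterlim (\<lambda>t. complex_of_real t * y) at_infinity at_top"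
    proof -
      have "filterlim (\<lambda>t. norm (complex_of_real t * y)) at_top at_top"
        using y(1) by (simp add: norm_mult) (rule filterlim_abs_real)
      then show ?thesis by (rule filterlim_norm_at_top_imp_at_infinity)
    qed
    from filterlim_compose[OF lim this]
    have "((\<lambda>t. exp (Re (g (of_real t * y)) - (norm (of_real t * y))\<^sup>2 / 2)) \<longlongrightarrow> 0) at_top" .
    then have "exp (Re (fps_nth G 0)) \<le> 0"
      by (rule tendsto_lowerbound[OF _ eventually_mono[OF eventually_ge_at_top[of 0] low]]) simp_all
    then show False by simp
  qed
  define e where "e = fps_expansion h 0"
  have h': "h holomorphic_on eball 0 \<infinity>" using h(1) by simp
  have eve: "eval_fps e z = h z" for z unfolding e_def using eval_fps_expansion'[OF h', of z] by simp
  have cre: "fps_conv_radius e = \<infinity>" unfolding e_def using conv_radius_fps_expansion[OF h'] by simp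
  have crm: "fps_conv_radius (fps_of_poly p * e) = \<infinity>" for p using fps_conv_radius_mult[of "fps_of_poly p" e] cre by simp
  have "F = fps_of_poly P * e"
    by (rule eval_fps_eqD) (use cre crF crm in \<open>auto simp: eval_fps_mult eve Ph\<close>)
  moreover have "fps_deriv e = fps_of_poly [:\<alpha>, 2 * \<beta>:] * e"
  proof (rule eval_fps_eqD)
    have crd: "fps_conv_radius (fps_deriv e) = \<infinity>" using fps_conv_radius_deriv[of e] cre by simp
    show "fps_conv_radius (fps_deriv e) > 0" "fps_conv_radius (fps_of_poly [:\<alpha>, 2 * \<beta>:] * e) > 0" unfolding crd crm by auto
    have "eval_fps (fps_deriv e) z = eval_fps (fps_of_poly [:\<alpha>, 2 * \<beta>:] * e) z" for z
    proof -
      have hz: "h = (\<lambda>z. exp (fps_nth G 0 + \<alpha> * z + \<beta> * z\<^sup>2))" using g(2) unfolding gz by auto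
      have "(h has_field_derivative (\<alpha> + 2 * \<beta> * z) * h z) (at z)"
        unfolding hz by (auto intro!: derivative_eq_intros)
      moreover have "(h has_field_derivative eval_fps (fps_deriv e) z) (at z)"
        using has_field_derivative_eval_fps[of z e] cre unfolding eve by simp
      ultimately have "eval_fps (fps_deriv e) z = (\<alpha> + 2 * \<beta> * z) * h z" by (rule DERIV_unique[rotated])
      then show ?thesis using cre by (simp add: eval_fps_mult eve mult_ac)
    qed
    then show "eventually (\<lambda>z. eval_fps (fps_deriv e) z = eval_fps (fps_of_poly [:\<alpha>, 2 * \<beta>:] * e) z) (nhds 0)" by simp
  qed
  ultimately show ?thesis using \<beta> by blast
qed

text \<open>The first conclusion places \<mu> among the values at which z is a minimiser; the second
  bounds those values from below and excludes finite zero sets for \<mu> < 5/32.\<close>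

lemma local_ground_finite_zeros:
  assumes mu: "0 < \<mu>" "\<mu> < 1/2" and lg: "local_ground \<mu> F" and fin: "finite {z. state F z = 0}"
  shows "\<exists>a. F = monomial a 1" "5/32 \<le> \<mu>"
proof -
  have f1: "fock1 F" and m: "mass F = 1" using lg unfolding local_ground_def by auto
  obtain P e \<alpha> \<beta> where "F = fps_of_poly P * e" "fps_deriv e = fps_of_poly [:\<alpha>, 2 * \<beta>:] * e" "norm \<beta> < 1/2"
    using finite_zeros_gauss_poly[OF fock1_imp_fock[OF f1] fin] by metis
  moreover have "F \<noteq> 0" using m unfolding mass_def by auto
  ultimately obtain a n where F: "F = monomial a n" using local_ground_gauss_imp_monomial[OF lg mu(1)] mu(2) by blast
  note N = not_local_ground_monomial[OF mu lg[unfolded F]]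
  show "\<exists>a. F = monomial a 1" using F N(1) by blast
  show "5/32 \<le> \<mu>" by (rule N(2))
qed

lemma finite_zeros_monomial: "mass (monomial a 1) = 1 \<Longrightarrow> finite {z. state (monomial a 1) z = 0}"
proof -
  assume "mass (monomial a 1) = 1"
  then have "a \<noteq> 0" unfolding norm_normalised by auto
  then have "{z. state (monomial a 1) z = 0} = {0}" unfolding state_monomial by auto
  then show ?thesis by simp
qed

lemma vortex_ground_ge: assumes "0 < \<mu>" "\<mu> < 1/2" "vortex_ground \<mu>" shows "5/32 \<le> \<mu>"
proof -
  obtain a where a: "ground \<mu> (monomial a 1)" using assms(3) unfolding vortex_ground_iff by blast
  then have "mass (monomial a 1) = 1" unfolding ground_def by simp
  from local_ground_finite_zeros(2)[OF assms(1,2) ground_imp_local[OF a] finite_zeros_monomial[OF this]] show ?thesis .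
qed

lemma ground_finite_zeros_imp_vortex:
  assumes "0 < \<mu>" "\<mu> < 1/2" "ground \<mu> F" "finite {z. state F z = 0}" shows "vortex_ground \<mu>"
  using local_ground_finite_zeros(1)[OF assms(1,2) ground_imp_local[OF assms(3)] assms(4)] assms(3) unfolding vortex_ground_iff by blast

theorem theorem1p7:
  "(\<forall>\<mu>::real. \<mu> > 0 \<longrightarrow> (\<exists>u. global_minimizer \<mu> u)) \<and>
   (\<forall>\<mu>::real. \<mu> > 1 / 2 \<longrightarrow> {u. global_minimizer \<mu> u} = rotation_orbit phi0) \<and>
   {u. global_minimizer (1 / 2) u} =
     rotation_orbit phi0 \<union> rotation_orbit phi1 \<union> (\<Union>b\<in>{0..}. rotation_orbit (psi b)) \<and>
   (\<exists>\<mu>\<^sub>0::real. 5 / 32 \<le> \<mu>\<^sub>0 \<and> \<mu>\<^sub>0 < 1 / 2 \<and>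
      (\<forall>\<mu>. \<mu>\<^sub>0 < \<mu> \<and> \<mu> < 1 / 2 \<longrightarrow> {u. global_minimizer \<mu> u} = rotation_orbit phi1) \<and>
      (\<forall>\<mu> u. 0 < \<mu> \<and> \<mu> < \<mu>\<^sub>0 \<and> global_minimizer \<mu> u \<longrightarrow> infinite {z. u z = 0})) \<and>
   (\<forall>(\<mu>::real) u. 0 < \<mu> \<and> \<mu> < 5 / 32 \<and> (local_minimizer \<mu> u \<or> global_minimizer \<mu> u) \<longrightarrow>
      infinite {z. u z = 0})"
proof (intro conjI allI impI)
  show "\<exists>u. global_minimizer \<mu> u" if "\<mu> > 0" for \<mu> using global_minimizer_iff[OF that] exists_ground[OF that] by blast
  show "{u. global_minimizer \<mu> u} = rotation_orbit phi0" if "\<mu> > 1/2" for \<mu> by (rule ground_large_set[OF that])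
  show "{u. global_minimizer (1 / 2) u} = rotation_orbit phi0 \<union> rotation_orbit phi1 \<union> (\<Union>b\<in>{0..}. rotation_orbit (psi b))"
    by (rule ground_half_set)
  show "\<exists>\<mu>\<^sub>0::real. 5 / 32 \<le> \<mu>\<^sub>0 \<and> \<mu>\<^sub>0 < 1 / 2 \<and>
      (\<forall>\<mu>. \<mu>\<^sub>0 < \<mu> \<and> \<mu> < 1 / 2 \<longrightarrow> {u. global_minimizer \<mu> u} = rotation_orbit phi1) \<and>
      (\<forall>\<mu> u. 0 < \<mu> \<and> \<mu> < \<mu>\<^sub>0 \<and> global_minimizer \<mu> u \<longrightarrow> infinite {z. u z = 0})"
  proof -
    \<comment> \<open>The threshold is the infimum of this set: it is at least 5/32 by the
      instability of z, and below 1/2 because some \<mu> >= 3/8 belongs to it.\<close>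
    define V where "V = {\<mu>. 0 < \<mu> \<and> \<mu> < 1/2 \<and> vortex_ground \<mu>}"
    have lb: "5/32 \<le> \<mu>" if "\<mu> \<in> V" for \<mu> using that vortex_ground_ge unfolding V_def by blast
    have bdd: "bdd_below V" using lb by (rule bdd_belowI)
    obtain m where m: "3/8 \<le> m" "m < 1/2" "vortex_ground m" using vortex_ground_near_half by blast
    then have mV: "m \<in> V" unfolding V_def by simp
    show ?thesis
    proof (intro exI[of _ "Inf V"] conjI allI impI)
      show "5/32 \<le> Inf V" using mV lb by (intro cInf_greatest) auto
      have "Inf V \<le> m" by (rule cInf_lower[OF mV bdd])
      then show lt: "Inf V < 1/2" using m by simp
      show "{u. global_minimizer \<mu> u} = rotation_orbit phi1" if "Inf V < \<mu> \<and> \<mu> < 1/2" for \<mu>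
      proof -
        have "V \<noteq> {}" using mV by blast
        \<comment> \<open>A point of \<open>V\<close> strictly below \<mu> puts \<mu> in the
          interior of the interval between it and 1/2, where \<open>vortex_ground_above\<close>
          gives uniqueness.\<close>
        from cInf_lessD[OF this, of \<mu>] that obtain \<nu> where \<nu>: "\<nu> \<in> V" "\<nu> < \<mu>" by blast
        have mu: "\<mu> > 0" using \<nu> lb[OF \<nu>(1)] by simp
        have g: "ground \<mu> F \<longleftrightarrow> (\<exists>a. F = monomial a 1 \<and> mass F = 1)" for F
          by (rule vortex_ground_above[OF _ \<nu>(2)]) (use \<nu>(1) that in \<open>simp_all add: V_def\<close>)
        show ?thesis unfolding orbit_phi1 global_minimizer_iff[OF mu] g by blast
      qed
      show "infinite {z. u z = 0}" if h: "0 < \<mu> \<and> \<mu> < Inf V \<and> global_minimizer \<mu> u" for \<mu> u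
      proof
        \<comment> \<open>A minimiser with finitely many zeros would be z, which would put \<mu>
          into \<open>V\<close>, below its infimum.\<close>
        assume fin: "finite {z. u z = 0}"
        obtain F where "ground \<mu> F" "u = state F" using h global_minimizer_iff[of \<mu> u] by blast
        then have "\<mu> \<in> V" unfolding V_def using ground_finite_zeros_imp_vortex[of \<mu> F] h lt fin by simp
        then have "Inf V \<le> \<mu>" using bdd by (rule cInf_lower)
        then show False using h by simp
      qed
    qed
  qed
  show "infinite {z. u z = 0}" if h: "0 < \<mu> \<and> \<mu> < 5 / 32 \<and> (local_minimizer \<mu> u \<or> global_minimizer \<mu> u)" for \<mu> u
  proof
    assume fin: "finite {z. u z = 0}"
    obtain F where "local_ground \<mu> F" "u = state F"
      using h local_minimizer_imp[of \<mu> u] global_minimizer_iff[of \<mu> u] ground_imp_local by blast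
    then show False using local_ground_finite_zeros(2)[of \<mu> F] h fin by auto
  qed
qed

end
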